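(* Let $\Phi$ be a unital commutative ring with $\frac16\in\Phi$; all Jordan pairs and Lie algebras are over $\Phi$. (i) Let $V$ be a strongly nondegenerate Jordan pair. Then $$Q_m(V)=\Big(\big(Q_m(\mathrm{TKK}(V))\big)_1,\ \big(Q_m(\mathrm{TKK}(V))\big)_{-1}\Big)$$ is the maximal Jordan pair of $\mathfrak M$-quotients of $V$. (ii) If $L=L_{-1}\oplus L_0\oplus L_1$ is a strongly nondegenerate Jordan 3-graded Lie algebra such that $Q_m(L)$ is Jordan 3-graded, then $$Q_m(L)\cong Q_m(\mathrm{TKK}(V))\cong\mathrm{TKK}(Q_m(V)),$$ where $V=(L_1,L_{-1})$ is the associated Jordan pair of $L$.
   Context: Jordan pairs $V=(V^+,V^-)$ are in the sense of Loos, with quadratic maps $x\mapsto Q_x\in\mathrm{Hom}(V^{-\sigma},V^\sigma)$ for $x\in V^\sigma$ ($\sigma=\pm$), and $\{x,y,z\}=D_{x,y}z=Q_{x,z}y$, $Q_{x,z}=Q_{x+z}-Q_x-Q_z$. $V$ is strongly nondegenerate if $Q_x=0$ implies $x=0$. An ideal $I=(I^+,I^-)$ is a pair of submodules with $Q_{I^\sigma}V^{-\sigma}+Q_{V^\sigma}I^{-\sigma}+\{V^\sigma,V^{-\sigma},I^\sigma\}\subseteq I^\sigma$. $V$ is semiprime if $Q_{I^\pm}I^\mp=0$ implies $I=0$ for ideals $I$ (strongly nondegenerate pairs are semiprime). $\mathrm{Ann}_V(I)^\sigma=\{z\in V^\sigma:\{z,I^{-\sigma},V^\sigma\}=\{z,V^{-\sigma},I^\sigma\}=\{V^{-\sigma},z,I^{-\sigma}\}=0\}$.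 A Jordan pair $W$ containing a semiprime Jordan pair $V$ as a subpair is a pair of $\mathfrak M$-quotients of $V$ if for every $0\ne q\in W^\sigma$ ($\sigma=\pm$) there is an ideal $I$ of $V$ with $\mathrm{Ann}_V(I)=0$ such that $\{q,I^{-\sigma},V^\sigma\}+\{q,V^{-\sigma},I^\sigma\}\subseteq V^\sigma$ and $\{I^{-\sigma},q,V^{-\sigma}\}\subseteq V^{-\sigma}$, with either $\{q,I^{-\sigma},V^\sigma\}+\{q,V^{-\sigma},I^\sigma\}\neq0$ or $\{I^{-\sigma},q,V^{-\sigma}\}\ne0$. The maximal Jordan pair of $\mathfrak M$-quotients of $V$, denoted $Q_m(V)$, is the pair of $\mathfrak M$-quotients $W$ of $V$ (unique up to isomorphism over $V$) such that for every pair of $\mathfrak M$-quotients $S$ of $V$ there is a unique monomorphism of Jordan pairs $S\to W$ that is the identity on $V$. TKK-algebra: for $(x,y)\in V^+\times V^-$ put $\delta(x,y)=(D_{x,y},-D_{y,x})\in\mathrm{End}(V^+)\times\mathrm{End}(V^-)$, and let $\mathrm{IDer}(V)$ be the $\Phi$-span of all $\delta(x,y)$. $\mathrm{TKK}(V)=V^+\oplus\mathrm{IDer}(V)\oplus V^-$ is a Lie algebra with bracket $$[x^+\oplus\gamma\oplus x^-,\,y^+\oplus\mu\oplus y^-]=(\gamma_+y^+-\mu_+x^+)\oplus([\gamma,\mu]+\delta(x^+,y^-)-\delta(y^+,x^-))\oplus(\gamma_-y^--\mu_-x^-),$$ 3-graded by $\mathrm{TKK}(V)_1=V^+$, $\mathrm{TKK}(V)_0=\mathrm{IDer}(V)$,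 $\mathrm{TKK}(V)_{-1}=V^-$. Lie algebras: a 3-graded Lie algebra is $L=L_{-1}\oplus L_0\oplus L_1$ with $[L_i,L_j]\subseteq L_{i+j}$ ($L_k=0$ for $|k|>1$). It is Jordan 3-graded if $[L_1,L_{-1}]=L_0$ and $(L_1,L_{-1})$ has a Jordan pair structure with $\{x,y,z\}=[[x,y],z]$ for $x,z\in L_{\pm1}$, $y\in L_{\mp1}$; this pair is the associated Jordan pair. Since $\frac16\in\Phi$, for any 3-graded Lie algebra the formula $Q_xy=\frac12[[x,y],x]$ makes $(L_1,L_{-1})$ a Jordan pair; this is the structure used in (i). $L$ is strongly nondegenerate if $[x,[x,L]]=0$ implies $x=0$; then $L$ is semiprime ($[I,I]\neq0$ for nonzero ideals $I$). For a semiprime Lie algebra $L$, $Q_m(L)=\varinjlim\mathrm{Der}(I,L)$ is the direct limit under restriction over essential ideals $I$ of $L$ (ideals meeting every nonzero ideal nontrivially), where $\mathrm{Der}(I,L)$ is the set of linear $\delta:I\to L$ with $\delta([x,y])=[\delta x,y]+[x,\delta y]$; the bracket of classes is $[\delta_I,\mu_J]=(\delta\mu-\mu\delta)_{[I\cap J,I\cap J]}$, and $L\subseteq Q_m(L)$ via $x\mapsto(\mathrm{ad}\,x)_L$. For $L$ 3-graded and strongly nondegenerate (in particular for $L=\mathrm{TKK}(V)$ with $V$ strongly nondegenerate), $Q_m(L)$ is 3-graded, $(Q_m(L))_k$ consisting of the classes $\delta_I$ with $I$ a graded essential ideal and $\delta(I_j)\subseteq L_{j+k}$ for all $j$. *)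

theory Defs
  imports "HOL-Algebra.Module" "HOL.Hull"
begin

text \<open>
  Modules are modules over a commutative ring in the sense of \<open>HOL-Algebra\<close>, with explicit carriers.
  A pair \<open>(V\<^sup>+, V\<^sup>-)\<close> is a family indexed by a sign, and \<open>V\<^sup>-\<^sup>\<sigma>\<close> is \<open>part V (- \<sigma>)\<close>; both components
  share one element type, but their carriers are unrelated.
\<close>

datatype sign = Pos | Neg

instantiation sign :: uminus
begin

primrec uminus_sign :: "sign \<Rightarrow> sign" where
  "- Pos = Neg"
| "- Neg = Pos"

instance ..

end

primrec deg :: "sign \<Rightarrow> int" where
  "deg Pos = 1"
| "deg Neg = -1"

definition linear_map ::
    "('a, 'r) ring_scheme \<Rightarrow> ('a, 'b, 'm) module_scheme \<Rightarrow> ('a, 'c, 'n) module_scheme \<Rightarrow> ('b \<Rightarrow> 'c) \<Rightarrow> bool" where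
  "linear_map R M N f \<longleftrightarrow>
     f \<in> carrier M \<rightarrow> carrier N \<and>
     (\<forall>x\<in>carrier M. \<forall>y\<in>carrier M. f (x \<oplus>\<^bsub>M\<^esub> y) = f x \<oplus>\<^bsub>N\<^esub> f y) \<and>
     (\<forall>a\<in>carrier R. \<forall>x\<in>carrier M. f (a \<odot>\<^bsub>M\<^esub> x) = a \<odot>\<^bsub>N\<^esub> f x)"

definition module_span ::
    "('a, 'r) ring_scheme \<Rightarrow> ('a, 'b, 'm) module_scheme \<Rightarrow> 'b set \<Rightarrow> 'b set" where
  "module_span R M S = (\<lambda>H. submodule H R M) hull S"

definition half :: "('a, 'r) ring_scheme \<Rightarrow> 'a" where
  "half R = inv\<^bsub>R\<^esub> (add_pow R (2::nat) \<one>\<^bsub>R\<^esub>)"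

section \<open>Jordan pairs\<close>

text \<open>
  \<open>quad V \<sigma> x y\<close> is \<open>Q\<^sub>x y\<close> for \<open>x \<in> V\<^sup>\<sigma>\<close> and \<open>y \<in> V\<^sup>-\<^sup>\<sigma>\<close>. The fields \<open>mult\<close> and \<open>one\<close> of the records
  \<open>part V \<sigma>\<close> play no role.
\<close>

record ('a, 'v) jordan_pair =
  part :: "sign \<Rightarrow> ('a, 'v) module"
  quad :: "sign \<Rightarrow> 'v \<Rightarrow> 'v \<Rightarrow> 'v"

abbreviation pcarrier :: "('a, 'v) jordan_pair \<Rightarrow> sign \<Rightarrow> 'v set" where
  "pcarrier V \<sigma> \<equiv> carrier (part V \<sigma>)"

abbreviation pzero :: "('a, 'v) jordan_pair \<Rightarrow> sign \<Rightarrow> 'v" where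
  "pzero V \<sigma> \<equiv> \<zero>\<^bsub>part V \<sigma>\<^esub>"

text \<open>\<open>quad2 V \<sigma> x z y\<close> is \<open>Q\<^sub>x\<^sub>,\<^sub>z y\<close> and \<open>triple V \<sigma> x y z\<close> is \<open>{x, y, z} = D\<^sub>x\<^sub>,\<^sub>y z\<close>, for \<open>x, z \<in> V\<^sup>\<sigma>\<close>.\<close>

definition quad2 :: "('a, 'v) jordan_pair \<Rightarrow> sign \<Rightarrow> 'v \<Rightarrow> 'v \<Rightarrow> 'v \<Rightarrow> 'v" where
  "quad2 V \<sigma> x z y =
     quad V \<sigma> (x \<oplus>\<^bsub>part V \<sigma>\<^esub> z) y \<ominus>\<^bsub>part V \<sigma>\<^esub> quad V \<sigma> x y \<ominus>\<^bsub>part V \<sigma>\<^esub> quad V \<sigma> z y"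

definition triple :: "('a, 'v) jordan_pair \<Rightarrow> sign \<Rightarrow> 'v \<Rightarrow> 'v \<Rightarrow> 'v \<Rightarrow> 'v" where
  "triple V \<sigma> x y z = quad2 V \<sigma> x z y"

text \<open>
  Loos requires the identities JP1, JP2, JP3 below in all scalar extensions \<open>V \<otimes> K\<close>. Since \<open>V \<otimes> K\<close> is spanned
  over \<open>K\<close> by \<open>V\<close>, this says that the identities hold on \<open>V\<close> together with all their homogeneous
  linearizations. Linearizing a variable in which an identity is quadratic gives nothing new (polarize the
  identity on \<open>V\<close> itself), so what has to be added is the (2,1)-linearization of JP1 in \<open>x\<close> (of degree 3) and
  the (3,1)- and (2,2)-linearizations of JP3 in \<open>x\<close> (of degree 4); the remaining components are
  polarizations of these.
\<close>

locale jordan_pair =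
  fixes R :: "('a, 'r) ring_scheme" (structure) and V :: "('a, 'v) jordan_pair"
  assumes is_module: "module R (part V \<sigma>)"
    and quad_linear: "x \<in> pcarrier V \<sigma> \<Longrightarrow> linear_map R (part V (- \<sigma>)) (part V \<sigma>) (quad V \<sigma> x)"
    and quad_smult:
      "\<lbrakk>a \<in> carrier R; x \<in> pcarrier V \<sigma>; y \<in> pcarrier V (- \<sigma>)\<rbrakk>
        \<Longrightarrow> quad V \<sigma> (a \<odot>\<^bsub>part V \<sigma>\<^esub> x) y = (a \<otimes> a) \<odot>\<^bsub>part V \<sigma>\<^esub> quad V \<sigma> x y"
    and quad2_linear:
      "\<lbrakk>x \<in> pcarrier V \<sigma>; y \<in> pcarrier V (- \<sigma>)\<rbrakk>
        \<Longrightarrow> linear_map R (part V \<sigma>) (part V \<sigma>) (\<lambda>z. quad2 V \<sigma> x z y)"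
    and JP1:
      "\<lbrakk>x \<in> pcarrier V \<sigma>; y \<in> pcarrier V (- \<sigma>); z \<in> pcarrier V (- \<sigma>)\<rbrakk>
        \<Longrightarrow> triple V \<sigma> x y (quad V \<sigma> x z) = quad V \<sigma> x (triple V (- \<sigma>) y x z)"
    and JP1_lin:
      "\<lbrakk>x \<in> pcarrier V \<sigma>; u \<in> pcarrier V \<sigma>; y \<in> pcarrier V (- \<sigma>); z \<in> pcarrier V (- \<sigma>)\<rbrakk>
        \<Longrightarrow> triple V \<sigma> u y (quad V \<sigma> x z) \<oplus>\<^bsub>part V \<sigma>\<^esub> triple V \<sigma> x y (quad2 V \<sigma> x u z)
          = quad2 V \<sigma> x u (triple V (- \<sigma>) y x z) \<oplus>\<^bsub>part V \<sigma>\<^esub> quad V \<sigma> x (triple V (- \<sigma>) y u z)"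
    and JP2:
      "\<lbrakk>x \<in> pcarrier V \<sigma>; y \<in> pcarrier V (- \<sigma>); z \<in> pcarrier V \<sigma>\<rbrakk>
        \<Longrightarrow> triple V \<sigma> (quad V \<sigma> x y) y z = triple V \<sigma> x (quad V (- \<sigma>) y x) z"
    and JP3:
      "\<lbrakk>x \<in> pcarrier V \<sigma>; y \<in> pcarrier V (- \<sigma>); z \<in> pcarrier V (- \<sigma>)\<rbrakk>
        \<Longrightarrow> quad V \<sigma> (quad V \<sigma> x y) z = quad V \<sigma> x (quad V (- \<sigma>) y (quad V \<sigma> x z))"
    and JP3_lin31:
      "\<lbrakk>x \<in> pcarrier V \<sigma>; u \<in> pcarrier V \<sigma>; y \<in> pcarrier V (- \<sigma>); z \<in> pcarrier V (- \<sigma>)\<rbrakk>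
        \<Longrightarrow> quad2 V \<sigma> (quad V \<sigma> x y) (quad2 V \<sigma> x u y) z
          = quad V \<sigma> x (quad V (- \<sigma>) y (quad2 V \<sigma> x u z))
            \<oplus>\<^bsub>part V \<sigma>\<^esub> quad2 V \<sigma> x u (quad V (- \<sigma>) y (quad V \<sigma> x z))"
    and JP3_lin22:
      "\<lbrakk>x \<in> pcarrier V \<sigma>; u \<in> pcarrier V \<sigma>; y \<in> pcarrier V (- \<sigma>); z \<in> pcarrier V (- \<sigma>)\<rbrakk>
        \<Longrightarrow> quad2 V \<sigma> (quad V \<sigma> x y) (quad V \<sigma> u y) z \<oplus>\<^bsub>part V \<sigma>\<^esub> quad V \<sigma> (quad2 V \<sigma> x u y) z
          = quad V \<sigma> x (quad V (- \<sigma>) y (quad V \<sigma> u z))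
            \<oplus>\<^bsub>part V \<sigma>\<^esub> quad V \<sigma> u (quad V (- \<sigma>) y (quad V \<sigma> x z))
            \<oplus>\<^bsub>part V \<sigma>\<^esub> quad2 V \<sigma> x u (quad V (- \<sigma>) y (quad2 V \<sigma> x u z))"

definition pair_strongly_nondegenerate :: "('a, 'v) jordan_pair \<Rightarrow> bool" where
  "pair_strongly_nondegenerate V \<longleftrightarrow>
     (\<forall>\<sigma>. \<forall>x\<in>pcarrier V \<sigma>.
        (\<forall>y\<in>pcarrier V (- \<sigma>). quad V \<sigma> x y = pzero V \<sigma>) \<longrightarrow> x = pzero V \<sigma>)"

definition pair_ideal :: "('a, 'r) ring_scheme \<Rightarrow> ('a, 'v) jordan_pair \<Rightarrow> (sign \<Rightarrow> 'v set) \<Rightarrow> bool" where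
  "pair_ideal R V I \<longleftrightarrow>
     (\<forall>\<sigma>. submodule (I \<sigma>) R (part V \<sigma>) \<and>
        (\<forall>x\<in>I \<sigma>. \<forall>y\<in>pcarrier V (- \<sigma>). quad V \<sigma> x y \<in> I \<sigma>) \<and>
        (\<forall>x\<in>pcarrier V \<sigma>. \<forall>y\<in>I (- \<sigma>). quad V \<sigma> x y \<in> I \<sigma>) \<and>
        (\<forall>x\<in>pcarrier V \<sigma>. \<forall>y\<in>pcarrier V (- \<sigma>). \<forall>z\<in>I \<sigma>. triple V \<sigma> x y z \<in> I \<sigma>))"

definition pair_semiprime :: "('a, 'r) ring_scheme \<Rightarrow> ('a, 'v) jordan_pair \<Rightarrow> bool" where
  "pair_semiprime R V \<longleftrightarrow>
     (\<forall>I. pair_ideal R V I \<and> (\<forall>\<sigma>. \<forall>x\<in>I \<sigma>. \<forall>y\<in>I (- \<sigma>). quad V \<sigma> x y = pzero V \<sigma>)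
        \<longrightarrow> (\<forall>\<sigma>. I \<sigma> = {pzero V \<sigma>}))"

definition pair_ann :: "('a, 'v) jordan_pair \<Rightarrow> (sign \<Rightarrow> 'v set) \<Rightarrow> sign \<Rightarrow> 'v set" where
  "pair_ann V I \<sigma> =
     {z \<in> pcarrier V \<sigma>.
        (\<forall>y\<in>I (- \<sigma>). \<forall>x\<in>pcarrier V \<sigma>. triple V \<sigma> z y x = pzero V \<sigma>) \<and>
        (\<forall>y\<in>pcarrier V (- \<sigma>). \<forall>x\<in>I \<sigma>. triple V \<sigma> z y x = pzero V \<sigma>) \<and>
        (\<forall>y\<in>pcarrier V (- \<sigma>). \<forall>x\<in>I (- \<sigma>). triple V (- \<sigma>) y z x = pzero V (- \<sigma>))}"

definition pair_hom ::
    "('a, 'r) ring_scheme \<Rightarrow> ('a, 'v) jordan_pair \<Rightarrow> ('a, 'w) jordan_pair \<Rightarrow> (sign \<Rightarrow> 'v \<Rightarrow> 'w) \<Rightarrow> bool" where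
  "pair_hom R V W h \<longleftrightarrow>
     (\<forall>\<sigma>. linear_map R (part V \<sigma>) (part W \<sigma>) (h \<sigma>) \<and>
        (\<forall>x\<in>pcarrier V \<sigma>. \<forall>y\<in>pcarrier V (- \<sigma>). h \<sigma> (quad V \<sigma> x y) = quad W \<sigma> (h \<sigma> x) (h (- \<sigma>) y)))"

definition pair_mono ::
    "('a, 'r) ring_scheme \<Rightarrow> ('a, 'v) jordan_pair \<Rightarrow> ('a, 'w) jordan_pair \<Rightarrow> (sign \<Rightarrow> 'v \<Rightarrow> 'w) \<Rightarrow> bool" where
  "pair_mono R V W h \<longleftrightarrow> pair_hom R V W h \<and> (\<forall>\<sigma>. inj_on (h \<sigma>) (pcarrier V \<sigma>))"

section \<open>Jordan pairs of \<open>\<MM>\<close>-quotients\<close>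

text \<open>
  The inclusion \<open>V \<subseteq> W\<close> is an explicit monomorphism \<open>\<iota>\<close>, and "identity on \<open>V\<close>" means compatibility with
  the given monomorphisms.
\<close>

definition M_quotients ::
    "('a, 'r) ring_scheme \<Rightarrow> ('a, 'v) jordan_pair \<Rightarrow> ('a, 'w) jordan_pair \<Rightarrow> (sign \<Rightarrow> 'v \<Rightarrow> 'w) \<Rightarrow> bool" where
  "M_quotients R V W \<iota> \<longleftrightarrow>
     jordan_pair R V \<and> pair_semiprime R V \<and> jordan_pair R W \<and> pair_mono R V W \<iota> \<and>
     (\<forall>\<sigma>. \<forall>q\<in>pcarrier W \<sigma> - {pzero W \<sigma>}. \<exists>I.
        pair_ideal R V I \<and> (\<forall>\<tau>. pair_ann V I \<tau> = {pzero V \<tau>}) \<and>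
        (\<forall>y\<in>I (- \<sigma>). \<forall>x\<in>pcarrier V \<sigma>. triple W \<sigma> q (\<iota> (- \<sigma>) y) (\<iota> \<sigma> x) \<in> \<iota> \<sigma> ` pcarrier V \<sigma>) \<and>
        (\<forall>y\<in>pcarrier V (- \<sigma>). \<forall>x\<in>I \<sigma>. triple W \<sigma> q (\<iota> (- \<sigma>) y) (\<iota> \<sigma> x) \<in> \<iota> \<sigma> ` pcarrier V \<sigma>) \<and>
        (\<forall>y\<in>I (- \<sigma>). \<forall>x\<in>pcarrier V (- \<sigma>).
           triple W (- \<sigma>) (\<iota> (- \<sigma>) y) q (\<iota> (- \<sigma>) x) \<in> \<iota> (- \<sigma>) ` pcarrier V (- \<sigma>)) \<and>
        ((\<exists>y\<in>I (- \<sigma>). \<exists>x\<in>pcarrier V \<sigma>. triple W \<sigma> q (\<iota> (- \<sigma>) y) (\<iota> \<sigma> x) \<noteq> pzero W \<sigma>) \<or>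
         (\<exists>y\<in>pcarrier V (- \<sigma>). \<exists>x\<in>I \<sigma>. triple W \<sigma> q (\<iota> (- \<sigma>) y) (\<iota> \<sigma> x) \<noteq> pzero W \<sigma>) \<or>
         (\<exists>y\<in>I (- \<sigma>). \<exists>x\<in>pcarrier V (- \<sigma>).
            triple W (- \<sigma>) (\<iota> (- \<sigma>) y) q (\<iota> (- \<sigma>) x) \<noteq> pzero W (- \<sigma>))))"

text \<open>
  The universal property ranges over all pairs \<open>S\<close> with elements in the type \<open>'s\<close>. HOL cannot quantify over
  \<open>'s\<close> inside a definition, so \<open>'s\<close> is a parameter; a theorem with \<open>'s\<close> a free type variable covers all \<open>S\<close>.
\<close>

definition maximal_M_quotients ::
    "'s itself \<Rightarrow> ('a, 'r) ring_scheme \<Rightarrow> ('a, 'v) jordan_pair \<Rightarrow> ('a, 'w) jordan_pair \<Rightarrow> (sign \<Rightarrow> 'v \<Rightarrow> 'w) \<Rightarrow> bool" where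
  "maximal_M_quotients T R V W \<iota> \<longleftrightarrow>
     M_quotients R V W \<iota> \<and>
     (\<forall>(S :: ('a, 's) jordan_pair) \<kappa>. M_quotients R V S \<kappa> \<longrightarrow>
        (\<exists>h. pair_mono R S W h \<and> (\<forall>\<sigma>. \<forall>x\<in>pcarrier V \<sigma>. h \<sigma> (\<kappa> \<sigma> x) = \<iota> \<sigma> x) \<and>
          (\<forall>h'. pair_mono R S W h' \<and> (\<forall>\<sigma>. \<forall>x\<in>pcarrier V \<sigma>. h' \<sigma> (\<kappa> \<sigma> x) = \<iota> \<sigma> x) \<longrightarrow>
             (\<forall>\<sigma>. \<forall>s\<in>pcarrier S \<sigma>. h' \<sigma> s = h \<sigma> s))))"

section \<open>Lie algebras\<close>

text \<open>As in the locale \<open>algebra\<close>, the product of the algebra, here the Lie bracket, is the field \<open>mult\<close>; \<open>one\<close> is not used.\<close>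

locale lie_algebra = module R L for R :: "('a, 'r) ring_scheme" (structure) and L :: "('a, 'l) module" (structure) +
  assumes bracket_linear: "x \<in> carrier L \<Longrightarrow> linear_map R L L (\<lambda>y. x \<otimes>\<^bsub>L\<^esub> y)"
    and bracket_linear': "y \<in> carrier L \<Longrightarrow> linear_map R L L (\<lambda>x. x \<otimes>\<^bsub>L\<^esub> y)"
    and bracket_self: "x \<in> carrier L \<Longrightarrow> x \<otimes>\<^bsub>L\<^esub> x = \<zero>\<^bsub>L\<^esub>"
    and jacobi:
      "\<lbrakk>x \<in> carrier L; y \<in> carrier L; z \<in> carrier L\<rbrakk>
        \<Longrightarrow> x \<otimes>\<^bsub>L\<^esub> (y \<otimes>\<^bsub>L\<^esub> z) \<oplus>\<^bsub>L\<^esub> y \<otimes>\<^bsub>L\<^esub> (z \<otimes>\<^bsub>L\<^esub> x) \<oplus>\<^bsub>L\<^esub> z \<otimes>\<^bsub>L\<^esub> (x \<otimes>\<^bsub>L\<^esub> y) = \<zero>\<^bsub>L\<^esub>"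

definition lie_isomorphic ::
    "('a, 'r) ring_scheme \<Rightarrow> ('a, 'l) module \<Rightarrow> ('a, 'm) module \<Rightarrow> bool" where
  "lie_isomorphic R L M \<longleftrightarrow>
     (\<exists>f. linear_map R L M f \<and> bij_betw f (carrier L) (carrier M) \<and>
        (\<forall>x\<in>carrier L. \<forall>y\<in>carrier L. f (x \<otimes>\<^bsub>L\<^esub> y) = f x \<otimes>\<^bsub>M\<^esub> f y))"

definition lie_strongly_nondegenerate :: "('a, 'l) module \<Rightarrow> bool" where
  "lie_strongly_nondegenerate L \<longleftrightarrow>
     (\<forall>x\<in>carrier L. (\<forall>y\<in>carrier L. x \<otimes>\<^bsub>L\<^esub> (x \<otimes>\<^bsub>L\<^esub> y) = \<zero>\<^bsub>L\<^esub>) \<longrightarrow> x = \<zero>\<^bsub>L\<^esub>)"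

definition lie_prod :: "('a, 'r) ring_scheme \<Rightarrow> ('a, 'l) module \<Rightarrow> 'l set \<Rightarrow> 'l set \<Rightarrow> 'l set" where
  "lie_prod R L A B = module_span R L {x \<otimes>\<^bsub>L\<^esub> y |x y. x \<in> A \<and> y \<in> B}"

definition lie_ideal :: "('a, 'r) ring_scheme \<Rightarrow> ('a, 'l) module \<Rightarrow> 'l set \<Rightarrow> bool" where
  "lie_ideal R L I \<longleftrightarrow> submodule I R L \<and> (\<forall>x\<in>I. \<forall>y\<in>carrier L. x \<otimes>\<^bsub>L\<^esub> y \<in> I)"

definition essential_ideal :: "('a, 'r) ring_scheme \<Rightarrow> ('a, 'l) module \<Rightarrow> 'l set \<Rightarrow> bool" where
  "essential_ideal R L I \<longleftrightarrow>
     lie_ideal R L I \<and> (\<forall>J. lie_ideal R L J \<and> J \<noteq> {\<zero>\<^bsub>L\<^esub>} \<longrightarrow> I \<inter> J \<noteq> {\<zero>\<^bsub>L\<^esub>})"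

section \<open>3-graded Lie algebras and their Jordan pairs\<close>

locale three_graded = lie_algebra R L
  for R :: "('a, 'r) ring_scheme" (structure) and L :: "('a, 'l) module" (structure) +
  fixes G :: "int \<Rightarrow> 'l set"
  assumes grade_submodule: "submodule (G k) R L"
    and grade_trivial: "\<bar>k\<bar> > 1 \<Longrightarrow> G k = {\<zero>\<^bsub>L\<^esub>}"
    and grade_direct_sum:
      "x \<in> carrier L \<Longrightarrow>
        \<exists>!p\<in>G (-1) \<times> G 0 \<times> G 1. x = fst p \<oplus>\<^bsub>L\<^esub> fst (snd p) \<oplus>\<^bsub>L\<^esub> snd (snd p)"
    and grade_bracket: "\<lbrakk>x \<in> G i; y \<in> G j\<rbrakk> \<Longrightarrow> x \<otimes>\<^bsub>L\<^esub> y \<in> G (i + j)"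

definition graded_ideal ::
    "('a, 'r) ring_scheme \<Rightarrow> ('a, 'l) module \<Rightarrow> (int \<Rightarrow> 'l set) \<Rightarrow> 'l set \<Rightarrow> bool" where
  "graded_ideal R L G I \<longleftrightarrow>
     lie_ideal R L I \<and>
     (\<forall>x\<in>I. \<exists>a\<in>I \<inter> G (-1). \<exists>b\<in>I \<inter> G 0. \<exists>c\<in>I \<inter> G 1. x = a \<oplus>\<^bsub>L\<^esub> b \<oplus>\<^bsub>L\<^esub> c)"

definition graded_part :: "('a, 'l) module \<Rightarrow> (int \<Rightarrow> 'l set) \<Rightarrow> sign \<Rightarrow> ('a, 'l) module" where
  "graded_part L G \<sigma> = L\<lparr>carrier := G (deg \<sigma>)\<rparr>"

locale jordan_three_graded = three_graded R L G
  for R :: "('a, 'r) ring_scheme" (structure) and L :: "('a, 'l) module" (structure)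
    and G :: "int \<Rightarrow> 'l set" +
  assumes generated: "lie_prod R L (G 1) (G (-1)) = G 0"
    and jordan_structure:
      "\<exists>V. jordan_pair R V \<and> part V = graded_part L G \<and>
        (\<forall>\<sigma>. \<forall>x\<in>G (deg \<sigma>). \<forall>y\<in>G (deg (- \<sigma>)). \<forall>z\<in>G (deg \<sigma>).
           triple V \<sigma> x y z = (x \<otimes>\<^bsub>L\<^esub> y) \<otimes>\<^bsub>L\<^esub> z)"

text \<open>
  \<open>(L\<^sub>1, L\<^sub>-\<^sub>1)\<close> with \<open>Q\<^sub>x y = 1/2 [[x, y], x]\<close>. When \<open>1/2 \<in> \<Phi>\<close> this is the only quadratic structure with
  \<open>{x, y, z} = [[x, y], z]\<close>, because \<open>2 Q\<^sub>x y = {x, y, x}\<close>.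
\<close>

definition assoc_pair ::
    "('a, 'r) ring_scheme \<Rightarrow> ('a, 'l) module \<Rightarrow> (int \<Rightarrow> 'l set) \<Rightarrow> ('a, 'l) jordan_pair" where
  "assoc_pair R L G =
     \<lparr>part = graded_part L G, quad = (\<lambda>\<sigma> x y. half R \<odot>\<^bsub>L\<^esub> ((x \<otimes>\<^bsub>L\<^esub> y) \<otimes>\<^bsub>L\<^esub> x))\<rparr>"

section \<open>The TKK-algebra\<close>

text \<open>
  \<open>End(V\<^sup>+) \<times> End(V\<^sup>-)\<close> with the componentwise commutator as product. Endomorphisms are \<open>undefined\<close>
  outside the carrier, so that equality of functions is equality of maps on \<open>V\<^sup>\<sigma>\<close>.
\<close>

definition End_pair :: "('a, 'r) ring_scheme \<Rightarrow> ('a, 'v) jordan_pair \<Rightarrow> ('a, sign \<Rightarrow> 'v \<Rightarrow> 'v) module" where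
  "End_pair R V =
     \<lparr>carrier = {\<gamma>. \<forall>\<sigma>. \<gamma> \<sigma> \<in> extensional (pcarrier V \<sigma>) \<and> linear_map R (part V \<sigma>) (part V \<sigma>) (\<gamma> \<sigma>)},
      mult = (\<lambda>\<gamma> \<mu> \<sigma>. \<lambda>z\<in>pcarrier V \<sigma>. \<gamma> \<sigma> (\<mu> \<sigma> z) \<ominus>\<^bsub>part V \<sigma>\<^esub> \<mu> \<sigma> (\<gamma> \<sigma> z)),
      one = (\<lambda>\<sigma>. \<lambda>z\<in>pcarrier V \<sigma>. pzero V \<sigma>),
      zero = (\<lambda>\<sigma>. \<lambda>z\<in>pcarrier V \<sigma>. pzero V \<sigma>),
      add = (\<lambda>\<gamma> \<mu> \<sigma>. \<lambda>z\<in>pcarrier V \<sigma>. \<gamma> \<sigma> z \<oplus>\<^bsub>part V \<sigma>\<^esub> \<mu> \<sigma> z),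
      smult = (\<lambda>a \<gamma> \<sigma>. \<lambda>z\<in>pcarrier V \<sigma>. a \<odot>\<^bsub>part V \<sigma>\<^esub> \<gamma> \<sigma> z)\<rparr>"

fun inner_der :: "('a, 'v) jordan_pair \<Rightarrow> 'v \<Rightarrow> 'v \<Rightarrow> sign \<Rightarrow> 'v \<Rightarrow> 'v" where
  "inner_der V x y Pos = (\<lambda>z\<in>pcarrier V Pos. triple V Pos x y z)"
| "inner_der V x y Neg = (\<lambda>z\<in>pcarrier V Neg. \<ominus>\<^bsub>part V Neg\<^esub> triple V Neg y x z)"

definition IDer :: "('a, 'r) ring_scheme \<Rightarrow> ('a, 'v) jordan_pair \<Rightarrow> (sign \<Rightarrow> 'v \<Rightarrow> 'v) set" where
  "IDer R V = module_span R (End_pair R V)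
     {inner_der V x y |x y. x \<in> pcarrier V Pos \<and> y \<in> pcarrier V Neg}"

definition TKK ::
    "('a, 'r) ring_scheme \<Rightarrow> ('a, 'v) jordan_pair \<Rightarrow> ('a, 'v \<times> (sign \<Rightarrow> 'v \<Rightarrow> 'v) \<times> 'v) module" where
  "TKK R V =
     \<lparr>carrier = pcarrier V Pos \<times> IDer R V \<times> pcarrier V Neg,
      mult = (\<lambda>(x, \<gamma>, x') (y, \<mu>, y').
        (\<gamma> Pos y \<ominus>\<^bsub>part V Pos\<^esub> \<mu> Pos x,
         \<gamma> \<otimes>\<^bsub>End_pair R V\<^esub> \<mu> \<oplus>\<^bsub>End_pair R V\<^esub> inner_der V x y' \<ominus>\<^bsub>End_pair R V\<^esub> inner_der V y x',
         \<gamma> Neg y' \<ominus>\<^bsub>part V Neg\<^esub> \<mu> Neg x')),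
      one = (pzero V Pos, \<zero>\<^bsub>End_pair R V\<^esub>, pzero V Neg),
      zero = (pzero V Pos, \<zero>\<^bsub>End_pair R V\<^esub>, pzero V Neg),
      add = (\<lambda>(x, \<gamma>, x') (y, \<mu>, y').
        (x \<oplus>\<^bsub>part V Pos\<^esub> y, \<gamma> \<oplus>\<^bsub>End_pair R V\<^esub> \<mu>, x' \<oplus>\<^bsub>part V Neg\<^esub> y')),
      smult = (\<lambda>a (x, \<gamma>, x').
        (a \<odot>\<^bsub>part V Pos\<^esub> x, a \<odot>\<^bsub>End_pair R V\<^esub> \<gamma>, a \<odot>\<^bsub>part V Neg\<^esub> x'))\<rparr>"

primrec TKK_in ::
    "('a, 'r) ring_scheme \<Rightarrow> ('a, 'v) jordan_pair \<Rightarrow> sign \<Rightarrow> 'v \<Rightarrow> 'v \<times> (sign \<Rightarrow> 'v \<Rightarrow> 'v) \<times> 'v" where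
  "TKK_in R V Pos = (\<lambda>x. (x, \<zero>\<^bsub>End_pair R V\<^esub>, pzero V Neg))"
| "TKK_in R V Neg = (\<lambda>x. (pzero V Pos, \<zero>\<^bsub>End_pair R V\<^esub>, x))"

definition TKK_grade ::
    "('a, 'r) ring_scheme \<Rightarrow> ('a, 'v) jordan_pair \<Rightarrow> int \<Rightarrow> ('v \<times> (sign \<Rightarrow> 'v \<Rightarrow> 'v) \<times> 'v) set" where
  "TKK_grade R V k =
     (if k = 1 then TKK_in R V Pos ` pcarrier V Pos
      else if k = -1 then TKK_in R V Neg ` pcarrier V Neg
      else if k = 0 then {pzero V Pos} \<times> IDer R V \<times> {pzero V Neg}
      else {\<zero>\<^bsub>TKK R V\<^esub>})"

section \<open>Maximal algebras of quotients of Lie algebras\<close>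

definition Der :: "('a, 'r) ring_scheme \<Rightarrow> ('a, 'l) module \<Rightarrow> 'l set \<Rightarrow> ('l \<Rightarrow> 'l) set" where
  "Der R L I =
     {\<delta> \<in> extensional I. linear_map R (L\<lparr>carrier := I\<rparr>) L \<delta> \<and>
        (\<forall>x\<in>I. \<forall>y\<in>I. \<delta> (x \<otimes>\<^bsub>L\<^esub> y) = (\<delta> x \<otimes>\<^bsub>L\<^esub> y) \<oplus>\<^bsub>L\<^esub> (x \<otimes>\<^bsub>L\<^esub> \<delta> y))}"

definition partial_ders :: "('a, 'r) ring_scheme \<Rightarrow> ('a, 'l) module \<Rightarrow> ('l set \<times> ('l \<Rightarrow> 'l)) set" where
  "partial_ders R L = (SIGMA I:{I. essential_ideal R L I}. Der R L I)"

text \<open>Two partial derivations are identified in the direct limit if their restrictions to some smaller essential ideal agree.\<close>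

definition der_rel ::
    "('a, 'r) ring_scheme \<Rightarrow> ('a, 'l) module \<Rightarrow> (('l set \<times> ('l \<Rightarrow> 'l)) \<times> ('l set \<times> ('l \<Rightarrow> 'l))) set" where
  "der_rel R L =
     {((I, \<delta>), (J, \<mu>)). (I, \<delta>) \<in> partial_ders R L \<and> (J, \<mu>) \<in> partial_ders R L \<and>
        (\<exists>K. essential_ideal R L K \<and> K \<subseteq> I \<inter> J \<and> (\<forall>x\<in>K. \<delta> x = \<mu> x))}"

definition der_class ::
    "('a, 'r) ring_scheme \<Rightarrow> ('a, 'l) module \<Rightarrow> 'l set \<Rightarrow> ('l \<Rightarrow> 'l) \<Rightarrow> ('l set \<times> ('l \<Rightarrow> 'l)) set" where
  "der_class R L I \<delta> = der_rel R L `` {(I, \<delta>)}"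

text \<open>
  An operation on classes is the union over all representatives of the classes of the results; by
  independence of representatives this union is a single class.
\<close>

definition Qm ::
    "('a, 'r) ring_scheme \<Rightarrow> ('a, 'l) module \<Rightarrow> ('a, ('l set \<times> ('l \<Rightarrow> 'l)) set) module" where
  "Qm R L =
     \<lparr>carrier = partial_ders R L // der_rel R L,
      mult = (\<lambda>A B. \<Union>(I, \<delta>)\<in>A. \<Union>(J, \<mu>)\<in>B.
        der_class R L (lie_prod R L (I \<inter> J) (I \<inter> J))
          (\<lambda>x\<in>lie_prod R L (I \<inter> J) (I \<inter> J). \<delta> (\<mu> x) \<ominus>\<^bsub>L\<^esub> \<mu> (\<delta> x))),
      one = der_class R L (carrier L) (\<lambda>x\<in>carrier L. \<zero>\<^bsub>L\<^esub>),
      zero = der_class R L (carrier L) (\<lambda>x\<in>carrier L. \<zero>\<^bsub>L\<^esub>),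
      add = (\<lambda>A B. \<Union>(I, \<delta>)\<in>A. \<Union>(J, \<mu>)\<in>B. der_class R L (I \<inter> J) (\<lambda>x\<in>I \<inter> J. \<delta> x \<oplus>\<^bsub>L\<^esub> \<mu> x)),
      smult = (\<lambda>a A. \<Union>(I, \<delta>)\<in>A. der_class R L I (\<lambda>x\<in>I. a \<odot>\<^bsub>L\<^esub> \<delta> x))\<rparr>"

definition Qm_emb :: "('a, 'r) ring_scheme \<Rightarrow> ('a, 'l) module \<Rightarrow> 'l \<Rightarrow> ('l set \<times> ('l \<Rightarrow> 'l)) set" where
  "Qm_emb R L x = der_class R L (carrier L) (\<lambda>y\<in>carrier L. x \<otimes>\<^bsub>L\<^esub> y)"

definition Qm_grade ::
    "('a, 'r) ring_scheme \<Rightarrow> ('a, 'l) module \<Rightarrow> (int \<Rightarrow> 'l set) \<Rightarrow> int \<Rightarrow> ('l set \<times> ('l \<Rightarrow> 'l)) set set" where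
  "Qm_grade R L G k =
     {der_class R L I \<delta> |I \<delta>. essential_ideal R L I \<and> graded_ideal R L G I \<and> \<delta> \<in> Der R L I \<and>
        (\<forall>j. \<forall>x\<in>I \<inter> G j. \<delta> x \<in> G (j + k))}"

section \<open>The maximal Jordan pair of \<open>\<MM>\<close>-quotients\<close>

definition Qm_pair ::
    "('a, 'r) ring_scheme \<Rightarrow> ('a, 'v) jordan_pair
      \<Rightarrow> ('a, (('v \<times> (sign \<Rightarrow> 'v \<Rightarrow> 'v) \<times> 'v) set \<times>
              ('v \<times> (sign \<Rightarrow> 'v \<Rightarrow> 'v) \<times> 'v \<Rightarrow> 'v \<times> (sign \<Rightarrow> 'v \<Rightarrow> 'v) \<times> 'v)) set) jordan_pair" where
  "Qm_pair R V = assoc_pair R (Qm R (TKK R V)) (Qm_grade R (TKK R V) (TKK_grade R V))"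

definition Qm_pair_emb ::
    "('a, 'r) ring_scheme \<Rightarrow> ('a, 'v) jordan_pair \<Rightarrow> sign \<Rightarrow> 'v
      \<Rightarrow> (('v \<times> (sign \<Rightarrow> 'v \<Rightarrow> 'v) \<times> 'v) set \<times>
          ('v \<times> (sign \<Rightarrow> 'v \<Rightarrow> 'v) \<times> 'v \<Rightarrow> 'v \<times> (sign \<Rightarrow> 'v \<Rightarrow> 'v) \<times> 'v)) set" where
  "Qm_pair_emb R V \<sigma> x = Qm_emb R (TKK R V) (TKK_in R V \<sigma> x)"

end

theory Submission
  imports Defs
begin

text \<open>
  Write \<open>T\<close> for \<open>TKK(V)\<close>. A homogeneous partial derivation \<open>\<delta>\<close> on a graded essential ideal \<open>N\<close> of \<open>T\<close>
  satisfies \<open>[\<delta>, x] = \<delta> x\<close> in \<open>Q\<^sub>m(T)\<close> for \<open>x \<in> N\<close>, so if it has degree 1 or -1, the ideal \<open>(N\<^sub>1, N\<^sub>-\<^sub>1)\<close>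
  of \<open>V\<close> consists of denominators for it: \<open>(Q\<^sub>m(T)\<^sub>1, Q\<^sub>m(T)\<^sub>-\<^sub>1)\<close> is a pair of \<open>\<MM>\<close>-quotients.
  Conversely, let \<open>S\<close> be a pair of \<open>\<MM>\<close>-quotients of \<open>V\<close>. An inner derivation of \<open>S\<close> that vanishes on \<open>V\<close> is
  zero, hence \<open>T\<close> embeds in \<open>TKK(S)\<close>. If \<open>I\<close> is an ideal of denominators of \<open>q \<in> S\<close> and \<open>N\<close> the essential
  ideal of \<open>T\<close> generated by \<open>I\<close>, then \<open>[[q, N], T] \<subseteq> T\<close>, so \<open>[q, [N, N]] \<subseteq> T\<close> and \<open>ad q\<close> is a partial
  derivation of \<open>T\<close> on \<open>[N, N]\<close>. This is the monomorphism from \<open>S\<close>, and it is forced, because an element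
  \<open>p\<close> of \<open>Q\<^sub>m(T)\<close> of degree 1 or -1 with \<open>[[p, N], T] = 0\<close> is zero.

  For (ii), an element of \<open>L\<^sub>0\<close> that kills \<open>L\<^sub>1\<close> and \<open>L\<^sub>-\<^sub>1\<close> is central, hence zero by nondegeneracy, so \<open>L\<close> is
  the TKK-algebra of its pair; \<open>Q\<^sub>m(L)\<close> has the same property, and is therefore also the TKK-algebra of its pair.
\<close>

text \<open>Four obstacles shape the proof. (1) A partial derivation need not map its domain N into
  N, but the product rule gives \<delta>[N,N] \<subseteq> N; so every composite, and every use of
  nondegeneracy for a value \<delta>(a), takes place on a square [N,N]. (2) Derivations of degree 2
  and -2 are not excluded by degree reasons; that they vanish on squares is a computation which
  divides by 6, and without it the components of \<open>Qm\<close> would not satisfy the relations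
  of a 3-grading. (3) The definition of \<MM>-quotients promises a nonzero product only for one
  ideal chosen together with q, whereas the proof must conclude q = 0 from vanishing against some
  other ideal with zero annihilator; \<open>annihilated\<close> transports the vanishing from q to
  the nonzero products of q that lie in V. (4) A linear relation between inner derivations of V has
  to persist in S before T maps to TKK(S). Nondegeneracy enters only through elements of degree 1
  and -1, together with faithfulness of degree 0 on them (\<open>nondeg_graded\<close>). The
  computational engine is the fundamental formula for ad x with x of degree 1 or -1, the Lie form of
  JP3.\<close>

section \<open>Modules and Lie algebras\<close>

text \<open>
  Elements of the product of all abelian groups whose carrier is a set of elements of \<open>'g\<close>. This
  product is a type of class \<open>ab_group_add\<close>, so the additive identities of a group with an explicit
  carrier can be checked there, without side conditions on membership.
\<close>

typedef 'g ab_section =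
  "{s :: 'g ring \<Rightarrow> 'g. \<forall>G. if abelian_group G then s G \<in> carrier G else s G = undefined}"
  by (rule exI[of _ "\<lambda>G. if abelian_group G then \<zero>\<^bsub>G\<^esub> else undefined"])
    (auto intro: abelian_monoid.zero_closed dest: abelian_group.axioms)

setup_lifting type_definition_ab_section

instantiation ab_section :: (type) ab_group_add
begin

lift_definition zero_ab_section :: "'a ab_section"
  is "\<lambda>G. if abelian_group G then \<zero>\<^bsub>G\<^esub> else undefined"
  by (auto intro: abelian_monoid.zero_closed dest: abelian_group.axioms)

lift_definition plus_ab_section :: "'a ab_section \<Rightarrow> 'a ab_section \<Rightarrow> 'a ab_section"
  is "\<lambda>s t G. if abelian_group G then s G \<oplus>\<^bsub>G\<^esub> t G else undefined"
  by (auto intro!: abelian_monoid.a_closed dest: abelian_group.axioms(1))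

lift_definition uminus_ab_section :: "'a ab_section \<Rightarrow> 'a ab_section"
  is "\<lambda>s G. if abelian_group G then \<ominus>\<^bsub>G\<^esub> s G else undefined"
  by (auto intro!: abelian_group.a_inv_closed)

lift_definition minus_ab_section :: "'a ab_section \<Rightarrow> 'a ab_section \<Rightarrow> 'a ab_section"
  is "\<lambda>s t G. if abelian_group G then s G \<ominus>\<^bsub>G\<^esub> t G else undefined"
  by (auto intro!: abelian_group.minus_closed)

instance
proof
  fix a b c :: "'a ab_section"
  show "a + b + c = a + (b + c)"
    by transfer (auto simp: fun_eq_iff abelian_monoid.a_assoc abelian_group.axioms(1))
  show "a + b = b + a"
    by transfer (auto simp: fun_eq_iff abelian_monoid.a_comm abelian_group.axioms(1))
  show "0 + a = a"
    by transfer (auto simp: fun_eq_iff abelian_monoid.l_zero abelian_group.axioms(1))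
  show "- a + a = 0"
    by transfer (auto simp: fun_eq_iff abelian_group.l_neg)
  show "a - b = a + - b"
    by transfer (auto simp: fun_eq_iff a_minus_def)
qed

end

lemma abelian_group_truncate: "abelian_group (ring.truncate G) \<longleftrightarrow> abelian_group G"
  by (simp add: abelian_group_def abelian_monoid_def abelian_group_axioms_def ring.truncate_def
      comm_group_def comm_monoid_def monoid_def comm_monoid_axioms_def group_def group_axioms_def
      Units_def)

text \<open>The coordinate injection into the product: \<open>x\<close> sits at the coordinate of
  \<open>G\<close>, and all other coordinates are zero. Coordinates are truncated records because
  the product needs a single index type, while \<open>G\<close> may be a module or another record
  extension. Elements outside the carrier go to zero.\<close>

lift_definition sec :: "('g, 'b) ring_scheme \<Rightarrow> 'g \<Rightarrow> 'g ab_section"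
  is "\<lambda>G x H. if abelian_group H
        then if H = ring.truncate G \<and> x \<in> carrier G then x else \<zero>\<^bsub>H\<^esub> else undefined"
  by (auto intro: abelian_monoid.zero_closed dest: abelian_group.axioms simp: ring.truncate_def)

context abelian_group
begin

lemma truncate_group: "abelian_group (ring.truncate G)"
  by (simp add: abelian_group_truncate abelian_group_axioms)

lemma sec_apply: "x \<in> carrier G \<Longrightarrow> Rep_ab_section (sec G x) (ring.truncate G) = x"
  by (simp add: sec.rep_eq truncate_group)

lemma sec_inject: "\<lbrakk>x \<in> carrier G; y \<in> carrier G\<rbrakk> \<Longrightarrow> sec G x = sec G y \<longleftrightarrow> x = y"
  by (metis sec_apply)

lemma secI: "\<lbrakk>sec G x = sec G y; x \<in> carrier G; y \<in> carrier G\<rbrakk> \<Longrightarrow> x = y"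
  by (simp add: sec_inject)

lemma sec_zero: "sec G \<zero> = 0"
proof (rule Rep_ab_section_inject[THEN iffD1], rule ext)
  fix H show "Rep_ab_section (sec G \<zero>) H = Rep_ab_section 0 H"
    by (cases "H = ring.truncate G") (simp_all add: sec.rep_eq zero_ab_section.rep_eq ring.truncate_def)
qed

lemma sec_add:
  assumes "x \<in> carrier G" "y \<in> carrier G"
  shows "sec G (x \<oplus> y) = sec G x + sec G y"
proof (rule Rep_ab_section_inject[THEN iffD1], rule ext)
  fix H show "Rep_ab_section (sec G (x \<oplus> y)) H = Rep_ab_section (sec G x + sec G y) H"
  proof (cases "H = ring.truncate G")
    case True
    then show ?thesis using assms truncate_group
      by (simp add: sec.rep_eq plus_ab_section.rep_eq) (simp add: ring.truncate_def)
  next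
    case False
    then show ?thesis
      by (simp add: sec.rep_eq plus_ab_section.rep_eq abelian_monoid.l_zero abelian_monoid.zero_closed
          abelian_group.axioms(1))
  qed
qed

lemma sec_neg: "x \<in> carrier G \<Longrightarrow> sec G (\<ominus> x) = - sec G x"
  using sec_add[of x "\<ominus> x"] by (simp add: r_neg sec_zero eq_neg_iff_add_eq_0 add.commute)

lemma sec_minus: "\<lbrakk>x \<in> carrier G; y \<in> carrier G\<rbrakk> \<Longrightarrow> sec G (x \<ominus> y) = sec G x - sec G y"
  by (simp add: a_minus_def sec_add sec_neg)

lemmas sec_simps = sec_zero sec_add sec_neg sec_minus

end

section \<open>Linear maps, submodules and spans\<close>

lemma linear_mapI:
  assumes "\<And>x. x \<in> carrier M \<Longrightarrow> f x \<in> carrier N"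
    and "\<And>x y. \<lbrakk>x \<in> carrier M; y \<in> carrier M\<rbrakk> \<Longrightarrow> f (x \<oplus>\<^bsub>M\<^esub> y) = f x \<oplus>\<^bsub>N\<^esub> f y"
    and "\<And>a x. \<lbrakk>a \<in> carrier R; x \<in> carrier M\<rbrakk> \<Longrightarrow> f (a \<odot>\<^bsub>M\<^esub> x) = a \<odot>\<^bsub>N\<^esub> f x"
  shows "linear_map R M N f"
  using assms by (auto simp: linear_map_def)

lemma linear_map_closed: "\<lbrakk>linear_map R M N f; x \<in> carrier M\<rbrakk> \<Longrightarrow> f x \<in> carrier N"
  by (auto simp: linear_map_def)

lemma linear_map_add:
  "\<lbrakk>linear_map R M N f; x \<in> carrier M; y \<in> carrier M\<rbrakk> \<Longrightarrow> f (x \<oplus>\<^bsub>M\<^esub> y) = f x \<oplus>\<^bsub>N\<^esub> f y"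
  by (auto simp: linear_map_def)

lemma linear_map_smult:
  "\<lbrakk>linear_map R M N f; a \<in> carrier R; x \<in> carrier M\<rbrakk> \<Longrightarrow> f (a \<odot>\<^bsub>M\<^esub> x) = a \<odot>\<^bsub>N\<^esub> f x"
  by (auto simp: linear_map_def)

lemma linear_map_zero:
  assumes "linear_map R M N f" "module R M" "module R N"
  shows "f \<zero>\<^bsub>M\<^esub> = \<zero>\<^bsub>N\<^esub>"
proof -
  interpret M: module R M by fact
  interpret N: module R N by fact
  have "f \<zero>\<^bsub>M\<^esub> = f (\<zero>\<^bsub>R\<^esub> \<odot>\<^bsub>M\<^esub> \<zero>\<^bsub>M\<^esub>)" by simp
  also have "\<dots> = \<zero>\<^bsub>R\<^esub> \<odot>\<^bsub>N\<^esub> f \<zero>\<^bsub>M\<^esub>" by (rule linear_map_smult[OF assms(1)]) auto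
  also have "\<dots> = \<zero>\<^bsub>N\<^esub>" using linear_map_closed[OF assms(1)] by simp
  finally show ?thesis .
qed

lemma linear_map_neg:
  assumes "linear_map R M N f" "module R M" "module R N" and x: "x \<in> carrier M"
  shows "f (\<ominus>\<^bsub>M\<^esub> x) = \<ominus>\<^bsub>N\<^esub> f x"
proof -
  interpret M: module R M by fact
  interpret N: module R N by fact
  have [simp]: "f x \<in> carrier N" "f (\<ominus>\<^bsub>M\<^esub> x) \<in> carrier N"
    using linear_map_closed[OF assms(1)] x by auto
  have "f (\<ominus>\<^bsub>M\<^esub> x) \<oplus>\<^bsub>N\<^esub> f x = \<zero>\<^bsub>N\<^esub>"
    using linear_map_add[OF assms(1), of "\<ominus>\<^bsub>M\<^esub> x" x] x linear_map_zero[OF assms(1-3)]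
    by (simp add: M.l_neg)
  then show ?thesis by (simp add: N.minus_equality)
qed

lemma linear_map_compose:
  "\<lbrakk>linear_map R M N f; linear_map R N P g\<rbrakk> \<Longrightarrow> linear_map R M P (\<lambda>x. g (f x))"
  unfolding linear_map_def by (auto simp: Pi_iff)

context module
begin

lemma submoduleI':
  assumes "H \<subseteq> carrier M" "\<zero>\<^bsub>M\<^esub> \<in> H" "\<And>x y. \<lbrakk>x \<in> H; y \<in> H\<rbrakk> \<Longrightarrow> x \<oplus>\<^bsub>M\<^esub> y \<in> H"
    and "\<And>a x. \<lbrakk>a \<in> carrier R; x \<in> H\<rbrakk> \<Longrightarrow> a \<odot>\<^bsub>M\<^esub> x \<in> H"
  shows "submodule H R M"
proof (rule submoduleI)
  fix x assume x: "x \<in> H"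
  then have "\<ominus>\<^bsub>M\<^esub> x = (\<ominus> \<one>) \<odot>\<^bsub>M\<^esub> x" using assms(1) by (auto simp: smult_l_minus)
  then show "\<ominus>\<^bsub>M\<^esub> x \<in> H" using assms(4) x by simp
qed (use assms in auto)

lemma submodule_zero: "submodule H R M \<Longrightarrow> \<zero>\<^bsub>M\<^esub> \<in> H"
  using submoduleE(1-3,5)[of H] r_neg by (metis ex_in_conv subsetD)

lemma submodule_minus: "\<lbrakk>submodule H R M; x \<in> H; y \<in> H\<rbrakk> \<Longrightarrow> x \<ominus>\<^bsub>M\<^esub> y \<in> H"
  unfolding a_minus_def by (blast intro: submoduleE)

lemma submodule_Int: "\<lbrakk>submodule H R M; submodule K R M\<rbrakk> \<Longrightarrow> submodule (H \<inter> K) R M"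
  by (rule submoduleI') (auto intro: submodule_zero submoduleE(4,5) dest: submoduleE(1)[THEN subsetD])

lemma module_span_submodule: 
  assumes "S \<subseteq> carrier M"
  shows "submodule (module_span R M S) R M"
proof -
  \<comment> \<open>The intersection in \<open>hull\<close> runs over a nonempty family, so it stays
    inside the carrier instead of becoming \<open>UNIV\<close>.\<close>
  let ?F = "{t. submodule t R M \<and> S \<subseteq> t}"
  have c: "carrier M \<in> ?F" using assms carrier_is_submodule by simp
  show ?thesis unfolding module_span_def hull_def
  proof (rule submoduleI')
    show "\<Inter> ?F \<subseteq> carrier M" using c by blast
    show "\<zero>\<^bsub>M\<^esub> \<in> \<Inter> ?F" using submodule_zero by auto
    show "x \<oplus>\<^bsub>M\<^esub> y \<in> \<Inter> ?F" if "x \<in> \<Inter> ?F" "y \<in> \<Inter> ?F" for x y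
      using that submoduleE(5) by blast
    show "a \<odot>\<^bsub>M\<^esub> x \<in> \<Inter> ?F" if "a \<in> carrier R" "x \<in> \<Inter> ?F" for a x
      using that submoduleE(4) by blast
  qed
qed

lemma module_span_base: "x \<in> S \<Longrightarrow> x \<in> module_span R M S"
  unfolding module_span_def by (rule hull_inc)

lemma module_span_least: "\<lbrakk>submodule H R M; S \<subseteq> H\<rbrakk> \<Longrightarrow> module_span R M S \<subseteq> H"
  unfolding module_span_def by (rule hull_minimal)

lemma module_span_induct [consumes 2, case_names base zero add smult]:
  assumes x: "x \<in> module_span R M S" and S: "S \<subseteq> carrier M"
    and base: "\<And>x. x \<in> S \<Longrightarrow> P x" and zero: "P \<zero>\<^bsub>M\<^esub>"
    and add: "\<And>x y. \<lbrakk>x \<in> carrier M; y \<in> carrier M; P x; P y\<rbrakk> \<Longrightarrow> P (x \<oplus>\<^bsub>M\<^esub> y)"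
    and smult: "\<And>a x. \<lbrakk>a \<in> carrier R; x \<in> carrier M; P x\<rbrakk> \<Longrightarrow> P (a \<odot>\<^bsub>M\<^esub> x)"
  shows "P x"
proof -
  have "submodule {x \<in> carrier M. P x} R M"
    by (rule submoduleI') (use zero add smult in auto)
  then have "module_span R M S \<subseteq> {x \<in> carrier M. P x}"
    using S base by (intro module_span_least) auto
  then show ?thesis using x by blast
qed

end

section \<open>Division by 2 and 3\<close>

lemma (in cring) Units_right_inverse:
  assumes "a \<in> carrier R" "b \<in> carrier R" "a \<otimes> b = \<one>"
  shows "a \<in> Units R"
  using assms m_comm[of a b] unfolding Units_def by auto

text \<open>A factor of a unit in a commutative ring is a unit, and 6 = 2 * 3.\<close>

lemma (in cring) units_2_3:
  assumes "add_pow R (6::nat) \<one> \<in> Units R"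
  shows "\<one> \<oplus> \<one> \<in> Units R" "\<one> \<oplus> \<one> \<oplus> \<one> \<in> Units R"
proof -
  define t where "t = \<one> \<oplus> \<one>"
  define h where "h = \<one> \<oplus> \<one> \<oplus> \<one>"
  define i where "i = inv (add_pow R (6::nat) \<one>)"
  have [simp]: "t \<in> carrier R" "h \<in> carrier R" by (simp_all add: t_def h_def)
  have i [simp]: "i \<in> carrier R" using assms by (simp add: i_def)
  have "6 = Suc (Suc (Suc (Suc (Suc (Suc 0)))))" by simp
  then have "add_pow R (6::nat) \<one> = \<one> \<oplus> \<one> \<oplus> \<one> \<oplus> \<one> \<oplus> \<one> \<oplus> \<one>"
    by (simp only: add.nat_pow_Suc add.nat_pow_0 l_zero one_closed)
  also have "\<dots> = t \<otimes> h" by (simp add: t_def h_def l_distr r_distr a_assoc)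
  finally have one: "t \<otimes> h \<otimes> i = \<one>" using Units_r_inv[OF assms] by (simp add: i_def)
  show "\<one> \<oplus> \<one> \<in> Units R"
    using Units_right_inverse[of t "h \<otimes> i"] one by (simp add: m_assoc t_def[symmetric])
  show "\<one> \<oplus> \<one> \<oplus> \<one> \<in> Units R"
    using Units_right_inverse[of h "t \<otimes> i"] one by (simp add: m_ac h_def[symmetric])
qed

locale six_module = module R M
  for R :: "('a, 'r) ring_scheme" (structure) and M :: "('a, 'b, 'm) module_scheme" (structure) +
  assumes six_unit: "add_pow R (6::nat) \<one> \<in> Units R"
begin

lemma two_torsion: assumes "x \<in> carrier M" "x \<oplus>\<^bsub>M\<^esub> x = \<zero>\<^bsub>M\<^esub>" shows "x = \<zero>\<^bsub>M\<^esub>"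
proof -
  note u = units_2_3(1)[OF six_unit]
  have "(\<one> \<oplus> \<one>) \<odot>\<^bsub>M\<^esub> x = \<zero>\<^bsub>M\<^esub>" using assms by (simp add: smult_l_distr)
  then have "inv (\<one> \<oplus> \<one>) \<odot>\<^bsub>M\<^esub> ((\<one> \<oplus> \<one>) \<odot>\<^bsub>M\<^esub> x) = \<zero>\<^bsub>M\<^esub>" using u by simp
  then show ?thesis using u assms(1) by (simp add: smult_assoc1[symmetric])
qed

lemma three_torsion: assumes "x \<in> carrier M" "x \<oplus>\<^bsub>M\<^esub> x \<oplus>\<^bsub>M\<^esub> x = \<zero>\<^bsub>M\<^esub>" shows "x = \<zero>\<^bsub>M\<^esub>"
proof -
  note u = units_2_3(2)[OF six_unit]
  have "(\<one> \<oplus> \<one> \<oplus> \<one>) \<odot>\<^bsub>M\<^esub> x = \<zero>\<^bsub>M\<^esub>" using assms by (simp add: smult_l_distr)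
  then have "inv (\<one> \<oplus> \<one> \<oplus> \<one>) \<odot>\<^bsub>M\<^esub> ((\<one> \<oplus> \<one> \<oplus> \<one>) \<odot>\<^bsub>M\<^esub> x) = \<zero>\<^bsub>M\<^esub>" using u by simp
  then show ?thesis using u assms(1) by (simp add: smult_assoc1[symmetric])
qed

text \<open>Cancels a factor 2 in an equation computed in \<open>ab_section\<close>. The factor
  appears as a repeated summand because that type is only an additive group.\<close>

lemma sec_two_torsion:
  assumes "x \<in> carrier M" "y \<in> carrier M" "sec M x + sec M x = sec M y + sec M y"
  shows "x = y"
proof -
  have "(x \<ominus>\<^bsub>M\<^esub> y) \<oplus>\<^bsub>M\<^esub> (x \<ominus>\<^bsub>M\<^esub> y) = \<zero>\<^bsub>M\<^esub>"
    using assms(3) by (intro M.secI) (simp_all add: assms(1,2) M.sec_simps algebra_simps)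
  then have "x \<ominus>\<^bsub>M\<^esub> y = \<zero>\<^bsub>M\<^esub>" by (rule two_torsion[rotated]) (simp add: assms(1,2))
  from arg_cong[OF this, of "sec M"] show ?thesis
    using assms(1,2) by (intro M.secI) (simp_all add: M.sec_simps)
qed

lemma sec_three_torsion:
  assumes "x \<in> carrier M" "y \<in> carrier M"
    "sec M x + sec M x + sec M x = sec M y + sec M y + sec M y"
  shows "x = y"
proof -
  have "(x \<ominus>\<^bsub>M\<^esub> y) \<oplus>\<^bsub>M\<^esub> (x \<ominus>\<^bsub>M\<^esub> y) \<oplus>\<^bsub>M\<^esub> (x \<ominus>\<^bsub>M\<^esub> y) = \<zero>\<^bsub>M\<^esub>"
    using assms(3) by (intro M.secI) (simp_all add: assms(1,2) M.sec_simps algebra_simps)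
  then have "x \<ominus>\<^bsub>M\<^esub> y = \<zero>\<^bsub>M\<^esub>" by (rule three_torsion[rotated]) (simp add: assms(1,2))
  from arg_cong[OF this, of "sec M"] show ?thesis
    using assms(1,2) by (intro M.secI) (simp_all add: M.sec_simps)
qed

lemma half_eq: "half R = inv (\<one> \<oplus> \<one>)"
  by (simp add: half_def numeral_2_eq_2 add_pow_def nat_pow_def add.nat_pow_Suc)

lemma half_closed [simp]: "half R \<in> carrier R"
  using units_2_3(1)[OF six_unit] by (simp add: half_eq)

lemma half_double:
  assumes x: "x \<in> carrier M"
  shows "half R \<odot>\<^bsub>M\<^esub> (x \<oplus>\<^bsub>M\<^esub> x) = x" "half R \<odot>\<^bsub>M\<^esub> x \<oplus>\<^bsub>M\<^esub> half R \<odot>\<^bsub>M\<^esub> x = x"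
proof -
  note u = units_2_3(1)[OF six_unit]
  have "half R \<odot>\<^bsub>M\<^esub> (x \<oplus>\<^bsub>M\<^esub> x) = half R \<odot>\<^bsub>M\<^esub> ((\<one> \<oplus> \<one>) \<odot>\<^bsub>M\<^esub> x)"
    using x by (simp add: smult_l_distr)
  also have "\<dots> = x" using u x by (simp add: half_eq smult_assoc1[symmetric])
  finally show "half R \<odot>\<^bsub>M\<^esub> (x \<oplus>\<^bsub>M\<^esub> x) = x" .
  then show "half R \<odot>\<^bsub>M\<^esub> x \<oplus>\<^bsub>M\<^esub> half R \<odot>\<^bsub>M\<^esub> x = x" using x by (simp add: smult_r_distr)
qed

lemma half_eq_zero: "\<lbrakk>x \<in> carrier M; half R \<odot>\<^bsub>M\<^esub> x = \<zero>\<^bsub>M\<^esub>\<rbrakk> \<Longrightarrow> x = \<zero>\<^bsub>M\<^esub>"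
  using half_double(2)[of x] by simp

end

section \<open>Bracket calculus\<close>

context lie_algebra
begin

text \<open>With right association an unparenthesized word \<open>x \<bullet> y \<bullet> z\<close>
  is [x,[y,z]], the product of the operators ad x and ad y applied to z. Identities below are
  computed as identities between such words.\<close>

abbreviation br (infixr \<open>\<bullet>\<close> 75) where "x \<bullet> y \<equiv> x \<otimes>\<^bsub>L\<^esub> y"
abbreviation ladd (infixl \<open>\<boxplus>\<close> 65) where "x \<boxplus> y \<equiv> x \<oplus>\<^bsub>L\<^esub> y"
abbreviation lneg (\<open>\<boxminus> _\<close> [81] 80) where "\<boxminus> x \<equiv> \<ominus>\<^bsub>L\<^esub> x"
abbreviation lsm (infixr \<open>\<cdot>\<close> 72) where "a \<cdot> x \<equiv> a \<odot>\<^bsub>L\<^esub> x"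
abbreviation lz (\<open>\<zero>\<^sub>L\<close>) where "\<zero>\<^sub>L \<equiv> \<zero>\<^bsub>L\<^esub>"

lemma br_closed [simp, intro]: "\<lbrakk>x \<in> carrier L; y \<in> carrier L\<rbrakk> \<Longrightarrow> x \<bullet> y \<in> carrier L"
  using linear_map_closed[OF bracket_linear] by blast

lemma br_add_r: "\<lbrakk>x \<in> carrier L; y \<in> carrier L; z \<in> carrier L\<rbrakk> \<Longrightarrow> x \<bullet> (y \<boxplus> z) = x \<bullet> y \<boxplus> x \<bullet> z"
  using linear_map_add[OF bracket_linear] by blast

lemma br_add_l: "\<lbrakk>x \<in> carrier L; y \<in> carrier L; z \<in> carrier L\<rbrakk> \<Longrightarrow> (x \<boxplus> y) \<bullet> z = x \<bullet> z \<boxplus> y \<bullet> z"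
  using linear_map_add[OF bracket_linear'] by blast

lemma br_smult_r: "\<lbrakk>a \<in> carrier R; x \<in> carrier L; y \<in> carrier L\<rbrakk> \<Longrightarrow> x \<bullet> (a \<cdot> y) = a \<cdot> (x \<bullet> y)"
  using linear_map_smult[OF bracket_linear] by blast

lemma br_smult_l: "\<lbrakk>a \<in> carrier R; x \<in> carrier L; y \<in> carrier L\<rbrakk> \<Longrightarrow> (a \<cdot> x) \<bullet> y = a \<cdot> (x \<bullet> y)"
  using linear_map_smult[OF bracket_linear'] by blast

lemma br_zero_r [simp]: "x \<in> carrier L \<Longrightarrow> x \<bullet> \<zero>\<^sub>L = \<zero>\<^sub>L"
  using linear_map_zero[OF bracket_linear] module_axioms by blast

lemma br_zero_l [simp]: "x \<in> carrier L \<Longrightarrow> \<zero>\<^sub>L \<bullet> x = \<zero>\<^sub>L"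
  using linear_map_zero[OF bracket_linear'] module_axioms by blast

lemma br_neg_r: "\<lbrakk>x \<in> carrier L; y \<in> carrier L\<rbrakk> \<Longrightarrow> x \<bullet> (\<boxminus> y) = \<boxminus> (x \<bullet> y)"
  using linear_map_neg[OF bracket_linear] module_axioms by blast

lemma br_neg_l: "\<lbrakk>x \<in> carrier L; y \<in> carrier L\<rbrakk> \<Longrightarrow> (\<boxminus> x) \<bullet> y = \<boxminus> (x \<bullet> y)"
  using linear_map_neg[OF bracket_linear'] module_axioms by blast

lemmas br_lin = br_add_r br_add_l br_smult_r br_smult_l br_neg_r br_neg_l

text \<open>Polarization of [x,x] = 0 at x + y.\<close>

lemma br_anti: assumes [simp]: "x \<in> carrier L" "y \<in> carrier L" shows "y \<bullet> x = \<boxminus> (x \<bullet> y)"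
proof -
  have "(x \<boxplus> y) \<bullet> (x \<boxplus> y) = \<zero>\<^sub>L" by (simp add: bracket_self)
  from arg_cong[OF this, of "sec L"]
  have "sec L (x \<bullet> x) + sec L (x \<bullet> y) + (sec L (y \<bullet> x) + sec L (y \<bullet> y)) = 0"
    by (simp add: br_lin M.sec_simps algebra_simps)
  then have "sec L (x \<bullet> y) + sec L (y \<bullet> x) = 0" by (simp add: bracket_self M.sec_zero)
  then have "sec L (y \<bullet> x) = - sec L (x \<bullet> y)" by (simp only: add_eq_0_iff)
  then show ?thesis by (intro M.secI) (simp_all add: M.sec_neg)
qed

text \<open>As a rewrite rule this is ad[x,y] = ad x ad y - ad y ad x; it brings every iterated
  bracket into the form of a sum of right-nested words.\<close>

lemma jacobi_left:
  assumes [simp]: "x \<in> carrier L" "y \<in> carrier L" "z \<in> carrier L"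
  shows "(x \<bullet> y) \<bullet> z = x \<bullet> y \<bullet> z \<boxplus> \<boxminus> (y \<bullet> x \<bullet> z)"
proof -
  have "sec L (x \<bullet> y \<bullet> z) + sec L (y \<bullet> z \<bullet> x) + sec L (z \<bullet> x \<bullet> y) = 0"
    using arg_cong[OF jacobi[of x y z], of "sec L"] by (simp add: M.sec_add M.sec_zero)
  moreover have "y \<bullet> z \<bullet> x = \<boxminus> (y \<bullet> x \<bullet> z)" by (subst br_anti[of x z]) (simp_all add: br_lin)
  moreover have "z \<bullet> x \<bullet> y = \<boxminus> ((x \<bullet> y) \<bullet> z)" by (rule br_anti) simp_all
  ultimately have "sec L ((x \<bullet> y) \<bullet> z) = sec L (x \<bullet> y \<bullet> z) - sec L (y \<bullet> x \<bullet> z)"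
    by (simp only: M.sec_neg br_closed assms) (simp add: algebra_simps)
  then show ?thesis by (intro M.secI) (simp_all add: M.sec_simps)
qed

lemma jacobi_der:
  assumes [simp]: "x \<in> carrier L" "y \<in> carrier L" "z \<in> carrier L"
  shows "x \<bullet> y \<bullet> z = (x \<bullet> y) \<bullet> z \<boxplus> y \<bullet> x \<bullet> z"
  by (intro M.secI) (simp_all add: jacobi_left M.sec_simps)

lemma br_commute_op:
  assumes "x \<in> carrier L" "y \<in> carrier L" "z \<in> carrier L" "x \<bullet> y = \<zero>\<^sub>L"
  shows "x \<bullet> y \<bullet> z = y \<bullet> x \<bullet> z"
  using jacobi_der[OF assms(1-3)] assms by simp

end

section \<open>Jordan pairs and their TKK-algebras\<close>

lemma sign_minus_minus [simp]: "- (- \<sigma>) = (\<sigma> :: sign)"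
  by (cases \<sigma>) simp_all

lemma deg_minus [simp]: "deg (- \<sigma>) = - deg \<sigma>"
  by (cases \<sigma>) simp_all

text \<open>The linearity axioms separated from JP1 to JP3: the calculus of \<open>quad\<close> and
  \<open>triple\<close> must be available for the associated pair of a graded Lie algebra while its
  Jordan identities are still being proved.\<close>

locale quadratic_pair =
  fixes R :: "('a, 'r) ring_scheme" (structure) and V :: "('a, 'v) jordan_pair"
  assumes is_module: "module R (part V \<sigma>)"
    and quad_linear: "x \<in> pcarrier V \<sigma> \<Longrightarrow> linear_map R (part V (- \<sigma>)) (part V \<sigma>) (quad V \<sigma> x)"
    and quad_smult:
      "\<lbrakk>a \<in> carrier R; x \<in> pcarrier V \<sigma>; y \<in> pcarrier V (- \<sigma>)\<rbrakk>
        \<Longrightarrow> quad V \<sigma> (a \<odot>\<^bsub>part V \<sigma>\<^esub> x) y = (a \<otimes> a) \<odot>\<^bsub>part V \<sigma>\<^esub> quad V \<sigma> x y"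
    and quad2_linear:
      "\<lbrakk>x \<in> pcarrier V \<sigma>; y \<in> pcarrier V (- \<sigma>)\<rbrakk>
        \<Longrightarrow> linear_map R (part V \<sigma>) (part V \<sigma>) (\<lambda>z. quad2 V \<sigma> x z y)"

sublocale jordan_pair \<subseteq> quadratic_pair
  by (rule quadratic_pair.intro) (fact is_module quad_linear quad_smult quad2_linear)+

sublocale quadratic_pair \<subseteq> P: module R "part V \<sigma>" for \<sigma>
  by (rule is_module)

context quadratic_pair
begin

lemma quad_closed [simp, intro]:
  "\<lbrakk>x \<in> pcarrier V \<sigma>; y \<in> pcarrier V (- \<sigma>)\<rbrakk> \<Longrightarrow> quad V \<sigma> x y \<in> pcarrier V \<sigma>"
  using linear_map_closed[OF quad_linear] by blast

lemma triple_closed [simp, intro]: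
  "\<lbrakk>x \<in> pcarrier V \<sigma>; y \<in> pcarrier V (- \<sigma>); z \<in> pcarrier V \<sigma>\<rbrakk> \<Longrightarrow> triple V \<sigma> x y z \<in> pcarrier V \<sigma>"
  using linear_map_closed[OF quad2_linear] by (auto simp: triple_def)

lemma quad_add_right:
  "\<lbrakk>x \<in> pcarrier V \<sigma>; y \<in> pcarrier V (- \<sigma>); z \<in> pcarrier V (- \<sigma>)\<rbrakk> \<Longrightarrow>
    quad V \<sigma> x (y \<oplus>\<^bsub>part V (- \<sigma>)\<^esub> z) = quad V \<sigma> x y \<oplus>\<^bsub>part V \<sigma>\<^esub> quad V \<sigma> x z"
  by (rule linear_map_add[OF quad_linear])

lemma quad_smult_right:
  "\<lbrakk>x \<in> pcarrier V \<sigma>; y \<in> pcarrier V (- \<sigma>); a \<in> carrier R\<rbrakk> \<Longrightarrow>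
    quad V \<sigma> x (a \<odot>\<^bsub>part V (- \<sigma>)\<^esub> y) = a \<odot>\<^bsub>part V \<sigma>\<^esub> quad V \<sigma> x y"
  by (rule linear_map_smult[OF quad_linear])

lemma quad_neg_right:
  "\<lbrakk>x \<in> pcarrier V \<sigma>; y \<in> pcarrier V (- \<sigma>)\<rbrakk> \<Longrightarrow>
    quad V \<sigma> x (\<ominus>\<^bsub>part V (- \<sigma>)\<^esub> y) = \<ominus>\<^bsub>part V \<sigma>\<^esub> quad V \<sigma> x y"
  by (rule linear_map_neg[OF quad_linear is_module is_module])

lemma quad_zero_right [simp]: "x \<in> pcarrier V \<sigma> \<Longrightarrow> quad V \<sigma> x (pzero V (- \<sigma>)) = pzero V \<sigma>"
  by (rule linear_map_zero[OF quad_linear is_module is_module])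

text \<open>The primed variants serve the simplifier, which rewrites \<open>- (- \<sigma>)\<close> to \<open>\<sigma>\<close>.\<close>

lemmas quad_right' = quad_add_right[where \<sigma> = "- \<sigma>", simplified] quad_smult_right[where \<sigma> = "- \<sigma>", simplified]
  quad_neg_right[where \<sigma> = "- \<sigma>", simplified] for \<sigma>
lemmas quad_right = quad_add_right quad_smult_right quad_neg_right quad_right'

lemma quad_add:
  assumes [simp]: "x \<in> pcarrier V \<sigma>" "z \<in> pcarrier V \<sigma>" "y \<in> pcarrier V (- \<sigma>)"
  shows "quad V \<sigma> (x \<oplus>\<^bsub>part V \<sigma>\<^esub> z) y
    = quad V \<sigma> x y \<oplus>\<^bsub>part V \<sigma>\<^esub> quad V \<sigma> z y \<oplus>\<^bsub>part V \<sigma>\<^esub> triple V \<sigma> x y z"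
  by (rule P.secI[of \<sigma>]) (simp_all add: triple_def quad2_def P.sec_simps)

lemma quad_neg:
  assumes [simp]: "x \<in> pcarrier V \<sigma>" "y \<in> pcarrier V (- \<sigma>)"
  shows "quad V \<sigma> (\<ominus>\<^bsub>part V \<sigma>\<^esub> x) y = quad V \<sigma> x y"
proof -
  have "\<ominus>\<^bsub>part V \<sigma>\<^esub> x = (\<ominus> \<one>) \<odot>\<^bsub>part V \<sigma>\<^esub> x" by (simp add: P.smult_l_minus)
  then show ?thesis using quad_smult[of "\<ominus> \<one>" x \<sigma> y]
    by (simp add: P.R.l_minus P.R.r_minus)
qed

lemma triple_commute:
  assumes [simp]: "x \<in> pcarrier V \<sigma>" "z \<in> pcarrier V \<sigma>" "y \<in> pcarrier V (- \<sigma>)"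
  shows "triple V \<sigma> x y z = triple V \<sigma> z y x"
  by (rule P.secI[of \<sigma>]) (simp_all add: triple_def quad2_def P.sec_simps P.a_comm[of x \<sigma> z])

lemma triple_add3:
  "\<lbrakk>x \<in> pcarrier V \<sigma>; y \<in> pcarrier V (- \<sigma>); z \<in> pcarrier V \<sigma>; w \<in> pcarrier V \<sigma>\<rbrakk> \<Longrightarrow>
    triple V \<sigma> x y (z \<oplus>\<^bsub>part V \<sigma>\<^esub> w) = triple V \<sigma> x y z \<oplus>\<^bsub>part V \<sigma>\<^esub> triple V \<sigma> x y w"
  unfolding triple_def by (rule linear_map_add[OF quad2_linear])

lemma triple_smult3:
  "\<lbrakk>a \<in> carrier R; x \<in> pcarrier V \<sigma>; y \<in> pcarrier V (- \<sigma>); z \<in> pcarrier V \<sigma>\<rbrakk> \<Longrightarrow>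
    triple V \<sigma> x y (a \<odot>\<^bsub>part V \<sigma>\<^esub> z) = a \<odot>\<^bsub>part V \<sigma>\<^esub> triple V \<sigma> x y z"
  unfolding triple_def by (rule linear_map_smult[OF quad2_linear])

lemma triple_neg3:
  "\<lbrakk>x \<in> pcarrier V \<sigma>; y \<in> pcarrier V (- \<sigma>); z \<in> pcarrier V \<sigma>\<rbrakk> \<Longrightarrow>
    triple V \<sigma> x y (\<ominus>\<^bsub>part V \<sigma>\<^esub> z) = \<ominus>\<^bsub>part V \<sigma>\<^esub> triple V \<sigma> x y z"
  unfolding triple_def by (rule linear_map_neg[OF quad2_linear is_module is_module])

lemma triple_zero3 [simp]:
  "\<lbrakk>x \<in> pcarrier V \<sigma>; y \<in> pcarrier V (- \<sigma>)\<rbrakk> \<Longrightarrow> triple V \<sigma> x y (pzero V \<sigma>) = pzero V \<sigma>"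
  unfolding triple_def by (rule linear_map_zero[OF quad2_linear is_module is_module])

lemma triple_add1:
  "\<lbrakk>x \<in> pcarrier V \<sigma>; y \<in> pcarrier V (- \<sigma>); z \<in> pcarrier V \<sigma>; w \<in> pcarrier V \<sigma>\<rbrakk> \<Longrightarrow>
    triple V \<sigma> (z \<oplus>\<^bsub>part V \<sigma>\<^esub> w) y x = triple V \<sigma> z y x \<oplus>\<^bsub>part V \<sigma>\<^esub> triple V \<sigma> w y x"
  by (simp add: triple_commute[of _ \<sigma> x] triple_add3)

lemma triple_smult1:
  "\<lbrakk>a \<in> carrier R; x \<in> pcarrier V \<sigma>; y \<in> pcarrier V (- \<sigma>); z \<in> pcarrier V \<sigma>\<rbrakk> \<Longrightarrow>
    triple V \<sigma> (a \<odot>\<^bsub>part V \<sigma>\<^esub> z) y x = a \<odot>\<^bsub>part V \<sigma>\<^esub> triple V \<sigma> z y x"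
  by (simp add: triple_commute[of _ \<sigma> x] triple_smult3)

lemma triple_neg1:
  "\<lbrakk>x \<in> pcarrier V \<sigma>; y \<in> pcarrier V (- \<sigma>); z \<in> pcarrier V \<sigma>\<rbrakk> \<Longrightarrow>
    triple V \<sigma> (\<ominus>\<^bsub>part V \<sigma>\<^esub> z) y x = \<ominus>\<^bsub>part V \<sigma>\<^esub> triple V \<sigma> z y x"
  by (simp add: triple_commute[of _ \<sigma> x] triple_neg3)

lemma triple_zero1 [simp]:
  "\<lbrakk>x \<in> pcarrier V \<sigma>; y \<in> pcarrier V (- \<sigma>)\<rbrakk> \<Longrightarrow> triple V \<sigma> (pzero V \<sigma>) y x = pzero V \<sigma>"
  by (simp add: triple_commute[of _ \<sigma> x])

lemma triple_eq_quad:
  assumes [simp]: "x \<in> pcarrier V \<sigma>" "z \<in> pcarrier V \<sigma>" "y \<in> pcarrier V (- \<sigma>)"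
  shows "triple V \<sigma> x y z
    = quad V \<sigma> (x \<oplus>\<^bsub>part V \<sigma>\<^esub> z) y \<ominus>\<^bsub>part V \<sigma>\<^esub> quad V \<sigma> x y \<ominus>\<^bsub>part V \<sigma>\<^esub> quad V \<sigma> z y"
  by (simp add: triple_def quad2_def)

lemma triple_add2:
  assumes [simp]: "x \<in> pcarrier V \<sigma>" "z \<in> pcarrier V \<sigma>" "y \<in> pcarrier V (- \<sigma>)" "w \<in> pcarrier V (- \<sigma>)"
  shows "triple V \<sigma> x (y \<oplus>\<^bsub>part V (- \<sigma>)\<^esub> w) z = triple V \<sigma> x y z \<oplus>\<^bsub>part V \<sigma>\<^esub> triple V \<sigma> x w z"
  by (rule P.secI[of \<sigma>]) (simp_all add: triple_eq_quad quad_right P.sec_simps)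

lemma triple_neg2:
  assumes [simp]: "x \<in> pcarrier V \<sigma>" "z \<in> pcarrier V \<sigma>" "y \<in> pcarrier V (- \<sigma>)"
  shows "triple V \<sigma> x (\<ominus>\<^bsub>part V (- \<sigma>)\<^esub> y) z = \<ominus>\<^bsub>part V \<sigma>\<^esub> triple V \<sigma> x y z"
  by (rule P.secI[of \<sigma>]) (simp_all add: triple_eq_quad quad_right P.sec_simps)

lemma triple_zero2 [simp]:
  assumes [simp]: "x \<in> pcarrier V \<sigma>" "z \<in> pcarrier V \<sigma>"
  shows "triple V \<sigma> x (pzero V (- \<sigma>)) z = pzero V \<sigma>"
  by (rule P.secI[of \<sigma>]) (simp_all add: triple_eq_quad quad_right P.sec_simps)

lemma triple_smult2:
  assumes [simp]: "x \<in> pcarrier V \<sigma>" "z \<in> pcarrier V \<sigma>" "y \<in> pcarrier V (- \<sigma>)" "a \<in> carrier R"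
  shows "triple V \<sigma> x (a \<odot>\<^bsub>part V (- \<sigma>)\<^esub> y) z = a \<odot>\<^bsub>part V \<sigma>\<^esub> triple V \<sigma> x y z"
  by (simp add: triple_eq_quad quad_right a_minus_def P.smult_r_distr P.smult_r_minus)

lemmas triple_zero2' [simp] = triple_zero2[where \<sigma> = "- \<sigma>", simplified] for \<sigma>
lemmas triple_linear2' = triple_add2[where \<sigma> = "- \<sigma>", simplified] triple_smult2[where \<sigma> = "- \<sigma>", simplified]
  triple_neg2[where \<sigma> = "- \<sigma>", simplified] for \<sigma>
lemmas triple_linear = triple_linear2' triple_add1 triple_add2 triple_add3 triple_smult1 triple_smult2 triple_smult3
  triple_neg1 triple_neg2 triple_neg3

lemma triple_self:
  assumes [simp]: "x \<in> pcarrier V \<sigma>" "y \<in> pcarrier V (- \<sigma>)"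
  shows "triple V \<sigma> x y x = quad V \<sigma> x y \<oplus>\<^bsub>part V \<sigma>\<^esub> quad V \<sigma> x y"
proof -
  \<comment> \<open>Quadratic homogeneity gives 4 \<open>quad\<close> for the argument x + x;
    subtracting two of them in the polarization leaves 2.\<close>
  have e: "x \<oplus>\<^bsub>part V \<sigma>\<^esub> x = (\<one> \<oplus> \<one>) \<odot>\<^bsub>part V \<sigma>\<^esub> x" by (simp add: P.smult_l_distr)
  have "quad V \<sigma> (x \<oplus>\<^bsub>part V \<sigma>\<^esub> x) y = ((\<one> \<oplus> \<one>) \<otimes> (\<one> \<oplus> \<one>)) \<odot>\<^bsub>part V \<sigma>\<^esub> quad V \<sigma> x y"
    unfolding e by (simp add: quad_smult)
  also have "\<dots> = quad V \<sigma> x y \<oplus>\<^bsub>part V \<sigma>\<^esub> quad V \<sigma> x y \<oplus>\<^bsub>part V \<sigma>\<^esub> quad V \<sigma> x y \<oplus>\<^bsub>part V \<sigma>\<^esub> quad V \<sigma> x y"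
    by (simp add: P.R.l_distr P.R.r_distr P.smult_l_distr P.a_ac)
  finally show ?thesis
    by (intro P.secI[of \<sigma>]) (simp_all add: triple_eq_quad P.sec_simps)
qed

end

section \<open>Linearized Jordan identities\<close>

context jordan_pair
begin

text \<open>\<open>JP1_lin\<close> is linear in \<open>w\<close> and still quadratic in
  \<open>x\<close>. Its value at x + u minus its values at x and at u is the trilinear
  component.\<close>

lemma JP1_linearized:
  assumes [simp]: "x \<in> pcarrier V \<sigma>" "u \<in> pcarrier V \<sigma>" "w \<in> pcarrier V \<sigma>"
    "y \<in> pcarrier V (- \<sigma>)" "z \<in> pcarrier V (- \<sigma>)"
  shows "sec (part V \<sigma>) (triple V \<sigma> x y (triple V \<sigma> u z w))
       + sec (part V \<sigma>) (triple V \<sigma> u y (triple V \<sigma> x z w))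
       + sec (part V \<sigma>) (triple V \<sigma> w y (triple V \<sigma> x z u))
       = sec (part V \<sigma>) (triple V \<sigma> x (triple V (- \<sigma>) y u z) w)
       + sec (part V \<sigma>) (triple V \<sigma> u (triple V (- \<sigma>) y x z) w)
       + sec (part V \<sigma>) (triple V \<sigma> x (triple V (- \<sigma>) y w z) u)"
proof -
  let ?s = "sec (part V \<sigma>)"
  define l where "l = (\<lambda>x. ?s (triple V \<sigma> w y (quad V \<sigma> x z)) + ?s (triple V \<sigma> x y (triple V \<sigma> x z w)))"
  define r where "r = (\<lambda>x. ?s (triple V \<sigma> x (triple V (- \<sigma>) y x z) w) + ?s (quad V \<sigma> x (triple V (- \<sigma>) y w z)))"
  have e: "l x = r x" if [simp]: "x \<in> pcarrier V \<sigma>" for x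
    using arg_cong[OF JP1_lin[of x \<sigma> w y z], of ?s]
    by (simp add: l_def r_def P.sec_simps triple_def[symmetric])
  have "(l (x \<oplus>\<^bsub>part V \<sigma>\<^esub> u) - l x - l u) = (r (x \<oplus>\<^bsub>part V \<sigma>\<^esub> u) - r x - r u)"
    by (simp add: e)
  then show ?thesis
    by (simp add: l_def r_def quad_add triple_linear P.sec_simps algebra_simps)
qed

text \<open>JP2 is polarized twice: the cross term in u, w is taken in \<open>e2\<close>, and then
  the cross term of that identity in y, z.\<close>

lemma JP2_linearized:
  assumes [simp]: "x \<in> pcarrier V \<sigma>" "u \<in> pcarrier V \<sigma>" "w \<in> pcarrier V \<sigma>"
    "y \<in> pcarrier V (- \<sigma>)" "z \<in> pcarrier V (- \<sigma>)"
  shows "sec (part V \<sigma>) (triple V \<sigma> (triple V \<sigma> u y w) z x)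
       + sec (part V \<sigma>) (triple V \<sigma> (triple V \<sigma> u z w) y x)
       = sec (part V \<sigma>) (triple V \<sigma> u (triple V (- \<sigma>) y w z) x)
       + sec (part V \<sigma>) (triple V \<sigma> w (triple V (- \<sigma>) y u z) x)"
proof -
  let ?s = "sec (part V \<sigma>)"
  have e: "?s (triple V \<sigma> (quad V \<sigma> u y) y x) = ?s (triple V \<sigma> u (quad V (- \<sigma>) y u) x)"
    if "u \<in> pcarrier V \<sigma>" "y \<in> pcarrier V (- \<sigma>)" for u y
    using JP2[of u \<sigma> y x] that by simp
  define l where "l = (\<lambda>y. ?s (triple V \<sigma> (triple V \<sigma> u y w) y x))"
  define r where "r = (\<lambda>y. ?s (triple V \<sigma> u (quad V (- \<sigma>) y w) x) + ?s (triple V \<sigma> w (quad V (- \<sigma>) y u) x))"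
  have e2: "l y = r y" if [simp]: "y \<in> pcarrier V (- \<sigma>)" for y
    using e[of "u \<oplus>\<^bsub>part V \<sigma>\<^esub> w" y] e[of u y] e[of w y]
    by (simp add: l_def r_def quad_add quad_right triple_linear P.sec_simps algebra_simps)
  have "l (y \<oplus>\<^bsub>part V (- \<sigma>)\<^esub> z) - l y - l z = r (y \<oplus>\<^bsub>part V (- \<sigma>)\<^esub> z) - r y - r z"
    by (simp add: e2)
  then show ?thesis
    by (simp add: l_def r_def quad_add triple_linear P.sec_simps algebra_simps)
qed

text \<open>The linearizations of JP1 (with y and z exchanged) and of JP2 share the term
  {x,z,{u,y,w}} and two terms on the right. Their difference is the identity, with no division. It
  says that the pair (D_{x,y}, -D_{y,x}) acts as a derivation of the triple product, which makes
  IDer(V) a Lie algebra.\<close>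

lemma five_linear:
  assumes [simp]: "x \<in> pcarrier V \<sigma>" "u \<in> pcarrier V \<sigma>" "w \<in> pcarrier V \<sigma>"
    "y \<in> pcarrier V (- \<sigma>)" "z \<in> pcarrier V (- \<sigma>)"
  shows "triple V \<sigma> x y (triple V \<sigma> u z w)
    = triple V \<sigma> (triple V \<sigma> x y u) z w \<ominus>\<^bsub>part V \<sigma>\<^esub> triple V \<sigma> u (triple V (- \<sigma>) y x z) w
      \<oplus>\<^bsub>part V \<sigma>\<^esub> triple V \<sigma> u z (triple V \<sigma> x y w)"
proof (rule P.secI[of \<sigma>])
  let ?s = "sec (part V \<sigma>)"
  have lin: "a' = c - e + b" if 1: "a + b + c = d + e + f" and 2: "a + a' = f + d"
    for a a' b c d e f :: "'v ab_section"
  proof -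
    have "a' = f + d - a" using 2 by (metis add_diff_cancel_left')
    moreover have "c = d + e + f - (a + b)" using 1 by (metis add_diff_cancel_left')
    moreover have "f + d - a = d + e + f - (a + b) - e + b" by (simp add: algebra_simps)
    ultimately show ?thesis by (simp only:)
  qed
  have c: "triple V (- \<sigma>) z a y = triple V (- \<sigma>) y a z" if "a \<in> pcarrier V \<sigma>" for a
    using triple_commute[of z "- \<sigma>" y a] that by simp
  have 1: "?s (triple V \<sigma> x z (triple V \<sigma> u y w)) + ?s (triple V \<sigma> u z (triple V \<sigma> x y w))
      + ?s (triple V \<sigma> (triple V \<sigma> x y u) z w)
      = ?s (triple V \<sigma> x (triple V (- \<sigma>) y u z) w) + ?s (triple V \<sigma> u (triple V (- \<sigma>) y x z) w)
      + ?s (triple V \<sigma> x (triple V (- \<sigma>) y w z) u)"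
    using JP1_linearized[of x \<sigma> u w z y] triple_commute[of w \<sigma> "triple V \<sigma> x y u" z]
    by (simp add: c)
  have 2: "?s (triple V \<sigma> x z (triple V \<sigma> u y w)) + ?s (triple V \<sigma> x y (triple V \<sigma> u z w))
       = ?s (triple V \<sigma> x (triple V (- \<sigma>) y w z) u) + ?s (triple V \<sigma> x (triple V (- \<sigma>) y u z) w)"
    using JP2_linearized[of x \<sigma> u w y z] triple_commute[of x \<sigma> "triple V \<sigma> u y w" z]
      triple_commute[of x \<sigma> "triple V \<sigma> u z w" y] triple_commute[of x \<sigma> u "triple V (- \<sigma>) y w z"]
      triple_commute[of x \<sigma> w "triple V (- \<sigma>) y u z"]
    by simp
  show "?s (triple V \<sigma> x y (triple V \<sigma> u z w)) = ?s (triple V \<sigma> (triple V \<sigma> x y u) z w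
      \<ominus>\<^bsub>part V \<sigma>\<^esub> triple V \<sigma> u (triple V (- \<sigma>) y x z) w \<oplus>\<^bsub>part V \<sigma>\<^esub> triple V \<sigma> u z (triple V \<sigma> x y w))"
    using lin[OF 1 2] by (simp add: P.sec_simps)
qed simp_all

end

text \<open>Since 6 is invertible, the homogeneous components of JP1 and JP3 can be separated by
  evaluating at x + u, x - u and at a doubled argument; the linearizations required in
  \<open>jordan_pair\<close> then follow from the plain identities.\<close>

lemma (in quadratic_pair) jordan_pairI:
  assumes six: "add_pow R (6::nat) \<one> \<in> Units R"
    and JP1: "\<And>\<sigma> x y z. \<lbrakk>x \<in> pcarrier V \<sigma>; y \<in> pcarrier V (- \<sigma>); z \<in> pcarrier V (- \<sigma>)\<rbrakk>
        \<Longrightarrow> triple V \<sigma> x y (quad V \<sigma> x z) = quad V \<sigma> x (triple V (- \<sigma>) y x z)"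
    and JP2: "\<And>\<sigma> x y z. \<lbrakk>x \<in> pcarrier V \<sigma>; y \<in> pcarrier V (- \<sigma>); z \<in> pcarrier V \<sigma>\<rbrakk>
        \<Longrightarrow> triple V \<sigma> (quad V \<sigma> x y) y z = triple V \<sigma> x (quad V (- \<sigma>) y x) z"
    and JP3: "\<And>\<sigma> x y z. \<lbrakk>x \<in> pcarrier V \<sigma>; y \<in> pcarrier V (- \<sigma>); z \<in> pcarrier V (- \<sigma>)\<rbrakk>
        \<Longrightarrow> quad V \<sigma> (quad V \<sigma> x y) z = quad V \<sigma> x (quad V (- \<sigma>) y (quad V \<sigma> x z))"
  shows "jordan_pair R V"
proof -
  interpret S: six_module R "part V \<sigma>" for \<sigma>
    using six P.module_axioms by (simp add: six_module_def six_module_axioms_def)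
  note expand = quad_add quad_right quad_neg triple_linear P.sec_simps
  have JP1_lin: "triple V \<sigma> u y (quad V \<sigma> x z) \<oplus>\<^bsub>part V \<sigma>\<^esub> triple V \<sigma> x y (triple V \<sigma> x z u)
      = triple V \<sigma> x (triple V (- \<sigma>) y x z) u \<oplus>\<^bsub>part V \<sigma>\<^esub> quad V \<sigma> x (triple V (- \<sigma>) y u z)"
    if [simp]: "x \<in> pcarrier V \<sigma>" "u \<in> pcarrier V \<sigma>" "y \<in> pcarrier V (- \<sigma>)" "z \<in> pcarrier V (- \<sigma>)"
    for \<sigma> x u y z
  proof (rule S.sec_two_torsion[where \<sigma> = \<sigma>])
    let ?s = "sec (part V \<sigma>)"
    define l where "l = (\<lambda>x. ?s (triple V \<sigma> x y (quad V \<sigma> x z)))"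
    define r where "r = (\<lambda>x. ?s (quad V \<sigma> x (triple V (- \<sigma>) y x z)))"
    have lr: "l x = r x" if "x \<in> pcarrier V \<sigma>" for x
      using JP1[of x \<sigma> y z] that by (simp add: l_def r_def)
    have c [simp]: "triple V \<sigma> u w x = triple V \<sigma> x w u" if "w \<in> pcarrier V (- \<sigma>)" for w
      using triple_commute[of u \<sigma> x w] that by simp
    let ?l = "triple V \<sigma> u y (quad V \<sigma> x z) \<oplus>\<^bsub>part V \<sigma>\<^esub> triple V \<sigma> x y (triple V \<sigma> x z u)"
    let ?r = "triple V \<sigma> x (triple V (- \<sigma>) y x z) u \<oplus>\<^bsub>part V \<sigma>\<^esub> quad V \<sigma> x (triple V (- \<sigma>) y u z)"
    let ?x = "x \<oplus>\<^bsub>part V \<sigma>\<^esub> u" and ?y = "x \<oplus>\<^bsub>part V \<sigma>\<^esub> \<ominus>\<^bsub>part V \<sigma>\<^esub> u"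
    \<comment> \<open>The difference of the values at x + u and x - u keeps what is odd in u: twice
      the component linear in u, and twice the value at u, which is removed.\<close>
    have "?s ?l + ?s ?l = l ?x - l ?y - l u - l u"
      unfolding l_def by (simp add: expand algebra_simps)
    also have "\<dots> = r ?x - r ?y - r u - r u" by (simp add: lr)
    also have "\<dots> = ?s ?r + ?s ?r"
      unfolding r_def by (simp add: expand algebra_simps)
    finally show "?s ?l + ?s ?l = ?s ?r + ?s ?r" .
  qed simp_all
  \<comment> \<open>The two sides of the components of JP3 of bidegree (3,1) and (2,2) in (x,u); the
    component of bidegree (1,3) is \<open>l31\<close> with x and u exchanged.\<close>
  define l31 where "l31 = (\<lambda>\<sigma> y z x u. triple V \<sigma> (quad V \<sigma> x y) z (triple V \<sigma> x y u))"
  define r31 where "r31 = (\<lambda>\<sigma> y z x u. quad V \<sigma> x (quad V (- \<sigma>) y (triple V \<sigma> x z u))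
    \<oplus>\<^bsub>part V \<sigma>\<^esub> triple V \<sigma> x (quad V (- \<sigma>) y (quad V \<sigma> x z)) u)"
  define l22 where "l22 = (\<lambda>\<sigma> y z x u. triple V \<sigma> (quad V \<sigma> x y) z (quad V \<sigma> u y)
    \<oplus>\<^bsub>part V \<sigma>\<^esub> quad V \<sigma> (triple V \<sigma> x y u) z)"
  define r22 where "r22 = (\<lambda>\<sigma> y z x u. quad V \<sigma> x (quad V (- \<sigma>) y (quad V \<sigma> u z))
    \<oplus>\<^bsub>part V \<sigma>\<^esub> quad V \<sigma> u (quad V (- \<sigma>) y (quad V \<sigma> x z))
    \<oplus>\<^bsub>part V \<sigma>\<^esub> triple V \<sigma> x (quad V (- \<sigma>) y (triple V \<sigma> x z u)) u)"
  have JP3_lin: "l31 \<sigma> y z x u = r31 \<sigma> y z x u" "l22 \<sigma> y z x u = r22 \<sigma> y z x u"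
    if [simp]: "x \<in> pcarrier V \<sigma>" "u \<in> pcarrier V \<sigma>" "y \<in> pcarrier V (- \<sigma>)" "z \<in> pcarrier V (- \<sigma>)"
    for \<sigma> x u y z
  proof -
    let ?s = "sec (part V \<sigma>)"
    let ?l31 = "\<lambda>x u. ?s (l31 \<sigma> y z x u)" and ?r31 = "\<lambda>x u. ?s (r31 \<sigma> y z x u)"
    let ?l22 = "\<lambda>x u. ?s (l22 \<sigma> y z x u)" and ?r22 = "\<lambda>x u. ?s (r22 \<sigma> y z x u)"
    have [simp]: "l31 \<sigma> y z x u \<in> pcarrier V \<sigma>" "l22 \<sigma> y z x u \<in> pcarrier V \<sigma>"
      "r31 \<sigma> y z x u \<in> pcarrier V \<sigma>" "r22 \<sigma> y z x u \<in> pcarrier V \<sigma>"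
      if [simp]: "x \<in> pcarrier V \<sigma>" "u \<in> pcarrier V \<sigma>" for x u
      by (simp_all add: l31_def l22_def r31_def r22_def)
    define l where "l = (\<lambda>x. ?s (quad V \<sigma> (quad V \<sigma> x y) z))"
    define r where "r = (\<lambda>x. ?s (quad V \<sigma> x (quad V (- \<sigma>) y (quad V \<sigma> x z))))"
    have lr: "l x = r x" if "x \<in> pcarrier V \<sigma>" for x
      using JP3[of x \<sigma> y z] that by (simp add: l_def r_def)
    have l_add: "l (x \<oplus>\<^bsub>part V \<sigma>\<^esub> u) = l x + ?l31 x u + ?l22 x u + ?l31 u x + l u"
      if [simp]: "x \<in> pcarrier V \<sigma>" "u \<in> pcarrier V \<sigma>" for x u
      using triple_commute[of u \<sigma> x y]
      by (simp add: l_def l31_def l22_def expand algebra_simps)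
    have r_add: "r (x \<oplus>\<^bsub>part V \<sigma>\<^esub> u) = r x + ?r31 x u + ?r22 x u + ?r31 u x + r u"
      if [simp]: "x \<in> pcarrier V \<sigma>" "u \<in> pcarrier V \<sigma>" for x u
    proof -
      have c [simp]: "triple V \<sigma> u w x = triple V \<sigma> x w u" if "w \<in> pcarrier V (- \<sigma>)" for w
        using triple_commute[of u \<sigma> x w] that by simp
      show ?thesis by (simp add: r_def r31_def r22_def expand algebra_simps)
    qed
    have s: "?l31 x u + ?l22 x u + ?l31 u x = ?r31 x u + ?r22 x u + ?r31 u x"
      if [simp]: "x \<in> pcarrier V \<sigma>" "u \<in> pcarrier V \<sigma>" for x u
      using l_add[of x u] r_add[of x u] by (simp add: lr algebra_simps)
    have neg: "?l31 x (\<ominus>\<^bsub>part V \<sigma>\<^esub> u) = - ?l31 x u" "?r31 x (\<ominus>\<^bsub>part V \<sigma>\<^esub> u) = - ?r31 x u"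
        "?l31 (\<ominus>\<^bsub>part V \<sigma>\<^esub> u) x = - ?l31 u x" "?r31 (\<ominus>\<^bsub>part V \<sigma>\<^esub> u) x = - ?r31 u x"
        "?l22 x (\<ominus>\<^bsub>part V \<sigma>\<^esub> u) = ?l22 x u" "?r22 x (\<ominus>\<^bsub>part V \<sigma>\<^esub> u) = ?r22 x u"
      if [simp]: "x \<in> pcarrier V \<sigma>" "u \<in> pcarrier V \<sigma>" for x u
      by (simp_all add: l31_def l22_def r31_def r22_def expand)
    have double: "?l31 x (u \<oplus>\<^bsub>part V \<sigma>\<^esub> u) = ?l31 x u + ?l31 x u"
        "?r31 x (u \<oplus>\<^bsub>part V \<sigma>\<^esub> u) = ?r31 x u + ?r31 x u"
        "?l31 (u \<oplus>\<^bsub>part V \<sigma>\<^esub> u) x = ?l31 u x + ?l31 u x + ?l31 u x + ?l31 u x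
          + ?l31 u x + ?l31 u x + ?l31 u x + ?l31 u x"
        "?r31 (u \<oplus>\<^bsub>part V \<sigma>\<^esub> u) x = ?r31 u x + ?r31 u x + ?r31 u x + ?r31 u x
          + ?r31 u x + ?r31 u x + ?r31 u x + ?r31 u x"
      if [simp]: "x \<in> pcarrier V \<sigma>" "u \<in> pcarrier V \<sigma>" for x u
      by (simp_all add: l31_def r31_def expand triple_self algebra_simps)
    show "l22 \<sigma> y z x u = r22 \<sigma> y z x u"
    proof (rule S.sec_two_torsion[where \<sigma> = \<sigma>])
      \<comment> \<open>Replacing u by its negative fixes the (2,2)-component and reverses the sign
        of the other two, so adding isolates \<open>l22\<close>; subtracting gives only the sum of
        the two odd components, as in \<open>anti\<close>.\<close>
      have "?l22 x u + ?l22 x u = (?l31 x u + ?l22 x u + ?l31 u x) + (- ?l31 x u + ?l22 x u - ?l31 u x)"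
        by simp
      also have "\<dots> = (?r31 x u + ?r22 x u + ?r31 u x) + (- ?r31 x u + ?r22 x u - ?r31 u x)"
        using s[of x u] s[of x "\<ominus>\<^bsub>part V \<sigma>\<^esub> u"] by (simp add: neg)
      finally show "?l22 x u + ?l22 x u = ?r22 x u + ?r22 x u" by simp
    qed simp_all
    have anti: "?l31 x u + ?l31 u x = ?r31 x u + ?r31 u x"
      if [simp]: "x \<in> pcarrier V \<sigma>" "u \<in> pcarrier V \<sigma>" for x u
    proof -
      have "l31 \<sigma> y z x u \<oplus>\<^bsub>part V \<sigma>\<^esub> l31 \<sigma> y z u x = r31 \<sigma> y z x u \<oplus>\<^bsub>part V \<sigma>\<^esub> r31 \<sigma> y z u x"
      proof (rule S.sec_two_torsion[where \<sigma> = \<sigma>])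
        let ?a = "l31 \<sigma> y z x u \<oplus>\<^bsub>part V \<sigma>\<^esub> l31 \<sigma> y z u x"
        let ?b = "r31 \<sigma> y z x u \<oplus>\<^bsub>part V \<sigma>\<^esub> r31 \<sigma> y z u x"
        have "?s ?a + ?s ?a = (?l31 x u + ?l22 x u + ?l31 u x) - (- ?l31 x u + ?l22 x u - ?l31 u x)"
          by (simp add: P.sec_simps algebra_simps)
        also have "\<dots> = (?r31 x u + ?r22 x u + ?r31 u x) - (- ?r31 x u + ?r22 x u - ?r31 u x)"
          using s[of x u] s[of x "\<ominus>\<^bsub>part V \<sigma>\<^esub> u"] by (simp add: neg)
        finally show "?s ?a + ?s ?a = ?s ?b + ?s ?b" by (simp add: P.sec_simps algebra_simps)
      qed simp_all
      from arg_cong[OF this, of ?s] show ?thesis by (simp add: P.sec_simps)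
    qed
    show "l31 \<sigma> y z x u = r31 \<sigma> y z x u"
    proof (rule S.sec_three_torsion[where \<sigma> = \<sigma>])
      let ?a = "l31 \<sigma> y z x u \<oplus>\<^bsub>part V \<sigma>\<^esub> l31 \<sigma> y z x u \<oplus>\<^bsub>part V \<sigma>\<^esub> l31 \<sigma> y z x u"
      let ?b = "r31 \<sigma> y z x u \<oplus>\<^bsub>part V \<sigma>\<^esub> r31 \<sigma> y z x u \<oplus>\<^bsub>part V \<sigma>\<^esub> r31 \<sigma> y z x u"
      \<comment> \<open>Doubling x multiplies the (3,1)-component by 8 and the (1,3)-component by 2.
        Subtracting twice the undoubled sum cancels the latter and leaves 6 times the former, which
        is why 3 must be invertible as well.\<close>
      have e: "?s ?a + ?s ?a = (?l31 u (x \<oplus>\<^bsub>part V \<sigma>\<^esub> x) + ?l31 (x \<oplus>\<^bsub>part V \<sigma>\<^esub> x) u)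
          - (?l31 x u + ?l31 u x) - (?l31 x u + ?l31 u x)"
        unfolding double[OF that(2,1)] by (simp add: P.sec_simps)
      have "?s ?a + ?s ?a = (?r31 u (x \<oplus>\<^bsub>part V \<sigma>\<^esub> x) + ?r31 (x \<oplus>\<^bsub>part V \<sigma>\<^esub> x) u)
          - (?r31 x u + ?r31 u x) - (?r31 x u + ?r31 u x)"
        unfolding e by (simp only: anti that P.a_closed)
      also have "\<dots> = ?s ?b + ?s ?b"
        unfolding double[OF that(2,1)] by (simp add: P.sec_simps)
      finally have "?a = ?b" by (intro S.sec_two_torsion[where \<sigma> = \<sigma>]) simp_all
      from arg_cong[OF this, of ?s] show "?l31 x u + ?l31 x u + ?l31 x u = ?r31 x u + ?r31 x u + ?r31 x u"
        by (simp add: P.sec_simps)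
    qed simp_all
  qed
  show ?thesis
  proof (rule jordan_pair.intro, goal_cases)
    case 1 show ?case by (rule is_module)
  next
    case 2 then show ?case by (rule quad_linear)
  next
    case 3 then show ?case by (rule quad_smult)
  next
    case 4 then show ?case by (rule quad2_linear)
  next
    case 5 then show ?case by (rule JP1)
  next
    case 6 from JP1_lin[OF 6] show ?case by (simp only: triple_def)
  next
    case 7 then show ?case by (rule JP2)
  next
    case 8 then show ?case by (rule JP3)
  next
    case 9 from JP3_lin(1)[OF 9] show ?case by (simp only: triple_def l31_def r31_def)
  next
    case 10 from JP3_lin(2)[OF 10] show ?case by (simp only: triple_def l22_def r22_def)
  qed
qed

section \<open>Endomorphism pairs and inner derivations\<close>

context jordan_pair
begin

abbreviation E where "E \<equiv> End_pair R V"

lemma E_apply: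
  assumes "z \<in> pcarrier V \<sigma>"
  shows "(\<gamma> \<oplus>\<^bsub>E\<^esub> \<mu>) \<sigma> z = \<gamma> \<sigma> z \<oplus>\<^bsub>part V \<sigma>\<^esub> \<mu> \<sigma> z"
    and "(\<gamma> \<otimes>\<^bsub>E\<^esub> \<mu>) \<sigma> z = \<gamma> \<sigma> (\<mu> \<sigma> z) \<ominus>\<^bsub>part V \<sigma>\<^esub> \<mu> \<sigma> (\<gamma> \<sigma> z)"
    and "(a \<odot>\<^bsub>E\<^esub> \<gamma>) \<sigma> z = a \<odot>\<^bsub>part V \<sigma>\<^esub> \<gamma> \<sigma> z"
    and "\<zero>\<^bsub>E\<^esub> \<sigma> z = pzero V \<sigma>"
  using assms by (simp_all add: End_pair_def)

lemma E_carrier: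
  "\<gamma> \<in> carrier E \<longleftrightarrow>
    (\<forall>\<sigma>. \<gamma> \<sigma> \<in> extensional (pcarrier V \<sigma>) \<and> linear_map R (part V \<sigma>) (part V \<sigma>) (\<gamma> \<sigma>))"
  by (simp add: End_pair_def)

lemma E_ext:
  assumes "\<gamma> \<in> carrier E" "\<mu> \<in> carrier E"
    and "\<And>\<sigma> z. z \<in> pcarrier V \<sigma> \<Longrightarrow> \<gamma> \<sigma> z = \<mu> \<sigma> z"
  shows "\<gamma> = \<mu>"
proof
  fix \<sigma>
  have "\<gamma> \<sigma> \<in> extensional (pcarrier V \<sigma>)" "\<mu> \<sigma> \<in> extensional (pcarrier V \<sigma>)"
    using assms(1,2) by (simp_all only: E_carrier)
  then show "\<gamma> \<sigma> = \<mu> \<sigma>" by (rule extensionalityI) (rule assms(3))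
qed

lemma E_linear:
  assumes "\<gamma> \<in> carrier E" "x \<in> pcarrier V \<sigma>"
  shows E_app_closed: "\<gamma> \<sigma> x \<in> pcarrier V \<sigma>"
    and E_app_neg: "\<gamma> \<sigma> (\<ominus>\<^bsub>part V \<sigma>\<^esub> x) = \<ominus>\<^bsub>part V \<sigma>\<^esub> \<gamma> \<sigma> x"
    and E_app_add: "y \<in> pcarrier V \<sigma> \<Longrightarrow> \<gamma> \<sigma> (x \<oplus>\<^bsub>part V \<sigma>\<^esub> y) = \<gamma> \<sigma> x \<oplus>\<^bsub>part V \<sigma>\<^esub> \<gamma> \<sigma> y"
    and E_app_smult: "a \<in> carrier R \<Longrightarrow> \<gamma> \<sigma> (a \<odot>\<^bsub>part V \<sigma>\<^esub> x) = a \<odot>\<^bsub>part V \<sigma>\<^esub> \<gamma> \<sigma> x"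
proof -
  have l: "linear_map R (part V \<sigma>) (part V \<sigma>) (\<gamma> \<sigma>)" using assms(1) by (simp add: E_carrier)
  show "\<gamma> \<sigma> x \<in> pcarrier V \<sigma>" by (rule linear_map_closed[OF l assms(2)])
  show "\<gamma> \<sigma> (\<ominus>\<^bsub>part V \<sigma>\<^esub> x) = \<ominus>\<^bsub>part V \<sigma>\<^esub> \<gamma> \<sigma> x"
    by (rule linear_map_neg[OF l is_module is_module assms(2)])
  show "y \<in> pcarrier V \<sigma> \<Longrightarrow> \<gamma> \<sigma> (x \<oplus>\<^bsub>part V \<sigma>\<^esub> y) = \<gamma> \<sigma> x \<oplus>\<^bsub>part V \<sigma>\<^esub> \<gamma> \<sigma> y"
    by (rule linear_map_add[OF l assms(2)])
  show "a \<in> carrier R \<Longrightarrow> \<gamma> \<sigma> (a \<odot>\<^bsub>part V \<sigma>\<^esub> x) = a \<odot>\<^bsub>part V \<sigma>\<^esub> \<gamma> \<sigma> x"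
    by (rule linear_map_smult[OF l _ assms(2)])
qed

lemma E_app_zero: "\<gamma> \<in> carrier E \<Longrightarrow> \<gamma> \<sigma> (pzero V \<sigma>) = pzero V \<sigma>"
  by (rule linear_map_zero[OF _ is_module is_module]) (simp add: E_carrier)

lemma E_closedI:
  assumes "\<And>\<sigma>. linear_map R (part V \<sigma>) (part V \<sigma>) (\<lambda>z. f \<sigma> z)"
  shows "(\<lambda>\<sigma>. \<lambda>z\<in>pcarrier V \<sigma>. f \<sigma> z) \<in> carrier E"
  using assms unfolding E_carrier linear_map_def by (auto simp: Pi_iff)

lemma E_add_closed:
  assumes [simp]: "\<gamma> \<in> carrier E" "\<mu> \<in> carrier E"
  shows "\<gamma> \<oplus>\<^bsub>E\<^esub> \<mu> \<in> carrier E"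
proof -
  have "linear_map R (part V \<sigma>) (part V \<sigma>) (\<lambda>z. \<gamma> \<sigma> z \<oplus>\<^bsub>part V \<sigma>\<^esub> \<mu> \<sigma> z)" for \<sigma>
    by (rule linear_mapI) (simp_all add: E_linear P.smult_r_distr P.a_ac)
  from E_closedI[of "\<lambda>\<sigma> z. \<gamma> \<sigma> z \<oplus>\<^bsub>part V \<sigma>\<^esub> \<mu> \<sigma> z", OF this]
  show ?thesis by (simp add: End_pair_def)
qed

lemma E_mult_closed:
  assumes [simp]: "\<gamma> \<in> carrier E" "\<mu> \<in> carrier E"
  shows "\<gamma> \<otimes>\<^bsub>E\<^esub> \<mu> \<in> carrier E"
proof -
  have "linear_map R (part V \<sigma>) (part V \<sigma>) (\<lambda>z. \<gamma> \<sigma> (\<mu> \<sigma> z) \<ominus>\<^bsub>part V \<sigma>\<^esub> \<mu> \<sigma> (\<gamma> \<sigma> z))" for \<sigma>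
    by (rule linear_mapI)
      (simp_all add: E_linear a_minus_def P.smult_r_distr P.smult_r_minus P.minus_add P.a_ac)
  from E_closedI[of "\<lambda>\<sigma> z. \<gamma> \<sigma> (\<mu> \<sigma> z) \<ominus>\<^bsub>part V \<sigma>\<^esub> \<mu> \<sigma> (\<gamma> \<sigma> z)", OF this]
  show ?thesis by (simp add: End_pair_def)
qed

lemma E_smult_closed:
  assumes [simp]: "\<gamma> \<in> carrier E" "a \<in> carrier R"
  shows "a \<odot>\<^bsub>E\<^esub> \<gamma> \<in> carrier E"
proof -
  have "linear_map R (part V \<sigma>) (part V \<sigma>) (\<lambda>z. a \<odot>\<^bsub>part V \<sigma>\<^esub> \<gamma> \<sigma> z)" for \<sigma>
    by (rule linear_mapI)
      (simp_all add: E_linear P.smult_r_distr P.smult_assoc1[symmetric] P.R.m_comm)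
  from E_closedI[of "\<lambda>\<sigma> z. a \<odot>\<^bsub>part V \<sigma>\<^esub> \<gamma> \<sigma> z", OF this]
  show ?thesis by (simp add: End_pair_def)
qed

lemma E_neg_closed:
  assumes [simp]: "\<gamma> \<in> carrier E"
  shows "(\<lambda>\<sigma>. \<lambda>z\<in>pcarrier V \<sigma>. \<ominus>\<^bsub>part V \<sigma>\<^esub> \<gamma> \<sigma> z) \<in> carrier E"
proof (rule E_closedI)
  fix \<sigma> show "linear_map R (part V \<sigma>) (part V \<sigma>) (\<lambda>z. \<ominus>\<^bsub>part V \<sigma>\<^esub> \<gamma> \<sigma> z)"
    by (rule linear_mapI) (simp_all add: E_linear P.smult_r_minus P.minus_add)
qed

lemma E_zero_closed: "\<zero>\<^bsub>E\<^esub> \<in> carrier E"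
proof -
  have "linear_map R (part V \<sigma>) (part V \<sigma>) (\<lambda>z. pzero V \<sigma>)" for \<sigma>
    by (rule linear_mapI) simp_all
  from E_closedI[of "\<lambda>\<sigma> z. pzero V \<sigma>", OF this]
  show ?thesis by (simp add: End_pair_def)
qed

lemmas E_ops_closed = E_add_closed E_mult_closed E_smult_closed E_neg_closed E_zero_closed

lemma E_module: "module R E"
proof (rule moduleI)
  show "cring R" by (rule module.axioms(1)[OF is_module[of Pos]])
  note simps = E_ops_closed E_apply E_app_closed E_zero_closed
  show "abelian_group E"
  proof (rule abelian_groupI)
    fix x assume x: "x \<in> carrier E"
    show "\<exists>y\<in>carrier E. y \<oplus>\<^bsub>E\<^esub> x = \<zero>\<^bsub>E\<^esub>"
    proof (rule bexI)
      show "(\<lambda>\<sigma>. \<lambda>z\<in>pcarrier V \<sigma>. \<ominus>\<^bsub>part V \<sigma>\<^esub> x \<sigma> z) \<oplus>\<^bsub>E\<^esub> x = \<zero>\<^bsub>E\<^esub>"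
        by (rule E_ext) (simp_all add: simps x P.l_neg)
    qed (simp add: E_ops_closed x)
  next
    fix x y z assume "x \<in> carrier E" "y \<in> carrier E" "z \<in> carrier E"
    then show "x \<oplus>\<^bsub>E\<^esub> y \<oplus>\<^bsub>E\<^esub> z = x \<oplus>\<^bsub>E\<^esub> (y \<oplus>\<^bsub>E\<^esub> z)"
      by (intro E_ext) (simp_all add: simps P.a_assoc)
  next
    fix x y assume "x \<in> carrier E" "y \<in> carrier E"
    then show "x \<oplus>\<^bsub>E\<^esub> y = y \<oplus>\<^bsub>E\<^esub> x"
      by (intro E_ext) (simp_all add: simps P.a_comm)
  next
    fix x assume "x \<in> carrier E"
    then show "\<zero>\<^bsub>E\<^esub> \<oplus>\<^bsub>E\<^esub> x = x"
      by (intro E_ext) (simp_all add: simps)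
  qed (simp_all add: E_ops_closed E_zero_closed)
  show "a \<odot>\<^bsub>E\<^esub> x \<in> carrier E" if "a \<in> carrier R" "x \<in> carrier E" for a x
    using that by (simp add: simps)
  show "(a \<oplus> b) \<odot>\<^bsub>E\<^esub> x = a \<odot>\<^bsub>E\<^esub> x \<oplus>\<^bsub>E\<^esub> b \<odot>\<^bsub>E\<^esub> x"
    if "a \<in> carrier R" "b \<in> carrier R" "x \<in> carrier E" for a b x
    using that by (intro E_ext) (simp_all add: simps P.smult_l_distr)
  show "a \<odot>\<^bsub>E\<^esub> (x \<oplus>\<^bsub>E\<^esub> y) = a \<odot>\<^bsub>E\<^esub> x \<oplus>\<^bsub>E\<^esub> a \<odot>\<^bsub>E\<^esub> y"
    if "a \<in> carrier R" "x \<in> carrier E" "y \<in> carrier E" for a x y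
    using that by (intro E_ext) (simp_all add: simps P.smult_r_distr)
  show "(a \<otimes> b) \<odot>\<^bsub>E\<^esub> x = a \<odot>\<^bsub>E\<^esub> (b \<odot>\<^bsub>E\<^esub> x)"
    if "a \<in> carrier R" "b \<in> carrier R" "x \<in> carrier E" for a b x
    using that by (intro E_ext) (simp_all add: simps P.smult_assoc1)
  show "\<one> \<odot>\<^bsub>E\<^esub> x = x" if "x \<in> carrier E" for x
    using that by (intro E_ext) (simp_all add: simps)
qed

sublocale E: module R E by (rule E_module)

lemma E_app_a_inv:
  assumes "\<gamma> \<in> carrier E" "z \<in> pcarrier V \<sigma>"
  shows "(\<ominus>\<^bsub>E\<^esub> \<gamma>) \<sigma> z = \<ominus>\<^bsub>part V \<sigma>\<^esub> \<gamma> \<sigma> z"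
proof -
  have "(\<ominus>\<^bsub>E\<^esub> \<gamma> \<oplus>\<^bsub>E\<^esub> \<gamma>) \<sigma> z = pzero V \<sigma>" using assms by (simp add: E.l_neg E_apply)
  then have "(\<ominus>\<^bsub>E\<^esub> \<gamma>) \<sigma> z \<oplus>\<^bsub>part V \<sigma>\<^esub> \<gamma> \<sigma> z = pzero V \<sigma>" using assms by (simp add: E_apply)
  then show ?thesis using assms by (intro P.minus_equality[symmetric]) (simp_all add: E_app_closed)
qed

lemma inner_der_apply:
  "z \<in> pcarrier V Pos \<Longrightarrow> inner_der V x y Pos z = triple V Pos x y z"
  "z \<in> pcarrier V Neg \<Longrightarrow> inner_der V x y Neg z = \<ominus>\<^bsub>part V Neg\<^esub> triple V Neg y x z"
  by simp_all

declare inner_der.simps [simp del]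

lemmas triple_closed_Neg [simp] = triple_closed[of _ Neg, simplified]
lemmas triple_linear_signs = triple_linear triple_add2[of _ Pos, simplified] triple_add2[of _ Neg, simplified]
  triple_smult2[of _ Pos, simplified] triple_smult2[of _ Neg, simplified]
  triple_neg2[of _ Pos, simplified] triple_neg2[of _ Neg, simplified]

lemma inner_der_closed [simp]:
  assumes [simp]: "x \<in> pcarrier V Pos" "y \<in> pcarrier V Neg"
  shows "inner_der V x y \<in> carrier E"
  unfolding E_carrier
proof
  fix \<sigma>
  have "linear_map R (part V Pos) (part V Pos) (\<lambda>z. triple V Pos x y z)"
    by (rule linear_mapI) (simp_all add: triple_linear)
  moreover have "linear_map R (part V Neg) (part V Neg) (\<lambda>z. \<ominus>\<^bsub>part V Neg\<^esub> triple V Neg y x z)"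
    by (rule linear_mapI) (simp_all add: triple_linear P.minus_add P.smult_r_minus)
  ultimately show "inner_der V x y \<sigma> \<in> extensional (pcarrier V \<sigma>) \<and>
      linear_map R (part V \<sigma>) (part V \<sigma>) (inner_der V x y \<sigma>)"
    by (cases \<sigma>) (auto simp: inner_der.simps linear_map_def Pi_iff)
qed

definition derivation :: "(sign \<Rightarrow> 'v \<Rightarrow> 'v) \<Rightarrow> bool" where
  "derivation \<gamma> \<longleftrightarrow> \<gamma> \<in> carrier E \<and>
    (\<forall>\<sigma>. \<forall>u\<in>pcarrier V \<sigma>. \<forall>z\<in>pcarrier V (- \<sigma>). \<forall>w\<in>pcarrier V \<sigma>.
      \<gamma> \<sigma> (triple V \<sigma> u z w) = triple V \<sigma> (\<gamma> \<sigma> u) z w \<oplus>\<^bsub>part V \<sigma>\<^esub>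
        triple V \<sigma> u (\<gamma> (- \<sigma>) z) w \<oplus>\<^bsub>part V \<sigma>\<^esub> triple V \<sigma> u z (\<gamma> \<sigma> w))"

text \<open>A restatement of \<open>five_linear\<close>: the minus sign in the negative component of
  \<open>inner_der\<close> produces the sign of its middle term.\<close>

lemma derivation_inner_der:
  assumes [simp]: "x \<in> pcarrier V Pos" "y \<in> pcarrier V Neg"
  shows "derivation (inner_der V x y)"
  unfolding derivation_def
proof (intro conjI allI ballI)
  show "inner_der V x y \<in> carrier E" by simp
  fix \<sigma> u z w assume uzw: "u \<in> pcarrier V \<sigma>" "z \<in> pcarrier V (- \<sigma>)" "w \<in> pcarrier V \<sigma>"
  show "inner_der V x y \<sigma> (triple V \<sigma> u z w) = triple V \<sigma> (inner_der V x y \<sigma> u) z w \<oplus>\<^bsub>part V \<sigma>\<^esub>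
        triple V \<sigma> u (inner_der V x y (- \<sigma>) z) w \<oplus>\<^bsub>part V \<sigma>\<^esub> triple V \<sigma> u z (inner_der V x y \<sigma> w)"
  proof (cases \<sigma>)
    case Pos
    then show ?thesis using uzw five_linear[of x Pos u w y z]
      by (simp add: inner_der_apply triple_linear_signs a_minus_def)
  next
    case Neg
    then show ?thesis using uzw five_linear[of y Neg u w x z]
      by (intro P.secI[of Neg]) (simp_all add: inner_der_apply triple_linear_signs P.sec_simps)
  qed
qed

lemma derivation_submodule: "submodule {\<gamma>. derivation \<gamma>} R E"
proof (rule E.submoduleI')
  note simps = E_apply E_app_closed triple_linear P.sec_simps algebra_simps
  show "{\<gamma>. derivation \<gamma>} \<subseteq> carrier E" by (auto simp: derivation_def)
  show "\<zero>\<^bsub>E\<^esub> \<in> {\<gamma>. derivation \<gamma>}" by (simp add: derivation_def E_apply)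
  show "x \<oplus>\<^bsub>E\<^esub> y \<in> {\<gamma>. derivation \<gamma>}" if "x \<in> {\<gamma>. derivation \<gamma>}" "y \<in> {\<gamma>. derivation \<gamma>}" for x y
    unfolding derivation_def mem_Collect_eq
  proof (intro conjI allI ballI)
    have [simp]: "x \<in> carrier E" "y \<in> carrier E" using that by (simp_all add: derivation_def)
    show "x \<oplus>\<^bsub>E\<^esub> y \<in> carrier E" by simp
    fix \<sigma> u z w assume [simp]: "u \<in> pcarrier V \<sigma>" "z \<in> pcarrier V (- \<sigma>)" "w \<in> pcarrier V \<sigma>"
    have "x \<sigma> (triple V \<sigma> u z w) = triple V \<sigma> (x \<sigma> u) z w \<oplus>\<^bsub>part V \<sigma>\<^esub>
        triple V \<sigma> u (x (- \<sigma>) z) w \<oplus>\<^bsub>part V \<sigma>\<^esub> triple V \<sigma> u z (x \<sigma> w)"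
      "y \<sigma> (triple V \<sigma> u z w) = triple V \<sigma> (y \<sigma> u) z w \<oplus>\<^bsub>part V \<sigma>\<^esub>
        triple V \<sigma> u (y (- \<sigma>) z) w \<oplus>\<^bsub>part V \<sigma>\<^esub> triple V \<sigma> u z (y \<sigma> w)"
      using that by (auto simp: derivation_def)
    then show "(x \<oplus>\<^bsub>E\<^esub> y) \<sigma> (triple V \<sigma> u z w) = triple V \<sigma> ((x \<oplus>\<^bsub>E\<^esub> y) \<sigma> u) z w \<oplus>\<^bsub>part V \<sigma>\<^esub>
        triple V \<sigma> u ((x \<oplus>\<^bsub>E\<^esub> y) (- \<sigma>) z) w \<oplus>\<^bsub>part V \<sigma>\<^esub> triple V \<sigma> u z ((x \<oplus>\<^bsub>E\<^esub> y) \<sigma> w)"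
      by (intro P.secI[of \<sigma>]) (simp_all add: simps)
  qed
  show "a \<odot>\<^bsub>E\<^esub> x \<in> {\<gamma>. derivation \<gamma>}" if "a \<in> carrier R" "x \<in> {\<gamma>. derivation \<gamma>}" for a x
    using that by (auto simp: derivation_def E_apply E_app_closed triple_linear P.smult_r_distr)
qed

lemma IDer_submodule: "submodule (IDer R V) R E"
  unfolding IDer_def by (rule E.module_span_submodule) auto

lemma inner_der_IDer [simp]:
  "\<lbrakk>x \<in> pcarrier V Pos; y \<in> pcarrier V Neg\<rbrakk> \<Longrightarrow> inner_der V x y \<in> IDer R V"
  unfolding IDer_def by (rule E.module_span_base) auto

lemma IDer_derivation: "\<gamma> \<in> IDer R V \<Longrightarrow> derivation \<gamma>"
proof -
  have "IDer R V \<subseteq> {\<gamma>. derivation \<gamma>}"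
    unfolding IDer_def
    by (rule E.module_span_least[OF derivation_submodule]) (auto intro: derivation_inner_der)
  then show "\<gamma> \<in> IDer R V \<Longrightarrow> derivation \<gamma>" by blast
qed

lemma IDer_closed [simp]: "\<gamma> \<in> IDer R V \<Longrightarrow> \<gamma> \<in> carrier E"
  using IDer_derivation by (auto simp: derivation_def)

lemma derivation_triple:
  assumes "\<gamma> \<in> IDer R V" "u \<in> pcarrier V \<sigma>" "z \<in> pcarrier V (- \<sigma>)" "w \<in> pcarrier V \<sigma>"
  shows "\<gamma> \<sigma> (triple V \<sigma> u z w) = triple V \<sigma> (\<gamma> \<sigma> u) z w \<oplus>\<^bsub>part V \<sigma>\<^esub>
        triple V \<sigma> u (\<gamma> (- \<sigma>) z) w \<oplus>\<^bsub>part V \<sigma>\<^esub> triple V \<sigma> u z (\<gamma> \<sigma> w)"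
  using IDer_derivation assms by (auto simp: derivation_def)

lemmas derivation_triple_signs = derivation_triple[of _ _ Pos, simplified] derivation_triple[of _ _ Neg, simplified]

text \<open>In \<gamma>{x,y,z} - {x,y,\<gamma>z} the derivation rule leaves exactly {\<gamma>x,y,z}
  + {x,\<gamma>y,z}. This drives both the closure of IDer(V) under commutators and the Jacobi
  identity of the TKK-algebra.\<close>

lemma bracket_inner_der:
  assumes [simp]: "\<gamma> \<in> IDer R V" "x \<in> pcarrier V Pos" "y \<in> pcarrier V Neg"
  shows "\<gamma> \<otimes>\<^bsub>E\<^esub> inner_der V x y = inner_der V (\<gamma> Pos x) y \<oplus>\<^bsub>E\<^esub> inner_der V x (\<gamma> Neg y)"
proof (rule E_ext)
  fix \<sigma> z assume z: "z \<in> pcarrier V \<sigma>"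
  show "(\<gamma> \<otimes>\<^bsub>E\<^esub> inner_der V x y) \<sigma> z = (inner_der V (\<gamma> Pos x) y \<oplus>\<^bsub>E\<^esub> inner_der V x (\<gamma> Neg y)) \<sigma> z"
  proof (cases \<sigma>)
    case Pos
    then show ?thesis using z by (intro P.secI[of Pos])
      (simp_all add: E_apply inner_der_apply E_linear derivation_triple_signs P.sec_simps)
  next
    case Neg
    then show ?thesis using z by (intro P.secI[of Neg])
      (simp_all add: E_apply inner_der_apply E_linear derivation_triple_signs P.sec_simps)
  qed
qed (simp_all add: E_ops_closed E_app_closed)

text \<open>Only the second factor has to be expanded into generators, because
  \<open>bracket_inner_der\<close> accepts any element of IDer(V) as first factor.\<close>

lemma IDer_bracket:
  assumes "\<gamma> \<in> IDer R V" "\<mu> \<in> IDer R V"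
  shows "\<gamma> \<otimes>\<^bsub>E\<^esub> \<mu> \<in> IDer R V"
proof -
  let ?S = "{inner_der V x y |x y. x \<in> pcarrier V Pos \<and> y \<in> pcarrier V Neg}"
  have "\<mu> \<in> module_span R E ?S" "?S \<subseteq> carrier E" using assms(2) by (auto simp: IDer_def)
  then show ?thesis
  proof (induction rule: E.module_span_induct)
    case (base \<mu>)
    then show ?case using assms(1) E.submoduleE(5)[OF IDer_submodule]
      by (auto simp: bracket_inner_der E_app_closed)
  next
    case zero
    have "\<gamma> \<otimes>\<^bsub>E\<^esub> \<zero>\<^bsub>E\<^esub> = \<zero>\<^bsub>E\<^esub>"
      using assms(1) by (intro E_ext) (simp_all add: E_ops_closed E_apply E_app_zero a_minus_def P.r_neg E_app_closed)
    then show ?case using E.submodule_zero[OF IDer_submodule] by simp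
  next
    case (add \<mu> \<nu>)
    have "\<gamma> \<otimes>\<^bsub>E\<^esub> (\<mu> \<oplus>\<^bsub>E\<^esub> \<nu>) = (\<gamma> \<otimes>\<^bsub>E\<^esub> \<mu>) \<oplus>\<^bsub>E\<^esub> (\<gamma> \<otimes>\<^bsub>E\<^esub> \<nu>)"
    proof (rule E_ext)
      fix \<sigma> z assume "z \<in> pcarrier V \<sigma>"
      then show "(\<gamma> \<otimes>\<^bsub>E\<^esub> (\<mu> \<oplus>\<^bsub>E\<^esub> \<nu>)) \<sigma> z = ((\<gamma> \<otimes>\<^bsub>E\<^esub> \<mu>) \<oplus>\<^bsub>E\<^esub> (\<gamma> \<otimes>\<^bsub>E\<^esub> \<nu>)) \<sigma> z"
        using add(1,2) assms(1)
        by (intro P.secI[of \<sigma>]) (simp_all add: E_apply E_linear P.sec_simps algebra_simps)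
    qed (use add(1,2) assms(1) in \<open>simp_all add: E_ops_closed\<close>)
    then show ?case using add E.submoduleE(5)[OF IDer_submodule] by simp
  next
    case (smult a \<mu>)
    have "\<gamma> \<otimes>\<^bsub>E\<^esub> (a \<odot>\<^bsub>E\<^esub> \<mu>) = a \<odot>\<^bsub>E\<^esub> (\<gamma> \<otimes>\<^bsub>E\<^esub> \<mu>)"
      using smult(1,2) assms(1) by (intro E_ext)
        (simp_all add: E_ops_closed E_apply E_linear a_minus_def P.smult_r_distr P.smult_r_minus)
    then show ?case using smult E.submoduleE(4)[OF IDer_submodule] by simp
  qed
qed

end

lemma (in abelian_group) a_inv_zero [simp]: "\<ominus> \<zero> = \<zero>"
  by (rule minus_equality) simp_all

lemma (in abelian_group) minus_zero_right [simp]: "x \<in> carrier G \<Longrightarrow> x \<ominus> \<zero> = x"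
  by (simp add: a_minus_def)

lemma (in module) smult_minus:
  "\<lbrakk>a \<in> carrier R; x \<in> carrier M; y \<in> carrier M\<rbrakk> \<Longrightarrow>
    a \<odot>\<^bsub>M\<^esub> (x \<ominus>\<^bsub>M\<^esub> y) = a \<odot>\<^bsub>M\<^esub> x \<ominus>\<^bsub>M\<^esub> a \<odot>\<^bsub>M\<^esub> y"
  by (simp add: a_minus_def smult_r_distr smult_r_minus)

section \<open>The TKK-algebra as a 3-graded Lie algebra\<close>

context jordan_pair
begin

abbreviation T where "T \<equiv> TKK R V"

lemma T_carrier: "(x, \<gamma>, x') \<in> carrier T \<longleftrightarrow> x \<in> pcarrier V Pos \<and> \<gamma> \<in> IDer R V \<and> x' \<in> pcarrier V Neg"
  by (simp add: TKK_def)

lemma T_ops: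
  "(x, \<gamma>, x') \<oplus>\<^bsub>T\<^esub> (y, \<mu>, y') = (x \<oplus>\<^bsub>part V Pos\<^esub> y, \<gamma> \<oplus>\<^bsub>E\<^esub> \<mu>, x' \<oplus>\<^bsub>part V Neg\<^esub> y')"
  "a \<odot>\<^bsub>T\<^esub> (x, \<gamma>, x') = (a \<odot>\<^bsub>part V Pos\<^esub> x, a \<odot>\<^bsub>E\<^esub> \<gamma>, a \<odot>\<^bsub>part V Neg\<^esub> x')"
  "\<zero>\<^bsub>T\<^esub> = (pzero V Pos, \<zero>\<^bsub>E\<^esub>, pzero V Neg)"
  "(x, \<gamma>, x') \<otimes>\<^bsub>T\<^esub> (y, \<mu>, y') =
    (\<gamma> Pos y \<ominus>\<^bsub>part V Pos\<^esub> \<mu> Pos x,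
     \<gamma> \<otimes>\<^bsub>E\<^esub> \<mu> \<oplus>\<^bsub>E\<^esub> inner_der V x y' \<ominus>\<^bsub>E\<^esub> inner_der V y x',
     \<gamma> Neg y' \<ominus>\<^bsub>part V Neg\<^esub> \<mu> Neg x')"
  by (simp_all add: TKK_def)

lemma IDer_ops [simp]:
  "\<lbrakk>\<gamma> \<in> IDer R V; \<mu> \<in> IDer R V\<rbrakk> \<Longrightarrow> \<gamma> \<oplus>\<^bsub>E\<^esub> \<mu> \<in> IDer R V"
  "\<lbrakk>\<gamma> \<in> IDer R V; \<mu> \<in> IDer R V\<rbrakk> \<Longrightarrow> \<gamma> \<ominus>\<^bsub>E\<^esub> \<mu> \<in> IDer R V"
  "\<lbrakk>\<gamma> \<in> IDer R V; \<mu> \<in> IDer R V\<rbrakk> \<Longrightarrow> \<gamma> \<otimes>\<^bsub>E\<^esub> \<mu> \<in> IDer R V"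
  "\<lbrakk>a \<in> carrier R; \<gamma> \<in> IDer R V\<rbrakk> \<Longrightarrow> a \<odot>\<^bsub>E\<^esub> \<gamma> \<in> IDer R V"
  "\<gamma> \<in> IDer R V \<Longrightarrow> \<ominus>\<^bsub>E\<^esub> \<gamma> \<in> IDer R V"
  "\<zero>\<^bsub>E\<^esub> \<in> IDer R V"
  using IDer_submodule by (auto intro: E.submoduleE E.submodule_zero E.submodule_minus IDer_bracket)

lemma IDer_app_closed [simp]: "\<lbrakk>\<gamma> \<in> IDer R V; x \<in> pcarrier V \<sigma>\<rbrakk> \<Longrightarrow> \<gamma> \<sigma> x \<in> pcarrier V \<sigma>"
  by (simp add: E_app_closed)

lemma T_module: "module R T"
proof (rule moduleI)
  show "cring R" by (rule module.axioms(1)[OF is_module[of Pos]])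
  show "abelian_group T"
  proof (rule abelian_groupI)
    fix X assume X: "X \<in> carrier T"
    obtain x \<gamma> x' where [simp]: "X = (x, \<gamma>, x')" by (cases X)
    show "\<exists>Y\<in>carrier T. Y \<oplus>\<^bsub>T\<^esub> X = \<zero>\<^bsub>T\<^esub>"
      using X by (intro bexI[of _ "(\<ominus>\<^bsub>part V Pos\<^esub> x, \<ominus>\<^bsub>E\<^esub> \<gamma>, \<ominus>\<^bsub>part V Neg\<^esub> x')"])
        (auto simp: T_ops T_carrier P.l_neg E.l_neg)
  next
    fix X Y assume "X \<in> carrier T" "Y \<in> carrier T"
    then show "X \<oplus>\<^bsub>T\<^esub> Y = Y \<oplus>\<^bsub>T\<^esub> X"
      by (cases X; cases Y) (simp add: T_ops T_carrier P.a_comm E.a_comm)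
  next
    fix X Y Z assume "X \<in> carrier T" "Y \<in> carrier T" "Z \<in> carrier T"
    then show "X \<oplus>\<^bsub>T\<^esub> Y \<oplus>\<^bsub>T\<^esub> Z = X \<oplus>\<^bsub>T\<^esub> (Y \<oplus>\<^bsub>T\<^esub> Z)"
      by (cases X; cases Y; cases Z) (simp add: T_ops T_carrier P.a_assoc E.a_assoc)
  next
    fix X Y assume "X \<in> carrier T" "Y \<in> carrier T"
    then show "X \<oplus>\<^bsub>T\<^esub> Y \<in> carrier T"
      by (cases X; cases Y) (simp add: T_ops T_carrier)
  next
    fix X assume "X \<in> carrier T"
    then show "\<zero>\<^bsub>T\<^esub> \<oplus>\<^bsub>T\<^esub> X = X" by (cases X) (simp add: T_ops T_carrier)
  qed (simp add: T_ops T_carrier)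
next
  fix a X assume "a \<in> carrier R" "X \<in> carrier T"
  then show "a \<odot>\<^bsub>T\<^esub> X \<in> carrier T" by (cases X) (simp add: T_ops T_carrier)
next
  fix a b X assume "a \<in> carrier R" "b \<in> carrier R" "X \<in> carrier T"
  then show "(a \<oplus> b) \<odot>\<^bsub>T\<^esub> X = a \<odot>\<^bsub>T\<^esub> X \<oplus>\<^bsub>T\<^esub> b \<odot>\<^bsub>T\<^esub> X"
    by (cases X) (simp add: T_ops T_carrier P.smult_l_distr E.smult_l_distr)
next
  fix a X Y assume "a \<in> carrier R" "X \<in> carrier T" "Y \<in> carrier T"
  then show "a \<odot>\<^bsub>T\<^esub> (X \<oplus>\<^bsub>T\<^esub> Y) = a \<odot>\<^bsub>T\<^esub> X \<oplus>\<^bsub>T\<^esub> a \<odot>\<^bsub>T\<^esub> Y"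
    by (cases X; cases Y) (simp add: T_ops T_carrier P.smult_r_distr E.smult_r_distr)
next
  fix a b X assume "a \<in> carrier R" "b \<in> carrier R" "X \<in> carrier T"
  then show "(a \<otimes> b) \<odot>\<^bsub>T\<^esub> X = a \<odot>\<^bsub>T\<^esub> (b \<odot>\<^bsub>T\<^esub> X)"
    by (cases X) (simp add: T_ops T_carrier P.smult_assoc1 E.smult_assoc1)
next
  fix X assume "X \<in> carrier T"
  then show "\<one> \<odot>\<^bsub>T\<^esub> X = X" by (cases X) (simp add: T_ops T_carrier)
qed

sublocale T: module R T by (rule T_module)

lemma mid_apply:
  assumes [simp]: "\<gamma> \<in> IDer R V" "\<mu> \<in> IDer R V" "x \<in> pcarrier V Pos" "y \<in> pcarrier V Pos"
    "x' \<in> pcarrier V Neg" "y' \<in> pcarrier V Neg"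
  shows "z \<in> pcarrier V Pos \<Longrightarrow>
    (\<gamma> \<otimes>\<^bsub>E\<^esub> \<mu> \<oplus>\<^bsub>E\<^esub> inner_der V x y' \<ominus>\<^bsub>E\<^esub> inner_der V y x') Pos z
      = \<gamma> Pos (\<mu> Pos z) \<ominus>\<^bsub>part V Pos\<^esub> \<mu> Pos (\<gamma> Pos z) \<oplus>\<^bsub>part V Pos\<^esub> triple V Pos x y' z
        \<ominus>\<^bsub>part V Pos\<^esub> triple V Pos y x' z"
    and "z \<in> pcarrier V Neg \<Longrightarrow>
    (\<gamma> \<otimes>\<^bsub>E\<^esub> \<mu> \<oplus>\<^bsub>E\<^esub> inner_der V x y' \<ominus>\<^bsub>E\<^esub> inner_der V y x') Neg z
      = \<gamma> Neg (\<mu> Neg z) \<ominus>\<^bsub>part V Neg\<^esub> \<mu> Neg (\<gamma> Neg z) \<ominus>\<^bsub>part V Neg\<^esub> triple V Neg y' x z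
        \<oplus>\<^bsub>part V Neg\<^esub> triple V Neg x' y z"
  by (simp_all add: a_minus_def E_apply E_app_a_inv inner_der_apply)

text \<open>Reduces an equation in T to equations in \<open>ab_section\<close>: the middle
  components are compared pointwise, after which the Lie axioms become additive identities between
  values of derivations and triple products.\<close>

lemma T_eqI:
  assumes "(x, \<gamma>, x') \<in> carrier T" "(y, \<mu>, y') \<in> carrier T"
    and "sec (part V Pos) x = sec (part V Pos) y" "sec (part V Neg) x' = sec (part V Neg) y'"
    and "\<And>z. z \<in> pcarrier V Pos \<Longrightarrow> sec (part V Pos) (\<gamma> Pos z) = sec (part V Pos) (\<mu> Pos z)"
    and "\<And>z. z \<in> pcarrier V Neg \<Longrightarrow> sec (part V Neg) (\<gamma> Neg z) = sec (part V Neg) (\<mu> Neg z)"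
  shows "(x, \<gamma>, x') = (y, \<mu>, y')"
proof -
  have "\<gamma> \<sigma> z = \<mu> \<sigma> z" if "z \<in> pcarrier V \<sigma>" for \<sigma> z
    using assms(1,2,5,6) that
    by (cases \<sigma>) (auto simp: T_carrier intro: P.secI[of Pos] P.secI[of Neg])
  then have "\<gamma> = \<mu>" using assms(1,2) by (intro E_ext) (auto simp: T_carrier)
  moreover have "x = y" using assms(1-3) by (intro P.secI[of Pos]) (auto simp: T_carrier)
  moreover have "x' = y'" using assms(1,2,4) by (intro P.secI[of Neg]) (auto simp: T_carrier)
  ultimately show ?thesis by simp
qed

lemma T_mult_closed: "\<lbrakk>X \<in> carrier T; Y \<in> carrier T\<rbrakk> \<Longrightarrow> X \<otimes>\<^bsub>T\<^esub> Y \<in> carrier T"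
  by (cases X; cases Y) (simp add: T_ops T_carrier)

lemmas T_expand = mid_apply E_apply E_linear derivation_triple_signs triple_linear_signs P.sec_simps

lemma T_lie: "lie_algebra R T"
proof (intro lie_algebra.intro lie_algebra_axioms.intro T_module)
  fix X assume X: "X \<in> carrier T"
  obtain x \<gamma> x' where Xe: "X = (x, \<gamma>, x')" by (cases X)
  have [simp]: "x \<in> pcarrier V Pos" "\<gamma> \<in> IDer R V" "x' \<in> pcarrier V Neg"
    using X by (simp_all add: Xe T_carrier)
  show "X \<otimes>\<^bsub>T\<^esub> X = \<zero>\<^bsub>T\<^esub>"
    unfolding Xe T_ops by (rule T_eqI) (simp_all add: T_carrier T_expand)
  show "linear_map R T T (\<lambda>Y. X \<otimes>\<^bsub>T\<^esub> Y)"
  proof (rule linear_mapI)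
    fix Y Z assume YZ: "Y \<in> carrier T" "Z \<in> carrier T"
    obtain y \<mu> y' where Ye: "Y = (y, \<mu>, y')" by (cases Y)
    obtain z \<nu> z' where Ze: "Z = (z, \<nu>, z')" by (cases Z)
    have [simp]: "y \<in> pcarrier V Pos" "\<mu> \<in> IDer R V" "y' \<in> pcarrier V Neg"
      "z \<in> pcarrier V Pos" "\<nu> \<in> IDer R V" "z' \<in> pcarrier V Neg"
      using YZ by (simp_all add: Ye Ze T_carrier)
    show "X \<otimes>\<^bsub>T\<^esub> (Y \<oplus>\<^bsub>T\<^esub> Z) = X \<otimes>\<^bsub>T\<^esub> Y \<oplus>\<^bsub>T\<^esub> X \<otimes>\<^bsub>T\<^esub> Z"
      unfolding Xe Ye Ze T_ops by (rule T_eqI) (simp_all add: T_carrier T_expand algebra_simps)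
  next
    fix a Y assume [simp]: "a \<in> carrier R" and Y: "Y \<in> carrier T"
    obtain y \<mu> y' where Ye: "Y = (y, \<mu>, y')" by (cases Y)
    have [simp]: "y \<in> pcarrier V Pos" "\<mu> \<in> IDer R V" "y' \<in> pcarrier V Neg"
      using Y by (simp_all add: Ye T_carrier)
    show "X \<otimes>\<^bsub>T\<^esub> (a \<odot>\<^bsub>T\<^esub> Y) = a \<odot>\<^bsub>T\<^esub> (X \<otimes>\<^bsub>T\<^esub> Y)"
      unfolding Xe Ye T_ops
      by (rule T_eqI) (simp_all add: T_carrier mid_apply E_apply E_linear triple_linear_signs
          P.smult_minus P.smult_r_distr P.smult_r_minus)
  qed (simp add: X T_mult_closed)
  show "linear_map R T T (\<lambda>Y. Y \<otimes>\<^bsub>T\<^esub> X)"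
  proof (rule linear_mapI)
    fix Y Z assume YZ: "Y \<in> carrier T" "Z \<in> carrier T"
    obtain y \<mu> y' where Ye: "Y = (y, \<mu>, y')" by (cases Y)
    obtain z \<nu> z' where Ze: "Z = (z, \<nu>, z')" by (cases Z)
    have [simp]: "y \<in> pcarrier V Pos" "\<mu> \<in> IDer R V" "y' \<in> pcarrier V Neg"
      "z \<in> pcarrier V Pos" "\<nu> \<in> IDer R V" "z' \<in> pcarrier V Neg"
      using YZ by (simp_all add: Ye Ze T_carrier)
    show "(Y \<oplus>\<^bsub>T\<^esub> Z) \<otimes>\<^bsub>T\<^esub> X = Y \<otimes>\<^bsub>T\<^esub> X \<oplus>\<^bsub>T\<^esub> Z \<otimes>\<^bsub>T\<^esub> X"
      unfolding Xe Ye Ze T_ops by (rule T_eqI) (simp_all add: T_carrier T_expand algebra_simps)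
  next
    fix a Y assume [simp]: "a \<in> carrier R" and Y: "Y \<in> carrier T"
    obtain y \<mu> y' where Ye: "Y = (y, \<mu>, y')" by (cases Y)
    have [simp]: "y \<in> pcarrier V Pos" "\<mu> \<in> IDer R V" "y' \<in> pcarrier V Neg"
      using Y by (simp_all add: Ye T_carrier)
    show "(a \<odot>\<^bsub>T\<^esub> Y) \<otimes>\<^bsub>T\<^esub> X = a \<odot>\<^bsub>T\<^esub> (Y \<otimes>\<^bsub>T\<^esub> X)"
      unfolding Xe Ye T_ops
      by (rule T_eqI) (simp_all add: T_carrier mid_apply E_apply E_linear triple_linear_signs
          P.smult_minus P.smult_r_distr P.smult_r_minus)
  qed (simp add: X T_mult_closed)
  fix Y Z assume YZ: "Y \<in> carrier T" "Z \<in> carrier T"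
  obtain y \<mu> y' where Ye: "Y = (y, \<mu>, y')" by (cases Y)
  obtain z \<nu> z' where Ze: "Z = (z, \<nu>, z')" by (cases Z)
  have [simp]: "y \<in> pcarrier V Pos" "\<mu> \<in> IDer R V" "y' \<in> pcarrier V Neg"
    "z \<in> pcarrier V Pos" "\<nu> \<in> IDer R V" "z' \<in> pcarrier V Neg"
    using YZ by (simp_all add: Ye Ze T_carrier)
  have c: "triple V \<sigma> x w y = triple V \<sigma> y w x" if "x \<in> pcarrier V \<sigma>" "y \<in> pcarrier V \<sigma>"
    "w \<in> pcarrier V (- \<sigma>)" for \<sigma> x y w using that by (rule triple_commute)
  \<comment> \<open>The triple product is symmetric in its outer arguments; one order is fixed for
    each pair so that equal terms of the Jacobi sum cancel syntactically.\<close>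
  have [simp]: "triple V Pos y z' x = triple V Pos x z' y" "triple V Pos z y' x = triple V Pos x y' z"
    "triple V Pos z x' y = triple V Pos y x' z"
    "triple V Neg y' z x' = triple V Neg x' z y'" "triple V Neg z' y x' = triple V Neg x' y z'"
    "triple V Neg z' x y' = triple V Neg y' x z'"
    by (simp_all add: c[of y Pos x] c[of z Pos x] c[of z Pos y] c[of y' Neg x'] c[of z' Neg x'] c[of z' Neg y'])
  show "X \<otimes>\<^bsub>T\<^esub> (Y \<otimes>\<^bsub>T\<^esub> Z) \<oplus>\<^bsub>T\<^esub> Y \<otimes>\<^bsub>T\<^esub> (Z \<otimes>\<^bsub>T\<^esub> X) \<oplus>\<^bsub>T\<^esub> Z \<otimes>\<^bsub>T\<^esub> (X \<otimes>\<^bsub>T\<^esub> Y) = \<zero>\<^bsub>T\<^esub>"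
    unfolding Xe Ye Ze T_ops
    by (rule T_eqI) (simp_all add: T_carrier T_expand a_minus_def E_app_a_inv inner_der_apply algebra_simps)
qed

sublocale T: lie_algebra R T by (rule T_lie)

lemma T_grade_iff:
  "(x, \<gamma>, x') \<in> TKK_grade R V k \<longleftrightarrow> (x, \<gamma>, x') \<in> carrier T \<and>
    (k = 1 \<or> x = pzero V Pos) \<and> (k = 0 \<or> \<gamma> = \<zero>\<^bsub>E\<^esub>) \<and> (k = -1 \<or> x' = pzero V Neg)"
  by (auto simp: TKK_grade_def T_carrier T_ops)

lemma T_graded: "three_graded R T (TKK_grade R V)"
proof (intro three_graded.intro three_graded_axioms.intro T_lie)
  fix k
  show "submodule (TKK_grade R V k) R T" for k
  proof (rule T.submoduleI')
    show "TKK_grade R V k \<subseteq> carrier T" by (auto simp: T_grade_iff)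
    show "\<zero>\<^bsub>T\<^esub> \<in> TKK_grade R V k" by (simp add: T_ops T_grade_iff T_carrier)
    show "X \<oplus>\<^bsub>T\<^esub> Y \<in> TKK_grade R V k" if "X \<in> TKK_grade R V k" "Y \<in> TKK_grade R V k" for X Y
      using that by (cases X; cases Y) (auto simp: T_ops T_grade_iff T_carrier)
    show "a \<odot>\<^bsub>T\<^esub> X \<in> TKK_grade R V k" if "a \<in> carrier R" "X \<in> TKK_grade R V k" for a X
      using that by (cases X) (auto simp: T_ops T_grade_iff T_carrier)
  qed
  show "TKK_grade R V k = {\<zero>\<^bsub>T\<^esub>}" if "\<bar>k\<bar> > 1"
    using that by (auto simp: TKK_grade_def)
next
  fix X assume X: "X \<in> carrier T"
  obtain x \<gamma> x' where Xe: "X = (x, \<gamma>, x')" by (cases X)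
  have [simp]: "x \<in> pcarrier V Pos" "\<gamma> \<in> IDer R V" "x' \<in> pcarrier V Neg"
    using X by (simp_all add: Xe T_carrier)
  show "\<exists>!p\<in>TKK_grade R V (-1) \<times> TKK_grade R V 0 \<times> TKK_grade R V 1.
      X = fst p \<oplus>\<^bsub>T\<^esub> fst (snd p) \<oplus>\<^bsub>T\<^esub> snd (snd p)"
    unfolding Xe
    by (rule ex1I[of _ "((pzero V Pos, \<zero>\<^bsub>E\<^esub>, x'), (pzero V Pos, \<gamma>, pzero V Neg), (x, \<zero>\<^bsub>E\<^esub>, pzero V Neg))"])
      (auto simp: T_grade_iff T_carrier T_ops)
next
  fix X Y i j assume XY: "X \<in> TKK_grade R V i" "Y \<in> TKK_grade R V j"
  obtain x \<gamma> x' where Xe: "X = (x, \<gamma>, x')" by (cases X)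
  obtain y \<mu> y' where Ye: "Y = (y, \<mu>, y')" by (cases Y)
  have [simp]: "x \<in> pcarrier V Pos" "\<gamma> \<in> IDer R V" "x' \<in> pcarrier V Neg"
    "y \<in> pcarrier V Pos" "\<mu> \<in> IDer R V" "y' \<in> pcarrier V Neg"
    using XY by (simp_all add: Xe Ye T_grade_iff T_carrier)
  have h: "i = 1 \<or> x = pzero V Pos" "i = 0 \<or> \<gamma> = \<zero>\<^bsub>E\<^esub>" "i = -1 \<or> x' = pzero V Neg"
    "j = 1 \<or> y = pzero V Pos" "j = 0 \<or> \<mu> = \<zero>\<^bsub>E\<^esub>" "j = -1 \<or> y' = pzero V Neg"
    using XY by (simp_all add: Xe Ye T_grade_iff)
  have "i + j = 1 \<or> \<gamma> Pos y \<ominus>\<^bsub>part V Pos\<^esub> \<mu> Pos x = pzero V Pos"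
    using h by (auto simp: E_apply E_app_zero)
  moreover have "i + j = -1 \<or> \<gamma> Neg y' \<ominus>\<^bsub>part V Neg\<^esub> \<mu> Neg x' = pzero V Neg"
    using h by (auto simp: E_apply E_app_zero)
  moreover have "i + j = 0 \<or> \<gamma> \<otimes>\<^bsub>E\<^esub> \<mu> \<oplus>\<^bsub>E\<^esub> inner_der V x y' \<ominus>\<^bsub>E\<^esub> inner_der V y x' = \<zero>\<^bsub>E\<^esub>"
  proof (cases "i + j = 0")
    case False
    have "(\<gamma> \<otimes>\<^bsub>E\<^esub> \<mu> \<oplus>\<^bsub>E\<^esub> inner_der V x y' \<ominus>\<^bsub>E\<^esub> inner_der V y x') \<sigma> z = pzero V \<sigma>"
      if "z \<in> pcarrier V \<sigma>" for \<sigma> z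
    proof -
      have "\<gamma> = \<zero>\<^bsub>E\<^esub> \<or> \<mu> = \<zero>\<^bsub>E\<^esub>" "x = pzero V Pos \<or> y' = pzero V Neg" "y = pzero V Pos \<or> x' = pzero V Neg"
        using h False by auto
      then show ?thesis using that
        triple_zero2[of _ Pos, simplified] triple_zero2[of _ Neg, simplified]
        by (cases \<sigma>) (auto simp: mid_apply E_apply E_app_zero)
    qed
    then show ?thesis by (intro disjI2 E_ext) (simp_all add: E_apply E_zero_closed)
  qed simp
  ultimately show "X \<otimes>\<^bsub>T\<^esub> Y \<in> TKK_grade R V (i + j)"
    by (simp add: Xe Ye T_ops T_grade_iff T_carrier)
qed

sublocale T: three_graded R T "TKK_grade R V" by (rule T_graded)

lemma TKK_in_mem [simp]: "x \<in> pcarrier V \<sigma> \<Longrightarrow> TKK_in R V \<sigma> x \<in> TKK_grade R V (deg \<sigma>)"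
  by (cases \<sigma>) (simp_all add: T_grade_iff T_carrier)

lemma TKK_grade_deg: "TKK_grade R V (deg \<sigma>) = TKK_in R V \<sigma> ` pcarrier V \<sigma>"
  by (cases \<sigma>) (simp_all add: TKK_grade_def)

lemma TKK_in_closed [simp]: "x \<in> pcarrier V \<sigma> \<Longrightarrow> TKK_in R V \<sigma> x \<in> carrier T"
  by (cases \<sigma>) (simp_all add: T_carrier)

lemma TKK_in_inject: "TKK_in R V \<sigma> x = TKK_in R V \<sigma> y \<longleftrightarrow> x = y"
  by (cases \<sigma>) auto

lemma TKK_in_linear: "linear_map R (part V \<sigma>) T (TKK_in R V \<sigma>)"
  by (rule linear_mapI; cases \<sigma>) (simp_all add: T_ops T_carrier E_zero_closed)

lemma TKK_in_zero [simp]: "TKK_in R V \<sigma> (pzero V \<sigma>) = \<zero>\<^bsub>T\<^esub>"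
  by (cases \<sigma>) (simp_all add: T_ops)

lemma inner_der_zero [simp]:
  "x \<in> pcarrier V Pos \<Longrightarrow> inner_der V x (pzero V Neg) = \<zero>\<^bsub>E\<^esub>"
  "y \<in> pcarrier V Neg \<Longrightarrow> inner_der V (pzero V Pos) y = \<zero>\<^bsub>E\<^esub>"
proof -
  show "inner_der V x (pzero V Neg) = \<zero>\<^bsub>E\<^esub>" if [simp]: "x \<in> pcarrier V Pos"
  proof (rule E_ext)
    fix \<sigma> z assume "z \<in> pcarrier V \<sigma>"
    then show "inner_der V x (pzero V Neg) \<sigma> z = \<zero>\<^bsub>E\<^esub> \<sigma> z"
      using triple_zero2[of _ Pos, simplified]
      by (cases \<sigma>) (simp_all add: inner_der_apply E_apply)
  qed (simp_all add: E_zero_closed)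
  show "inner_der V (pzero V Pos) y = \<zero>\<^bsub>E\<^esub>" if [simp]: "y \<in> pcarrier V Neg"
  proof (rule E_ext)
    fix \<sigma> z assume "z \<in> pcarrier V \<sigma>"
    then show "inner_der V (pzero V Pos) y \<sigma> z = \<zero>\<^bsub>E\<^esub> \<sigma> z"
      using triple_zero2[of _ Neg, simplified]
      by (cases \<sigma>) (simp_all add: inner_der_apply E_apply)
  qed (simp_all add: E_zero_closed)
qed

lemma E_mult_zero: "\<zero>\<^bsub>E\<^esub> \<otimes>\<^bsub>E\<^esub> \<zero>\<^bsub>E\<^esub> = \<zero>\<^bsub>E\<^esub>"
  by (rule E_ext) (simp_all add: E_apply E_ops_closed)

lemma TKK_bracket:
  assumes [simp]: "x \<in> pcarrier V Pos" "y \<in> pcarrier V Neg"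
  shows "TKK_in R V Pos x \<otimes>\<^bsub>T\<^esub> TKK_in R V Neg y = (pzero V Pos, inner_der V x y, pzero V Neg)"
  by (simp add: T_ops E_apply E_mult_zero)

text \<open>For negative x two signs cancel: the bracket of a negative with a positive element is
  minus an inner derivation, and inner derivations act on the negative part by minus the triple
  product.\<close>

lemma TKK_triple:
  assumes xyz: "x \<in> pcarrier V \<sigma>" "y \<in> pcarrier V (- \<sigma>)" "z \<in> pcarrier V \<sigma>"
  shows "(TKK_in R V \<sigma> x \<otimes>\<^bsub>T\<^esub> TKK_in R V (- \<sigma>) y) \<otimes>\<^bsub>T\<^esub> TKK_in R V \<sigma> z
    = TKK_in R V \<sigma> (triple V \<sigma> x y z)"
proof (cases \<sigma>)
  case Pos
  then have [simp]: "x \<in> pcarrier V Pos" "y \<in> pcarrier V Neg" "z \<in> pcarrier V Pos" using xyz by simp_all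
  have "(pzero V Pos, inner_der V x y, pzero V Neg) \<otimes>\<^bsub>T\<^esub> TKK_in R V Pos z = TKK_in R V Pos (triple V Pos x y z)"
    unfolding TKK_in.simps T_ops
    by (rule T_eqI) (simp_all add: T_carrier mid_apply E_apply E_linear E_app_zero inner_der_apply)
  then show ?thesis using Pos TKK_bracket[of x y] by simp
next
  case Neg
  then have [simp]: "x \<in> pcarrier V Neg" "y \<in> pcarrier V Pos" "z \<in> pcarrier V Neg" using xyz by simp_all
  have "(pzero V Pos, inner_der V y x, pzero V Neg) \<otimes>\<^bsub>T\<^esub> TKK_in R V Neg z = \<ominus>\<^bsub>T\<^esub> TKK_in R V Neg (triple V Neg x y z)"
  proof -
    have e: "\<ominus>\<^bsub>T\<^esub> TKK_in R V Neg (triple V Neg x y z) = TKK_in R V Neg (\<ominus>\<^bsub>part V Neg\<^esub> triple V Neg x y z)"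
      using linear_map_neg[OF TKK_in_linear[of Neg] is_module T_module, of "triple V Neg x y z"] by simp
    show ?thesis unfolding e unfolding TKK_in.simps T_ops
      by (rule T_eqI) (simp_all add: T_carrier mid_apply E_apply E_linear E_app_zero inner_der_apply)
  qed
  moreover have "TKK_in R V Neg x \<otimes>\<^bsub>T\<^esub> TKK_in R V Pos y = \<ominus>\<^bsub>T\<^esub> (pzero V Pos, inner_der V y x, pzero V Neg)"
    using T.br_anti[of "TKK_in R V Pos y" "TKK_in R V Neg x"] TKK_bracket[of y x] TKK_in_closed[of y Pos] TKK_in_closed[of x Neg]
    by simp
  moreover have "(pzero V Pos, inner_der V y x, pzero V Neg) \<in> carrier T" by (simp add: T_carrier)
  moreover have "TKK_in R V Neg (triple V Neg x y z) \<in> carrier T" "TKK_in R V Neg z \<in> carrier T"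
    using TKK_in_closed[of _ Neg] by simp_all
  ultimately show ?thesis using Neg by (simp add: T.br_neg_l del: TKK_in.simps)
qed

lemma T_generated: "lie_prod R T (TKK_grade R V 1) (TKK_grade R V (-1)) = TKK_grade R V 0"
proof
  show "lie_prod R T (TKK_grade R V 1) (TKK_grade R V (-1)) \<subseteq> TKK_grade R V 0"
    unfolding lie_prod_def
    by (rule T.module_span_least[OF T.grade_submodule]) (use T.grade_bracket in fastforce)
  let ?S = "{inner_der V x y |x y. x \<in> pcarrier V Pos \<and> y \<in> pcarrier V Neg}"
  let ?B = "{x \<otimes>\<^bsub>T\<^esub> y |x y. x \<in> TKK_grade R V 1 \<and> y \<in> TKK_grade R V (-1)}"
  have B: "?B \<subseteq> carrier T" using T.submoduleE(1)[OF T.grade_submodule] by blast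
  note sub = T.module_span_submodule[OF B]
  have *: "(pzero V Pos, \<gamma>, pzero V Neg) \<in> module_span R T ?B" if "\<gamma> \<in> IDer R V" for \<gamma>
  proof -
    have "\<gamma> \<in> module_span R E ?S" "?S \<subseteq> carrier E" using that by (auto simp: IDer_def)
    then show ?thesis
    proof (induction rule: E.module_span_induct)
      case (base \<gamma>)
      then obtain x y where xy: "\<gamma> = inner_der V x y" "x \<in> pcarrier V Pos" "y \<in> pcarrier V Neg" by auto
      have "TKK_in R V Pos x \<in> TKK_grade R V 1" "TKK_in R V Neg y \<in> TKK_grade R V (-1)"
        using TKK_in_mem[of x Pos] TKK_in_mem[of y Neg] xy by simp_all
      then show ?case using TKK_bracket[of x y] xy
        by (intro T.module_span_base) (metis (mono_tags, lifting) mem_Collect_eq)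
    next
      case zero
      then show ?case using T.submodule_zero[OF sub] by (simp add: T_ops)
    next
      case (add \<gamma> \<mu>)
      then show ?case using T.submoduleE(5)[OF sub, of "(pzero V Pos, \<gamma>, pzero V Neg)" "(pzero V Pos, \<mu>, pzero V Neg)"]
        by (simp add: T_ops)
    next
      case (smult a \<gamma>)
      then show ?case using T.submoduleE(4)[OF sub, of a "(pzero V Pos, \<gamma>, pzero V Neg)"]
        by (simp add: T_ops)
    qed
  qed
  show "TKK_grade R V 0 \<subseteq> lie_prod R T (TKK_grade R V 1) (TKK_grade R V (-1))"
    using * unfolding lie_prod_def by (auto simp: T_grade_iff T_carrier)
qed

text \<open>A degree-zero element is a pair of maps, and bracketing it with elements of degree 1 or
  -1 is evaluation.\<close>

lemma T_faithful:
  assumes d: "d \<in> TKK_grade R V 0"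
    and "\<And>\<sigma> x. x \<in> TKK_grade R V (deg \<sigma>) \<Longrightarrow> d \<otimes>\<^bsub>T\<^esub> x = \<zero>\<^bsub>T\<^esub>"
  shows "d = \<zero>\<^bsub>T\<^esub>"
proof -
  obtain \<gamma> where g: "d = (pzero V Pos, \<gamma>, pzero V Neg)" "\<gamma> \<in> IDer R V"
    using d by (cases d) (auto simp: T_grade_iff T_carrier)
  have "\<gamma> \<sigma> z = pzero V \<sigma>" if "z \<in> pcarrier V \<sigma>" for \<sigma> z
    using assms(2)[of "TKK_in R V \<sigma> z" \<sigma>] TKK_in_mem[OF that] that g
    by (cases \<sigma>) (auto simp: T_ops E_apply)
  then have "\<gamma> = \<zero>\<^bsub>E\<^esub>" using g by (intro E_ext) (auto simp: E_apply E_zero_closed)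
  then show ?thesis using g by (simp add: T_ops)
qed

end

section \<open>3-graded Lie algebras\<close>

text \<open>The bracket relations of a 3-grading without the direct sum decomposition. This is
  enough for the associated Jordan pair, and it is what the homogeneous parts of \<open>Qm\<close>
  are shown to satisfy for every nondegenerate graded algebra.\<close>

locale subgraded_lie = lie_algebra R L
  for R :: "('a, 'r) ring_scheme" (structure) and L :: "('a, 'l) module" (structure) +
  fixes G :: "int \<Rightarrow> 'l set"
  assumes six_unit: "add_pow R (6::nat) \<one> \<in> Units R"
    and grade_submodule: "submodule (G k) R L"
    and grade_trivial: "\<bar>k\<bar> > 1 \<Longrightarrow> G k = {\<zero>\<^bsub>L\<^esub>}"
    and grade_bracket: "\<lbrakk>x \<in> G i; y \<in> G j\<rbrakk> \<Longrightarrow> x \<otimes>\<^bsub>L\<^esub> y \<in> G (i + j)"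

sublocale subgraded_lie \<subseteq> S: six_module R L
  by unfold_locales (rule six_unit)

context subgraded_lie
begin

lemma G_closed: "x \<in> G k \<Longrightarrow> x \<in> carrier L"
  using submoduleE(1)[OF grade_submodule] by blast

lemma G_add: "\<lbrakk>x \<in> G k; y \<in> G k\<rbrakk> \<Longrightarrow> x \<boxplus> y \<in> G k"
  by (rule submoduleE(5)[OF grade_submodule])

lemma G_neg: "x \<in> G k \<Longrightarrow> \<boxminus> x \<in> G k"
  by (rule submoduleE(3)[OF grade_submodule])

lemma G_smult: "\<lbrakk>a \<in> carrier R; x \<in> G k\<rbrakk> \<Longrightarrow> a \<cdot> x \<in> G k"
  by (rule submoduleE(4)[OF grade_submodule])

lemma G_zero: "\<zero>\<^sub>L \<in> G k"
  by (rule submodule_zero[OF grade_submodule])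

lemmas G_ops = G_add G_neg G_smult G_zero

lemma brG: "\<lbrakk>x \<in> G i; y \<in> G j; i + j = k\<rbrakk> \<Longrightarrow> x \<bullet> y \<in> G k"
  using grade_bracket by blast

lemma br0: "\<lbrakk>x \<in> G i; y \<in> G j; \<bar>i + j\<bar> > 1\<rbrakk> \<Longrightarrow> x \<bullet> y = \<zero>\<^sub>L"
  using grade_bracket grade_trivial by blast

text \<open>By degrees (ad x)^3 vanishes on degree -s, and [y,z] = 0. Expanding ad((ad x)^3 y) = 0
  with binomial coefficients 1, -3, 3, -1 and applying it to z leaves only the two middle terms,
  hence three times the claim.\<close>

lemma quad_words:
  assumes s: "s = 1 \<or> s = -1" and x: "x \<in> G s" and y: "y \<in> G (- s)" and z: "z \<in> G (- s)"
  shows "x \<bullet> x \<bullet> y \<bullet> x \<bullet> z = x \<bullet> y \<bullet> x \<bullet> x \<bullet> z"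
proof (rule S.sec_three_torsion)
  note [simp] = G_closed[OF x] G_closed[OF y] G_closed[OF z]
  have e: "x \<bullet> x \<bullet> w \<in> G s" if "w \<in> G (- s)" for w
    by (rule brG[OF x brG[OF x that refl]]) simp
  have e3: "x \<bullet> x \<bullet> x \<bullet> w = \<zero>\<^sub>L" if "w \<in> G (- s)" for w
    by (rule br0[OF x e[OF that]]) (use s in auto)
  have [simp]: "y \<bullet> z = \<zero>\<^sub>L" by (rule br0[OF y z]) (use s in auto)
  have "(x \<bullet> x \<bullet> x \<bullet> y) \<bullet> z = \<zero>\<^sub>L" using e3[OF y] by simp
  moreover have "sec L ((x \<bullet> x \<bullet> x \<bullet> y) \<bullet> z) =
      sec L (x \<bullet> y \<bullet> x \<bullet> x \<bullet> z) + sec L (x \<bullet> y \<bullet> x \<bullet> x \<bullet> z) + sec L (x \<bullet> y \<bullet> x \<bullet> x \<bullet> z)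
      - sec L (x \<bullet> x \<bullet> y \<bullet> x \<bullet> z) - sec L (x \<bullet> x \<bullet> y \<bullet> x \<bullet> z) - sec L (x \<bullet> x \<bullet> y \<bullet> x \<bullet> z)"
    using e3[OF z] by (simp add: jacobi_left br_lin M.sec_simps algebra_simps)
  ultimately show "sec L (x \<bullet> x \<bullet> y \<bullet> x \<bullet> z) + sec L (x \<bullet> x \<bullet> y \<bullet> x \<bullet> z) + sec L (x \<bullet> x \<bullet> y \<bullet> x \<bullet> z)
    = sec L (x \<bullet> y \<bullet> x \<bullet> x \<bullet> z) + sec L (x \<bullet> y \<bullet> x \<bullet> x \<bullet> z) + sec L (x \<bullet> y \<bullet> x \<bullet> x \<bullet> z)"
    by (simp add: M.sec_zero algebra_simps)
qed (simp_all add: G_closed[OF x] G_closed[OF y] G_closed[OF z])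

text \<open>JP3 in Lie form: since \<open>quad\<close> is -1/2 (ad x)^2, this is Q_{Q_x y} = Q_x Q_y
  Q_x up to the common factor. Expand ad((ad x)^2 y) = (ad x)^2 ad y - 2 ad x ad y ad x + ad y (ad
  x)^2 twice; words with (ad x)^3 vanish by degree, and \<open>quad_words\<close>, applied to z and
  to [y,[x,z]], identifies the rest.\<close>

lemma fundamental_formula:
  assumes s: "s = 1 \<or> s = -1" and x: "x \<in> G s" and y: "y \<in> G (- s)" and z: "z \<in> G (- s)"
  shows "(x \<bullet> x \<bullet> y) \<bullet> (x \<bullet> x \<bullet> y) \<bullet> z = x \<bullet> x \<bullet> y \<bullet> y \<bullet> x \<bullet> x \<bullet> z"
proof (rule M.secI)
  note [simp] = G_closed[OF x] G_closed[OF y] G_closed[OF z]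
  have [simp]: "y \<bullet> z = \<zero>\<^sub>L" by (rule br0[OF y z]) (use s in auto)
  have yxz: "y \<bullet> x \<bullet> z \<in> G (- s)" by (rule brG[OF y brG[OF x z refl]]) simp
  have xxz: "x \<bullet> x \<bullet> z \<in> G s" by (rule brG[OF x brG[OF x z refl]]) simp
  have [simp]: "x \<bullet> x \<bullet> x \<bullet> y \<bullet> x \<bullet> z = \<zero>\<^sub>L"
    by (rule br0[OF x brG[OF x brG[OF x yxz refl] refl]]) (use s in auto)
  have [simp]: "x \<bullet> x \<bullet> y \<bullet> x \<bullet> x \<bullet> z = \<zero>\<^sub>L"
    by (rule br0[OF x brG[OF x brG[OF y xxz refl] refl]]) (use s in auto)
  have r1 [simp]: "x \<bullet> y \<bullet> x \<bullet> x \<bullet> z = x \<bullet> x \<bullet> y \<bullet> x \<bullet> z"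
    by (rule quad_words[OF s x y z, symmetric])
  have r2 [simp]: "x \<bullet> x \<bullet> y \<bullet> x \<bullet> y \<bullet> x \<bullet> z = x \<bullet> y \<bullet> x \<bullet> x \<bullet> y \<bullet> x \<bullet> z"
    by (rule quad_words[OF s x y yxz])
  show "sec L ((x \<bullet> x \<bullet> y) \<bullet> (x \<bullet> x \<bullet> y) \<bullet> z) = sec L (x \<bullet> x \<bullet> y \<bullet> y \<bullet> x \<bullet> x \<bullet> z)"
    by (simp add: jacobi_left br_lin M.sec_simps algebra_simps)
qed (simp_all add: G_closed[OF x] G_closed[OF y] G_closed[OF z])

lemma br_xyx: "\<lbrakk>x \<in> carrier L; y \<in> carrier L\<rbrakk> \<Longrightarrow> (x \<bullet> y) \<bullet> x = \<boxminus> (x \<bullet> x \<bullet> y)"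
  by (rule br_anti) simp_all

text \<open>The additive inverse is chosen inside the carrier of the record, so it has to be
  identified after the carrier has been restricted to one degree.\<close>

lemma graded_part_minus:
  assumes "u \<in> G (deg \<sigma>)" "v \<in> G (deg \<sigma>)"
  shows "u \<ominus>\<^bsub>graded_part L G \<sigma>\<^esub> v = u \<ominus>\<^bsub>L\<^esub> v"
proof -
  interpret P: module R "graded_part L G \<sigma>"
    unfolding graded_part_def by (rule submodule.submodule_is_module[OF grade_submodule module_axioms])
  have "\<ominus>\<^bsub>graded_part L G \<sigma>\<^esub> v = \<boxminus> v"
    by (rule P.minus_equality) (use assms(2) in \<open>auto simp: graded_part_def G_closed M.l_neg intro: G_neg\<close>)
  then show ?thesis by (simp add: a_minus_def) (simp add: graded_part_def)
qed

abbreviation "AP \<equiv> assoc_pair R L G"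

lemma part_AP: "part AP \<sigma> = L\<lparr>carrier := G (deg \<sigma>)\<rparr>"
  by (simp add: assoc_pair_def graded_part_def)

lemma quad_AP: "quad AP \<sigma> x y = half R \<cdot> ((x \<bullet> y) \<bullet> x)"
  by (simp add: assoc_pair_def)

lemma quad_AP_closed:
  assumes "x \<in> G (deg \<sigma>)" "y \<in> G (- deg \<sigma>)"
  shows "quad AP \<sigma> x y \<in> G (deg \<sigma>)"
  unfolding quad_AP
  by (rule G_smult[OF S.half_closed brG[OF brG[OF assms refl] assms(1)]]) simp

text \<open>The polarization of \<open>quad\<close> is half the sum of [[x,y],z] and [[z,y],x].
  These agree because [x,z] = 0 by degree, so ad x and ad z commute on y.\<close>

lemma triple_AP:
  assumes x: "x \<in> G (deg \<sigma>)" and y: "y \<in> G (- deg \<sigma>)" and z: "z \<in> G (deg \<sigma>)"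
  shows "triple AP \<sigma> x y z = (x \<bullet> y) \<bullet> z"
proof -
  have s: "deg \<sigma> = 1 \<or> deg \<sigma> = -1" by (cases \<sigma>) simp_all
  note [simp] = G_closed[OF x] G_closed[OF y] G_closed[OF z]
  have xz: "x \<bullet> z = \<zero>\<^sub>L" by (rule br0[OF x z]) (use s in auto)
  have c: "(z \<bullet> y) \<bullet> x = (x \<bullet> y) \<bullet> z"
    using br_anti[of x "z \<bullet> y"] br_anti[of z "x \<bullet> y"] br_commute_op[of x z y] xz
    by (simp add: br_anti[of y] jacobi_left br_lin)
  have q: "quad AP \<sigma> u y \<in> G (deg \<sigma>)" if "u \<in> G (deg \<sigma>)" for u
    by (rule quad_AP_closed[OF that y])
  have "triple AP \<sigma> x y z = quad AP \<sigma> (x \<boxplus> z) y \<ominus>\<^bsub>L\<^esub> quad AP \<sigma> x y \<ominus>\<^bsub>L\<^esub> quad AP \<sigma> z y"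
  proof -
    have "quad AP \<sigma> (x \<boxplus> z) y \<ominus>\<^bsub>L\<^esub> quad AP \<sigma> x y \<in> G (deg \<sigma>)"
      using q[OF x] q[OF G_add[OF x z]] by (auto simp: a_minus_def intro: G_ops)
    then show ?thesis
      using q[OF x] q[OF z] q[OF G_add[OF x z]] graded_part_minus[of _ \<sigma>]
      unfolding triple_def quad2_def by (simp add: assoc_pair_def) (simp add: graded_part_def)
  qed
  also have "\<dots> = half R \<cdot> ((x \<bullet> y) \<bullet> z) \<boxplus> half R \<cdot> ((z \<bullet> y) \<bullet> x)"
    by (rule M.secI) (simp_all add: quad_AP br_lin smult_r_distr M.sec_simps)
  also have "\<dots> = (x \<bullet> y) \<bullet> z" unfolding c by (rule S.half_double) simp
  finally show ?thesis .
qed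

lemma AP_quadratic: "quadratic_pair R AP"
proof (rule quadratic_pair.intro)
  show "module R (part AP \<sigma>)" for \<sigma>
    unfolding part_AP by (rule submodule.submodule_is_module[OF grade_submodule module_axioms])
next
  fix x \<sigma> assume "x \<in> pcarrier AP \<sigma>"
  then have x: "x \<in> G (deg \<sigma>)" by (simp add: part_AP)
  note [simp] = G_closed[OF x]
  show "linear_map R (part AP (- \<sigma>)) (part AP \<sigma>) (quad AP \<sigma> x)"
    by (rule linear_mapI) (use x quad_AP_closed[OF x] in
      \<open>simp_all add: part_AP quad_AP G_closed br_lin smult_r_distr smult_assoc1[symmetric] R.m_comm\<close>)
next
  fix a x y \<sigma> assume a: "a \<in> carrier R" "x \<in> pcarrier AP \<sigma>" "y \<in> pcarrier AP (- \<sigma>)"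
  then show "quad AP \<sigma> (a \<odot>\<^bsub>part AP \<sigma>\<^esub> x) y = (a \<otimes> a) \<odot>\<^bsub>part AP \<sigma>\<^esub> quad AP \<sigma> x y"
    by (simp add: part_AP quad_AP G_closed br_lin smult_assoc1[symmetric] R.m_ac)
next
  fix x y \<sigma> assume "x \<in> pcarrier AP \<sigma>" "y \<in> pcarrier AP (- \<sigma>)"
  then have x: "x \<in> G (deg \<sigma>)" and y: "y \<in> G (- deg \<sigma>)" by (simp_all add: part_AP)
  note [simp] = G_closed[OF x] G_closed[OF y]
  have t: "(x \<bullet> y) \<bullet> z \<in> G (deg \<sigma>)" if "z \<in> G (deg \<sigma>)" for z
    by (rule brG[OF brG[OF x y refl] that]) simp
  show "linear_map R (part AP \<sigma>) (part AP \<sigma>) (\<lambda>z. quad2 AP \<sigma> x z y)"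
    unfolding triple_def[symmetric]
    by (rule linear_mapI) (use t in \<open>simp_all add: part_AP triple_AP[OF x y] G_ops G_closed br_lin\<close>)
qed

text \<open>Only the plain identities are needed, by \<open>jordan_pairI\<close>: JP1 is
  \<open>quad_words\<close>, JP3 is \<open>fundamental_formula\<close>, and JP2 is one application
  of the Jacobi identity.\<close>

lemma AP_jordan: "jordan_pair R AP"
proof -
  interpret Q: quadratic_pair R AP by (rule AP_quadratic)
  show ?thesis
  proof (rule Q.jordan_pairI[OF six_unit])
    fix \<sigma> x y z assume "x \<in> pcarrier AP \<sigma>" "y \<in> pcarrier AP (- \<sigma>)" "z \<in> pcarrier AP (- \<sigma>)"
    then have x: "x \<in> G (deg \<sigma>)" and y: "y \<in> G (- deg \<sigma>)" and z: "z \<in> G (- deg \<sigma>)"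
      by (simp_all add: part_AP)
    have s: "deg \<sigma> = 1 \<or> deg \<sigma> = -1" by (cases \<sigma>) simp_all
    note [simp] = G_closed[OF x] G_closed[OF y] G_closed[OF z]
    have xxz: "x \<bullet> x \<bullet> z \<in> G (deg \<sigma>)" by (rule brG[OF x brG[OF x z refl]]) simp
    have [simp]: "x \<bullet> x \<bullet> x \<bullet> z = \<zero>\<^sub>L"
      by (rule br0[OF x xxz]) (use s in auto)
    have yz: "y \<bullet> z = \<zero>\<^sub>L" by (rule br0[OF y z]) (use s in auto)
    have "triple AP \<sigma> x y (quad AP \<sigma> x z) = (x \<bullet> y) \<bullet> quad AP \<sigma> x z"
      by (rule triple_AP[OF x y quad_AP_closed[OF x z]])
    also have "\<dots> = \<boxminus> (half R \<cdot> ((x \<bullet> y) \<bullet> x \<bullet> x \<bullet> z))"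
      by (simp add: quad_AP br_xyx br_lin smult_r_minus)
    \<comment> \<open>Expanded into words, the left side loses its term with (ad x)^3 and the right
      side its term with [y,z]; what remains is \<open>quad_words\<close>.\<close>
    also have "(x \<bullet> y) \<bullet> x \<bullet> x \<bullet> z = x \<bullet> x \<bullet> ((y \<bullet> x) \<bullet> z)"
      using quad_words[OF s x y z] yz by (simp add: jacobi_left br_lin)
    also have "\<boxminus> (half R \<cdot> (x \<bullet> x \<bullet> ((y \<bullet> x) \<bullet> z))) = quad AP \<sigma> x ((y \<bullet> x) \<bullet> z)"
      by (simp add: quad_AP br_xyx smult_r_minus)
    also have "(y \<bullet> x) \<bullet> z = triple AP (- \<sigma>) y x z"
      by (rule triple_AP[symmetric]) (use x y z in simp_all)
    finally show "triple AP \<sigma> x y (quad AP \<sigma> x z) = quad AP \<sigma> x (triple AP (- \<sigma>) y x z)" .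
    have e: "quad AP \<sigma> u v = \<boxminus> (half R \<cdot> (u \<bullet> u \<bullet> v))" if "u \<in> carrier L" "v \<in> carrier L" for u v \<sigma>
      using that by (simp add: quad_AP br_xyx smult_r_minus)
    show "quad AP \<sigma> (quad AP \<sigma> x y) z = quad AP \<sigma> x (quad AP (- \<sigma>) y (quad AP \<sigma> x z))"
      by (simp add: e br_lin smult_r_minus fundamental_formula[OF s x y z])
  next
    fix \<sigma> x y z assume "x \<in> pcarrier AP \<sigma>" "y \<in> pcarrier AP (- \<sigma>)" "z \<in> pcarrier AP \<sigma>"
    then have x: "x \<in> G (deg \<sigma>)" and y: "y \<in> G (- deg \<sigma>)" and z: "z \<in> G (deg \<sigma>)"
      by (simp_all add: part_AP)
    note [simp] = G_closed[OF x] G_closed[OF y] G_closed[OF z]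
    have q: "quad AP (- \<sigma>) y x \<in> G (- deg \<sigma>)"
      using quad_AP_closed[of y "- \<sigma>" x] x y by simp
    \<comment> \<open>Jacobi for the derivation ad[x,y]: the term [[x,y],[x,y]] vanishes, and
      exchanging x and y in the other one absorbs the sign.\<close>
    have "((x \<bullet> y) \<bullet> x) \<bullet> y = x \<bullet> ((y \<bullet> x) \<bullet> y)"
    proof -
      have "((x \<bullet> y) \<bullet> x) \<bullet> y = (x \<bullet> y) \<bullet> (x \<bullet> y) \<boxplus> \<boxminus> (x \<bullet> ((x \<bullet> y) \<bullet> y))"
        by (rule jacobi_left) simp_all
      then show ?thesis by (simp add: bracket_self br_anti[of x y] br_lin)
    qed
    then have "quad AP \<sigma> x y \<bullet> y = x \<bullet> quad AP (- \<sigma>) y x"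
      by (simp add: quad_AP br_lin)
    then show "triple AP \<sigma> (quad AP \<sigma> x y) y z = triple AP \<sigma> x (quad AP (- \<sigma>) y x) z"
      by (simp add: triple_AP[OF quad_AP_closed[OF x y] y z] triple_AP[OF x q z])
  qed
qed

end

section \<open>Ideals, their squares, and derivations of ideals\<close>

context lie_algebra
begin

lemma idealD:
  assumes "lie_ideal R L I"
  shows ideal_submodule: "submodule I R L"
    and ideal_left: "\<lbrakk>x \<in> I; y \<in> carrier L\<rbrakk> \<Longrightarrow> x \<bullet> y \<in> I"
    and ideal_right: "\<lbrakk>x \<in> I; y \<in> carrier L\<rbrakk> \<Longrightarrow> y \<bullet> x \<in> I"
    and ideal_closed: "x \<in> I \<Longrightarrow> x \<in> carrier L"
    and ideal_add: "\<lbrakk>x \<in> I; z \<in> I\<rbrakk> \<Longrightarrow> x \<boxplus> z \<in> I"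
    and ideal_neg: "x \<in> I \<Longrightarrow> \<boxminus> x \<in> I"
    and ideal_smult: "\<lbrakk>a \<in> carrier R; x \<in> I\<rbrakk> \<Longrightarrow> a \<cdot> x \<in> I"
    and ideal_zero: "\<zero>\<^sub>L \<in> I"
proof -
  show s: "submodule I R L" using assms by (simp add: lie_ideal_def)
  show l: "\<lbrakk>x \<in> I; y \<in> carrier L\<rbrakk> \<Longrightarrow> x \<bullet> y \<in> I" using assms by (simp add: lie_ideal_def)
  show c: "x \<in> I \<Longrightarrow> x \<in> carrier L" using submoduleE(1)[OF s] by blast
  show "\<lbrakk>x \<in> I; z \<in> I\<rbrakk> \<Longrightarrow> x \<boxplus> z \<in> I" by (rule submoduleE(5)[OF s])
  show n: "x \<in> I \<Longrightarrow> \<boxminus> x \<in> I" for x by (rule submoduleE(3)[OF s])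
  show "\<lbrakk>a \<in> carrier R; x \<in> I\<rbrakk> \<Longrightarrow> a \<cdot> x \<in> I" by (rule submoduleE(4)[OF s])
  show "\<zero>\<^sub>L \<in> I" by (rule submodule_zero[OF s])
  show "\<lbrakk>x \<in> I; y \<in> carrier L\<rbrakk> \<Longrightarrow> y \<bullet> x \<in> I" using n[OF l] br_anti[of x y] c by simp
qed

lemma idealI:
  assumes "I \<subseteq> carrier L" "\<zero>\<^sub>L \<in> I" "\<And>x y. \<lbrakk>x \<in> I; y \<in> I\<rbrakk> \<Longrightarrow> x \<boxplus> y \<in> I"
    "\<And>a x. \<lbrakk>a \<in> carrier R; x \<in> I\<rbrakk> \<Longrightarrow> a \<cdot> x \<in> I" "\<And>x y. \<lbrakk>x \<in> I; y \<in> carrier L\<rbrakk> \<Longrightarrow> x \<bullet> y \<in> I"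
  shows "lie_ideal R L I"
  unfolding lie_ideal_def using submoduleI'[OF assms(1-4)] assms(5) by simp

lemma carrier_ideal: "lie_ideal R L (carrier L)"
  by (rule idealI) auto

lemma ideal_Int: "\<lbrakk>lie_ideal R L I; lie_ideal R L J\<rbrakk> \<Longrightarrow> lie_ideal R L (I \<inter> J)"
  unfolding lie_ideal_def by (auto intro: submodule_Int)

lemma lie_prod_closed:
  assumes "lie_ideal R L I" "lie_ideal R L J"
  shows lie_prod_gens: "{x \<bullet> y |x y. x \<in> I \<and> y \<in> J} \<subseteq> carrier L"
    and lie_prod_submodule: "submodule (lie_prod R L I J) R L"
    and lie_prod_base: "\<lbrakk>x \<in> I; y \<in> J\<rbrakk> \<Longrightarrow> x \<bullet> y \<in> lie_prod R L I J"
proof -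
  show g: "{x \<bullet> y |x y. x \<in> I \<and> y \<in> J} \<subseteq> carrier L"
    using ideal_closed[OF assms(1)] ideal_closed[OF assms(2)] by auto
  show "submodule (lie_prod R L I J) R L"
    unfolding lie_prod_def by (rule module_span_submodule[OF g])
  show "\<lbrakk>x \<in> I; y \<in> J\<rbrakk> \<Longrightarrow> x \<bullet> y \<in> lie_prod R L I J"
    unfolding lie_prod_def by (rule module_span_base) auto
qed

lemma lie_prod_induct [consumes 3, case_names base zero add smult]:
  assumes I: "lie_ideal R L I" and J: "lie_ideal R L J" and x: "x \<in> lie_prod R L I J"
    and base: "\<And>x y. \<lbrakk>x \<in> I; y \<in> J\<rbrakk> \<Longrightarrow> P (x \<bullet> y)" and zero: "P \<zero>\<^sub>L"
    and add: "\<And>x y. \<lbrakk>x \<in> carrier L; y \<in> carrier L; P x; P y\<rbrakk> \<Longrightarrow> P (x \<boxplus> y)"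
    and smult: "\<And>a x. \<lbrakk>a \<in> carrier R; x \<in> carrier L; P x\<rbrakk> \<Longrightarrow> P (a \<cdot> x)"
  shows "P x"
  using x[unfolded lie_prod_def] lie_prod_gens[OF I J]
proof (induction rule: module_span_induct)
  case (base x) then show ?case using assms(4) by auto
qed (use zero add smult in auto)

lemma lie_prod_ideal:
  assumes I: "lie_ideal R L I" and J: "lie_ideal R L J"
  shows "lie_ideal R L (lie_prod R L I J)"
proof -
  note sub = lie_prod_submodule[OF I J]
  have "x \<bullet> z \<in> lie_prod R L I J" if "x \<in> lie_prod R L I J" and z: "z \<in> carrier L" for x z
    using I J that(1)
  proof (induction rule: lie_prod_induct)
    case (base x y)
    have [simp]: "x \<in> carrier L" "y \<in> carrier L" using base ideal_closed I J by auto
    have "(x \<bullet> y) \<bullet> z = x \<bullet> (y \<bullet> z) \<boxplus> (x \<bullet> z) \<bullet> y"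
      using z jacobi_left[of x y z] br_anti[of "x \<bullet> z" y] by simp
    then show ?case
      using base z ideal_left[OF I] ideal_left[OF J]
      by (simp add: submoduleE(5)[OF sub] lie_prod_base[OF I J])
  next
    case zero then show ?case using z submodule_zero[OF sub] by simp
  next
    case (add x y) then show ?case using z submoduleE(5)[OF sub] by (simp add: br_add_l)
  next
    case (smult a x) then show ?case using z submoduleE(4)[OF sub] by (simp add: br_smult_l)
  qed
  then show ?thesis using sub by (simp add: lie_ideal_def)
qed

lemma lie_prod_subset:
  assumes I: "lie_ideal R L I" and J: "lie_ideal R L J"
  shows "lie_prod R L I J \<subseteq> I \<inter> J"
  unfolding lie_prod_def
  by (rule module_span_least[OF submodule_Int[OF ideal_submodule[OF I] ideal_submodule[OF J]]])
    (use ideal_left[OF I] ideal_right[OF J] ideal_closed[OF I] ideal_closed[OF J] in auto)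

lemma DerD:
  assumes d: "\<delta> \<in> Der R L I" and I: "lie_ideal R L I"
  shows Der_closed: "x \<in> I \<Longrightarrow> \<delta> x \<in> carrier L"
    and Der_add: "\<lbrakk>x \<in> I; y \<in> I\<rbrakk> \<Longrightarrow> \<delta> (x \<boxplus> y) = \<delta> x \<boxplus> \<delta> y"
    and Der_smult: "\<lbrakk>a \<in> carrier R; x \<in> I\<rbrakk> \<Longrightarrow> \<delta> (a \<cdot> x) = a \<cdot> \<delta> x"
    and Der_br: "\<lbrakk>x \<in> I; y \<in> I\<rbrakk> \<Longrightarrow> \<delta> (x \<bullet> y) = \<delta> x \<bullet> y \<boxplus> x \<bullet> \<delta> y"
    and Der_neg: "x \<in> I \<Longrightarrow> \<delta> (\<boxminus> x) = \<boxminus> \<delta> x"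
    and Der_zero: "\<delta> \<zero>\<^sub>L = \<zero>\<^sub>L"
proof -
  have l: "linear_map R (L\<lparr>carrier := I\<rparr>) L \<delta>" using d by (simp add: Der_def)
  show c: "x \<in> I \<Longrightarrow> \<delta> x \<in> carrier L" for x using linear_map_closed[OF l] by simp
  show "\<lbrakk>x \<in> I; y \<in> I\<rbrakk> \<Longrightarrow> \<delta> (x \<boxplus> y) = \<delta> x \<boxplus> \<delta> y" using linear_map_add[OF l] by simp
  show sm: "\<lbrakk>a \<in> carrier R; x \<in> I\<rbrakk> \<Longrightarrow> \<delta> (a \<cdot> x) = a \<cdot> \<delta> x" for a x
    using linear_map_smult[OF l] by simp
  show "\<lbrakk>x \<in> I; y \<in> I\<rbrakk> \<Longrightarrow> \<delta> (x \<bullet> y) = \<delta> x \<bullet> y \<boxplus> x \<bullet> \<delta> y" using d by (simp add: Der_def)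
  show "\<delta> (\<boxminus> x) = \<boxminus> \<delta> x" if x: "x \<in> I"
    using sm[of "\<ominus> \<one>" x] x c[OF x] ideal_closed[OF I x] by (simp add: smult_l_minus)
  show "\<delta> \<zero>\<^sub>L = \<zero>\<^sub>L" using sm[of \<zero> "\<zero>\<^sub>L"] ideal_zero[OF I] c[of "\<zero>\<^sub>L"] by simp
qed

lemma DerI:
  assumes "\<And>x. x \<in> I \<Longrightarrow> f x \<in> carrier L"
    and "\<And>x y. \<lbrakk>x \<in> I; y \<in> I\<rbrakk> \<Longrightarrow> f (x \<boxplus> y) = f x \<boxplus> f y"
    and "\<And>a x. \<lbrakk>a \<in> carrier R; x \<in> I\<rbrakk> \<Longrightarrow> f (a \<cdot> x) = a \<cdot> f x"
    and "\<And>x y. \<lbrakk>x \<in> I; y \<in> I\<rbrakk> \<Longrightarrow> f (x \<bullet> y) = f x \<bullet> y \<boxplus> x \<bullet> f y"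
    and I: "lie_ideal R L I"
  shows "(\<lambda>x\<in>I. f x) \<in> Der R L I"
proof -
  have "linear_map R (L\<lparr>carrier := I\<rparr>) L (\<lambda>x\<in>I. f x)"
    by (rule linear_mapI) (use assms ideal_add[OF I] ideal_smult[OF I] in simp_all)
  then show ?thesis using assms ideal_left[OF I] ideal_closed[OF I] by (simp add: Der_def)
qed

lemma Der_restrict:
  assumes d: "\<delta> \<in> Der R L I" and I: "lie_ideal R L I" and J: "lie_ideal R L J" and "J \<subseteq> I"
  shows "restrict \<delta> J \<in> Der R L J"
  by (rule DerI) (use assms(4) J DerD[OF d I] in \<open>simp_all add: subset_iff\<close>)

text \<open>Each summand of [\<delta>x,y] + [x,\<delta>y] has a factor in the ideal J. Nothing
  comparable holds for \<delta>(J), and therefore squares of ideals serve as domains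
  throughout.\<close>

lemma Der_lie_prod:
  assumes d: "\<delta> \<in> Der R L I" and I: "lie_ideal R L I" and J: "lie_ideal R L J" and JI: "J \<subseteq> I"
    and x: "x \<in> lie_prod R L J J"
  shows "\<delta> x \<in> J"
proof -
  have sub: "lie_prod R L J J \<subseteq> I" using lie_prod_subset[OF J J] JI by blast
  \<comment> \<open>Membership in I is carried through the induction because linearity of \<delta>
    is available only there.\<close>
  have "x \<in> I \<and> \<delta> x \<in> J" using J J x
  proof (induction rule: lie_prod_induct)
    case (base x y)
    then have "x \<in> I" "y \<in> I" using JI by auto
    then show ?case using base Der_br[OF d I] Der_closed[OF d I] ideal_left[OF J] ideal_right[OF J]
        ideal_add[OF J] ideal_left[OF I] ideal_closed[OF I] by simp
  next
    case zero
    then show ?case using Der_zero[OF d I] ideal_zero I J by simp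
  qed (simp_all add: Der_add[OF d I] Der_smult[OF d I] ideal_add[OF J] ideal_add[OF I]
      ideal_smult[OF J] ideal_smult[OF I])
  then show ?thesis by simp
qed

end

section \<open>Homogeneous components\<close>

context three_graded
begin

lemma decompose:
  assumes "x \<in> carrier L"
  obtains a b c where "a \<in> G (-1)" "b \<in> G 0" "c \<in> G 1" "x = a \<boxplus> b \<boxplus> c"
proof -
  from ex1_implies_ex[OF grade_direct_sum[OF assms]]
  obtain p where p: "p \<in> G (-1) \<times> G 0 \<times> G 1" "x = fst p \<boxplus> fst (snd p) \<boxplus> snd (snd p)" by auto
  show thesis by (rule that[of "fst p" "fst (snd p)" "snd (snd p)"]) (use p in auto)
qed

lemma decompose_unique:
  assumes "a \<in> G (-1)" "b \<in> G 0" "c \<in> G 1" "a' \<in> G (-1)" "b' \<in> G 0" "c' \<in> G 1"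
    and e: "a \<boxplus> b \<boxplus> c = a' \<boxplus> b' \<boxplus> c'"
  shows "a = a'" "b = b'" "c = c'"
proof -
  have "a \<boxplus> b \<boxplus> c \<in> carrier L"
    using assms(1-3) submoduleE(1)[OF grade_submodule] by (meson M.a_closed subsetD)
  from grade_direct_sum[OF this]
  have u: "p = q" if "p \<in> G (-1) \<times> G 0 \<times> G 1" "q \<in> G (-1) \<times> G 0 \<times> G 1"
    "a \<boxplus> b \<boxplus> c = fst p \<boxplus> fst (snd p) \<boxplus> snd (snd p)"
    "a \<boxplus> b \<boxplus> c = fst q \<boxplus> fst (snd q) \<boxplus> snd (snd q)" for p q
    using that by blast
  have "(a, b, c) = (a', b', c')" by (rule u) (use assms in auto)
  then show "a = a'" "b = b'" "c = c'" by auto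
qed

text \<open>The sum of the homogeneous parts of I. Gradedness of an ideal becomes the single
  inclusion I \<subseteq> gr I, which can be checked on a spanning set because \<open>gr I\<close>
  is again an ideal.\<close>

definition gr :: "'l set \<Rightarrow> 'l set" where
  "gr I = {a \<boxplus> b \<boxplus> c |a b c. a \<in> I \<inter> G (-1) \<and> b \<in> I \<inter> G 0 \<and> c \<in> I \<inter> G 1}"

lemma grI: "\<lbrakk>a \<in> I; a \<in> G (-1); b \<in> I; b \<in> G 0; c \<in> I; c \<in> G 1\<rbrakk> \<Longrightarrow> a \<boxplus> b \<boxplus> c \<in> gr I"
  unfolding gr_def by blast

lemma graded_ideal_gr: "graded_ideal R L G I \<longleftrightarrow> lie_ideal R L I \<and> I \<subseteq> gr I"
  unfolding graded_ideal_def gr_def by blast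

end

text \<open>A common abstraction of TKK(V) for strongly nondegenerate V and of a strongly
  nondegenerate Jordan 3-graded algebra. Nondegeneracy is asked for homogeneous elements of degree 1
  or -1, tested against the opposite degree; degree 0 is controlled by its faithful action.\<close>

locale nondeg_graded = three_graded R L G
  for R :: "('a, 'r) ring_scheme" (structure) and L :: "('a, 'l) module" (structure)
    and G :: "int \<Rightarrow> 'l set" +
  assumes six_unit: "add_pow R (6::nat) \<one> \<in> Units R"
    and nondeg: "\<lbrakk>s = 1 \<or> s = -1; z \<in> G s; \<And>y. y \<in> G (- s) \<Longrightarrow> z \<otimes>\<^bsub>L\<^esub> (z \<otimes>\<^bsub>L\<^esub> y) = \<zero>\<^bsub>L\<^esub>\<rbrakk> \<Longrightarrow> z = \<zero>\<^bsub>L\<^esub>"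
    and faithful: "\<lbrakk>d \<in> G 0; \<And>s x. \<lbrakk>s = 1 \<or> s = -1; x \<in> G s\<rbrakk> \<Longrightarrow> d \<otimes>\<^bsub>L\<^esub> x = \<zero>\<^bsub>L\<^esub>\<rbrakk> \<Longrightarrow> d = \<zero>\<^bsub>L\<^esub>"

sublocale nondeg_graded \<subseteq> subgraded_lie R L G
  by (intro subgraded_lie.intro subgraded_lie_axioms.intro lie_algebra_axioms)
    (fact six_unit grade_submodule grade_trivial grade_bracket)+

context nondeg_graded
begin

text \<open>Nondegeneracy passes to ideals. For v of degree -s, the fundamental formula writes the
  square of ad((ad u)^2 v) as (ad u)^2 applied to (ad v)^2 (ad u)^2 z; the latter lies in I, so the
  hypothesis applies. Nondegeneracy is then used twice, for (ad u)^2 v and for u.\<close>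

lemma nondeg_ideal:
  assumes I: "lie_ideal R L I" and s: "s = 1 \<or> s = -1" and u: "u \<in> I" "u \<in> G s"
    and h: "\<And>y. \<lbrakk>y \<in> I; y \<in> G (- s)\<rbrakk> \<Longrightarrow> u \<bullet> u \<bullet> y = \<zero>\<^sub>L"
  shows "u = \<zero>\<^sub>L"
proof (rule nondeg[OF s u(2)])
  fix v assume v: "v \<in> G (- s)"
  have uuv: "u \<bullet> u \<bullet> v \<in> G s" by (rule brG[OF u(2) brG[OF u(2) v refl]]) simp
  show "u \<bullet> u \<bullet> v = \<zero>\<^sub>L"
  proof (rule nondeg[OF s uuv])
    fix z assume z: "z \<in> G (- s)"
    have uuz: "u \<bullet> u \<bullet> z \<in> G s" by (rule brG[OF u(2) brG[OF u(2) z refl]]) simp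
    have "v \<bullet> v \<bullet> u \<bullet> u \<bullet> z \<in> G (- s)" by (rule brG[OF v brG[OF v uuz refl]]) simp
    moreover have "v \<bullet> v \<bullet> u \<bullet> u \<bullet> z \<in> I"
    proof -
      note [simp] = G_closed[OF u(2)] G_closed[OF v] G_closed[OF z]
      have "u \<bullet> u \<bullet> z \<in> I" by (rule ideal_left[OF I u(1)]) simp
      then have "v \<bullet> u \<bullet> u \<bullet> z \<in> I" by (rule ideal_right[OF I]) simp
      then show ?thesis by (rule ideal_right[OF I]) simp
    qed
    ultimately have "u \<bullet> u \<bullet> v \<bullet> v \<bullet> u \<bullet> u \<bullet> z = \<zero>\<^sub>L" by (intro h)
    then show "(u \<bullet> u \<bullet> v) \<bullet> (u \<bullet> u \<bullet> v) \<bullet> z = \<zero>\<^sub>L"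
      using fundamental_formula[OF s u(2) v z] by simp
  qed
qed

text \<open>The dual form of nondegeneracy: k is now the argument and not the operator. It is
  reduced to the direct form by showing that (ad x)^2 (ad k)^2 y vanishes, so that by the
  fundamental formula each (ad k)^2 y is an absolute zero divisor for its opposite degree.\<close>

lemma extreme_zero:
  assumes s: "s = 1 \<or> s = -1" and k: "k \<in> G s" and h: "\<And>x. x \<in> G (- s) \<Longrightarrow> x \<bullet> x \<bullet> k = \<zero>\<^sub>L"
  shows "k = \<zero>\<^sub>L"
proof -
  note [simp] = G_closed[OF k]
  \<comment> \<open>Polarization of the hypothesis; the two mixed terms coincide because [x,y] = 0
    by degree, which costs a factor 2.\<close>
  have lin: "x \<bullet> y \<bullet> k = \<zero>\<^sub>L" if x: "x \<in> G (- s)" and y: "y \<in> G (- s)" for x y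
  proof (rule S.two_torsion)
    note [simp] = G_closed[OF x] G_closed[OF y]
    have "x \<bullet> y = \<zero>\<^sub>L" by (rule br0[OF x y]) (use s in auto)
    then have c: "y \<bullet> x \<bullet> k = x \<bullet> y \<bullet> k" using br_commute_op[of x y k] by simp
    have "(x \<boxplus> y) \<bullet> (x \<boxplus> y) \<bullet> k = \<zero>\<^sub>L" by (rule h[OF G_add[OF x y]])
    then show "x \<bullet> y \<bullet> k \<boxplus> x \<bullet> y \<bullet> k = \<zero>\<^sub>L"
      using h[OF x] h[OF y] by (simp add: br_lin c)
  qed (use x y G_closed in simp)
  \<comment> \<open>The element e = [x,k] commutes with all of degree -s, in particular with x.
    Hence one x can be moved through both factors k and finally meets e itself in [e,e] = 0.\<close>
  have w: "x \<bullet> x \<bullet> k \<bullet> k \<bullet> y = \<zero>\<^sub>L" if x: "x \<in> G (- s)" and y: "y \<in> G (- s)" for x y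
  proof -
    note [simp] = G_closed[OF x] G_closed[OF y]
    define e where "e = x \<bullet> k"
    have e0: "e \<in> G 0" unfolding e_def by (rule brG[OF x k]) simp
    note [simp] = G_closed[OF e0]
    have ey: "e \<bullet> z = \<zero>\<^sub>L" if "z \<in> G (- s)" for z
      using lin[OF that x] br_anti[of z e] G_closed[OF that] by (simp add: e_def)
    have xe: "x \<bullet> e = \<zero>\<^sub>L" using lin[OF x x] by (simp add: e_def)
    have xy: "x \<bullet> y = \<zero>\<^sub>L" by (rule br0[OF x y]) (use s in auto)
    have "x \<bullet> k \<bullet> y = \<zero>\<^sub>L"
      using jacobi_der[of x k y] ey[OF y] xy by (simp add: e_def)
    then have "x \<bullet> k \<bullet> k \<bullet> y = e \<bullet> k \<bullet> y" using jacobi_der[of x k "k \<bullet> y"] by (simp add: e_def)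
    also have "\<dots> = (e \<bullet> k) \<bullet> y" using jacobi_der[of e k y] ey[OF y] by simp
    finally have "x \<bullet> x \<bullet> k \<bullet> k \<bullet> y = (x \<bullet> e \<bullet> k) \<bullet> y"
      using jacobi_der[of x "e \<bullet> k" y] xy by simp
    also have "x \<bullet> e \<bullet> k = (x \<bullet> e) \<bullet> k \<boxplus> e \<bullet> x \<bullet> k" by (rule jacobi_der) simp_all
    also have "\<dots> = \<zero>\<^sub>L" using xe by (simp add: e_def[symmetric] bracket_self)
    finally show ?thesis by simp
  qed
  show ?thesis
  proof (rule nondeg[OF s k])
    fix y assume y: "y \<in> G (- s)"
    have kky: "k \<bullet> k \<bullet> y \<in> G s" by (rule brG[OF k brG[OF k y refl]]) simp
    show "k \<bullet> k \<bullet> y = \<zero>\<^sub>L"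
    proof (rule nondeg[OF s kky])
      fix z assume z: "z \<in> G (- s)"
      show "(k \<bullet> k \<bullet> y) \<bullet> (k \<bullet> k \<bullet> y) \<bullet> z = \<zero>\<^sub>L"
        unfolding fundamental_formula[OF s k y z] w[OF y z] by simp
    qed
  qed
qed

text \<open>Contrapositively, a nonzero ideal contains a nonzero element of degree 1 or -1. For x of
  degree 1, (ad x)^2 sees only the component of degree -1 of an element and maps it into degree 1 of
  the ideal, so \<open>extreme_zero\<close> removes that component; the component of degree 1 is
  symmetric, and faithfulness disposes of degree 0.\<close>

lemma ideal_meets:
  assumes K: "lie_ideal R L K" and h: "\<And>s x. \<lbrakk>s = 1 \<or> s = -1; x \<in> K; x \<in> G s\<rbrakk> \<Longrightarrow> x = \<zero>\<^sub>L"
  shows "K = {\<zero>\<^sub>L}"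
proof -
  have "k = \<zero>\<^sub>L" if k: "k \<in> K" for k
  proof -
    obtain a b c where abc: "a \<in> G (-1)" "b \<in> G 0" "c \<in> G 1" and e: "k = a \<boxplus> b \<boxplus> c"
      using decompose[OF ideal_closed[OF K k]] .
    note [simp] = abc[THEN G_closed]
    have "a = \<zero>\<^sub>L"
    proof (rule extreme_zero[OF _ abc(1)])
      fix x assume "x \<in> G (- (-1))"
      then have x: "x \<in> G 1" by simp
      note [simp] = G_closed[OF x]
      have xa: "x \<bullet> a \<in> G 0" by (rule brG[OF x abc(1)]) simp
      have "x \<bullet> c = \<zero>\<^sub>L" by (rule br0[OF x abc(3)]) simp
      moreover have "x \<bullet> x \<bullet> b = \<zero>\<^sub>L" by (rule br0[OF x brG[OF x abc(2) refl]]) simp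
      ultimately have "x \<bullet> x \<bullet> a = x \<bullet> x \<bullet> k" by (simp add: e br_add_r)
      moreover have "x \<bullet> x \<bullet> k \<in> K" using k by (intro ideal_right[OF K]) auto
      moreover have "x \<bullet> x \<bullet> a \<in> G 1" by (rule brG[OF x xa]) simp
      ultimately show "x \<bullet> x \<bullet> a = \<zero>\<^sub>L" using h[of 1] by simp
    qed simp
    moreover have "c = \<zero>\<^sub>L"
    proof (rule extreme_zero[OF _ abc(3)])
      fix x assume x: "x \<in> G (- 1)"
      note [simp] = G_closed[OF x]
      have xc: "x \<bullet> c \<in> G 0" by (rule brG[OF x abc(3)]) simp
      have "x \<bullet> a = \<zero>\<^sub>L" by (rule br0[OF x abc(1)]) simp
      moreover have "x \<bullet> x \<bullet> b = \<zero>\<^sub>L" by (rule br0[OF x brG[OF x abc(2) refl]]) simp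
      ultimately have "x \<bullet> x \<bullet> c = x \<bullet> x \<bullet> k" by (simp add: e br_add_r)
      moreover have "x \<bullet> x \<bullet> k \<in> K" using k by (intro ideal_right[OF K]) auto
      moreover have "x \<bullet> x \<bullet> c \<in> G (-1)" by (rule brG[OF x xc]) simp
      ultimately show "x \<bullet> x \<bullet> c = \<zero>\<^sub>L" using h[of "-1"] by simp
    qed simp
    ultimately have kb: "k = b" by (simp add: e)
    have "b = \<zero>\<^sub>L"
    proof (rule faithful[OF abc(2)])
      fix s x assume s: "s = (1::int) \<or> s = -1" and x: "x \<in> G s"
      have "b \<bullet> x \<in> G s" by (rule brG[OF abc(2) x]) simp
      moreover have "b \<bullet> x \<in> K" using k kb ideal_left[OF K] G_closed[OF x] by simp
      ultimately show "b \<bullet> x = \<zero>\<^sub>L" using h[OF s] by simp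
    qed
    then show ?thesis using kb by simp
  qed
  then show ?thesis using ideal_zero[OF K] by blast
qed

section \<open>Essential ideals\<close>

lemma essentialD: "essential_ideal R L I \<Longrightarrow> lie_ideal R L I"
  by (simp add: essential_ideal_def)

lemma essentialI:
  assumes "lie_ideal R L I"
    and "\<And>J s z. \<lbrakk>lie_ideal R L J; s = 1 \<or> s = -1; z \<in> J; z \<in> G s; z \<noteq> \<zero>\<^sub>L\<rbrakk> \<Longrightarrow> \<exists>w\<in>I \<inter> J. w \<noteq> \<zero>\<^sub>L"
  shows "essential_ideal R L I"
  unfolding essential_ideal_def
proof (intro conjI allI impI)
  fix J assume J: "lie_ideal R L J \<and> J \<noteq> {\<zero>\<^sub>L}"
  then obtain s z where "s = (1::int) \<or> s = -1" "z \<in> J" "z \<in> G s" "z \<noteq> \<zero>\<^sub>L"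
    using ideal_meets[of J] by blast
  then show "I \<inter> J \<noteq> {\<zero>\<^sub>L}" using assms(2)[of J s z] J by blast
qed (rule assms(1))

lemma essential_meets:
  assumes I: "essential_ideal R L I" and J: "lie_ideal R L J" "z \<in> J" "z \<noteq> \<zero>\<^sub>L"
  obtains s w where "s = (1::int) \<or> s = -1" "w \<in> I" "w \<in> J" "w \<in> G s" "w \<noteq> \<zero>\<^sub>L"
proof -
  have "I \<inter> J \<noteq> {\<zero>\<^sub>L}" using I J unfolding essential_ideal_def by blast
  then show thesis using ideal_meets[OF ideal_Int[OF essentialD[OF I] J(1)]] that by blast
qed

lemma essential_carrier: "essential_ideal R L (carrier L)"
  by (rule essentialI[OF carrier_ideal]) (auto dest: ideal_closed)

lemma essential_Int:
  assumes I: "essential_ideal R L I" and J: "essential_ideal R L J"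
  shows "essential_ideal R L (I \<inter> J)"
proof (rule essentialI)
  show "lie_ideal R L (I \<inter> J)" by (intro ideal_Int essentialD I J)
  fix K s z assume K: "lie_ideal R L K" "z \<in> K" "z \<noteq> \<zero>\<^sub>L"
  then obtain w where "w \<in> J" "w \<in> K" "w \<noteq> \<zero>\<^sub>L" using essential_meets[OF J] by metis
  then show "\<exists>w\<in>I \<inter> J \<inter> K. w \<noteq> \<zero>\<^sub>L"
    using essential_meets[OF I ideal_Int[OF essentialD[OF J] K(1)], of w] by blast
qed

text \<open>For a nonzero homogeneous w in I and K, \<open>nondeg_ideal\<close> supplies y in I with
  [w,[w,y]] nonzero, and this element lies in [I,I] as well as in K.\<close>

lemma essential_lie_prod:
  assumes I: "essential_ideal R L I"
  shows "essential_ideal R L (lie_prod R L I I)"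
proof (rule essentialI)
  note i = essentialD[OF I]
  show "lie_ideal R L (lie_prod R L I I)" by (rule lie_prod_ideal[OF i i])
  fix K s z assume K: "lie_ideal R L K" "z \<in> K" "z \<noteq> \<zero>\<^sub>L"
  then obtain s w where w: "s = (1::int) \<or> s = -1" "w \<in> I" "w \<in> K" "w \<in> G s" "w \<noteq> \<zero>\<^sub>L"
    using essential_meets[OF I] by metis
  then obtain y where y: "y \<in> I" "w \<bullet> w \<bullet> y \<noteq> \<zero>\<^sub>L" using nondeg_ideal[OF i w(1,2,4)] by blast
  have "w \<bullet> w \<bullet> y \<in> lie_prod R L I I"
    using w(2) y(1) ideal_left[OF i] ideal_closed[OF i] by (intro lie_prod_base[OF i i]) auto
  moreover have "w \<bullet> w \<bullet> y \<in> K"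
    using w(2,3) y(1) ideal_closed[OF i] by (intro ideal_left[OF K(1)]) auto
  ultimately show "\<exists>w\<in>lie_prod R L I I \<inter> K. w \<noteq> \<zero>\<^sub>L" using y(2) by blast
qed

text \<open>The centralizer of an ideal is an ideal. If it were nonzero it would share a nonzero
  homogeneous element of degree 1 or -1 with I, contrary to nondegeneracy inside I.\<close>

lemma essential_centralizer:
  assumes I: "essential_ideal R L I" and z: "z \<in> carrier L" and h: "\<And>y. y \<in> I \<Longrightarrow> z \<bullet> y = \<zero>\<^sub>L"
  shows "z = \<zero>\<^sub>L"
proof (rule ccontr)
  assume nz: "z \<noteq> \<zero>\<^sub>L"
  note i = essentialD[OF I]
  let ?C = "{z \<in> carrier L. \<forall>y\<in>I. z \<bullet> y = \<zero>\<^sub>L}"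
  have C: "lie_ideal R L ?C"
  proof (rule idealI)
    fix x y assume x: "x \<in> ?C" and y: "y \<in> carrier L"
    have "(x \<bullet> y) \<bullet> w = \<zero>\<^sub>L" if w: "w \<in> I" for w
      using jacobi_left[of x y w] x y w ideal_closed[OF i w] ideal_right[OF i w y] by simp
    then show "x \<bullet> y \<in> ?C" using x y by simp
  qed (use ideal_closed[OF i] in \<open>simp_all add: br_lin subset_iff\<close>)
  from essential_meets[OF I C, of z]
  obtain s u where u: "s = (1::int) \<or> s = -1" "u \<in> I" "u \<in> ?C" "u \<in> G s" "u \<noteq> \<zero>\<^sub>L"
    using z h nz by blast
  have "u = \<zero>\<^sub>L" by (rule nondeg_ideal[OF i u(1,2,4)]) (use u(3) in simp)
  then show False using u(5) by simp
qed

section \<open>Graded ideals\<close>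

lemma gr_ideal:
  assumes I: "lie_ideal R L I"
  shows "lie_ideal R L (gr I)" "gr I \<subseteq> I" "\<And>x k. \<lbrakk>x \<in> I; x \<in> G k\<rbrakk> \<Longrightarrow> x \<in> gr I"
proof -
  note cl = G_closed ideal_closed[OF I]
  show sub: "gr I \<subseteq> I" unfolding gr_def by (auto intro: ideal_add[OF I])
  show hom: "x \<in> gr I" if x: "x \<in> I" "x \<in> G k" for x k
  proof -
    note z = ideal_zero[OF I] G_zero
    consider "k = -1" | "k = 0" | "k = 1" | "\<bar>k\<bar> > 1" by linarith
    then show ?thesis
    proof cases
      case 1 then show ?thesis using grI[of x I "\<zero>\<^sub>L" "\<zero>\<^sub>L"] x z cl(2)[OF x(1)] by simp
    next
      case 2 then show ?thesis using grI[of "\<zero>\<^sub>L" I x "\<zero>\<^sub>L"] x z cl(2)[OF x(1)] by simp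
    next
      case 3 then show ?thesis using grI[of "\<zero>\<^sub>L" I "\<zero>\<^sub>L" x] x z cl(2)[OF x(1)] by simp
    next
      case 4 then show ?thesis using grI[of "\<zero>\<^sub>L" I "\<zero>\<^sub>L" "\<zero>\<^sub>L"] x z grade_trivial by auto
    qed
  qed
  have add: "x \<boxplus> y \<in> gr I" if xy: "x \<in> gr I" "y \<in> gr I" for x y
  proof -
    obtain a b c where 1: "a \<in> I \<inter> G (-1)" "b \<in> I \<inter> G 0" "c \<in> I \<inter> G 1" "x = a \<boxplus> b \<boxplus> c"
      using xy(1) unfolding gr_def by blast
    obtain a' b' c' where 2: "a' \<in> I \<inter> G (-1)" "b' \<in> I \<inter> G 0" "c' \<in> I \<inter> G 1" "y = a' \<boxplus> b' \<boxplus> c'"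
      using xy(2) unfolding gr_def by blast
    have "x \<boxplus> y = (a \<boxplus> a') \<boxplus> (b \<boxplus> b') \<boxplus> (c \<boxplus> c')"
      using 1 2 by (intro M.secI) (auto simp: cl M.sec_simps algebra_simps)
    then show ?thesis unfolding gr_def using 1 2 by (blast intro: G_add ideal_add[OF I])
  qed
  show "lie_ideal R L (gr I)"
  proof (rule idealI)
    show "gr I \<subseteq> carrier L" using sub ideal_closed[OF I] by blast
    show "\<zero>\<^sub>L \<in> gr I" by (rule hom[OF ideal_zero[OF I] G_zero])
    show "x \<boxplus> y \<in> gr I" if "x \<in> gr I" "y \<in> gr I" for x y by (rule add[OF that])
    show "r \<cdot> x \<in> gr I" if r: "r \<in> carrier R" "x \<in> gr I" for r x
    proof -
      obtain a b c where 1: "a \<in> I \<inter> G (-1)" "b \<in> I \<inter> G 0" "c \<in> I \<inter> G 1" "x = a \<boxplus> b \<boxplus> c"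
        using r(2) unfolding gr_def by blast
      have "r \<cdot> x = (r \<cdot> a) \<boxplus> (r \<cdot> b) \<boxplus> (r \<cdot> c)" using 1 r by (auto simp: cl smult_r_distr)
      then show ?thesis unfolding gr_def using 1 r by (blast intro: G_smult ideal_smult[OF I])
    qed
    show "x \<bullet> y \<in> gr I" if xy: "x \<in> gr I" "y \<in> carrier L" for x y
    proof -
      obtain a b c where 1: "a \<in> I \<inter> G (-1)" "b \<in> I \<inter> G 0" "c \<in> I \<inter> G 1" "x = a \<boxplus> b \<boxplus> c"
        using xy(1) unfolding gr_def by blast
      obtain a' b' c' where 2: "a' \<in> G (-1)" "b' \<in> G 0" "c' \<in> G 1" "y = a' \<boxplus> b' \<boxplus> c'"
        using decompose[OF xy(2)] .
      have m: "u \<bullet> v \<in> gr I" if "u \<in> I \<inter> G i" "v \<in> G j" for u v i j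
        using that by (intro hom[OF ideal_left[OF I] brG[OF _ _ refl]]) (auto dest: G_closed)
      have "x \<bullet> y = (a \<bullet> a' \<boxplus> b \<bullet> a' \<boxplus> c \<bullet> a') \<boxplus> (a \<bullet> b' \<boxplus> b \<bullet> b' \<boxplus> c \<bullet> b') \<boxplus> (a \<bullet> c' \<boxplus> b \<bullet> c' \<boxplus> c \<bullet> c')"
        using 1 2 by (auto simp: cl br_lin)
      then show ?thesis using m 1 2 by (auto intro!: add)
    qed
  qed
qed

lemma graded_carrier: "graded_ideal R L G (carrier L)"
  unfolding graded_ideal_gr
proof (intro conjI carrier_ideal subsetI)
  fix x assume "x \<in> carrier L"
  then obtain a b c where "a \<in> G (-1)" "b \<in> G 0" "c \<in> G 1" "x = a \<boxplus> b \<boxplus> c" by (rule decompose)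
  then show "x \<in> gr (carrier L)" using grI[of a "carrier L" b c] by (simp add: G_closed)
qed

lemma graded_Int:
  assumes I: "graded_ideal R L G I" and J: "graded_ideal R L G J"
  shows "graded_ideal R L G (I \<inter> J)"
proof -
  have i: "lie_ideal R L I" "lie_ideal R L J" using I J by (auto simp: graded_ideal_def)
  have "I \<inter> J \<subseteq> gr (I \<inter> J)"
  proof
    fix x assume x: "x \<in> I \<inter> J"
    obtain a b c where 1: "a \<in> I \<inter> G (-1)" "b \<in> I \<inter> G 0" "c \<in> I \<inter> G 1" "x = a \<boxplus> b \<boxplus> c"
      using x I unfolding graded_ideal_def by blast
    obtain a' b' c' where 2: "a' \<in> J \<inter> G (-1)" "b' \<in> J \<inter> G 0" "c' \<in> J \<inter> G 1" "x = a' \<boxplus> b' \<boxplus> c'"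
      using x J unfolding graded_ideal_def by blast
    have "a = a'" "b = b'" "c = c'" using decompose_unique[of a b c a' b' c'] 1 2 by auto
    then show "x \<in> gr (I \<inter> J)" using 1 2 unfolding gr_def by blast
  qed
  then show ?thesis using ideal_Int[OF i] by (simp add: graded_ideal_gr)
qed

lemma graded_lie_prod:
  assumes I: "graded_ideal R L G I"
  shows "graded_ideal R L G (lie_prod R L I I)"
proof -
  have i: "lie_ideal R L I" and ig: "I \<subseteq> gr I" using I by (simp_all add: graded_ideal_gr)
  note k = lie_prod_ideal[OF i i]
  note g = gr_ideal[OF k]
  have "x \<in> gr (lie_prod R L I I)" if "x \<in> lie_prod R L I I" for x
    using i i that
  proof (induction rule: lie_prod_induct)
    case (base x y)
    obtain a b c where 1: "a \<in> I \<inter> G (-1)" "b \<in> I \<inter> G 0" "c \<in> I \<inter> G 1" "x = a \<boxplus> b \<boxplus> c"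
      using base(1) ig unfolding gr_def by blast
    obtain a' b' c' where 2: "a' \<in> I \<inter> G (-1)" "b' \<in> I \<inter> G 0" "c' \<in> I \<inter> G 1" "y = a' \<boxplus> b' \<boxplus> c'"
      using base(2) ig unfolding gr_def by blast
    have m: "u \<bullet> v \<in> gr (lie_prod R L I I)" if "u \<in> I \<inter> G i" "v \<in> I \<inter> G j" for u v i j
      using that by (intro g(3)[OF lie_prod_base[OF i i] brG[OF _ _ refl]]) auto
    have "x \<bullet> y = (a \<bullet> a' \<boxplus> b \<bullet> a' \<boxplus> c \<bullet> a') \<boxplus> (a \<bullet> b' \<boxplus> b \<bullet> b' \<boxplus> c \<bullet> b') \<boxplus> (a \<bullet> c' \<boxplus> b \<bullet> c' \<boxplus> c \<bullet> c')"
      using 1 2 by (auto simp: G_closed br_lin)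
    then show ?case using m 1 2 by (auto intro!: ideal_add[OF g(1)])
  qed (auto intro: ideal_zero[OF g(1)] ideal_add[OF g(1)] ideal_smult[OF g(1)])
  then show ?thesis using k by (auto simp: graded_ideal_gr)
qed

lemma Der_vanish_graded:
  assumes d: "\<delta> \<in> Der R L I" and I: "lie_ideal R L I" and K: "graded_ideal R L G K" and KI: "K \<subseteq> I"
    and h: "\<And>k x. \<lbrakk>x \<in> K; x \<in> G k; \<bar>k\<bar> \<le> 1\<rbrakk> \<Longrightarrow> \<delta> x = \<zero>\<^sub>L" and x: "x \<in> K"
  shows "\<delta> x = \<zero>\<^sub>L"
proof -
  obtain a b c where 1: "a \<in> K \<inter> G (-1)" "b \<in> K \<inter> G 0" "c \<in> K \<inter> G 1" "x = a \<boxplus> b \<boxplus> c"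
    using x K unfolding graded_ideal_def by blast
  then show ?thesis
    using KI h[of a "-1"] h[of b 0] h[of c 1] Der_add[OF d I] ideal_add[OF I] by (auto simp: subset_iff)
qed

end

section \<open>Partial derivations on graded ideals\<close>

context nondeg_graded
begin

definition homogeneous :: "'l set \<Rightarrow> ('l \<Rightarrow> 'l) \<Rightarrow> int \<Rightarrow> bool" where
  "homogeneous I \<delta> k \<longleftrightarrow> (\<forall>j. \<forall>x\<in>I \<inter> G j. \<delta> x \<in> G (j + k))"

lemma homogeneousD: "\<lbrakk>homogeneous I \<delta> k; x \<in> I; x \<in> G j; j + k = i\<rbrakk> \<Longrightarrow> \<delta> x \<in> G i"
  by (auto simp: homogeneous_def)

lemma graded_idealD: "graded_ideal R L G I \<Longrightarrow> lie_ideal R L I"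
  by (simp add: graded_ideal_def)

text \<open>In a square, degree s is mapped to degree 2s and vanishes. A value \<delta>(a) with a of
  degree 0 lies in I of degree s, and the product rule for [a,y] shows that it commutes with all y
  in I of degree -s; then \<open>nondeg_ideal\<close> applies.\<close>

lemma Der_vanish:
  assumes d: "\<delta> \<in> Der R L I" and I: "graded_ideal R L G I" and s: "s = 1 \<or> s = -1"
    and hom: "homogeneous I \<delta> s" and h: "\<And>x. \<lbrakk>x \<in> I; x \<in> G (- s)\<rbrakk> \<Longrightarrow> \<delta> x = \<zero>\<^sub>L"
    and x: "x \<in> lie_prod R L I I"
  shows "\<delta> x = \<zero>\<^sub>L"
proof -
  note i = graded_idealD[OF I]
  note sub = lie_prod_subset[OF i i]
  show ?thesis
  proof (rule Der_vanish_graded[OF d i graded_lie_prod[OF I] _ _ x])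
    show "lie_prod R L I I \<subseteq> I" using sub by blast
    fix k a assume a: "a \<in> lie_prod R L I I" "a \<in> G k" "\<bar>k\<bar> \<le> 1"
    have aI: "a \<in> I" using a(1) sub by blast
    have da: "\<delta> a \<in> G (k + s)" by (rule homogeneousD[OF hom aI a(2) refl])
    consider "k = - s" | "k = s" | "k = 0" using s a(3) by linarith
    then show "\<delta> a = \<zero>\<^sub>L"
    proof cases
      case 1 then show ?thesis using h aI a(2) by simp
    next
      case 2 then show ?thesis using da s grade_trivial[of "k + s"] by auto
    next
      case 3
      show ?thesis
      proof (rule nondeg_ideal[OF i s])
        show "\<delta> a \<in> I" by (rule Der_lie_prod[OF d i i _ a(1)]) simp
        show zs: "\<delta> a \<in> G s" using da 3 by simp
        fix y assume y: "y \<in> I" "y \<in> G (- s)"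
        have ay: "a \<bullet> y \<in> I" "a \<bullet> y \<in> G (- s)"
          using brG[OF a(2) y(2)] 3 ideal_left[OF i aI] G_closed[OF y(2)] by simp_all
        have "\<delta> (a \<bullet> y) = \<delta> a \<bullet> y \<boxplus> a \<bullet> \<delta> y" by (rule Der_br[OF d i aI y(1)])
        then have "\<delta> a \<bullet> y = \<zero>\<^sub>L" using h[OF ay] h[OF y] G_closed[OF zs] G_closed[OF y(2)] G_closed[OF a(2)] by simp
        then show "\<delta> a \<bullet> \<delta> a \<bullet> y = \<zero>\<^sub>L" using G_closed[OF zs] by simp
      qed
    qed
  qed
qed

text \<open>The case left open is a of degree 0. Its value e = \<delta>(a) lies in I and commutes
  with the parts of I of degree 1 and -1; it remains to show that [e,x] = 0 for every x of those
  degrees in L, so that faithfulness gives e = 0.\<close>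

lemma Der_vanish_0:
  assumes d: "\<delta> \<in> Der R L I" and I: "graded_ideal R L G I"
    and hom: "homogeneous I \<delta> 0" and h: "\<And>s x. \<lbrakk>s = 1 \<or> s = -1; x \<in> I; x \<in> G s\<rbrakk> \<Longrightarrow> \<delta> x = \<zero>\<^sub>L"
    and x: "x \<in> lie_prod R L I I"
  shows "\<delta> x = \<zero>\<^sub>L"
proof -
  note i = graded_idealD[OF I]
  note sub = lie_prod_subset[OF i i]
  show ?thesis
  proof (rule Der_vanish_graded[OF d i graded_lie_prod[OF I] _ _ x])
    show "lie_prod R L I I \<subseteq> I" using sub by blast
    fix k a assume a: "a \<in> lie_prod R L I I" "a \<in> G k" "\<bar>k\<bar> \<le> 1"
    have aI: "a \<in> I" using a(1) sub by blast
    consider "k = 1 \<or> k = -1" | "k = 0" using a(3) by linarith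
    then show "\<delta> a = \<zero>\<^sub>L"
    proof cases
      case 1 then show ?thesis using h aI a(2) by blast
    next
      case 2
      define e where "e = \<delta> a"
      have eI: "e \<in> I" unfolding e_def by (rule Der_lie_prod[OF d i i _ a(1)]) simp
      have e0: "e \<in> G 0" unfolding e_def using homogeneousD[OF hom aI a(2)] 2 by simp
      note [simp] = G_closed[OF e0] G_closed[OF a(2)]
      have ey: "e \<bullet> y = \<zero>\<^sub>L" if s: "s = 1 \<or> s = -1" and y: "y \<in> I" "y \<in> G s" for s y
      proof -
        have ay: "a \<bullet> y \<in> I" "a \<bullet> y \<in> G s"
          using brG[OF a(2) y(2)] 2 ideal_left[OF i aI] G_closed[OF y(2)] by simp_all
        have "\<delta> (a \<bullet> y) = \<delta> a \<bullet> y \<boxplus> a \<bullet> \<delta> y" by (rule Der_br[OF d i aI y(1)])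
        then show ?thesis
          using h[OF s ay] h[OF s y] G_closed[OF y(2)] by (simp add: e_def[symmetric])
      qed
      have "e = \<zero>\<^sub>L"
      proof (rule faithful[OF e0])
        fix s x assume s: "s = (1::int) \<or> s = -1" and x: "x \<in> G s"
        note [simp] = G_closed[OF x]
        define p where "p = e \<bullet> x"
        have p: "p \<in> G s" "p \<in> I"
          unfolding p_def using brG[OF e0 x] ideal_left[OF i eI] by simp_all
        note [simp] = G_closed[OF p(1)]
        show "e \<bullet> x = \<zero>\<^sub>L" unfolding p_def[symmetric]
        proof (rule nondeg_ideal[OF i s p(2,1)])
          fix y assume y: "y \<in> I" "y \<in> G (- s)"
          note [simp] = G_closed[OF y(2)]
          define f where "f = x \<bullet> y"
          have f: "f \<in> G 0" "f \<in> I" unfolding f_def using brG[OF x y(2)] ideal_right[OF i y(1)] by simp_all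
          note [simp] = G_closed[OF f(1)]
          have "e \<bullet> y = \<zero>\<^sub>L" using ey[of "- s" y] s y by auto
          \<comment> \<open>Since [e,y] = 0, the bracket of p = [e,x] with y is [e,f] for f = [x,y]
            of degree 0. This commutes with p, because e kills both p and [f,p], elements of I of
            degree s.\<close>
          then have py: "p \<bullet> y = e \<bullet> f"
            unfolding p_def f_def using jacobi_left[of e x y] by simp
          have "f \<bullet> p \<in> I" "f \<bullet> p \<in> G s" using ideal_left[OF i f(2)] brG[OF f(1) p(1)] by simp_all
          then have "(e \<bullet> f) \<bullet> p = \<zero>\<^sub>L"
            using jacobi_left[of e f p] ey[OF s p(2,1)] ey[OF s, of "f \<bullet> p"] by simp
          then show "p \<bullet> p \<bullet> y = \<zero>\<^sub>L" unfolding py using br_anti[of "e \<bullet> f" p] by simp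
        qed
      qed
      then show ?thesis by (simp add: e_def)
    qed
  qed
qed

text \<open>
  A derivation of degree 2 or -2 is an absolute zero divisor of the semidirect sum, which forces
  \<open>[a, [a, \<delta> a]] = 0\<close> for every \<open>a\<close> on which it does not vanish by degree reasons.
\<close>

lemma Der_degree_two_quad:
  assumes d: "\<delta> \<in> Der R L I" and i: "lie_ideal R L I" and s: "s = 1 \<or> s = -1"
    and hom: "homogeneous I \<delta> (2 * s)" and a: "a \<in> I" "a \<in> G (- s)"
  shows "a \<bullet> a \<bullet> \<delta> a = \<zero>\<^sub>L"
proof -
  have s': "- s = 1 \<or> - s = -1" using s by auto
  note [simp] = G_closed[OF a(2)]
  define W where "W = \<delta> a"
  have W: "W \<in> G s" unfolding W_def by (rule homogeneousD[OF hom a]) simp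
  note [simp] = G_closed[OF W]
  \<comment> \<open>The element of the semidirect sum in which \<delta> acts as ad D: up to sign
    f(u) is a word in D and ad a. Products of degree beyond 1 vanish, so all brackets of W =
    \<delta>(a) needed below are expressible through f.\<close>
  define f where "f = (\<lambda>u. \<delta> (a \<bullet> a \<bullet> u))"
  have facts: "W \<bullet> a \<bullet> u = f u" "W \<bullet> a \<bullet> a \<bullet> u = \<boxminus> (a \<bullet> f u)" "W \<bullet> u = \<zero>\<^sub>L"
    "a \<bullet> a \<bullet> a \<bullet> u = \<zero>\<^sub>L" "f u \<in> G s" if u: "u \<in> G s" for u
  proof -
    note [simp] = G_closed[OF u]
    have au: "a \<bullet> u \<in> I" "a \<bullet> u \<in> G 0" using ideal_left[OF i a(1)] brG[OF a(2) u] by simp_all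
    have aau: "a \<bullet> a \<bullet> u \<in> I" "a \<bullet> a \<bullet> u \<in> G (- s)"
      using ideal_left[OF i a(1)] brG[OF a(2) au(2)] by simp_all
    have fe: "\<delta> (a \<bullet> a \<bullet> u) = f u" by (simp add: f_def)
    show fu: "f u \<in> G s" unfolding f_def by (rule homogeneousD[OF hom aau]) simp
    have dau: "\<delta> (a \<bullet> u) = \<zero>\<^sub>L"
      using homogeneousD[OF hom au refl] grade_trivial[of "0 + 2 * s"] s by auto
    show "W \<bullet> u = \<zero>\<^sub>L" by (rule br0[OF W u]) (use s in auto)
    show z: "a \<bullet> a \<bullet> a \<bullet> u = \<zero>\<^sub>L" by (rule br0[OF a(2) aau(2)]) (use s in auto)
    show "W \<bullet> a \<bullet> u = f u" 
      using Der_br[OF d i a(1) au(1)] dau by (simp add: W_def[symmetric] fe)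
    have "\<zero>\<^sub>L = \<delta> a \<bullet> a \<bullet> a \<bullet> u \<boxplus> a \<bullet> \<delta> (a \<bullet> a \<bullet> u)"
      using Der_br[OF d i a(1) aau(1)] z Der_zero[OF d i] by simp
    from arg_cong[OF this, of "sec L"]
    show "W \<bullet> a \<bullet> a \<bullet> u = \<boxminus> (a \<bullet> f u)" using G_closed[OF fu]
      by (intro M.secI) (simp_all add: W_def[symmetric] fe M.sec_simps eq_neg_iff_add_eq_0)
  qed
  have aW: "a \<bullet> W \<in> G 0" by (rule brG[OF a(2) W]) simp
  have aaW: "a \<bullet> a \<bullet> W \<in> G (- s)" by (rule brG[OF a(2) aW]) simp
  have aaaW: "a \<bullet> a \<bullet> a \<bullet> W = \<zero>\<^sub>L" by (rule br0[OF a(2) aaW]) (use s in auto)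
  \<comment> \<open>Expand the bracket of (ad a)^3 W = 0 with u binomially. The outer terms vanish
    and each of the two middle ones equals -3 [a,[a,f(u)]], so that 6 times the claim
    vanishes.\<close>
  have aaf: "a \<bullet> a \<bullet> f u = \<zero>\<^sub>L" if u: "u \<in> G s" for u
  proof -
    note [simp] = G_closed[OF u] facts(5)[OF u, THEN G_closed]
    define F where "F = sec L (a \<bullet> a \<bullet> f u)"
    have w: "sec L ((a \<bullet> a \<bullet> a \<bullet> W) \<bullet> u) = - (F + F + F + (F + F + F))"
      using facts[OF u] by (simp add: jacobi_left br_lin M.sec_simps F_def algebra_simps)
    have "sec L ((a \<bullet> a \<bullet> a \<bullet> W) \<bullet> u) = 0" using aaaW by (simp add: M.sec_zero)
    then have e: "F + F + F + (F + F + F) = 0" unfolding w by (simp only: neg_equal_0_iff_equal)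
    have X: "sec L (a \<bullet> a \<bullet> f u \<boxplus> a \<bullet> a \<bullet> f u \<boxplus> a \<bullet> a \<bullet> f u) = F + F + F"
      by (simp add: M.sec_add F_def)
    have "a \<bullet> a \<bullet> f u \<boxplus> a \<bullet> a \<bullet> f u \<boxplus> a \<bullet> a \<bullet> f u = \<zero>\<^sub>L"
      by (rule S.sec_two_torsion, simp, simp, unfold X M.sec_zero e) simp
    then show ?thesis by (rule S.three_torsion[rotated]) simp
  qed
  define c where "c = a \<bullet> a \<bullet> W"
  have c: "c \<in> G (- s)" unfolding c_def by (rule aaW)
  note [simp] = G_closed[OF c]
  \<comment> \<open>Of (ad a)^2 ad W - 2 ad a ad W ad a + ad W (ad a)^2 applied to u, the first term
    is 0, the second gives -2 [a,f(u)] and the third -[a,f(u)].\<close>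
  have cu: "c \<bullet> u = \<boxminus> (a \<bullet> f u) \<boxplus> \<boxminus> (a \<bullet> f u) \<boxplus> \<boxminus> (a \<bullet> f u)" if u: "u \<in> G s" for u
  proof -
    note [simp] = G_closed[OF u] facts(5)[OF u, THEN G_closed]
    show ?thesis unfolding c_def
      by (rule M.secI) (simp_all add: facts[OF u] jacobi_left br_lin M.sec_simps algebra_simps)
  qed
  have ca: "c \<bullet> a = \<zero>\<^sub>L" by (rule br0[OF c a(2)]) (use s in auto)
  have caf: "c \<bullet> a \<bullet> f u = \<zero>\<^sub>L" if u: "u \<in> G s" for u
  proof -
    note fu = facts(5)[OF u]
    note [simp] = G_closed[OF u] G_closed[OF fu] facts(5)[OF fu, THEN G_closed]
    have "c \<bullet> a \<bullet> f u = a \<bullet> c \<bullet> f u" by (rule br_commute_op) (simp_all add: ca)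
    then show ?thesis by (simp add: cu[OF fu] br_lin aaf[OF fu])
  qed
  have "c = \<zero>\<^sub>L"
  proof (rule nondeg[OF s' c])
    fix u assume "u \<in> G (- (- s))"
    then have u: "u \<in> G s" by simp
    note [simp] = G_closed[OF u] facts(5)[OF u, THEN G_closed]
    show "c \<bullet> c \<bullet> u = \<zero>\<^sub>L" by (simp add: cu[OF u] br_lin caf[OF u])
  qed
  then show ?thesis by (simp add: c_def W_def)
qed

text \<open>Only elements b of degree -s can have nonzero values. For b in the square, z =
  \<delta>(b) lies in I, and the aim is [z,[z,a]] = 0 for all a in I of degree -s, so that
  \<open>nondeg_ideal\<close> gives z = 0.\<close>

lemma Der_degree_two:
  assumes d: "\<delta> \<in> Der R L I" and I: "graded_ideal R L G I" and s: "s = 1 \<or> s = -1"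
    and hom: "homogeneous I \<delta> (2 * s)" and x: "x \<in> lie_prod R L I I"
  shows "\<delta> x = \<zero>\<^sub>L"
proof -
  note i = graded_idealD[OF I]
  note sub = lie_prod_subset[OF i i]
  have dG: "\<delta> a \<in> G s" if "a \<in> I" "a \<in> G (- s)" for a
    by (rule homogeneousD[OF hom that]) simp
  have ab: "a \<bullet> b = \<zero>\<^sub>L" if "a \<in> G (- s)" "b \<in> G (- s)" for a b
    by (rule br0[OF that]) (use s in auto)
  \<comment> \<open>The product rule applied to [a,b], which is zero by degree.\<close>
  have sym: "b \<bullet> \<delta> a = a \<bullet> \<delta> b" if a: "a \<in> I" "a \<in> G (- s)" and b: "b \<in> I" "b \<in> G (- s)" for a b
  proof -
    note [simp] = G_closed[OF a(2)] G_closed[OF b(2)] G_closed[OF dG[OF a]] G_closed[OF dG[OF b]]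
    have "\<delta> a \<bullet> b \<boxplus> a \<bullet> \<delta> b = \<zero>\<^sub>L"
      using Der_br[OF d i a(1) b(1)] ab[OF a(2) b(2)] Der_zero[OF d i] by simp
    then have "sec L (\<delta> a \<bullet> b) + sec L (a \<bullet> \<delta> b) = 0" using M.sec_add[of "\<delta> a \<bullet> b" "a \<bullet> \<delta> b"] by (simp add: M.sec_zero)
    then show ?thesis using br_anti[of "\<delta> a" b] by (intro M.secI) (simp_all add: M.sec_simps add_eq_0_iff)
  qed
  \<comment> \<open>The cubic identity [a,[a,\<delta>a]] = 0 is polarized at a + b and a - b. By
    \<open>sym\<close> and commutation the three mixed terms of each bidegree coincide, giving 3P +
    3Q = 0 and -3P + 3Q = 0, hence 6P = 0.\<close>
  have quad: "a \<bullet> a \<bullet> \<delta> b = \<zero>\<^sub>L" if a: "a \<in> I" "a \<in> G (- s)" and b: "b \<in> I" "b \<in> G (- s)" for a b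
  proof -
    note [simp] = G_closed[OF a(2)] G_closed[OF b(2)] G_closed[OF dG[OF a]] G_closed[OF dG[OF b]]
    have [simp]: "a \<bullet> b \<bullet> \<delta> a = a \<bullet> a \<bullet> \<delta> b" "b \<bullet> a \<bullet> \<delta> b = b \<bullet> b \<bullet> \<delta> a"
      using sym[OF a b] by simp_all
    have [simp]: "b \<bullet> a \<bullet> \<delta> a = a \<bullet> a \<bullet> \<delta> b" "a \<bullet> b \<bullet> \<delta> b = b \<bullet> b \<bullet> \<delta> a"
      using br_commute_op[of b a "\<delta> a"] br_commute_op[of a b "\<delta> b"] ab a b by simp_all
    have q: "c \<bullet> c \<bullet> \<delta> c = \<zero>\<^sub>L" if "c \<in> I" "c \<in> G (- s)" for c
      by (rule Der_degree_two_quad[OF d i s hom that])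
    define P where "P = sec L (a \<bullet> a \<bullet> \<delta> b)"
    define Q where "Q = sec L (b \<bullet> b \<bullet> \<delta> a)"
    have "sec L ((a \<boxplus> b) \<bullet> (a \<boxplus> b) \<bullet> \<delta> (a \<boxplus> b)) = 0"
      using q[of "a \<boxplus> b"] a b by (simp add: G_add ideal_add[OF i] M.sec_zero)
    then have 1: "P + P + P + (Q + Q + Q) = 0"
      using q[OF a] q[OF b] by (simp add: Der_add[OF d i a(1) b(1)] br_lin M.sec_simps P_def Q_def algebra_simps)
    have "sec L ((a \<boxplus> \<boxminus> b) \<bullet> (a \<boxplus> \<boxminus> b) \<bullet> \<delta> (a \<boxplus> \<boxminus> b)) = 0"
      using q[of "a \<boxplus> \<boxminus> b"] a b by (simp add: G_add G_neg ideal_add[OF i] ideal_neg[OF i] M.sec_zero)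
    then have 2: "- (P + P + P) + (Q + Q + Q) = 0"
      using q[OF a] q[OF b] a b by (simp add: Der_add[OF d i] Der_neg[OF d i] ideal_neg[OF i] br_lin M.sec_simps
          P_def Q_def algebra_simps)
    have 3: "(P + P + P) + (P + P + P) = 0"
    proof -
      have "(P + P + P) + (P + P + P) = (P + P + P + (Q + Q + Q)) - (- (P + P + P) + (Q + Q + Q))"
        by (simp add: algebra_simps)
      then show ?thesis unfolding 1 2 by simp
    qed
    have X: "sec L (a \<bullet> a \<bullet> \<delta> b \<boxplus> a \<bullet> a \<bullet> \<delta> b \<boxplus> a \<bullet> a \<bullet> \<delta> b) = P + P + P"
      by (simp add: M.sec_add P_def)
    have "a \<bullet> a \<bullet> \<delta> b \<boxplus> a \<bullet> a \<bullet> \<delta> b \<boxplus> a \<bullet> a \<bullet> \<delta> b = \<zero>\<^sub>L"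
      by (rule S.sec_two_torsion, simp, simp, unfold X M.sec_zero 3) simp
    then show ?thesis by (rule S.three_torsion[rotated]) simp
  qed
  show ?thesis
  proof (rule Der_vanish_graded[OF d i graded_lie_prod[OF I] _ _ x])
    show "lie_prod R L I I \<subseteq> I" using sub by blast
    fix k b assume b: "b \<in> lie_prod R L I I" "b \<in> G k" "\<bar>k\<bar> \<le> 1"
    have bI: "b \<in> I" using b(1) sub by blast
    have db: "\<delta> b \<in> G (k + 2 * s)" by (rule homogeneousD[OF hom bI b(2) refl])
    show "\<delta> b = \<zero>\<^sub>L"
    proof (cases "k = - s")
      case False
      then show ?thesis using db grade_trivial[of "k + 2 * s"] s b(3) by auto
    next
      case True
      then have bG: "b \<in> G (- s)" using b(2) by simp
      define z where "z = \<delta> b"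
      have z: "z \<in> G s" "z \<in> I"
        unfolding z_def using dG[OF bI bG] Der_lie_prod[OF d i i _ b(1)] by simp_all
      note [simp] = G_closed[OF bG] G_closed[OF z(1)]
      show ?thesis unfolding z_def[symmetric]
      proof (rule nondeg_ideal[OF i s z(2,1)])
        fix a assume a: "a \<in> I" "a \<in> G (- s)"
        note [simp] = G_closed[OF a(2)] G_closed[OF dG[OF a]]
        have za: "z \<bullet> a = \<boxminus> (b \<bullet> \<delta> a)"
          using br_anti[of a z] sym[OF a bI bG] by (simp add: z_def[symmetric])
        have zda: "z \<bullet> \<delta> a = \<zero>\<^sub>L" by (rule br0[OF z(1) dG[OF a]]) (use s in auto)
        have zb: "z \<bullet> b \<in> I" "z \<bullet> b \<in> G 0" using ideal_left[OF i z(2)] brG[OF z(1) bG] by simp_all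
        have dzb: "\<delta> (z \<bullet> b) = \<zero>\<^sub>L"
          using homogeneousD[OF hom zb refl] grade_trivial[of "0 + 2 * s"] s by auto
        \<comment> \<open>The element [z,b] has degree 0, so \<delta> kills it. Once it commutes
          with a, the product rule makes it commute with \<delta>(a), and this is [z,[z,a]] = 0
          after rewriting [z,a] = -[b,\<delta>(a)].\<close>
        have "(z \<bullet> b) \<bullet> a = \<zero>\<^sub>L"
          using jacobi_left[of z b a] ab[OF bG a(2)] quad[OF bI bG a] by (simp add: za br_lin)
        then have "(z \<bullet> b) \<bullet> \<delta> a = \<zero>\<^sub>L"
          using Der_br[OF d i zb(1) a(1)] dzb Der_zero[OF d i] by simp
        then have "z \<bullet> b \<bullet> \<delta> a = \<zero>\<^sub>L" using jacobi_der[of z b "\<delta> a"] zda by simp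
        then show "z \<bullet> z \<bullet> a = \<zero>\<^sub>L" by (simp add: za br_lin)
      qed
    qed
  qed
qed

text \<open>Beyond degree 2 in absolute value every homogeneous value lands outside the grading.
  Together with \<open>Der_degree_two\<close> this confines the nonzero homogeneous classes to
  degrees -1, 0 and 1.\<close>

lemma Der_degree_large:
  assumes d: "\<delta> \<in> Der R L I" and I: "graded_ideal R L G I" and k: "\<bar>k\<bar> > 1"
    and hom: "homogeneous I \<delta> k" and x: "x \<in> lie_prod R L I I"
  shows "\<delta> x = \<zero>\<^sub>L"
proof -
  consider s where "s = 1 \<or> s = -1" "k = 2 * s" | "\<bar>k\<bar> > 2"
  proof -
    have "k = 2 * 1 \<or> k = 2 * (-1) \<or> \<bar>k\<bar> > 2" using k by linarith
    then show thesis using that by blast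
  qed
  then show ?thesis
  proof cases
    case 1 then show ?thesis using Der_degree_two[OF d I] hom x by blast
  next
    case 2
    note i = graded_idealD[OF I]
    show ?thesis
    proof (rule Der_vanish_graded[OF d i graded_lie_prod[OF I] _ _ x])
      show "lie_prod R L I I \<subseteq> I" using lie_prod_subset[OF i i] by blast
      fix j a assume a: "a \<in> lie_prod R L I I" "a \<in> G j" "\<bar>j\<bar> \<le> 1"
      have "a \<in> I" using a(1) lie_prod_subset[OF i i] by blast
      from homogeneousD[OF hom this a(2) refl] show "\<delta> a = \<zero>\<^sub>L"
        using grade_trivial[of "j + k"] 2 a(3) by auto
    qed
  qed
qed

end

section \<open>The maximal algebra of quotients\<close>

context nondeg_graded
begin

abbreviation Q where "Q \<equiv> Qm R L"
abbreviation cl where "cl I \<delta> \<equiv> der_class R L I \<delta>"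

definition pder :: "'l set \<Rightarrow> ('l \<Rightarrow> 'l) \<Rightarrow> bool" where
  "pder I \<delta> \<longleftrightarrow> essential_ideal R L I \<and> \<delta> \<in> Der R L I"

lemma pderD:
  assumes "pder I \<delta>"
  shows pder_ess: "essential_ideal R L I" and pder_der: "\<delta> \<in> Der R L I" and pder_ideal: "lie_ideal R L I"
  using assms essentialD by (auto simp: pder_def)

lemma partial_ders_iff: "(I, \<delta>) \<in> partial_ders R L \<longleftrightarrow> pder I \<delta>"
  by (simp add: partial_ders_def pder_def)

text \<open>For x in both domains and y in K, also [x,y] lies in K, so the product rules show that
  the difference of the two values at x centralizes the essential ideal K.\<close>

lemma Der_agree:
  assumes 1: "pder I \<delta>" and 2: "pder J \<mu>" and K: "essential_ideal R L K" "K \<subseteq> I \<inter> J"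
    and h: "\<And>y. y \<in> K \<Longrightarrow> \<delta> y = \<mu> y" and x: "x \<in> I \<inter> J"
  shows "\<delta> x = \<mu> x"
proof -
  note i = pder_ideal[OF 1] note j = pder_ideal[OF 2] note k = essentialD[OF K(1)]
  have [simp]: "x \<in> carrier L" "\<delta> x \<in> carrier L" "\<mu> x \<in> carrier L"
    using x ideal_closed[OF i] Der_closed[OF pder_der[OF 1] i] Der_closed[OF pder_der[OF 2] j] by auto
  have "\<delta> x \<boxplus> \<boxminus> \<mu> x = \<zero>\<^sub>L"
  proof (rule essential_centralizer[OF K(1)])
    fix y assume y: "y \<in> K"
    have yIJ: "y \<in> I" "y \<in> J" using K y by auto
    have [simp]: "y \<in> carrier L" "\<mu> y \<in> carrier L" using ideal_closed[OF k y] Der_closed[OF pder_der[OF 2] j yIJ(2)] by auto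
    have "x \<bullet> y \<in> K" using ideal_right[OF k y] by simp
    then have "\<delta> x \<bullet> y \<boxplus> x \<bullet> \<delta> y = \<mu> x \<bullet> y \<boxplus> x \<bullet> \<mu> y"
      using h[of "x \<bullet> y"] Der_br[OF pder_der[OF 1] i, of x y] Der_br[OF pder_der[OF 2] j, of x y] x yIJ by simp
    then have "\<delta> x \<bullet> y = \<mu> x \<bullet> y" by (simp add: h[OF y])
    then show "(\<delta> x \<boxplus> \<boxminus> \<mu> x) \<bullet> y = \<zero>\<^sub>L" by (simp add: br_lin M.r_neg)
  qed simp
  from arg_cong[OF this, of "sec L"] show ?thesis by (intro M.secI) (simp_all add: M.sec_simps)
qed

text \<open>Removes the existential ideal from the identification: equivalent partial derivations
  agree wherever both are defined. Equality of classes becomes a pointwise check.\<close>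

lemma der_rel_iff:
  "((I, \<delta>), (J, \<mu>)) \<in> der_rel R L \<longleftrightarrow> pder I \<delta> \<and> pder J \<mu> \<and> (\<forall>x\<in>I \<inter> J. \<delta> x = \<mu> x)"
proof
  assume "((I, \<delta>), (J, \<mu>)) \<in> der_rel R L"
  then show "pder I \<delta> \<and> pder J \<mu> \<and> (\<forall>x\<in>I \<inter> J. \<delta> x = \<mu> x)"
    using Der_agree unfolding der_rel_def partial_ders_iff by blast
next
  assume "pder I \<delta> \<and> pder J \<mu> \<and> (\<forall>x\<in>I \<inter> J. \<delta> x = \<mu> x)"
  then show "((I, \<delta>), (J, \<mu>)) \<in> der_rel R L"
    using essential_Int[of I J] pder_ess unfolding der_rel_def partial_ders_iff by blast
qed

lemma der_rel_equiv: "equiv (partial_ders R L) (der_rel R L)"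
proof (rule equivI)
  show "der_rel R L \<subseteq> partial_ders R L \<times> partial_ders R L" by (auto simp: der_rel_def)
  show "refl_on (partial_ders R L) (der_rel R L)"
    by (auto simp: refl_on_def der_rel_iff partial_ders_iff)
  show "sym (der_rel R L)" unfolding sym_def by (auto simp: der_rel_iff)
  show "trans (der_rel R L)"
  proof (rule transI)
    fix A B C assume AB: "(A, B) \<in> der_rel R L" and BC: "(B, C) \<in> der_rel R L"
    obtain I \<delta> J \<mu> K \<nu> where e: "A = (I, \<delta>)" "B = (J, \<mu>)" "C = (K, \<nu>)" by (cases A, cases B, cases C)
    have p: "pder I \<delta>" "pder J \<mu>" "pder K \<nu>" using AB BC by (auto simp: e der_rel_iff)
    have "\<delta> x = \<nu> x" if "x \<in> I \<inter> K" for x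
    proof (rule Der_agree[OF p(1,3) _ _ _ that])
      show "essential_ideal R L (I \<inter> J \<inter> K)" by (intro essential_Int pder_ess[OF p(1)] pder_ess[OF p(2)] pder_ess[OF p(3)])
      show "\<delta> y = \<nu> y" if "y \<in> I \<inter> J \<inter> K" for y using AB BC that by (auto simp: e der_rel_iff)
    qed auto
    then show "(A, C) \<in> der_rel R L" using p by (auto simp: e der_rel_iff)
  qed
qed

lemma cl_mem: "(J, \<mu>) \<in> cl I \<delta> \<longleftrightarrow> pder I \<delta> \<and> pder J \<mu> \<and> (\<forall>x\<in>I \<inter> J. \<delta> x = \<mu> x)"
  by (simp add: der_class_def der_rel_iff)

lemma cl_self: "pder I \<delta> \<Longrightarrow> (I, \<delta>) \<in> cl I \<delta>"
  by (simp add: cl_mem)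

lemma cl_eq_iff: "\<lbrakk>pder I \<delta>; pder J \<mu>\<rbrakk> \<Longrightarrow> cl I \<delta> = cl J \<mu> \<longleftrightarrow> (\<forall>x\<in>I \<inter> J. \<delta> x = \<mu> x)"
  using eq_equiv_class_iff[OF der_rel_equiv, of "(I, \<delta>)" "(J, \<mu>)"]
  by (simp add: der_class_def partial_ders_iff der_rel_iff)

lemma cl_eqI:
  assumes "pder I \<delta>" "pder J \<mu>" "essential_ideal R L K" "K \<subseteq> I \<inter> J" "\<And>y. y \<in> K \<Longrightarrow> \<delta> y = \<mu> y"
  shows "cl I \<delta> = cl J \<mu>"
  using assms Der_agree[OF assms(1-4)] by (simp add: cl_eq_iff)

lemma Q_carrier: "A \<in> carrier Q \<longleftrightarrow> (\<exists>I \<delta>. pder I \<delta> \<and> A = cl I \<delta>)"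
  by (simp add: Qm_def quotient_def der_class_def Bex_def partial_ders_iff split_paired_Ex)

lemma cl_closed: "pder I \<delta> \<Longrightarrow> cl I \<delta> \<in> carrier Q"
  by (auto simp: Q_carrier)

lemma Q_carrierE:
  assumes "A \<in> carrier Q" obtains I \<delta> where "pder I \<delta>" "A = cl I \<delta>"
  using assms by (auto simp: Q_carrier)

text \<open>Evaluates the unions by which operations on classes are encoded: if the result does not
  depend on the representative, the union is that one result, the class being nonempty.\<close>

lemma UN_cl:
  assumes "pder I \<delta>" "\<And>J \<mu>. \<lbrakk>pder J \<mu>; \<And>x. x \<in> I \<inter> J \<Longrightarrow> \<delta> x = \<mu> x\<rbrakk> \<Longrightarrow> F J \<mu> = C"
  shows "(\<Union>(J, \<mu>)\<in>cl I \<delta>. F J \<mu>) = C"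
proof -
  have "F J \<mu> = C" if "(J, \<mu>) \<in> cl I \<delta>" for J \<mu> using assms(2)[of J \<mu>] that by (simp add: cl_mem)
  then have "(\<Union>(J, \<mu>)\<in>cl I \<delta>. F J \<mu>) = (\<Union>p\<in>cl I \<delta>. C)" by (intro SUP_cong) auto
  then show ?thesis using cl_self[OF assms(1)] by auto
qed

section \<open>Operations on partial derivations and on classes\<close>

lemma pder_add:
  assumes 1: "pder I \<delta>" and 2: "pder J \<mu>"
  shows "pder (I \<inter> J) (\<lambda>x\<in>I \<inter> J. \<delta> x \<boxplus> \<mu> x)"
proof -
  note i = pder_ideal[OF 1] note j = pder_ideal[OF 2]
  note d = pder_der[OF 1] note m = pder_der[OF 2]
  have "(\<lambda>x\<in>I \<inter> J. \<delta> x \<boxplus> \<mu> x) \<in> Der R L (I \<inter> J)"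
  proof (rule DerI)
    fix x y assume xy: "x \<in> I \<inter> J" "y \<in> I \<inter> J"
    then have [simp]: "\<delta> x \<in> carrier L" "\<mu> x \<in> carrier L" "\<delta> y \<in> carrier L" "\<mu> y \<in> carrier L" "x \<in> carrier L" "y \<in> carrier L"
      using Der_closed[OF d i] Der_closed[OF m j] ideal_closed[OF i] by auto
    show "\<delta> (x \<boxplus> y) \<boxplus> \<mu> (x \<boxplus> y) = \<delta> x \<boxplus> \<mu> x \<boxplus> (\<delta> y \<boxplus> \<mu> y)"
      using xy by (simp add: Der_add[OF d i] Der_add[OF m j] M.a_ac)
    show "\<delta> (x \<bullet> y) \<boxplus> \<mu> (x \<bullet> y) = (\<delta> x \<boxplus> \<mu> x) \<bullet> y \<boxplus> x \<bullet> (\<delta> y \<boxplus> \<mu> y)"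
      using xy by (simp add: Der_br[OF d i] Der_br[OF m j] br_lin M.a_ac)
  next
    fix a x assume "a \<in> carrier R" "x \<in> I \<inter> J"
    then show "\<delta> (a \<cdot> x) \<boxplus> \<mu> (a \<cdot> x) = a \<cdot> (\<delta> x \<boxplus> \<mu> x)"
      by (simp add: Der_smult[OF d i] Der_smult[OF m j] Der_closed[OF d i] Der_closed[OF m j] smult_r_distr)
  qed (use Der_closed[OF d i] Der_closed[OF m j] ideal_Int[OF i j] in auto)
  then show ?thesis using essential_Int[OF pder_ess[OF 1] pder_ess[OF 2]] by (simp add: pder_def)
qed

lemma pder_smult:
  assumes 1: "pder I \<delta>" and r: "r \<in> carrier R"
  shows "pder I (\<lambda>x\<in>I. r \<cdot> \<delta> x)"
proof -
  note i = pder_ideal[OF 1] note d = pder_der[OF 1]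
  have "(\<lambda>x\<in>I. r \<cdot> \<delta> x) \<in> Der R L I"
    by (rule DerI) (use r i ideal_closed[OF i] in \<open>simp_all add: Der_closed[OF d i] Der_add[OF d i] Der_br[OF d i]
        Der_smult[OF d i] smult_r_distr br_lin smult_assoc1[symmetric] R.m_comm\<close>)
  then show ?thesis using pder_ess[OF 1] by (simp add: pder_def)
qed

text \<open>On the square of I \<inter> J both derivations take values in I \<inter> J, by
  \<open>Der_lie_prod\<close>, so both composites of the commutator are defined there.\<close>

lemma commutator_closed:
  assumes 1: "pder I \<delta>" and 2: "pder J \<mu>" and x: "x \<in> lie_prod R L (I \<inter> J) (I \<inter> J)"
  shows "x \<in> I" "x \<in> J" "x \<in> carrier L" "\<delta> x \<in> I" "\<delta> x \<in> J" "\<mu> x \<in> I" "\<mu> x \<in> J"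
    "\<delta> x \<in> carrier L" "\<mu> x \<in> carrier L" "\<delta> (\<mu> x) \<in> carrier L" "\<mu> (\<delta> x) \<in> carrier L"
proof -
  note i = pder_ideal[OF 1] note j = pder_ideal[OF 2]
  note d = pder_der[OF 1] note m = pder_der[OF 2]
  note k = ideal_Int[OF i j]
  show xi: "x \<in> I" "x \<in> J" using x lie_prod_subset[OF k k] by auto
  have "\<delta> x \<in> I \<inter> J" by (rule Der_lie_prod[OF d i k _ x]) simp
  then show dx: "\<delta> x \<in> I" "\<delta> x \<in> J" by auto
  have "\<mu> x \<in> I \<inter> J" by (rule Der_lie_prod[OF m j k _ x]) simp
  then show mx: "\<mu> x \<in> I" "\<mu> x \<in> J" by auto
  show "x \<in> carrier L" "\<delta> x \<in> carrier L" "\<mu> x \<in> carrier L" "\<delta> (\<mu> x) \<in> carrier L" "\<mu> (\<delta> x) \<in> carrier L"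
    using ideal_closed[OF i] xi dx mx Der_closed[OF d i] Der_closed[OF m j] by auto
qed

lemma pder_commutator:
  assumes 1: "pder I \<delta>" and 2: "pder J \<mu>"
  shows "pder (lie_prod R L (I \<inter> J) (I \<inter> J))
    (\<lambda>x\<in>lie_prod R L (I \<inter> J) (I \<inter> J). \<delta> (\<mu> x) \<ominus>\<^bsub>L\<^esub> \<mu> (\<delta> x))"
proof -
  note i = pder_ideal[OF 1] note j = pder_ideal[OF 2]
  note d = pder_der[OF 1] note m = pder_der[OF 2]
  note k = ideal_Int[OF i j]
  let ?K = "lie_prod R L (I \<inter> J) (I \<inter> J)"
  note c = commutator_closed[OF 1 2]
  note simps = Der_closed[OF d i] Der_closed[OF m j] Der_add[OF d i] Der_add[OF m j] Der_smult[OF d i] Der_smult[OF m j]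
    Der_br[OF d i] Der_br[OF m j]
  have "(\<lambda>x\<in>?K. \<delta> (\<mu> x) \<ominus>\<^bsub>L\<^esub> \<mu> (\<delta> x)) \<in> Der R L ?K"
  proof (rule DerI)
    fix x y assume x: "x \<in> ?K" and y: "y \<in> ?K"
    note [simp] = c[OF x] c[OF y]
    show "\<delta> (\<mu> (x \<boxplus> y)) \<ominus>\<^bsub>L\<^esub> \<mu> (\<delta> (x \<boxplus> y)) = (\<delta> (\<mu> x) \<ominus>\<^bsub>L\<^esub> \<mu> (\<delta> x)) \<boxplus> (\<delta> (\<mu> y) \<ominus>\<^bsub>L\<^esub> \<mu> (\<delta> y))"
      by (rule M.secI) (simp_all add: simps M.sec_simps algebra_simps)
    show "\<delta> (\<mu> (x \<bullet> y)) \<ominus>\<^bsub>L\<^esub> \<mu> (\<delta> (x \<bullet> y)) = (\<delta> (\<mu> x) \<ominus>\<^bsub>L\<^esub> \<mu> (\<delta> x)) \<bullet> y \<boxplus> x \<bullet> (\<delta> (\<mu> y) \<ominus>\<^bsub>L\<^esub> \<mu> (\<delta> y))"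
      by (rule M.secI) (simp_all add: simps ideal_left[OF i] ideal_left[OF j] a_minus_def br_lin M.sec_simps algebra_simps)
  next
    fix a x assume a: "a \<in> carrier R" and x: "x \<in> ?K"
    note [simp] = c[OF x]
    show "\<delta> (\<mu> (a \<cdot> x)) \<ominus>\<^bsub>L\<^esub> \<mu> (\<delta> (a \<cdot> x)) = a \<cdot> (\<delta> (\<mu> x) \<ominus>\<^bsub>L\<^esub> \<mu> (\<delta> x))"
      using a by (simp add: simps smult_minus)
  next
    show "lie_ideal R L ?K" by (rule lie_prod_ideal[OF k k])
  qed (use c in simp)
  then show ?thesis using essential_lie_prod[OF essential_Int[OF pder_ess[OF 1] pder_ess[OF 2]]] by (simp add: pder_def)
qed

lemma cl_add:
  assumes 1: "pder I \<delta>" and 2: "pder J \<mu>"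
  shows "cl I \<delta> \<oplus>\<^bsub>Q\<^esub> cl J \<mu> = cl (I \<inter> J) (\<lambda>x\<in>I \<inter> J. \<delta> x \<boxplus> \<mu> x)"
proof -
  have "(\<Union>(I, \<delta>)\<in>cl I \<delta>. \<Union>(J, \<mu>)\<in>cl J \<mu>. cl (I \<inter> J) (\<lambda>x\<in>I \<inter> J. \<delta> x \<boxplus> \<mu> x))
    = cl (I \<inter> J) (\<lambda>x\<in>I \<inter> J. \<delta> x \<boxplus> \<mu> x)"
  proof (intro UN_cl 1 2)
    fix I' \<delta>' J' \<mu>' assume h: "pder I' \<delta>'" "\<And>x. x \<in> I \<inter> I' \<Longrightarrow> \<delta> x = \<delta>' x"
      "pder J' \<mu>'" "\<And>x. x \<in> J \<inter> J' \<Longrightarrow> \<mu> x = \<mu>' x"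
    show "cl (I' \<inter> J') (\<lambda>x\<in>I' \<inter> J'. \<delta>' x \<boxplus> \<mu>' x) = cl (I \<inter> J) (\<lambda>x\<in>I \<inter> J. \<delta> x \<boxplus> \<mu> x)"
      by (subst cl_eq_iff[OF pder_add[OF h(1,3)] pder_add[OF 1 2]]) (use h(2,4) in auto)
  qed
  then show ?thesis by (simp add: Qm_def)
qed

lemma cl_smult:
  assumes 1: "pder I \<delta>" and r: "r \<in> carrier R"
  shows "r \<odot>\<^bsub>Q\<^esub> cl I \<delta> = cl I (\<lambda>x\<in>I. r \<cdot> \<delta> x)"
proof -
  have "(\<Union>(I, \<delta>)\<in>cl I \<delta>. cl I (\<lambda>x\<in>I. r \<cdot> \<delta> x)) = cl I (\<lambda>x\<in>I. r \<cdot> \<delta> x)"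
  proof (intro UN_cl 1)
    fix I' \<delta>' assume h: "pder I' \<delta>'" "\<And>x. x \<in> I \<inter> I' \<Longrightarrow> \<delta> x = \<delta>' x"
    show "cl I' (\<lambda>x\<in>I'. r \<cdot> \<delta>' x) = cl I (\<lambda>x\<in>I. r \<cdot> \<delta> x)"
      by (subst cl_eq_iff[OF pder_smult[OF h(1) r] pder_smult[OF 1 r]]) (use h(2) in auto)
  qed
  then show ?thesis by (simp add: Qm_def)
qed

lemma cl_mult:
  assumes 1: "pder I \<delta>" and 2: "pder J \<mu>"
  shows "cl I \<delta> \<otimes>\<^bsub>Q\<^esub> cl J \<mu> = cl (lie_prod R L (I \<inter> J) (I \<inter> J))
    (\<lambda>x\<in>lie_prod R L (I \<inter> J) (I \<inter> J). \<delta> (\<mu> x) \<ominus>\<^bsub>L\<^esub> \<mu> (\<delta> x))"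
proof -
  let ?C = "\<lambda>I \<delta> J \<mu>. cl (lie_prod R L (I \<inter> J) (I \<inter> J))
    (\<lambda>x\<in>lie_prod R L (I \<inter> J) (I \<inter> J). \<delta> (\<mu> x) \<ominus>\<^bsub>L\<^esub> \<mu> (\<delta> x))"
  have "(\<Union>(I, \<delta>)\<in>cl I \<delta>. \<Union>(J, \<mu>)\<in>cl J \<mu>. ?C I \<delta> J \<mu>) = ?C I \<delta> J \<mu>"
  proof (intro UN_cl 1 2)
    fix I' \<delta>' J' \<mu>' assume h: "pder I' \<delta>'" "\<And>x. x \<in> I \<inter> I' \<Longrightarrow> \<delta> x = \<delta>' x"
      "pder J' \<mu>'" "\<And>x. x \<in> J \<inter> J' \<Longrightarrow> \<mu> x = \<mu>' x"
    show "?C I' \<delta>' J' \<mu>' = ?C I \<delta> J \<mu>"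
    proof (subst cl_eq_iff[OF pder_commutator[OF h(1,3)] pder_commutator[OF 1 2]], rule ballI)
      fix x assume x: "x \<in> lie_prod R L (I' \<inter> J') (I' \<inter> J') \<inter> lie_prod R L (I \<inter> J) (I \<inter> J)"
      note c = commutator_closed[OF 1 2, of x] commutator_closed[OF h(1,3), of x]
      have "\<delta> x = \<delta>' x" "\<mu> x = \<mu>' x" using x c h(2,4) by auto
      moreover have "\<delta> (\<mu> x) = \<delta>' (\<mu> x)" "\<mu> (\<delta> x) = \<mu>' (\<delta> x)"
        using x c calculation by (auto intro!: h(2,4))
      ultimately show "(\<lambda>x\<in>lie_prod R L (I' \<inter> J') (I' \<inter> J'). \<delta>' (\<mu>' x) \<ominus>\<^bsub>L\<^esub> \<mu>' (\<delta>' x)) x =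
          (\<lambda>x\<in>lie_prod R L (I \<inter> J) (I \<inter> J). \<delta> (\<mu> x) \<ominus>\<^bsub>L\<^esub> \<mu> (\<delta> x)) x"
        using x by simp
    qed
  qed
  then show ?thesis by (simp add: Qm_def)
qed

lemma pder_zero: "pder (carrier L) (\<lambda>x\<in>carrier L. \<zero>\<^sub>L)"
  using essential_carrier by (auto simp: pder_def intro!: DerI carrier_ideal)

lemma Q_zero: "\<zero>\<^bsub>Q\<^esub> = cl (carrier L) (\<lambda>x\<in>carrier L. \<zero>\<^sub>L)"
  by (simp add: Qm_def)

lemma cl_eq_zero: "pder I \<delta> \<Longrightarrow> cl I \<delta> = \<zero>\<^bsub>Q\<^esub> \<longleftrightarrow> (\<forall>x\<in>I. \<delta> x = \<zero>\<^sub>L)"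
  using cl_eq_iff[OF _ pder_zero, of I \<delta>] ideal_closed[OF pder_ideal] by (auto simp: Q_zero)

lemma cl_eq_zeroI:
  assumes "pder I \<delta>" "essential_ideal R L K" "K \<subseteq> I" "\<And>x. x \<in> K \<Longrightarrow> \<delta> x = \<zero>\<^sub>L"
  shows "cl I \<delta> = \<zero>\<^bsub>Q\<^esub>"
  unfolding Q_zero
  by (rule cl_eqI[OF assms(1) pder_zero assms(2)])
    (use assms(3,4) ideal_closed[OF pder_ideal[OF assms(1)]] in auto)

section \<open>The Lie algebra structure of the quotient algebra\<close>

lemma Q_module: "module R Q"
proof (rule moduleI)
  show "cring R" by (rule R.is_cring)
  show "abelian_group Q"
  proof (rule abelian_groupI)
    fix A B assume "A \<in> carrier Q" "B \<in> carrier Q"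
    then obtain I \<delta> J \<mu> where A: "pder I \<delta>" "A = cl I \<delta>" and B: "pder J \<mu>" "B = cl J \<mu>"
      by (auto elim!: Q_carrierE)
    show "A \<oplus>\<^bsub>Q\<^esub> B \<in> carrier Q" using cl_closed[OF pder_add[OF A(1) B(1)]] by (simp add: A B cl_add)
    show "A \<oplus>\<^bsub>Q\<^esub> B = B \<oplus>\<^bsub>Q\<^esub> A"
      using Der_closed[OF pder_der[OF A(1)] pder_ideal[OF A(1)]] Der_closed[OF pder_der[OF B(1)] pder_ideal[OF B(1)]]
      by (simp add: A B cl_add cl_eq_iff pder_add) (auto intro: M.a_comm)
  next
    fix A B C assume "A \<in> carrier Q" "B \<in> carrier Q" "C \<in> carrier Q"
    then obtain I \<delta> J \<mu> K \<nu> where A: "pder I \<delta>" "A = cl I \<delta>" and B: "pder J \<mu>" "B = cl J \<mu>" and C: "pder K \<nu>" "C = cl K \<nu>"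
      by (auto elim!: Q_carrierE)
    show "A \<oplus>\<^bsub>Q\<^esub> B \<oplus>\<^bsub>Q\<^esub> C = A \<oplus>\<^bsub>Q\<^esub> (B \<oplus>\<^bsub>Q\<^esub> C)"
      using Der_closed[OF pder_der[OF A(1)] pder_ideal[OF A(1)]] Der_closed[OF pder_der[OF B(1)] pder_ideal[OF B(1)]]
        Der_closed[OF pder_der[OF C(1)] pder_ideal[OF C(1)]]
      unfolding A(2) B(2) C(2) cl_add[OF A(1) B(1)] cl_add[OF B(1) C(1)]
        cl_add[OF pder_add[OF A(1) B(1)] C(1)] cl_add[OF A(1) pder_add[OF B(1) C(1)]]
      by (subst cl_eq_iff[OF pder_add[OF pder_add[OF A(1) B(1)] C(1)] pder_add[OF A(1) pder_add[OF B(1) C(1)]]])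
        (auto simp: M.a_assoc)
  next
    show "\<zero>\<^bsub>Q\<^esub> \<in> carrier Q" unfolding Q_zero by (rule cl_closed[OF pder_zero])
  next
    fix A assume "A \<in> carrier Q"
    then obtain I \<delta> where A: "pder I \<delta>" "A = cl I \<delta>" by (auto elim!: Q_carrierE)
    note c = Der_closed[OF pder_der[OF A(1)] pder_ideal[OF A(1)]]
    show "\<zero>\<^bsub>Q\<^esub> \<oplus>\<^bsub>Q\<^esub> A = A"
      unfolding Q_zero A(2) cl_add[OF pder_zero A(1)]
      by (subst cl_eq_iff[OF pder_add[OF pder_zero A(1)] A(1)]) (use c in auto)
    have m: "\<ominus> \<one> \<in> carrier R" by simp
    show "\<exists>B\<in>carrier Q. B \<oplus>\<^bsub>Q\<^esub> A = \<zero>\<^bsub>Q\<^esub>"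
    proof (rule bexI)
      show "cl I (\<lambda>x\<in>I. (\<ominus> \<one>) \<cdot> \<delta> x) \<oplus>\<^bsub>Q\<^esub> A = \<zero>\<^bsub>Q\<^esub>"
        unfolding A(2) cl_add[OF pder_smult[OF A(1) m] A(1)]
        by (subst cl_eq_zero[OF pder_add[OF pder_smult[OF A(1) m] A(1)]]) (use c in \<open>auto simp: smult_l_minus M.l_neg\<close>)
    qed (rule cl_closed[OF pder_smult[OF A(1) m]])
  qed
next
  fix a A assume a: "a \<in> carrier R" and "A \<in> carrier Q"
  then obtain I \<delta> where A: "pder I \<delta>" "A = cl I \<delta>" by (auto elim!: Q_carrierE)
  note c = Der_closed[OF pder_der[OF A(1)] pder_ideal[OF A(1)]]
  show "a \<odot>\<^bsub>Q\<^esub> A \<in> carrier Q" using cl_closed[OF pder_smult[OF A(1) a]] by (simp add: A cl_smult a)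
next
  fix A assume "A \<in> carrier Q"
  then obtain I \<delta> where A: "pder I \<delta>" "A = cl I \<delta>" by (auto elim!: Q_carrierE)
  note c = Der_closed[OF pder_der[OF A(1)] pder_ideal[OF A(1)]]
  show "\<one> \<odot>\<^bsub>Q\<^esub> A = A"
    unfolding A(2) cl_smult[OF A(1) R.one_closed]
    by (subst cl_eq_iff[OF pder_smult[OF A(1) R.one_closed] A(1)]) (use c in auto)
next
  fix a b A assume ab: "a \<in> carrier R" "b \<in> carrier R" and "A \<in> carrier Q"
  then obtain I \<delta> where A: "pder I \<delta>" "A = cl I \<delta>" by (auto elim!: Q_carrierE)
  note c = Der_closed[OF pder_der[OF A(1)] pder_ideal[OF A(1)]]
  have s: "a \<oplus> b \<in> carrier R" "a \<otimes> b \<in> carrier R" using ab by simp_all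
  show "(a \<oplus> b) \<odot>\<^bsub>Q\<^esub> A = a \<odot>\<^bsub>Q\<^esub> A \<oplus>\<^bsub>Q\<^esub> b \<odot>\<^bsub>Q\<^esub> A"
    unfolding A(2) cl_smult[OF A(1) s(1)] cl_smult[OF A(1) ab(1)] cl_smult[OF A(1) ab(2)]
      cl_add[OF pder_smult[OF A(1) ab(1)] pder_smult[OF A(1) ab(2)]]
    by (subst cl_eq_iff[OF pder_smult[OF A(1) s(1)] pder_add[OF pder_smult[OF A(1) ab(1)] pder_smult[OF A(1) ab(2)]]])
      (use c ab in \<open>auto simp: smult_l_distr\<close>)
  show "(a \<otimes> b) \<odot>\<^bsub>Q\<^esub> A = a \<odot>\<^bsub>Q\<^esub> (b \<odot>\<^bsub>Q\<^esub> A)"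
    unfolding A(2) cl_smult[OF A(1) s(2)] cl_smult[OF A(1) ab(2)] cl_smult[OF pder_smult[OF A(1) ab(2)] ab(1)]
    by (subst cl_eq_iff[OF pder_smult[OF A(1) s(2)] pder_smult[OF pder_smult[OF A(1) ab(2)] ab(1)]])
      (use c ab in \<open>auto simp: smult_assoc1\<close>)
next
  fix a A B assume a: "a \<in> carrier R" and "A \<in> carrier Q" "B \<in> carrier Q"
  then obtain I \<delta> J \<mu> where A: "pder I \<delta>" "A = cl I \<delta>" and B: "pder J \<mu>" "B = cl J \<mu>"
    by (auto elim!: Q_carrierE)
  note c = Der_closed[OF pder_der[OF A(1)] pder_ideal[OF A(1)]] Der_closed[OF pder_der[OF B(1)] pder_ideal[OF B(1)]]
  show "a \<odot>\<^bsub>Q\<^esub> (A \<oplus>\<^bsub>Q\<^esub> B) = a \<odot>\<^bsub>Q\<^esub> A \<oplus>\<^bsub>Q\<^esub> a \<odot>\<^bsub>Q\<^esub> B"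
    unfolding A(2) B(2) cl_smult[OF A(1) a] cl_smult[OF B(1) a] cl_add[OF A(1) B(1)]
      cl_add[OF pder_smult[OF A(1) a] pder_smult[OF B(1) a]] cl_smult[OF pder_add[OF A(1) B(1)] a]
    by (subst cl_eq_iff[OF pder_smult[OF pder_add[OF A(1) B(1)] a] pder_add[OF pder_smult[OF A(1) a] pder_smult[OF B(1) a]]])
      (use c a in \<open>auto simp: smult_r_distr\<close>)
qed

end

context nondeg_graded
begin

sublocale Q: module R Q by (rule Q_module)

lemma pder_restrict:
  assumes 1: "pder I \<delta>" and J: "essential_ideal R L J" "J \<subseteq> I"
  shows "pder J (restrict \<delta> J)"
  using Der_restrict[OF pder_der[OF 1] pder_ideal[OF 1] essentialD[OF J(1)] J(2)] J(1) by (simp add: pder_def)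

lemma cl_restrict: "\<lbrakk>pder I \<delta>; essential_ideal R L J; J \<subseteq> I\<rbrakk> \<Longrightarrow> cl I \<delta> = cl J (restrict \<delta> J)"
  by (subst cl_eq_iff[OF _ pder_restrict]) auto

text \<open>Up to three classes can be represented on one essential ideal, after which their sums
  and commutators are compared on equal domains.\<close>

lemma Q_common:
  assumes "A \<in> carrier Q" "B \<in> carrier Q" "C \<in> carrier Q"
  obtains K \<delta> \<mu> \<nu> where "pder K \<delta>" "A = cl K \<delta>" "pder K \<mu>" "B = cl K \<mu>" "pder K \<nu>" "C = cl K \<nu>"
proof -
  obtain I \<delta> J \<mu> K \<nu> where A: "pder I \<delta>" "A = cl I \<delta>" and B: "pder J \<mu>" "B = cl J \<mu>" and C: "pder K \<nu>" "C = cl K \<nu>"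
    using assms by (auto elim!: Q_carrierE)
  have e: "essential_ideal R L (I \<inter> J \<inter> K)"
    by (intro essential_Int pder_ess[OF A(1)] pder_ess[OF B(1)] pder_ess[OF C(1)])
  show thesis
    by (rule that[OF pder_restrict[OF A(1) e] _ pder_restrict[OF B(1) e] _ pder_restrict[OF C(1) e]])
      (use A B C cl_restrict[OF A(1) e] cl_restrict[OF B(1) e] cl_restrict[OF C(1) e] in auto)
qed

lemma cl_add': "\<lbrakk>pder K \<delta>; pder K \<mu>\<rbrakk> \<Longrightarrow> cl K \<delta> \<oplus>\<^bsub>Q\<^esub> cl K \<mu> = cl K (\<lambda>x\<in>K. \<delta> x \<boxplus> \<mu> x)"
  using cl_add[of K \<delta> K \<mu>] by simp

lemma cl_mult': "\<lbrakk>pder K \<delta>; pder K \<mu>\<rbrakk> \<Longrightarrow> cl K \<delta> \<otimes>\<^bsub>Q\<^esub> cl K \<mu> =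
    cl (lie_prod R L K K) (\<lambda>x\<in>lie_prod R L K K. \<delta> (\<mu> x) \<ominus>\<^bsub>L\<^esub> \<mu> (\<delta> x))"
  using cl_mult[of K \<delta> K \<mu>] by simp

lemma pder_add': "\<lbrakk>pder K \<delta>; pder K \<mu>\<rbrakk> \<Longrightarrow> pder K (\<lambda>x\<in>K. \<delta> x \<boxplus> \<mu> x)"
  using pder_add[of K \<delta> K \<mu>] by simp

lemma pder_commutator': "\<lbrakk>pder K \<delta>; pder K \<mu>\<rbrakk> \<Longrightarrow>
    pder (lie_prod R L K K) (\<lambda>x\<in>lie_prod R L K K. \<delta> (\<mu> x) \<ominus>\<^bsub>L\<^esub> \<mu> (\<delta> x))"
  using pder_commutator[of K \<delta> K \<mu>] by simp

lemma commutator_closed':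
  assumes "pder K \<delta>" "x \<in> lie_prod R L K K"
  shows "x \<in> K" "x \<in> carrier L" "\<delta> x \<in> K" "\<delta> x \<in> carrier L"
  using commutator_closed[OF assms(1,1), of x] assms(2) by simp_all

lemma Q_mult_closed: assumes "A \<in> carrier Q" "B \<in> carrier Q" shows "A \<otimes>\<^bsub>Q\<^esub> B \<in> carrier Q"
proof -
  obtain I \<delta> J \<mu> where A: "pder I \<delta>" "A = cl I \<delta>" and B: "pder J \<mu>" "B = cl J \<mu>"
    using assms by (auto elim!: Q_carrierE)
  show ?thesis using cl_closed[OF pder_commutator[OF A(1) B(1)]] by (simp add: A B cl_mult)
qed

lemma Q_mult_add:
  assumes "A \<in> carrier Q" "B \<in> carrier Q" "C \<in> carrier Q"
  shows "A \<otimes>\<^bsub>Q\<^esub> (B \<oplus>\<^bsub>Q\<^esub> C) = A \<otimes>\<^bsub>Q\<^esub> B \<oplus>\<^bsub>Q\<^esub> A \<otimes>\<^bsub>Q\<^esub> C"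
proof -
  obtain K \<delta> \<mu> \<nu> where A: "pder K \<delta>" "A = cl K \<delta>" and B: "pder K \<mu>" "B = cl K \<mu>" and C: "pder K \<nu>" "C = cl K \<nu>"
    using Q_common[OF assms] .
  note i = pder_ideal[OF A(1)]
  show ?thesis
    unfolding A(2) B(2) C(2) cl_add'[OF B(1) C(1)] cl_mult'[OF A(1) B(1)] cl_mult'[OF A(1) C(1)]
      cl_mult'[OF A(1) pder_add'[OF B(1) C(1)]]
      cl_add'[OF pder_commutator'[OF A(1) B(1)] pder_commutator'[OF A(1) C(1)]]
  proof (subst cl_eq_iff[OF pder_commutator'[OF A(1) pder_add'[OF B(1) C(1)]]
        pder_add'[OF pder_commutator'[OF A(1) B(1)] pder_commutator'[OF A(1) C(1)]]], rule ballI, goal_cases)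
    case (1 x)
    then have x: "x \<in> lie_prod R L K K" by simp
    note [simp] = commutator_closed'[OF A(1) x] commutator_closed'[OF B(1) x] commutator_closed'[OF C(1) x]
      Der_closed[OF pder_der[OF A(1)] i] Der_closed[OF pder_der[OF B(1)] i] Der_closed[OF pder_der[OF C(1)] i]
    show ?case using x
      by (intro M.secI) (simp_all add: Der_add[OF pder_der[OF A(1)] i] M.sec_simps algebra_simps)
  qed
qed

lemma Q_mult_smult:
  assumes "A \<in> carrier Q" "B \<in> carrier Q" and r: "r \<in> carrier R"
  shows "A \<otimes>\<^bsub>Q\<^esub> (r \<odot>\<^bsub>Q\<^esub> B) = r \<odot>\<^bsub>Q\<^esub> (A \<otimes>\<^bsub>Q\<^esub> B)"
proof -
  obtain K \<delta> \<mu> \<nu> where A: "pder K \<delta>" "A = cl K \<delta>" and B: "pder K \<mu>" "B = cl K \<mu>" and "pder K \<nu>" "B = cl K \<nu>"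
    using Q_common[OF assms(1,2,2)] .
  note i = pder_ideal[OF A(1)]
  show ?thesis
    unfolding A(2) B(2) cl_smult[OF B(1) r] cl_mult'[OF A(1) B(1)] cl_mult'[OF A(1) pder_smult[OF B(1) r]]
      cl_smult[OF pder_commutator'[OF A(1) B(1)] r]
  proof (subst cl_eq_iff[OF pder_commutator'[OF A(1) pder_smult[OF B(1) r]] pder_smult[OF pder_commutator'[OF A(1) B(1)] r]],
      rule ballI, goal_cases)
    case (1 x)
    then have x: "x \<in> lie_prod R L K K" by simp
    note [simp] = commutator_closed'[OF A(1) x] commutator_closed'[OF B(1) x]
      Der_closed[OF pder_der[OF A(1)] i] Der_closed[OF pder_der[OF B(1)] i]
    show ?case using x r by (simp add: Der_smult[OF pder_der[OF A(1)] i] smult_minus)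
  qed
qed

text \<open>Used to transfer linearity of the bracket from the second argument to the first.\<close>

lemma Q_mult_swap:
  assumes "A \<in> carrier Q" "B \<in> carrier Q"
  shows "B \<otimes>\<^bsub>Q\<^esub> A = (\<ominus> \<one>) \<odot>\<^bsub>Q\<^esub> (A \<otimes>\<^bsub>Q\<^esub> B)"
proof -
  obtain K \<delta> \<mu> \<nu> where A: "pder K \<delta>" "A = cl K \<delta>" and B: "pder K \<mu>" "B = cl K \<mu>" and "pder K \<nu>" "B = cl K \<nu>"
    using Q_common[OF assms(1,2,2)] .
  note i = pder_ideal[OF A(1)]
  have m: "\<ominus> \<one> \<in> carrier R" by simp
  show ?thesis
    unfolding A(2) B(2) cl_mult'[OF A(1) B(1)] cl_mult'[OF B(1) A(1)] cl_smult[OF pder_commutator'[OF A(1) B(1)] m]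
  proof (subst cl_eq_iff[OF pder_commutator'[OF B(1) A(1)] pder_smult[OF pder_commutator'[OF A(1) B(1)] m]],
      rule ballI, goal_cases)
    case (1 x)
    then have x: "x \<in> lie_prod R L K K" by simp
    note [simp] = commutator_closed'[OF A(1) x] commutator_closed'[OF B(1) x]
      Der_closed[OF pder_der[OF A(1)] i] Der_closed[OF pder_der[OF B(1)] i]
    show ?case using x by (intro M.secI) (simp_all add: smult_l_minus M.sec_simps)
  qed
qed

lemma Q_lie: "lie_algebra R Q"
proof (intro lie_algebra.intro lie_algebra_axioms.intro Q_module)
  fix A assume A: "A \<in> carrier Q"
  show "linear_map R Q Q (\<lambda>B. A \<otimes>\<^bsub>Q\<^esub> B)"
    by (rule linear_mapI) (simp_all add: A Q_mult_closed Q_mult_add Q_mult_smult)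
  show "linear_map R Q Q (\<lambda>B. B \<otimes>\<^bsub>Q\<^esub> A)"
    by (rule linear_mapI) (simp_all add: A Q_mult_closed Q_mult_add Q_mult_smult Q_mult_swap[OF A] Q.smult_r_distr
        Q.smult_assoc1[symmetric] R.m_comm)
  show "A \<otimes>\<^bsub>Q\<^esub> A = \<zero>\<^bsub>Q\<^esub>"
  proof -
    obtain K \<delta> where K: "pder K \<delta>" "A = cl K \<delta>" using A by (auto elim!: Q_carrierE)
    note i = pder_ideal[OF K(1)]
    show ?thesis unfolding K(2) cl_mult'[OF K(1,1)]
    proof (subst cl_eq_zero[OF pder_commutator'[OF K(1,1)]], rule ballI)
      fix x assume x: "x \<in> lie_prod R L K K"
      then show "(\<lambda>x\<in>lie_prod R L K K. \<delta> (\<delta> x) \<ominus>\<^bsub>L\<^esub> \<delta> (\<delta> x)) x = \<zero>\<^sub>L"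
        using commutator_closed'[OF K(1) x] Der_closed[OF pder_der[OF K(1)] i] by (simp add: a_minus_def M.r_neg)
    qed
  qed
next
  fix A B C assume ABC: "A \<in> carrier Q" "B \<in> carrier Q" "C \<in> carrier Q"
  obtain K \<delta> \<mu> \<nu> where A: "pder K \<delta>" "A = cl K \<delta>" and B: "pder K \<mu>" "B = cl K \<mu>" and C: "pder K \<nu>" "C = cl K \<nu>"
    using Q_common[OF ABC] .
  note i = pder_ideal[OF A(1)]
  \<comment> \<open>A double commutator is defined on the second iterated square: on K'' one
    application of a derivation lands in K', and there the inner commutator is defined.\<close>
  define K' where "K' = lie_prod R L K K"
  define K'' where "K'' = lie_prod R L K' K'"
  have eK': "essential_ideal R L K'" unfolding K'_def by (rule essential_lie_prod[OF pder_ess[OF A(1)]])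
  note i' = essentialD[OF eK']
  have sub: "K' \<subseteq> K" "K'' \<subseteq> K'" unfolding K'_def K''_def using lie_prod_subset[OF i i] lie_prod_subset[OF i' i'] K'_def by auto
  have KK: "K \<inter> K' = K'" using sub by blast
  have tri: "pder K'' (\<lambda>x\<in>K''. \<delta> ((\<lambda>x\<in>K'. \<mu> (\<nu> x) \<ominus>\<^bsub>L\<^esub> \<nu> (\<mu> x)) x) \<ominus>\<^bsub>L\<^esub> (\<lambda>x\<in>K'. \<mu> (\<nu> x) \<ominus>\<^bsub>L\<^esub> \<nu> (\<mu> x)) (\<delta> x))"
      "cl K \<delta> \<otimes>\<^bsub>Q\<^esub> (cl K \<mu> \<otimes>\<^bsub>Q\<^esub> cl K \<nu>) = cl K'' (\<lambda>x\<in>K''. \<delta> ((\<lambda>x\<in>K'. \<mu> (\<nu> x) \<ominus>\<^bsub>L\<^esub> \<nu> (\<mu> x)) x)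
        \<ominus>\<^bsub>L\<^esub> (\<lambda>x\<in>K'. \<mu> (\<nu> x) \<ominus>\<^bsub>L\<^esub> \<nu> (\<mu> x)) (\<delta> x))"
    if "pder K \<delta>" "pder K \<mu>" "pder K \<nu>" for \<delta> \<mu> \<nu>
    using pder_commutator[OF that(1) pder_commutator'[OF that(2,3)]] cl_mult[OF that(1) pder_commutator'[OF that(2,3)]]
      cl_mult'[OF that(2,3)] by (simp_all add: K'_def[symmetric] KK K''_def[symmetric])
  show "A \<otimes>\<^bsub>Q\<^esub> (B \<otimes>\<^bsub>Q\<^esub> C) \<oplus>\<^bsub>Q\<^esub> B \<otimes>\<^bsub>Q\<^esub> (C \<otimes>\<^bsub>Q\<^esub> A) \<oplus>\<^bsub>Q\<^esub> C \<otimes>\<^bsub>Q\<^esub> (A \<otimes>\<^bsub>Q\<^esub> B) = \<zero>\<^bsub>Q\<^esub>"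
    unfolding A(2) B(2) C(2) tri(2)[OF A(1) B(1) C(1)] tri(2)[OF B(1) C(1) A(1)] tri(2)[OF C(1) A(1) B(1)]
      cl_add'[OF tri(1)[OF A(1) B(1) C(1)] tri(1)[OF B(1) C(1) A(1)]]
      cl_add'[OF pder_add'[OF tri(1)[OF A(1) B(1) C(1)] tri(1)[OF B(1) C(1) A(1)]] tri(1)[OF C(1) A(1) B(1)]]
  proof (subst cl_eq_zero[OF pder_add'[OF pder_add'[OF tri(1)[OF A(1) B(1) C(1)] tri(1)[OF B(1) C(1) A(1)]]
        tri(1)[OF C(1) A(1) B(1)]]], rule ballI, goal_cases)
    case (1 x)
    have x: "x \<in> K'" using 1 sub by blast
    have c: "\<delta> y \<in> K \<and> y \<in> K" if "pder K \<delta>" "y \<in> K'" for \<delta> y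
      using commutator_closed'[OF that(1), of y] that(2) by (simp add: K'_def)
    have c': "\<delta> x \<in> K'" if "pder K \<delta>" for \<delta>
      by (rule Der_lie_prod[OF pder_der[OF that] i i' sub(1)]) (use 1 in \<open>simp add: K''_def\<close>)
    note D = pder_der[OF A(1)] pder_der[OF B(1)] pder_der[OF C(1)]
    have [simp]: "x \<in> K" "\<delta> x \<in> K'" "\<mu> x \<in> K'" "\<nu> x \<in> K'" "\<delta> x \<in> K" "\<mu> x \<in> K" "\<nu> x \<in> K"
      using c' A(1) B(1) C(1) sub x by auto
    have [simp]: "f y \<in> K" if "f = \<delta> \<or> f = \<mu> \<or> f = \<nu>" "y \<in> K'" for f y
      using that c A(1) B(1) C(1) by blast
    have [simp]: "y \<in> K \<Longrightarrow> \<delta> y \<in> carrier L" "y \<in> K \<Longrightarrow> \<mu> y \<in> carrier L" "y \<in> K \<Longrightarrow> \<nu> y \<in> carrier L" for y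
      using Der_closed[OF D(1) i] Der_closed[OF D(2) i] Der_closed[OF D(3) i] by auto
    show ?case using 1 x ideal_neg[OF i]
      by (intro M.secI) (simp_all add: a_minus_def Der_add[OF D(1) i] Der_add[OF D(2) i] Der_add[OF D(3) i]
          Der_neg[OF D(1) i] Der_neg[OF D(2) i] Der_neg[OF D(3) i] M.sec_simps algebra_simps)
  qed
qed

section \<open>The grading of the quotient algebra\<close>

abbreviation "Qg \<equiv> Qm_grade R L G"

lemma Qg_iff: "A \<in> Qg k \<longleftrightarrow> (\<exists>I \<delta>. A = cl I \<delta> \<and> pder I \<delta> \<and> graded_ideal R L G I \<and> homogeneous I \<delta> k)"
  unfolding Qm_grade_def pder_def homogeneous_def by blast

lemma QgI: "\<lbrakk>pder I \<delta>; graded_ideal R L G I; homogeneous I \<delta> k\<rbrakk> \<Longrightarrow> cl I \<delta> \<in> Qg k"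
  by (auto simp: Qg_iff)

lemma QgE:
  assumes "A \<in> Qg k"
  obtains I \<delta> where "A = cl I \<delta>" "pder I \<delta>" "graded_ideal R L G I" "homogeneous I \<delta> k"
  using assms by (auto simp: Qg_iff)

text \<open>The vanishing beyond degree 1 is where \<open>Der_degree_large\<close> enters: a
  representative of such degree is zero on the square of its domain, which is still
  essential.\<close>

lemma Q_subgraded: "subgraded_lie R Q Qg"
proof (intro subgraded_lie.intro subgraded_lie_axioms.intro Q_lie six_unit)
  have z: "\<zero>\<^bsub>Q\<^esub> \<in> Qg k" for k
    unfolding Q_zero
    by (rule QgI[OF pder_zero graded_carrier]) (auto simp: homogeneous_def G_zero G_closed)
  show "submodule (Qg k) R Q" for k
  proof (rule Q.submoduleI')
    show "Qg k \<subseteq> carrier Q" by (auto elim!: QgE intro: cl_closed)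
    show "\<zero>\<^bsub>Q\<^esub> \<in> Qg k" by (rule z)
    show "A \<oplus>\<^bsub>Q\<^esub> B \<in> Qg k" if AB: "A \<in> Qg k" "B \<in> Qg k" for A B
    proof -
      obtain I \<delta> where A: "A = cl I \<delta>" "pder I \<delta>" "graded_ideal R L G I" "homogeneous I \<delta> k" using QgE[OF AB(1)] .
      obtain J \<mu> where B: "B = cl J \<mu>" "pder J \<mu>" "graded_ideal R L G J" "homogeneous J \<mu> k" using QgE[OF AB(2)] .
      show ?thesis unfolding A(1) B(1) cl_add[OF A(2) B(2)]
        by (rule QgI[OF pder_add[OF A(2) B(2)] graded_Int[OF A(3) B(3)]])
          (use A(4) B(4) in \<open>auto simp: homogeneous_def intro: G_add\<close>)
    qed
    show "r \<odot>\<^bsub>Q\<^esub> A \<in> Qg k" if r: "r \<in> carrier R" and AA: "A \<in> Qg k" for r A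
    proof -
      obtain I \<delta> where A: "A = cl I \<delta>" "pder I \<delta>" "graded_ideal R L G I" "homogeneous I \<delta> k" using QgE[OF AA] .
      show ?thesis unfolding A(1) cl_smult[OF A(2) r]
        by (rule QgI[OF pder_smult[OF A(2) r] A(3)]) (use A(4) r in \<open>auto simp: homogeneous_def intro: G_smult\<close>)
    qed
  qed
  show "Qg k = {\<zero>\<^bsub>Q\<^esub>}" if k: "\<bar>k\<bar> > 1" for k
  proof -
    have "A = \<zero>\<^bsub>Q\<^esub>" if "A \<in> Qg k" for A
    proof -
      obtain I \<delta> where A: "A = cl I \<delta>" "pder I \<delta>" "graded_ideal R L G I" "homogeneous I \<delta> k" using QgE[OF \<open>A \<in> Qg k\<close>] .
      note i = pder_ideal[OF A(2)]
      show ?thesis unfolding A(1)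
        by (rule cl_eq_zeroI[OF A(2) essential_lie_prod[OF pder_ess[OF A(2)]]])
          (use lie_prod_subset[OF i i] Der_degree_large[OF pder_der[OF A(2)] A(3) k A(4)] in auto)
    qed
    then show ?thesis using z by blast
  qed
  show "A \<otimes>\<^bsub>Q\<^esub> B \<in> Qg (i + j)" if AB: "A \<in> Qg i" "B \<in> Qg j" for A B i j
  proof -
    obtain I \<delta> where A: "A = cl I \<delta>" "pder I \<delta>" "graded_ideal R L G I" "homogeneous I \<delta> i" using QgE[OF AB(1)] .
    obtain J \<mu> where B: "B = cl J \<mu>" "pder J \<mu>" "graded_ideal R L G J" "homogeneous J \<mu> j" using QgE[OF AB(2)] .
    show ?thesis unfolding A(1) B(1) cl_mult[OF A(2) B(2)]
    proof (rule QgI[OF pder_commutator[OF A(2) B(2)] graded_lie_prod[OF graded_Int[OF A(3) B(3)]]])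
      show "homogeneous (lie_prod R L (I \<inter> J) (I \<inter> J))
          (\<lambda>x\<in>lie_prod R L (I \<inter> J) (I \<inter> J). \<delta> (\<mu> x) \<ominus>\<^bsub>L\<^esub> \<mu> (\<delta> x)) (i + j)"
        unfolding homogeneous_def
      proof (intro allI ballI)
        fix l x assume x: "x \<in> lie_prod R L (I \<inter> J) (I \<inter> J) \<inter> G l"
        note c = commutator_closed[OF A(2) B(2), of x]
        have "\<delta> (\<mu> x) \<in> G (l + (i + j))"
          using homogeneousD[OF A(4) _ homogeneousD[OF B(4) _ _ refl]] c x by auto
        moreover have "\<mu> (\<delta> x) \<in> G (l + (i + j))"
          using homogeneousD[OF B(4) _ homogeneousD[OF A(4) _ _ refl]] c x by auto
        ultimately show "(\<lambda>x\<in>lie_prod R L (I \<inter> J) (I \<inter> J). \<delta> (\<mu> x) \<ominus>\<^bsub>L\<^esub> \<mu> (\<delta> x)) x \<in> G (l + (i + j))"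
          using x by (simp add: a_minus_def G_add G_neg)
      qed
    qed
  qed
qed

sublocale Q: subgraded_lie R Q Qg by (rule Q_subgraded)

section \<open>The embedding of the algebra into its quotient algebra\<close>

abbreviation "emb \<equiv> Qm_emb R L"

lemma pder_ad: "x \<in> carrier L \<Longrightarrow> pder (carrier L) (\<lambda>y\<in>carrier L. x \<bullet> y)"
  unfolding pder_def
  by (intro conjI essential_carrier DerI carrier_ideal) (simp_all add: br_lin jacobi_der[of x])

lemma emb_cl: "emb x = cl (carrier L) (\<lambda>y\<in>carrier L. x \<bullet> y)"
  by (simp add: Qm_emb_def)

lemma emb_closed: "x \<in> carrier L \<Longrightarrow> emb x \<in> carrier Q"
  unfolding emb_cl by (rule cl_closed[OF pder_ad])

lemma emb_linear: "linear_map R L Q emb"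
proof (rule linear_mapI)
  fix x y assume xy: "x \<in> carrier L" "y \<in> carrier L"
  then have "x \<boxplus> y \<in> carrier L" by simp
  note p = pder_ad[OF xy(1)] pder_ad[OF xy(2)] pder_ad[OF this]
  show "emb (x \<boxplus> y) = emb x \<oplus>\<^bsub>Q\<^esub> emb y"
    unfolding emb_cl cl_add'[OF p(1,2)]
    by (subst cl_eq_iff[OF p(3) pder_add'[OF p(1,2)]]) (use xy in \<open>auto simp: br_lin\<close>)
next
  fix a x assume ax: "a \<in> carrier R" "x \<in> carrier L"
  then have "a \<cdot> x \<in> carrier L" by simp
  note p = pder_ad[OF ax(2)] pder_ad[OF this]
  show "emb (a \<cdot> x) = a \<odot>\<^bsub>Q\<^esub> emb x"
    unfolding emb_cl cl_smult[OF p(1) ax(1)]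
    by (subst cl_eq_iff[OF p(2) pder_smult[OF p(1) ax(1)]]) (use ax in \<open>auto simp: br_lin\<close>)
qed (rule emb_closed)

text \<open>The commutator of \<delta> with ad x is ad(\<delta>x) by the product rule. Through this,
  brackets in \<open>Qm\<close> with elements of the domain become evaluations in L.\<close>

lemma emb_act:
  assumes 1: "pder I \<delta>" and x: "x \<in> I"
  shows "cl I \<delta> \<otimes>\<^bsub>Q\<^esub> emb x = emb (\<delta> x)"
proof -
  note i = pder_ideal[OF 1] note d = pder_der[OF 1]
  have xc: "x \<in> carrier L" "\<delta> x \<in> carrier L" using ideal_closed[OF i x] Der_closed[OF d i x] .
  note p = pder_ad[OF xc(1)] pder_ad[OF xc(2)]
  have II: "I \<inter> carrier L = I" using ideal_closed[OF i] by auto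
  have e: "cl I \<delta> \<otimes>\<^bsub>Q\<^esub> emb x = cl (lie_prod R L I I)
      (\<lambda>y\<in>lie_prod R L I I. \<delta> ((\<lambda>y\<in>carrier L. x \<bullet> y) y) \<ominus>\<^bsub>L\<^esub> (\<lambda>y\<in>carrier L. x \<bullet> y) (\<delta> y))"
    and q: "pder (lie_prod R L I I)
      (\<lambda>y\<in>lie_prod R L I I. \<delta> ((\<lambda>y\<in>carrier L. x \<bullet> y) y) \<ominus>\<^bsub>L\<^esub> (\<lambda>y\<in>carrier L. x \<bullet> y) (\<delta> y))"
    unfolding emb_cl using cl_mult[OF 1 p(1)] pder_commutator[OF 1 p(1)] by (simp_all only: II)
  show ?thesis unfolding e unfolding emb_cl
  proof (subst cl_eq_iff[OF q p(2)], rule ballI)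
    fix y assume "y \<in> lie_prod R L I I \<inter> carrier L"
    then have y: "y \<in> lie_prod R L I I" by simp
    note c = commutator_closed'[OF 1 y]
    note [simp] = c xc
    show "(\<lambda>y\<in>lie_prod R L I I. \<delta> ((\<lambda>y\<in>carrier L. x \<bullet> y) y) \<ominus>\<^bsub>L\<^esub> (\<lambda>y\<in>carrier L. x \<bullet> y) (\<delta> y)) y =
        (\<lambda>y\<in>carrier L. \<delta> x \<bullet> y) y"
      using y by (intro M.secI) (simp_all add: Der_br[OF d i x] M.sec_simps)
  qed
qed

lemma emb_bracket: "\<lbrakk>x \<in> carrier L; y \<in> carrier L\<rbrakk> \<Longrightarrow> emb (x \<bullet> y) = emb x \<otimes>\<^bsub>Q\<^esub> emb y"
  using emb_act[OF pder_ad, of x y] by (simp add: emb_cl[of x])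

lemma emb_eq_zero: "\<lbrakk>x \<in> carrier L; emb x = \<zero>\<^bsub>Q\<^esub>\<rbrakk> \<Longrightarrow> x = \<zero>\<^sub>L"
  using cl_eq_zero[OF pder_ad, of x] essential_centralizer[OF essential_carrier, of x] by (simp add: emb_cl)

lemma emb_grade: "x \<in> G k \<Longrightarrow> emb x \<in> Qg k"
  unfolding emb_cl
  by (rule QgI[OF pder_ad graded_carrier]) (auto simp: homogeneous_def G_closed intro: brG)

lemma emb_inj: "inj_on emb (carrier L)"
proof (rule inj_onI)
  fix x y assume xy: "x \<in> carrier L" "y \<in> carrier L" "emb x = emb y"
  have "emb (x \<boxplus> \<boxminus> y) = \<zero>\<^bsub>Q\<^esub>"
    using xy linear_map_add[OF emb_linear, of x "\<boxminus> y"] linear_map_neg[OF emb_linear module_axioms Q_module, of y]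
      emb_closed[of y] by (simp add: Q.M.r_neg)
  then have "x \<boxplus> \<boxminus> y = \<zero>\<^sub>L" using xy by (intro emb_eq_zero) simp_all
  from arg_cong[OF this, of "sec L"] show "x = y" using xy by (intro M.secI) (simp_all add: M.sec_simps)
qed

text \<open>The ideal I need not be the domain of a representative. On the intersection with such a
  domain, \<open>emb_act\<close> and injectivity of \<open>emb\<close> turn the hypothesis into that
  of \<open>Der_vanish\<close>.\<close>

lemma Q_vanish:
  assumes A: "A \<in> Qg s" and s: "s = 1 \<or> s = -1" and I: "essential_ideal R L I" "graded_ideal R L G I"
    and h: "\<And>x. \<lbrakk>x \<in> I; x \<in> G (- s)\<rbrakk> \<Longrightarrow> A \<otimes>\<^bsub>Q\<^esub> emb x = \<zero>\<^bsub>Q\<^esub>"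
  shows "A = \<zero>\<^bsub>Q\<^esub>"
proof -
  obtain J \<delta> where J: "A = cl J \<delta>" "pder J \<delta>" "graded_ideal R L G J" "homogeneous J \<delta> s" using QgE[OF A] .
  note j = pder_ideal[OF J(2)]
  let ?K = "I \<inter> J"
  have K: "essential_ideal R L ?K" "graded_ideal R L G ?K"
    using essential_Int[OF I(1) pder_ess[OF J(2)]] graded_Int[OF I(2) J(3)] .
  note k = essentialD[OF K(1)]
  have p: "pder ?K (restrict \<delta> ?K)" by (rule pder_restrict[OF J(2) K(1)]) simp
  have van: "\<delta> x = \<zero>\<^sub>L" if "x \<in> ?K" "x \<in> G (- s)" for x
    using h[of x] that emb_act[OF J(2), of x] Der_closed[OF pder_der[OF J(2)] j, of x]
    by (intro emb_eq_zero) (auto simp: J(1))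
  have "restrict \<delta> ?K x = \<zero>\<^sub>L" if "x \<in> lie_prod R L ?K ?K" for x
  proof (rule Der_vanish[OF pder_der[OF p] K(2) s _ _ that])
    show "homogeneous ?K (restrict \<delta> ?K) s" using J(4) by (auto simp: homogeneous_def)
  qed (use van in auto)
  then have "\<delta> x = \<zero>\<^sub>L" if "x \<in> lie_prod R L ?K ?K" for x
    using that lie_prod_subset[OF k k] by (metis Int_iff restrict_apply' subsetD)
  then show ?thesis unfolding J(1)
    by (intro cl_eq_zeroI[OF J(2) essential_lie_prod[OF K(1)]]) (use lie_prod_subset[OF k k] in auto)
qed

text \<open>Testing against the elements of L inside \<open>Qm\<close> shows that a representative
  kills the parts of its domain of degree 1 and -1, so \<open>Der_vanish_0\<close> applies. This is
  the faithfulness that makes \<open>Qm\<close> recoverable from its Jordan pair.\<close>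

lemma Q_faithful:
  assumes A: "A \<in> Qg 0" and h: "\<And>s X. \<lbrakk>s = 1 \<or> s = -1; X \<in> Qg s\<rbrakk> \<Longrightarrow> A \<otimes>\<^bsub>Q\<^esub> X = \<zero>\<^bsub>Q\<^esub>"
  shows "A = \<zero>\<^bsub>Q\<^esub>"
proof -
  obtain I \<delta> where I: "A = cl I \<delta>" "pder I \<delta>" "graded_ideal R L G I" "homogeneous I \<delta> 0" using QgE[OF A] .
  note i = pder_ideal[OF I(2)]
  have van: "\<delta> x = \<zero>\<^sub>L" if "s = 1 \<or> s = -1" "x \<in> I" "x \<in> G s" for s x
    using h[OF that(1) emb_grade[OF that(3)]] emb_act[OF I(2) that(2)] Der_closed[OF pder_der[OF I(2)] i that(2)]
    by (intro emb_eq_zero) (auto simp: I(1))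
  show ?thesis unfolding I(1)
    by (rule cl_eq_zeroI[OF I(2) essential_lie_prod[OF pder_ess[OF I(2)]]])
      (use lie_prod_subset[OF i i] Der_vanish_0[OF pder_der[OF I(2)] I(3,4) van] in auto)
qed

end

section \<open>Elements of an extension as partial derivations\<close>

text \<open>Used for two extensions: T inside TKK(S), for the universal property, and a graded
  algebra inside the quotient algebra of an isomorphic copy of it, for the transport of quotient
  algebras along isomorphisms.\<close>

locale lie_extension = nondeg_graded R L G + N: lie_algebra R N
  for R :: "('a, 'r) ring_scheme" (structure) and L :: "('a, 'l) module" (structure)
    and G :: "int \<Rightarrow> 'l set" and N :: "('a, 'n) module" +
  fixes \<psi> :: "'l \<Rightarrow> 'n"
  assumes psi_linear: "linear_map R L N \<psi>" and psi_inj: "inj_on \<psi> (carrier L)"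
    and psi_bracket: "\<lbrakk>x \<in> carrier L; y \<in> carrier L\<rbrakk> \<Longrightarrow> \<psi> (x \<otimes>\<^bsub>L\<^esub> y) = \<psi> x \<otimes>\<^bsub>N\<^esub> \<psi> y"
begin

lemma psi_closed [simp, intro]: "x \<in> carrier L \<Longrightarrow> \<psi> x \<in> carrier N"
  by (rule linear_map_closed[OF psi_linear])

lemma psi_add: "\<lbrakk>x \<in> carrier L; y \<in> carrier L\<rbrakk> \<Longrightarrow> \<psi> (x \<boxplus> y) = \<psi> x \<oplus>\<^bsub>N\<^esub> \<psi> y"
  by (rule linear_map_add[OF psi_linear])

lemma psi_smult: "\<lbrakk>a \<in> carrier R; x \<in> carrier L\<rbrakk> \<Longrightarrow> \<psi> (a \<cdot> x) = a \<odot>\<^bsub>N\<^esub> \<psi> x"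
  by (rule linear_map_smult[OF psi_linear])

lemma psi_zero: "\<psi> \<zero>\<^sub>L = \<zero>\<^bsub>N\<^esub>"
  by (rule linear_map_zero[OF psi_linear module_axioms N.module_axioms])

lemma psi_neg: "x \<in> carrier L \<Longrightarrow> \<psi> (\<boxminus> x) = \<ominus>\<^bsub>N\<^esub> \<psi> x"
  by (rule linear_map_neg[OF psi_linear module_axioms N.module_axioms])

lemma psi_eq: "\<lbrakk>\<psi> x = \<psi> y; x \<in> carrier L; y \<in> carrier L\<rbrakk> \<Longrightarrow> x = y"
  using psi_inj by (auto dest: inj_onD)

definition absorbs :: "'n \<Rightarrow> 'l set \<Rightarrow> bool" where
  "absorbs q K \<longleftrightarrow> q \<in> carrier N \<and> essential_ideal R L K \<and> (\<forall>x\<in>K. q \<otimes>\<^bsub>N\<^esub> \<psi> x \<in> \<psi> ` carrier L)"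

definition act :: "'n \<Rightarrow> 'l \<Rightarrow> 'l" where
  "act q x = the_inv_into (carrier L) \<psi> (q \<otimes>\<^bsub>N\<^esub> \<psi> x)"

text \<open>The class of ad q restricted to an ideal that q maps into L. The choice of the ideal is
  immaterial, since two such restrictions agree on the intersection (\<open>hm_eq\<close>).\<close>

definition hm :: "'n \<Rightarrow> ('l set \<times> ('l \<Rightarrow> 'l)) set" where
  "hm q = (let K = SOME K. absorbs q K in cl K (restrict (act q) K))"

lemma absorbsD:
  assumes "absorbs q K"
  shows absorbs_closed: "q \<in> carrier N" and absorbs_ess: "essential_ideal R L K"
    and absorbs_ideal: "lie_ideal R L K"
    and act_closed: "x \<in> K \<Longrightarrow> act q x \<in> carrier L"
    and psi_act: "x \<in> K \<Longrightarrow> \<psi> (act q x) = q \<otimes>\<^bsub>N\<^esub> \<psi> x"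
  using assms the_inv_into_into[OF psi_inj _ subset_refl] f_the_inv_into_f[OF psi_inj] essentialD
  by (auto simp: absorbs_def act_def)

lemma absorbsI:
  assumes "q \<in> carrier N" "essential_ideal R L K" "\<And>x. x \<in> K \<Longrightarrow> \<exists>y\<in>carrier L. q \<otimes>\<^bsub>N\<^esub> \<psi> x = \<psi> y"
  shows "absorbs q K"
  using assms by (auto simp: absorbs_def image_iff)

text \<open>The operator ad q is a derivation of N, and the identities for \<open>act q\<close> are
  pulled back along the injective \<open>\<psi>\<close>.\<close>

lemma pder_act:
  assumes q: "absorbs q K"
  shows "pder K (restrict (act q) K)"
proof -
  note k = absorbs_ideal[OF q] note [simp] = absorbs_closed[OF q]
  have [simp]: "x \<in> carrier L" if "x \<in> K" for x using ideal_closed[OF k that] .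
  have "(\<lambda>x\<in>K. act q x) \<in> Der R L K"
  proof (rule DerI)
    fix x y assume xy: "x \<in> K" "y \<in> K"
    note [simp] = xy act_closed[OF q xy(1)] act_closed[OF q xy(2)]
    show "act q (x \<boxplus> y) = act q x \<boxplus> act q y"
      by (rule psi_eq) (simp_all add: psi_add psi_act[OF q] act_closed[OF q] ideal_add[OF k] N.br_add_r)
    have m: "x \<bullet> y \<in> K" by (rule ideal_left[OF k]) simp_all
    show "act q (x \<bullet> y) = act q x \<bullet> y \<boxplus> x \<bullet> act q y"
      by (rule psi_eq) (simp_all add: m psi_add psi_act[OF q] act_closed[OF q] psi_bracket N.jacobi_der[of q])
  next
    fix a x assume "a \<in> carrier R" "x \<in> K"
    then show "act q (a \<cdot> x) = a \<cdot> act q x"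
      by (intro psi_eq) (simp_all add: psi_smult psi_act[OF q] act_closed[OF q] ideal_smult[OF k] N.br_smult_r)
  qed (use act_closed[OF q] k in auto)
  then show ?thesis using absorbs_ess[OF q] by (simp add: pder_def)
qed

lemma hm_eq: "absorbs q K \<Longrightarrow> hm q = cl K (restrict (act q) K)"
proof -
  assume q: "absorbs q K"
  define J where "J = (SOME K. absorbs q K)"
  have J: "absorbs q J" unfolding J_def using q by (rule someI)
  have "hm q = cl J (restrict (act q) J)" by (simp add: hm_def J_def[symmetric])
  also have "\<dots> = cl K (restrict (act q) K)"
    by (subst cl_eq_iff[OF pder_act[OF J] pder_act[OF q]]) auto
  finally show ?thesis .
qed

lemma hm_closed: "absorbs q K \<Longrightarrow> hm q \<in> carrier Q"
  by (simp add: hm_eq cl_closed pder_act)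

lemma hm_eqI:
  assumes q: "absorbs q K" and J: "pder J \<mu>" and E: "essential_ideal R L E" "E \<subseteq> K \<inter> J"
    and h: "\<And>x. x \<in> E \<Longrightarrow> \<psi> (\<mu> x) = q \<otimes>\<^bsub>N\<^esub> \<psi> x"
  shows "hm q = cl J \<mu>"
  unfolding hm_eq[OF q]
proof (rule cl_eqI[OF pder_act[OF q] J E])
  fix x assume x: "x \<in> E"
  then have "x \<in> K" "x \<in> J" using E by auto
  then show "restrict (act q) K x = \<mu> x"
    using h[OF x] psi_act[OF q] act_closed[OF q] Der_closed[OF pder_der[OF J] pder_ideal[OF J]]
    by (auto intro: psi_eq)
qed

lemma absorbs_add:
  assumes q: "absorbs q K" and p: "absorbs p J"
  shows "absorbs (q \<oplus>\<^bsub>N\<^esub> p) (K \<inter> J)" "hm (q \<oplus>\<^bsub>N\<^esub> p) = hm q \<oplus>\<^bsub>Q\<^esub> hm p"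
proof -
  note [simp] = absorbs_closed[OF q] absorbs_closed[OF p]
  note e = essential_Int[OF absorbs_ess[OF q] absorbs_ess[OF p]]
  note cl = ideal_closed[OF essentialD[OF e]]
  have *: "\<psi> (act q x \<boxplus> act p x) = (q \<oplus>\<^bsub>N\<^esub> p) \<otimes>\<^bsub>N\<^esub> \<psi> x" if "x \<in> K \<inter> J" for x
    using that cl[OF that] act_closed[OF q] act_closed[OF p] psi_act[OF q] psi_act[OF p]
    by (simp add: psi_add N.br_add_l)
  show a: "absorbs (q \<oplus>\<^bsub>N\<^esub> p) (K \<inter> J)"
  proof (rule absorbsI[OF _ e])
    fix x assume x: "x \<in> K \<inter> J"
    show "\<exists>y\<in>carrier L. (q \<oplus>\<^bsub>N\<^esub> p) \<otimes>\<^bsub>N\<^esub> \<psi> x = \<psi> y"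
      using *[OF x, symmetric] act_closed[OF q] act_closed[OF p] x by (intro bexI[of _ "act q x \<boxplus> act p x"]) auto
  qed simp
  show "hm (q \<oplus>\<^bsub>N\<^esub> p) = hm q \<oplus>\<^bsub>Q\<^esub> hm p"
    unfolding hm_eq[OF q] hm_eq[OF p] cl_add[OF pder_act[OF q] pder_act[OF p]]
    by (rule hm_eqI[OF a pder_add[OF pder_act[OF q] pder_act[OF p]] e]) (use * in auto)
qed

lemma absorbs_smult:
  assumes q: "absorbs q K" and r: "r \<in> carrier R"
  shows "absorbs (r \<odot>\<^bsub>N\<^esub> q) K" "hm (r \<odot>\<^bsub>N\<^esub> q) = r \<odot>\<^bsub>Q\<^esub> hm q"
proof -
  note [simp] = absorbs_closed[OF q]
  note e = absorbs_ess[OF q] note cl = ideal_closed[OF essentialD[OF e]]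
  have *: "\<psi> (r \<cdot> act q x) = (r \<odot>\<^bsub>N\<^esub> q) \<otimes>\<^bsub>N\<^esub> \<psi> x" if "x \<in> K" for x
    using that cl[OF that] act_closed[OF q that] psi_act[OF q that] r by (simp add: psi_smult N.br_smult_l)
  show a: "absorbs (r \<odot>\<^bsub>N\<^esub> q) K"
  proof (rule absorbsI[OF _ e])
    fix x assume x: "x \<in> K"
    show "\<exists>y\<in>carrier L. (r \<odot>\<^bsub>N\<^esub> q) \<otimes>\<^bsub>N\<^esub> \<psi> x = \<psi> y"
      using *[OF x, symmetric] act_closed[OF q x] r by (intro bexI[of _ "r \<cdot> act q x"]) auto
  qed (use r in simp)
  show "hm (r \<odot>\<^bsub>N\<^esub> q) = r \<odot>\<^bsub>Q\<^esub> hm q"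
    unfolding hm_eq[OF q] cl_smult[OF pder_act[OF q] r]
    by (rule hm_eqI[OF a pder_smult[OF pder_act[OF q] r] e]) (use * in auto)
qed

text \<open>The square is needed as a domain because q must still act on the values of p, and p on
  those of q.\<close>

lemma absorbs_bracket:
  assumes q: "absorbs q K" and p: "absorbs p J"
  shows "absorbs (q \<otimes>\<^bsub>N\<^esub> p) (lie_prod R L (K \<inter> J) (K \<inter> J))" "hm (q \<otimes>\<^bsub>N\<^esub> p) = hm q \<otimes>\<^bsub>Q\<^esub> hm p"
proof -
  note [simp] = absorbs_closed[OF q] absorbs_closed[OF p]
  let ?E = "lie_prod R L (K \<inter> J) (K \<inter> J)"
  note e = essential_lie_prod[OF essential_Int[OF absorbs_ess[OF q] absorbs_ess[OF p]]]
  note pq = pder_act[OF q] and pp = pder_act[OF p]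
  have *: "act q (act p x) \<ominus>\<^bsub>L\<^esub> act p (act q x) \<in> carrier L"
     "\<psi> (act q (act p x) \<ominus>\<^bsub>L\<^esub> act p (act q x)) = (q \<otimes>\<^bsub>N\<^esub> p) \<otimes>\<^bsub>N\<^esub> \<psi> x"
     "restrict (act q) K (restrict (act p) J x) \<ominus>\<^bsub>L\<^esub> restrict (act p) J (restrict (act q) K x)
        = act q (act p x) \<ominus>\<^bsub>L\<^esub> act p (act q x)" if x: "x \<in> ?E" for x
  proof -
    note c = commutator_closed[OF pq pp x]
    have m: "x \<in> K" "x \<in> J" "x \<in> carrier L" "act q x \<in> J" "act p x \<in> K" using c by simp_all
    show "act q (act p x) \<ominus>\<^bsub>L\<^esub> act p (act q x) \<in> carrier L"
      using m act_closed[OF q] act_closed[OF p] by simp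
    show "\<psi> (act q (act p x) \<ominus>\<^bsub>L\<^esub> act p (act q x)) = (q \<otimes>\<^bsub>N\<^esub> p) \<otimes>\<^bsub>N\<^esub> \<psi> x"
      using m act_closed[OF q] act_closed[OF p]
      by (simp add: psi_add psi_neg psi_act[OF q] psi_act[OF p] N.jacobi_left[of q p] a_minus_def)
    show "restrict (act q) K (restrict (act p) J x) \<ominus>\<^bsub>L\<^esub> restrict (act p) J (restrict (act q) K x)
        = act q (act p x) \<ominus>\<^bsub>L\<^esub> act p (act q x)" using m by simp
  qed
  show a: "absorbs (q \<otimes>\<^bsub>N\<^esub> p) ?E"
  proof (rule absorbsI[OF _ e])
    fix x assume x: "x \<in> ?E"
    show "\<exists>y\<in>carrier L. (q \<otimes>\<^bsub>N\<^esub> p) \<otimes>\<^bsub>N\<^esub> \<psi> x = \<psi> y"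
      using *(2)[OF x, symmetric] *(1)[OF x] by (rule bexI)
  qed simp
  show "hm (q \<otimes>\<^bsub>N\<^esub> p) = hm q \<otimes>\<^bsub>Q\<^esub> hm p"
    unfolding hm_eq[OF q] hm_eq[OF p] cl_mult[OF pq pp]
  proof (rule hm_eqI[OF a pder_commutator[OF pq pp] e])
    fix x assume x: "x \<in> ?E"
    show "\<psi> ((\<lambda>x\<in>?E. restrict (act q) K (restrict (act p) J x) \<ominus>\<^bsub>L\<^esub> restrict (act p) J (restrict (act q) K x)) x)
        = (q \<otimes>\<^bsub>N\<^esub> p) \<otimes>\<^bsub>N\<^esub> \<psi> x"
      unfolding restrict_apply'[OF x] *(3)[OF x] by (rule *(2)[OF x])
  qed simp
qed

lemma absorbs_psi:
  assumes x: "x \<in> carrier L"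
  shows "absorbs (\<psi> x) (carrier L)" "hm (\<psi> x) = emb x"
proof -
  show a: "absorbs (\<psi> x) (carrier L)"
  proof (rule absorbsI[OF _ essential_carrier])
    fix y assume y: "y \<in> carrier L"
    show "\<exists>z\<in>carrier L. \<psi> x \<otimes>\<^bsub>N\<^esub> \<psi> y = \<psi> z"
      using x y by (intro bexI[of _ "x \<bullet> y"]) (simp_all add: psi_bracket)
  qed (use x in simp)
  show "hm (\<psi> x) = emb x" unfolding emb_cl
    by (rule hm_eqI[OF a pder_ad[OF x] essential_carrier]) (simp_all add: x psi_bracket)
qed

lemma hm_zero_iff:
  assumes q: "absorbs q K"
  shows "hm q = \<zero>\<^bsub>Q\<^esub> \<longleftrightarrow> (\<forall>x\<in>K. q \<otimes>\<^bsub>N\<^esub> \<psi> x = \<zero>\<^bsub>N\<^esub>)"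
proof -
  have "act q x = \<zero>\<^sub>L \<longleftrightarrow> q \<otimes>\<^bsub>N\<^esub> \<psi> x = \<zero>\<^bsub>N\<^esub>" if "x \<in> K" for x
    using psi_act[OF q that] act_closed[OF q that] psi_zero psi_eq[of "act q x" "\<zero>\<^sub>L"] by auto
  then show ?thesis by (simp add: hm_eq[OF q] cl_eq_zero[OF pder_act[OF q]])
qed

lemma hm_grade:
  assumes q: "absorbs q K" and K: "graded_ideal R L G K"
    and h: "\<And>j x. \<lbrakk>x \<in> K; x \<in> G j\<rbrakk> \<Longrightarrow> \<exists>y\<in>G (j + k). q \<otimes>\<^bsub>N\<^esub> \<psi> x = \<psi> y"
  shows "hm q \<in> Qg k"
  unfolding hm_eq[OF q]
proof (rule QgI[OF pder_act[OF q] K])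
  show "homogeneous K (restrict (act q) K) k"
    unfolding homogeneous_def
  proof (intro allI ballI)
    fix j x assume x: "x \<in> K \<inter> G j"
    then obtain y where y: "y \<in> G (j + k)" "q \<otimes>\<^bsub>N\<^esub> \<psi> x = \<psi> y" using h by blast
    then have "act q x = y" using x psi_act[OF q, of x] act_closed[OF q, of x] G_closed[OF y(1)] by (intro psi_eq) auto
    then show "restrict (act q) K x \<in> G (j + k)" using x y by simp
  qed
qed

end

section \<open>Lie algebras determined by their Jordan pair\<close>

text \<open>Generation of degree 0 and its faithful action are what identifies L with the
  TKK-algebra of its pair: the first makes degree 0 map onto the inner derivations, the second makes
  this map injective.\<close>

locale reduced_graded = three_graded R L G
  for R :: "('a, 'r) ring_scheme" (structure) and L :: "('a, 'l) module" (structure)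
    and G :: "int \<Rightarrow> 'l set" +
  assumes six_unit: "add_pow R (6::nat) \<one> \<in> Units R"
    and generated: "lie_prod R L (G 1) (G (-1)) = G 0"
    and faithful: "\<lbrakk>d \<in> G 0; \<And>s x. \<lbrakk>s = 1 \<or> s = -1; x \<in> G s\<rbrakk> \<Longrightarrow> d \<otimes>\<^bsub>L\<^esub> x = \<zero>\<^bsub>L\<^esub>\<rbrakk> \<Longrightarrow> d = \<zero>\<^bsub>L\<^esub>"

sublocale reduced_graded \<subseteq> subgraded_lie R L G
  by (intro subgraded_lie.intro subgraded_lie_axioms.intro lie_algebra_axioms)
    (fact six_unit grade_submodule grade_trivial grade_bracket)+

sublocale reduced_graded \<subseteq> J: jordan_pair R AP
  by (rule AP_jordan)

context reduced_graded
begin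

abbreviation "EA \<equiv> End_pair R AP"
abbreviation "TA \<equiv> TKK R AP"

definition AD :: "'l \<Rightarrow> sign \<Rightarrow> 'l \<Rightarrow> 'l" where
  "AD d = (\<lambda>\<sigma>. \<lambda>z\<in>G (deg \<sigma>). d \<bullet> z)"

lemma AP_parts: "pcarrier AP \<sigma> = G (deg \<sigma>)" "x \<oplus>\<^bsub>part AP \<sigma>\<^esub> y = x \<boxplus> y" "a \<odot>\<^bsub>part AP \<sigma>\<^esub> x = a \<cdot> x"
  "pzero AP \<sigma> = \<zero>\<^sub>L"
  by (simp_all add: part_AP)

lemma AP_neg: "x \<in> G (deg \<sigma>) \<Longrightarrow> \<ominus>\<^bsub>part AP \<sigma>\<^esub> x = \<boxminus> x"
  by (rule J.P.minus_equality) (simp_all add: AP_parts G_closed G_neg M.l_neg)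

lemma AP_minus: "\<lbrakk>x \<in> G (deg \<sigma>); y \<in> G (deg \<sigma>)\<rbrakk> \<Longrightarrow> x \<ominus>\<^bsub>part AP \<sigma>\<^esub> y = x \<boxplus> \<boxminus> y"
  by (simp add: a_minus_def AP_neg AP_parts)

lemma AD_apply: "z \<in> G (deg \<sigma>) \<Longrightarrow> AD d \<sigma> z = d \<bullet> z"
  by (simp add: AD_def)

lemma AD_closed: assumes d: "d \<in> G 0" shows "AD d \<in> carrier EA"
proof -
  have "linear_map R (part AP \<sigma>) (part AP \<sigma>) (\<lambda>z. d \<bullet> z)" for \<sigma>
    by (rule linear_mapI) (use d brG[OF d] in \<open>simp_all add: AP_parts G_closed br_lin\<close>)
  from J.E_closedI[of "\<lambda>\<sigma> z. d \<bullet> z", OF this] show ?thesis by (simp add: AD_def AP_parts)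
qed

lemma AD_eqI:
  assumes "d \<in> G 0" "\<gamma> \<in> carrier EA" "\<And>\<sigma> z. z \<in> G (deg \<sigma>) \<Longrightarrow> \<gamma> \<sigma> z = d \<bullet> z"
  shows "AD d = \<gamma>"
  by (rule J.E_ext[OF AD_closed[OF assms(1)] assms(2)]) (simp add: assms(3) AP_parts AD_apply)

lemma AD_ops:
  assumes d: "d \<in> G 0" and e: "e \<in> G 0"
  shows "AD (d \<boxplus> e) = AD d \<oplus>\<^bsub>EA\<^esub> AD e" "a \<in> carrier R \<Longrightarrow> AD (a \<cdot> d) = a \<odot>\<^bsub>EA\<^esub> AD d"
    "AD (d \<bullet> e) = AD d \<otimes>\<^bsub>EA\<^esub> AD e" "AD \<zero>\<^sub>L = \<zero>\<^bsub>EA\<^esub>"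
proof -
  note [simp] = AD_closed[OF d] AD_closed[OF e] G_closed[OF d] G_closed[OF e]
  have m: "u \<bullet> z \<in> G (deg \<sigma>)" if "u \<in> G 0" "z \<in> G (deg \<sigma>)" for u z \<sigma> using brG[OF that] by simp
  show "AD (d \<boxplus> e) = AD d \<oplus>\<^bsub>EA\<^esub> AD e"
    by (rule AD_eqI[OF G_add[OF d e]]) (simp_all add: J.E_ops_closed J.E_apply AP_parts AD_apply G_closed br_lin)
  show "AD (a \<cdot> d) = a \<odot>\<^bsub>EA\<^esub> AD d" if "a \<in> carrier R"
    by (rule AD_eqI[OF G_smult[OF that d]]) (simp_all add: that J.E_ops_closed J.E_apply AP_parts AD_apply G_closed br_lin)
  show "AD (d \<bullet> e) = AD d \<otimes>\<^bsub>EA\<^esub> AD e"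
    by (rule AD_eqI[OF brG[OF d e]])
      (simp_all add: J.E_ops_closed J.E_apply AP_parts AD_apply G_closed m[OF d] m[OF e] AP_minus jacobi_left)
  show "AD \<zero>\<^sub>L = \<zero>\<^bsub>EA\<^esub>"
    by (rule AD_eqI[OF G_zero]) (simp_all add: J.E_ops_closed J.E_apply AP_parts G_closed)
qed

lemma inner_der_AD:
  assumes x: "x \<in> G 1" and y: "y \<in> G (-1)"
  shows "inner_der AP x y = AD (x \<bullet> y)"
proof (rule AD_eqI[symmetric])
  note [simp] = G_closed[OF x] G_closed[OF y]
  show "x \<bullet> y \<in> G 0" by (rule brG[OF x y]) simp
  show "inner_der AP x y \<in> carrier EA" using x y by (intro J.inner_der_closed) (simp_all add: AP_parts)
  fix \<sigma> z assume z: "z \<in> G (deg \<sigma>)"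
  show "inner_der AP x y \<sigma> z = (x \<bullet> y) \<bullet> z"
  proof (cases \<sigma>)
    case Pos
    then show ?thesis using x y z by (simp add: J.inner_der_apply AP_parts triple_AP)
  next
    case Neg
    have "(y \<bullet> x) \<bullet> z \<in> G (-1)" using brG[OF brG[OF y x refl], of z "-1"] z Neg by simp
    then show ?thesis using Neg x y z AP_neg[of "(y \<bullet> x) \<bullet> z" Neg] G_closed[OF z]
      by (simp add: J.inner_der_apply AP_parts triple_AP br_anti[of x y] br_lin)
  qed
qed

text \<open>The spanning brackets [x,y] of degree 0 act as the spanning inner derivations, and
  \<open>AD\<close> is linear; each inclusion is an induction over one of the two spans.\<close>

lemma AD_image: "AD ` G 0 = IDer R AP"
proof
  note sub = J.IDer_submodule
  let ?B = "{x \<bullet> y |x y. x \<in> G 1 \<and> y \<in> G (-1)}"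
  have B: "?B \<subseteq> carrier L" by (auto simp: G_closed)
  have "d \<in> G 0 \<and> AD d \<in> IDer R AP" if d: "d \<in> module_span R L ?B" for d
    using d B
  proof (induction rule: module_span_induct)
    case (base d)
    then obtain x y where xy: "d = x \<bullet> y" "x \<in> G 1" "y \<in> G (-1)" by blast
    then show ?case using inner_der_AD[OF xy(2,3)] J.inner_der_IDer[of x y] brG[OF xy(2,3)] by (simp add: AP_parts)
  next
    case zero then show ?case using J.E.submodule_zero[OF sub] by (simp add: AD_ops(4)[OF G_zero G_zero] G_zero)
  next
    case (add x y) then show ?case using J.E.submoduleE(5)[OF sub] by (simp add: AD_ops(1) G_add)
  next
    case (smult a x) then show ?case using J.E.submoduleE(4)[OF sub] by (simp add: AD_ops(2)[of x x] G_smult)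
  qed
  then show "AD ` G 0 \<subseteq> IDer R AP" using generated by (auto simp: lie_prod_def)
  let ?S = "{inner_der AP x y |x y. x \<in> pcarrier AP Pos \<and> y \<in> pcarrier AP Neg}"
  have S: "?S \<subseteq> carrier EA" using J.inner_der_closed by blast
  have "\<exists>d\<in>G 0. \<gamma> = AD d" if "\<gamma> \<in> module_span R EA ?S" for \<gamma>
    using that S
  proof (induction rule: J.E.module_span_induct)
    case (base \<gamma>)
    then obtain x y where "\<gamma> = inner_der AP x y" "x \<in> G 1" "y \<in> G (-1)" by (auto simp: AP_parts)
    then show ?case using inner_der_AD[of x y] brG[of x 1 y "-1" 0] by auto
  next
    case zero then show ?case using AD_ops(4)[OF G_zero G_zero] G_zero by (intro bexI[of _ "\<zero>\<^sub>L"]) auto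
  next
    case (add \<gamma> \<mu>)
    then obtain d e where "d \<in> G 0" "\<gamma> = AD d" "e \<in> G 0" "\<mu> = AD e" by blast
    then show ?case using AD_ops(1)[of d e] G_add[of d 0 e] by (intro bexI[of _ "d \<boxplus> e"]) simp_all
  next
    case (smult a \<gamma>)
    then obtain d where "d \<in> G 0" "\<gamma> = AD d" by blast
    then show ?case using AD_ops(2)[of d d a] G_smult[of a d 0] smult(1) by (intro bexI[of _ "a \<cdot> d"]) simp_all
  qed
  then show "IDer R AP \<subseteq> AD ` G 0" by (auto simp: IDer_def)
qed

lemma AD_inj: assumes "d \<in> G 0" "e \<in> G 0" "AD d = AD e" shows "d = e"
proof -
  note [simp] = G_closed[OF assms(1)] G_closed[OF assms(2)]
  have "d \<boxplus> \<boxminus> e = \<zero>\<^sub>L"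
  proof (rule faithful)
    show "d \<boxplus> \<boxminus> e \<in> G 0" by (intro G_add G_neg assms)
    fix s x assume s: "s = (1::int) \<or> s = -1" and x: "x \<in> G s"
    obtain \<sigma> where "s = deg \<sigma>" using s deg.simps by metis
    then have "d \<bullet> x = e \<bullet> x" using AD_apply[of x \<sigma>] x assms(3) by metis
    then show "(d \<boxplus> \<boxminus> e) \<bullet> x = \<zero>\<^sub>L" using G_closed[OF x] by (simp add: br_lin M.r_neg)
  qed
  from arg_cong[OF this, of "sec L"] show ?thesis by (intro M.secI) (simp_all add: M.sec_simps)
qed

text \<open>Well defined by uniqueness of the homogeneous decomposition. Elements of the TKK-algebra
  list degree 1 first, whereas the decomposition starts with degree -1.\<close>

definition toT :: "'l \<Rightarrow> 'l \<times> (sign \<Rightarrow> 'l \<Rightarrow> 'l) \<times> 'l" where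
  "toT x = (THE t. \<exists>a\<in>G (-1). \<exists>b\<in>G 0. \<exists>c\<in>G 1. x = a \<boxplus> b \<boxplus> c \<and> t = (c, AD b, a))"

lemma toT_eq:
  assumes "a \<in> G (-1)" "b \<in> G 0" "c \<in> G 1"
  shows "toT (a \<boxplus> b \<boxplus> c) = (c, AD b, a)"
  unfolding toT_def
proof (rule the_equality)
  fix t assume "\<exists>a'\<in>G (-1). \<exists>b'\<in>G 0. \<exists>c'\<in>G 1. a \<boxplus> b \<boxplus> c = a' \<boxplus> b' \<boxplus> c' \<and> t = (c', AD b', a')"
  then show "t = (c, AD b, a)" using decompose_unique[OF assms] by blast
qed (use assms in blast)

lemma TA_carrier: "(x, \<gamma>, y) \<in> carrier TA \<longleftrightarrow> x \<in> G 1 \<and> \<gamma> \<in> IDer R AP \<and> y \<in> G (-1)"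
  by (simp add: J.T_carrier AP_parts)

lemma toT_closed: "x \<in> carrier L \<Longrightarrow> toT x \<in> carrier TA"
  using AD_image by (elim decompose) (auto simp: toT_eq TA_carrier)

lemma toT_linear: "linear_map R L TA toT"
proof (rule linear_mapI)
  fix x y assume xy: "x \<in> carrier L" "y \<in> carrier L"
  obtain a b c where 1: "a \<in> G (-1)" "b \<in> G 0" "c \<in> G 1" "x = a \<boxplus> b \<boxplus> c" using decompose[OF xy(1)] .
  obtain a' b' c' where 2: "a' \<in> G (-1)" "b' \<in> G 0" "c' \<in> G 1" "y = a' \<boxplus> b' \<boxplus> c'" using decompose[OF xy(2)] .
  have "x \<boxplus> y = (a \<boxplus> a') \<boxplus> (b \<boxplus> b') \<boxplus> (c \<boxplus> c')"
    using 1 2 by (intro M.secI) (auto simp: G_closed M.sec_simps algebra_simps)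
  then show "toT (x \<boxplus> y) = toT x \<oplus>\<^bsub>TA\<^esub> toT y"
    using 1 2 by (simp add: toT_eq G_add J.T_ops AD_ops(1) AP_parts)
next
  fix r x assume r: "r \<in> carrier R" and x: "x \<in> carrier L"
  obtain a b c where 1: "a \<in> G (-1)" "b \<in> G 0" "c \<in> G 1" "x = a \<boxplus> b \<boxplus> c" using decompose[OF x] .
  have "r \<cdot> x = (r \<cdot> a) \<boxplus> (r \<cdot> b) \<boxplus> (r \<cdot> c)" using 1 r by (simp add: G_closed smult_r_distr)
  then show "toT (r \<cdot> x) = r \<odot>\<^bsub>TA\<^esub> toT x"
    using 1 r by (simp add: toT_eq G_smult J.T_ops AD_ops(2)[of b b] AP_parts)
qed (rule toT_closed)

lemma toT_bracket:
  assumes "x \<in> carrier L" "y \<in> carrier L"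
  shows "toT (x \<bullet> y) = toT x \<otimes>\<^bsub>TA\<^esub> toT y"
proof -
  obtain a b c where 1: "a \<in> G (-1)" "b \<in> G 0" "c \<in> G 1" "x = a \<boxplus> b \<boxplus> c" using decompose[OF assms(1)] .
  obtain a' b' c' where 2: "a' \<in> G (-1)" "b' \<in> G 0" "c' \<in> G 1" "y = a' \<boxplus> b' \<boxplus> c'" using decompose[OF assms(2)] .
  note [simp] = 1(1-3)[THEN G_closed] 2(1-3)[THEN G_closed]
  have z: "a \<bullet> a' = \<zero>\<^sub>L" "c \<bullet> c' = \<zero>\<^sub>L" using br0[OF 1(1) 2(1)] br0[OF 1(3) 2(3)] by simp_all
  have m: "b \<bullet> a' \<in> G (-1)" "b' \<bullet> a \<in> G (-1)" "b \<bullet> b' \<in> G 0" "c \<bullet> a' \<in> G 0" "c' \<bullet> a \<in> G 0" "b \<bullet> c' \<in> G 1" "b' \<bullet> c \<in> G 1"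
    using brG[OF 1(2) 2(1)] brG[OF 2(2) 1(1)] brG[OF 1(2) 2(2)] brG[OF 1(3) 2(1)] brG[OF 2(3) 1(1)] brG[OF 1(2) 2(3)] brG[OF 2(2) 1(3)]
    by simp_all
  have e: "x \<bullet> y = (b \<bullet> a' \<boxplus> \<boxminus> (b' \<bullet> a)) \<boxplus> (b \<bullet> b' \<boxplus> c \<bullet> a' \<boxplus> \<boxminus> (c' \<bullet> a)) \<boxplus> (b \<bullet> c' \<boxplus> \<boxminus> (b' \<bullet> c))"
    unfolding 1(4) 2(4)
    by (rule M.secI) (simp_all add: br_lin z M.sec_simps br_anti[of b' a] br_anti[of c' a] br_anti[of b' c] algebra_simps)
  have "toT (x \<bullet> y) = (b \<bullet> c' \<boxplus> \<boxminus> (b' \<bullet> c), AD (b \<bullet> b' \<boxplus> c \<bullet> a' \<boxplus> \<boxminus> (c' \<bullet> a)), b \<bullet> a' \<boxplus> \<boxminus> (b' \<bullet> a))"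
    unfolding e by (rule toT_eq) (simp_all add: m G_add G_neg)
  moreover have "AD (b \<bullet> b' \<boxplus> c \<bullet> a' \<boxplus> \<boxminus> (c' \<bullet> a)) = AD b \<otimes>\<^bsub>EA\<^esub> AD b' \<oplus>\<^bsub>EA\<^esub> inner_der AP c a' \<ominus>\<^bsub>EA\<^esub> inner_der AP c' a"
  proof -
    have mz: "(c' \<bullet> a) \<bullet> z \<in> G (deg \<sigma>)" if "z \<in> G (deg \<sigma>)" for z \<sigma>
      using brG[OF m(5) that] by simp
    have "AD (\<boxminus> (c' \<bullet> a)) = \<ominus>\<^bsub>EA\<^esub> AD (c' \<bullet> a)"
      by (rule AD_eqI[OF G_neg[OF m(5)]])
        (simp_all add: AD_closed[OF m(5)] J.E_app_a_inv AP_parts AP_neg mz AD_apply G_closed br_lin)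
    then show ?thesis
      by (simp add: AD_ops m G_add G_neg 1 2 inner_der_AD a_minus_def)
  qed
  ultimately show ?thesis
    using m 1 2 by (simp add: toT_eq J.T_ops AD_apply[of _ Pos, simplified] AD_apply[of _ Neg, simplified]
        AP_minus[of _ Pos, simplified] AP_minus[of _ Neg, simplified])
qed

lemma toT_bij: "bij_betw toT (carrier L) (carrier TA)"
proof (rule bij_betwI')
  fix x y assume xy: "x \<in> carrier L" "y \<in> carrier L"
  obtain a b c where 1: "a \<in> G (-1)" "b \<in> G 0" "c \<in> G 1" "x = a \<boxplus> b \<boxplus> c" using decompose[OF xy(1)] .
  obtain a' b' c' where 2: "a' \<in> G (-1)" "b' \<in> G 0" "c' \<in> G 1" "y = a' \<boxplus> b' \<boxplus> c'" using decompose[OF xy(2)] .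
  show "toT x = toT y \<longleftrightarrow> x = y"
  proof
    assume "toT x = toT y"
    then show "x = y" using 1 2 AD_inj[of b b'] by (simp add: toT_eq)
  qed simp
next
  fix t assume t: "t \<in> carrier TA"
  obtain c \<gamma> a where e: "t = (c, \<gamma>, a)" by (cases t)
  then obtain b where "b \<in> G 0" "\<gamma> = AD b" using t AD_image by (auto simp: TA_carrier)
  then show "\<exists>x\<in>carrier L. t = toT x"
    using t e by (intro bexI[of _ "a \<boxplus> b \<boxplus> c"]) (auto simp: TA_carrier toT_eq G_closed)
qed (rule toT_closed)

lemma toT_in: assumes "x \<in> G (deg \<sigma>)" shows "toT x = TKK_in R AP \<sigma> x"
proof (cases \<sigma>)
  case Pos
  then show ?thesis using assms toT_eq[of "\<zero>\<^sub>L" "\<zero>\<^sub>L" x] AD_ops(4)[OF G_zero G_zero] by (simp add: G_zero G_closed AP_parts)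
next
  case Neg
  then show ?thesis using assms toT_eq[of x "\<zero>\<^sub>L" "\<zero>\<^sub>L"] AD_ops(4)[OF G_zero G_zero] by (simp add: G_zero G_closed AP_parts)
qed

lemma toT_grade: "x \<in> G k \<Longrightarrow> toT x \<in> TKK_grade R AP k"
proof -
  assume x: "x \<in> G k"
  consider "k = deg Pos" | "k = deg Neg" | "k = 0" | "\<bar>k\<bar> > 1" by (cases "k = 1"; cases "k = -1"; cases "k = 0") auto
  then show ?thesis
  proof cases
    case 1 then show ?thesis using x toT_in[of x Pos] J.TKK_in_mem[of x Pos] by (simp add: AP_parts)
  next
    case 2 then show ?thesis using x toT_in[of x Neg] J.TKK_in_mem[of x Neg] by (simp add: AP_parts)
  next
    case 3
    have "AD x \<in> IDer R AP" using x 3 AD_image by auto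
    then show ?thesis using x 3 toT_eq[of "\<zero>\<^sub>L" x "\<zero>\<^sub>L"]
      by (simp add: G_zero G_closed J.T_grade_iff TA_carrier AP_parts)
  next
    case 4
    then have "x = \<zero>\<^sub>L" using x grade_trivial by blast
    then show ?thesis using linear_map_zero[OF toT_linear module_axioms J.T_module] J.T.submodule_zero[OF J.T.grade_submodule] by simp
  qed
qed

lemma toT_grade_iff: "x \<in> carrier L \<Longrightarrow> toT x \<in> TKK_grade R AP k \<longleftrightarrow> x \<in> G k"
proof
  assume x: "x \<in> carrier L" "toT x \<in> TKK_grade R AP k"
  obtain a b c where 1: "a \<in> G (-1)" "b \<in> G 0" "c \<in> G 1" "x = a \<boxplus> b \<boxplus> c" using decompose[OF x(1)] .
  note [simp] = 1(1-3)[THEN G_closed]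
  have h: "k = 1 \<or> c = \<zero>\<^sub>L" "k = 0 \<or> AD b = \<zero>\<^bsub>EA\<^esub>" "k = -1 \<or> a = \<zero>\<^sub>L"
    using x(2) 1 by (simp_all add: toT_eq J.T_grade_iff AP_parts)
  have b: "AD b = \<zero>\<^bsub>EA\<^esub> \<Longrightarrow> b = \<zero>\<^sub>L" using AD_inj[OF 1(2) G_zero] AD_ops(4)[OF G_zero G_zero] by simp
  have "a \<in> G k" using h(3) 1(1) G_zero by blast
  moreover have "b \<in> G k" using h(2) b 1(2) G_zero by blast
  moreover have "c \<in> G k" using h(1) 1(3) G_zero by blast
  ultimately show "x \<in> G k" unfolding 1(4) by (intro G_add)
qed (rule toT_grade)

lemma TKK_assoc_iso: "lie_isomorphic R L TA"
  unfolding lie_isomorphic_def using toT_linear toT_bij toT_bracket by blast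

end

section \<open>The pair of \<open>\<MM>\<close>-quotients\<close>

context nondeg_graded
begin

text \<open>For y in I of degree 0 the element [z,y] lies in I of degree s, and its bracket with any
  w in I of degree -s vanishes by Jacobi, since z commutes with w and [y,w]; hence it is zero. The
  degree s is trivial, and \<open>essential_centralizer\<close> finishes.\<close>

lemma graded_centralizer:
  assumes I: "essential_ideal R L I" "graded_ideal R L G I" and s: "s = 1 \<or> s = -1" and z: "z \<in> G s"
    and h: "\<And>y. \<lbrakk>y \<in> I; y \<in> G (- s)\<rbrakk> \<Longrightarrow> z \<bullet> y = \<zero>\<^sub>L"
  shows "z = \<zero>\<^sub>L"
proof (rule essential_centralizer[OF I(1) G_closed[OF z]])
  note i = essentialD[OF I(1)]
  note [simp] = G_closed[OF z]
  have hom: "z \<bullet> y = \<zero>\<^sub>L" if y: "y \<in> I" "y \<in> G k" "\<bar>k\<bar> \<le> 1" for y k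
  proof -
    note [simp] = G_closed[OF y(2)]
    consider "k = - s" | "k = s" | "k = 0" using s y(3) by linarith
    then show ?thesis
    proof cases
      case 1 then show ?thesis using h y by simp
    next
      case 2 then show ?thesis using br0[OF z y(2)] s by auto
    next
      case 3
      have u: "z \<bullet> y \<in> I" "z \<bullet> y \<in> G s" using ideal_right[OF i y(1)] brG[OF z y(2)] 3 by simp_all
      show ?thesis
      proof (rule nondeg_ideal[OF i s u])
        fix w assume w: "w \<in> I" "w \<in> G (- s)"
        note [simp] = G_closed[OF w(2)]
        have "y \<bullet> w \<in> I" "y \<bullet> w \<in> G (- s)" using ideal_left[OF i y(1)] brG[OF y(2) w(2)] 3 by simp_all
        then have "(z \<bullet> y) \<bullet> w = \<zero>\<^sub>L" using jacobi_left[of z y w] h[of "y \<bullet> w"] h[OF w] by simp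
        then show "(z \<bullet> y) \<bullet> (z \<bullet> y) \<bullet> w = \<zero>\<^sub>L" by simp
      qed
    qed
  qed
  fix y assume "y \<in> I"
  then obtain a b c where 1: "a \<in> I \<inter> G (-1)" "b \<in> I \<inter> G 0" "c \<in> I \<inter> G 1" "y = a \<boxplus> b \<boxplus> c"
    using I(2) unfolding graded_ideal_def by blast
  then show "z \<bullet> y = \<zero>\<^sub>L" using hom[of a "-1"] hom[of b 0] hom[of c 1] by (auto simp: G_closed br_add_r)
qed

text \<open>A version with one more bracket, matching the triple products in the definition of
  \<MM>-quotients. For x in the domain of a representative, [A,x] is an element of degree 0 of L,
  and by faithfulness it vanishes once it kills degrees 1 and -1.\<close>

lemma Q_vanish2:
  assumes A: "A \<in> Qg s" and s: "s = 1 \<or> s = -1" and I: "essential_ideal R L I" "graded_ideal R L G I"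
    and h: "\<And>x t v. \<lbrakk>x \<in> I; x \<in> G (- s); t = 1 \<or> t = -1; v \<in> G t\<rbrakk> \<Longrightarrow> (A \<otimes>\<^bsub>Q\<^esub> emb x) \<otimes>\<^bsub>Q\<^esub> emb v = \<zero>\<^bsub>Q\<^esub>"
  shows "A = \<zero>\<^bsub>Q\<^esub>"
proof -
  obtain J \<delta> where J: "A = cl J \<delta>" "pder J \<delta>" "graded_ideal R L G J" "homogeneous J \<delta> s" using QgE[OF A] .
  show ?thesis
  proof (rule Q_vanish[OF A s essential_Int[OF I(1) pder_ess[OF J(2)]] graded_Int[OF I(2) J(3)]])
    fix x assume x: "x \<in> I \<inter> J" "x \<in> G (- s)"
    have d: "\<delta> x \<in> G 0" using homogeneousD[OF J(4), of x "- s" 0] x by simp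
    have e: "A \<otimes>\<^bsub>Q\<^esub> emb x = emb (\<delta> x)" unfolding J(1) by (rule emb_act[OF J(2)]) (use x in simp)
    have "\<delta> x = \<zero>\<^sub>L"
    proof (rule faithful[OF d])
      fix t v assume t: "t = (1::int) \<or> t = -1" and v: "v \<in> G t"
      have "emb (\<delta> x \<bullet> v) = \<zero>\<^bsub>Q\<^esub>"
        using h[OF _ x(2) t v] x(1) G_closed[OF d] G_closed[OF v] by (simp add: e emb_bracket)
      then show "\<delta> x \<bullet> v = \<zero>\<^sub>L" using G_closed[OF d] G_closed[OF v] by (intro emb_eq_zero) simp_all
    qed
    then show "A \<otimes>\<^bsub>Q\<^esub> emb x = \<zero>\<^bsub>Q\<^esub>" unfolding e using linear_map_zero[OF emb_linear module_axioms Q_module] by simp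
  qed
qed

end

lemma sign_deg_cases: assumes "s = 1 \<or> s = (-1::int)" obtains \<sigma> where "s = deg \<sigma>"
  using assms deg.simps by metis

lemma deg_cases: "deg \<sigma> = 1 \<or> deg \<sigma> = -1"
  by (cases \<sigma>) simp_all

lemma pair_hom_triple:
  assumes V: "quadratic_pair R V" and W: "quadratic_pair R W" and h: "pair_hom R V W h"
    and [simp]: "x \<in> pcarrier V \<sigma>" "y \<in> pcarrier V (- \<sigma>)" "z \<in> pcarrier V \<sigma>"
  shows "h \<sigma> (triple V \<sigma> x y z) = triple W \<sigma> (h \<sigma> x) (h (- \<sigma>) y) (h \<sigma> z)"
proof -
  interpret V: quadratic_pair R V by (rule V)
  interpret W: quadratic_pair R W by (rule W)
  have l: "linear_map R (part V \<tau>) (part W \<tau>) (h \<tau>)" for \<tau> using h by (simp add: pair_hom_def)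
  have q: "h \<sigma> (quad V \<sigma> u y) = quad W \<sigma> (h \<sigma> u) (h (- \<sigma>) y)" if "u \<in> pcarrier V \<sigma>" for u
    using h that by (simp add: pair_hom_def)
  have c: "h \<tau> u \<in> pcarrier W \<tau>" if "u \<in> pcarrier V \<tau>" for u \<tau> by (rule linear_map_closed[OF l that])
  have n: "h \<sigma> (\<ominus>\<^bsub>part V \<sigma>\<^esub> u) = \<ominus>\<^bsub>part W \<sigma>\<^esub> h \<sigma> u" if "u \<in> pcarrier V \<sigma>" for u
    by (rule linear_map_neg[OF l V.is_module W.is_module that])
  show ?thesis
    by (simp add: V.triple_eq_quad W.triple_eq_quad c a_minus_def linear_map_add[OF l] n q)
qed

section \<open>Strongly nondegenerate pairs and their TKK-algebras\<close>

locale nondeg_pair = jordan_pair R V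
  for R :: "('a, 'r) ring_scheme" (structure) and V :: "('a, 'v) jordan_pair" +
  assumes six_unit: "add_pow R (6::nat) \<one> \<in> Units R" and nondegenerate: "pair_strongly_nondegenerate V"
begin

lemma part_six: "six_module R (part V \<sigma>)"
  using six_unit P.module_axioms by (simp add: six_module_def six_module_axioms_def)

lemma quad_eq_zero:
  assumes "x \<in> pcarrier V \<sigma>" "\<And>y. y \<in> pcarrier V (- \<sigma>) \<Longrightarrow> quad V \<sigma> x y = pzero V \<sigma>"
  shows "x = pzero V \<sigma>"
  using nondegenerate assms unfolding pair_strongly_nondegenerate_def by blast

lemma quad_half:
  assumes [simp]: "x \<in> pcarrier V \<sigma>" "y \<in> pcarrier V (- \<sigma>)"
  shows "quad V \<sigma> x y = half R \<odot>\<^bsub>part V \<sigma>\<^esub> triple V \<sigma> x y x"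
  by (simp add: triple_self six_module.half_double[OF part_six])

lemma TKK_br_br:
  assumes xyz: "x \<in> pcarrier V \<sigma>" "y \<in> pcarrier V (- \<sigma>)" "z \<in> pcarrier V \<sigma>"
  shows "T.br (TKK_in R V \<sigma> x) (T.br (TKK_in R V \<sigma> z) (TKK_in R V (- \<sigma>) y)) = \<ominus>\<^bsub>T\<^esub> TKK_in R V \<sigma> (triple V \<sigma> z y x)"
  using T.br_anti[of "T.br (TKK_in R V \<sigma> z) (TKK_in R V (- \<sigma>) y)" "TKK_in R V \<sigma> x"] assms
  by (simp add: TKK_triple)

text \<open>For x in the pair, [x,[x,y]] = -{x,y,x} = -2 Q_x y, so nondegeneracy in degrees 1 and -1
  is that of V; degree 0 is \<open>T_faithful\<close>.\<close>

lemma T_nondeg: "nondeg_graded R T (TKK_grade R V)"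
proof (intro nondeg_graded.intro nondeg_graded_axioms.intro T_graded six_unit)
  fix s :: int and z assume s: "s = 1 \<or> s = -1" and z: "z \<in> TKK_grade R V s"
    and h: "\<And>y. y \<in> TKK_grade R V (- s) \<Longrightarrow> T.br z (T.br z y) = \<zero>\<^bsub>T\<^esub>"
  obtain \<sigma> where \<sigma>: "s = deg \<sigma>" using sign_deg_cases[OF s] .
  then obtain x where x: "x \<in> pcarrier V \<sigma>" "z = TKK_in R V \<sigma> x" using z TKK_grade_deg by auto
  have "x = pzero V \<sigma>"
  proof (rule quad_eq_zero[OF x(1)])
    fix y assume y: "y \<in> pcarrier V (- \<sigma>)"
    have "\<ominus>\<^bsub>T\<^esub> TKK_in R V \<sigma> (triple V \<sigma> x y x) = \<zero>\<^bsub>T\<^esub>"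
      using h[of "TKK_in R V (- \<sigma>) y"] TKK_in_mem[OF y] TKK_br_br[OF x(1) y x(1)] \<sigma> x(2) by simp
    then have "\<ominus>\<^bsub>T\<^esub> (\<ominus>\<^bsub>T\<^esub> TKK_in R V \<sigma> (triple V \<sigma> x y x)) = \<zero>\<^bsub>T\<^esub>" by simp
    then have "TKK_in R V \<sigma> (triple V \<sigma> x y x) = TKK_in R V \<sigma> (pzero V \<sigma>)"
      using x(1) y TKK_in_closed[of "triple V \<sigma> x y x" \<sigma>] by simp
    then have "triple V \<sigma> x y x = pzero V \<sigma>" using TKK_in_inject by blast
    then show "quad V \<sigma> x y = pzero V \<sigma>" using quad_half[OF x(1) y] six_module.half_closed[OF part_six] by simp
  qed
  then show "z = \<zero>\<^bsub>T\<^esub>" by (simp add: x(2))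
next
  fix d assume d: "d \<in> TKK_grade R V 0"
    and h: "\<And>s x. \<lbrakk>s = 1 \<or> s = - 1; x \<in> TKK_grade R V s\<rbrakk> \<Longrightarrow> T.br d x = \<zero>\<^bsub>T\<^esub>"
  show "d = \<zero>\<^bsub>T\<^esub>" by (rule T_faithful[OF d]) (rule h[OF deg_cases])
qed

sublocale K: nondeg_graded R T "TKK_grade R V" by (rule T_nondeg)

text \<open>For x in an ideal with zero products, JP3 writes Q_{Q_x v} z as Q_x applied to Q_v Q_x
  z, an element of the ideal. So every Q_x v is zero, and then x is.\<close>

lemma semiprime: "pair_semiprime R V"
  unfolding pair_semiprime_def
proof (intro allI impI)
  fix I \<sigma> assume h: "pair_ideal R V I \<and> (\<forall>\<sigma>. \<forall>x\<in>I \<sigma>. \<forall>y\<in>I (- \<sigma>). quad V \<sigma> x y = pzero V \<sigma>)"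
  then have sub: "submodule (I \<tau>) R (part V \<tau>)" for \<tau> by (simp add: pair_ideal_def)
  have cl: "x \<in> pcarrier V \<tau>" if "x \<in> I \<tau>" for x \<tau> using P.submoduleE(1)[OF sub] that by blast
  have q0: "quad V \<tau> x y = pzero V \<tau>" if "x \<in> I \<tau>" "y \<in> I (- \<tau>)" for x y \<tau> using h that by blast
  have ql: "quad V \<tau> x y \<in> I \<tau>" if "x \<in> I \<tau>" "y \<in> pcarrier V (- \<tau>)" for x y \<tau>
    using h that by (simp add: pair_ideal_def)
  have qr: "quad V \<tau> x y \<in> I \<tau>" if "x \<in> pcarrier V \<tau>" "y \<in> I (- \<tau>)" for x y \<tau>
    using h that by (simp add: pair_ideal_def)
  have "x = pzero V \<sigma>" if x: "x \<in> I \<sigma>" for x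
  proof (rule quad_eq_zero[OF cl[OF x]])
    fix v assume v: "v \<in> pcarrier V (- \<sigma>)"
    show "quad V \<sigma> x v = pzero V \<sigma>"
    proof (rule quad_eq_zero)
      show "quad V \<sigma> x v \<in> pcarrier V \<sigma>" using cl[OF x] v by simp
      fix z assume z: "z \<in> pcarrier V (- \<sigma>)"
      have "quad V (- \<sigma>) v (quad V \<sigma> x z) \<in> I (- \<sigma>)"
        using qr[of v "- \<sigma>" "quad V \<sigma> x z"] v ql[OF x z] by simp
      then show "quad V \<sigma> (quad V \<sigma> x v) z = pzero V \<sigma>"
        unfolding JP3[OF cl[OF x] v z] by (rule q0[OF x])
    qed
  qed
  then show "I \<sigma> = {pzero V \<sigma>}" using P.submodule_zero[OF sub] by blast
qed

definition pair_part :: "('v \<times> (sign \<Rightarrow> 'v \<Rightarrow> 'v) \<times> 'v) set \<Rightarrow> sign \<Rightarrow> 'v set" where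
  "pair_part I \<sigma> = {x \<in> pcarrier V \<sigma>. TKK_in R V \<sigma> x \<in> I}"

lemma pair_part_ideal:
  assumes I: "lie_ideal R T I"
  shows "pair_ideal R V (pair_part I)"
proof -
  note m = T.ideal_left[OF I] T.ideal_right[OF I]
  have sub: "submodule (pair_part I \<sigma>) R (part V \<sigma>)" for \<sigma>
  proof (rule P.submoduleI')
    show "pair_part I \<sigma> \<subseteq> pcarrier V \<sigma>" by (auto simp: pair_part_def)
    show "pzero V \<sigma> \<in> pair_part I \<sigma>" using T.ideal_zero[OF I] by (simp add: pair_part_def)
    show "x \<oplus>\<^bsub>part V \<sigma>\<^esub> y \<in> pair_part I \<sigma>" if "x \<in> pair_part I \<sigma>" "y \<in> pair_part I \<sigma>" for x y
      using that T.ideal_add[OF I] by (simp add: pair_part_def linear_map_add[OF TKK_in_linear])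
    show "a \<odot>\<^bsub>part V \<sigma>\<^esub> x \<in> pair_part I \<sigma>" if "a \<in> carrier R" "x \<in> pair_part I \<sigma>" for a x
      using that T.ideal_smult[OF I] by (simp add: pair_part_def linear_map_smult[OF TKK_in_linear])
  qed
  have tri: "triple V \<sigma> x y z \<in> pair_part I \<sigma>"
    if xyz: "x \<in> pcarrier V \<sigma>" "y \<in> pcarrier V (- \<sigma>)" "z \<in> pcarrier V \<sigma>"
      and i: "x \<in> pair_part I \<sigma> \<or> y \<in> pair_part I (- \<sigma>) \<or> z \<in> pair_part I \<sigma>" for x y z \<sigma>
  proof -
    have "T.br (T.br (TKK_in R V \<sigma> x) (TKK_in R V (- \<sigma>) y)) (TKK_in R V \<sigma> z) \<in> I"
      using i
    proof (elim disjE)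
      assume "x \<in> pair_part I \<sigma>"
      then show ?thesis using xyz by (intro m(1)) (simp_all add: pair_part_def)
    next
      assume "y \<in> pair_part I (- \<sigma>)"
      then show ?thesis using xyz by (intro m(1)[OF m(2)]) (simp_all add: pair_part_def)
    next
      assume "z \<in> pair_part I \<sigma>"
      then show ?thesis using xyz by (intro m(2)) (simp_all add: pair_part_def)
    qed
    then show ?thesis using xyz by (simp add: TKK_triple pair_part_def)
  qed
  have cl: "x \<in> pcarrier V \<sigma>" if "x \<in> pair_part I \<sigma>" for x \<sigma> using that by (simp add: pair_part_def)
  have q: "quad V \<sigma> x y \<in> pair_part I \<sigma>" if "x \<in> pcarrier V \<sigma>" "y \<in> pcarrier V (- \<sigma>)"
    "x \<in> pair_part I \<sigma> \<or> y \<in> pair_part I (- \<sigma>)" for x y \<sigma>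
    unfolding quad_half[OF that(1,2)]
    using that by (intro P.submoduleE(4)[OF sub] tri six_module.half_closed[OF part_six]) auto
  show ?thesis unfolding pair_ideal_def
  proof (intro allI conjI ballI)
    fix \<sigma> show "submodule (pair_part I \<sigma>) R (part V \<sigma>)" by (rule sub)
  next
    fix \<sigma> x y assume "x \<in> pair_part I \<sigma>" "y \<in> pcarrier V (- \<sigma>)"
    then show "quad V \<sigma> x y \<in> pair_part I \<sigma>" using q[of x \<sigma> y] cl[of x \<sigma>] by simp
  next
    fix \<sigma> x y assume "x \<in> pcarrier V \<sigma>" "y \<in> pair_part I (- \<sigma>)"
    then show "quad V \<sigma> x y \<in> pair_part I \<sigma>" using q[of x \<sigma> y] cl[of y "- \<sigma>"] by simp
  next
    fix \<sigma> x y z assume "x \<in> pcarrier V \<sigma>" "y \<in> pcarrier V (- \<sigma>)" "z \<in> pair_part I \<sigma>"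
    then show "triple V \<sigma> x y z \<in> pair_part I \<sigma>" using tri[of x \<sigma> y z] cl[of z \<sigma>] by simp
  qed
qed

text \<open>For z in the annihilator and y in the ideal of the opposite sign, [z,y] kills both
  degrees: the first condition in \<open>pair_ann\<close> covers the sign of z, the third the
  opposite one. Hence [z,y] = 0 by faithfulness, and z is zero by
  \<open>graded_centralizer\<close>.\<close>

lemma pair_part_ann:
  assumes I: "essential_ideal R T I" "graded_ideal R T (TKK_grade R V) I"
  shows "pair_ann V (pair_part I) \<tau> = {pzero V \<tau>}"
proof -
  have cl: "x \<in> pcarrier V \<sigma>" if "x \<in> pair_part I \<sigma>" for x \<sigma> using that by (simp add: pair_part_def)
  have "z = pzero V \<tau>" if z: "z \<in> pair_ann V (pair_part I) \<tau>" for z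
  proof -
    have zc: "z \<in> pcarrier V \<tau>" using z by (simp add: pair_ann_def)
    let ?Z = "TKK_in R V \<tau> z"
    have "?Z = \<zero>\<^bsub>T\<^esub>"
    proof (rule K.graded_centralizer[OF I deg_cases TKK_in_mem[OF zc]])
      fix Y assume Y: "Y \<in> I" "Y \<in> TKK_grade R V (- deg \<tau>)"
      obtain y where y: "y \<in> pcarrier V (- \<tau>)" "Y = TKK_in R V (- \<tau>) y"
        using Y(2) TKK_grade_deg[of "- \<tau>"] by auto
      have yI: "y \<in> pair_part I (- \<tau>)" using y Y(1) by (simp add: pair_part_def)
      show "T.br ?Z Y = \<zero>\<^bsub>T\<^esub>"
      proof (rule T_faithful)
        show "T.br ?Z Y \<in> TKK_grade R V 0" using K.brG[OF TKK_in_mem[OF zc] Y(2)] by simp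
        fix \<sigma> X assume "X \<in> TKK_grade R V (deg \<sigma>)"
        then obtain x where x: "x \<in> pcarrier V \<sigma>" "X = TKK_in R V \<sigma> x" using TKK_grade_deg by auto
        show "T.br (T.br ?Z Y) X = \<zero>\<^bsub>T\<^esub>"
        proof (cases "\<sigma> = \<tau>")
          case True
          have "triple V \<tau> z y x = pzero V \<tau>" using z x yI True by (auto simp: pair_ann_def)
          then show ?thesis using TKK_triple[OF zc y(1)] x True by (simp add: y(2))
        next
          case False
          then have s: "\<sigma> = - \<tau>" by (cases \<sigma>; cases \<tau>) auto
          have "triple V (- \<tau>) x z y = pzero V (- \<tau>)" using z x yI s by (auto simp: pair_ann_def)
          then have "triple V (- \<tau>) y z x = pzero V (- \<tau>)" using triple_commute[of y "- \<tau>" x z] x y zc s by simp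
          moreover have "T.br ?Z Y = \<ominus>\<^bsub>T\<^esub> T.br Y ?Z" using y zc by (intro T.br_anti) simp_all
          ultimately show ?thesis using TKK_triple[of y "- \<tau>" z x] x y zc s by (simp add: T.br_neg_l)
        qed
      qed
    qed
    then show ?thesis using TKK_in_inject[of \<tau> z "pzero V \<tau>"] by simp
  qed
  moreover have "pzero V \<tau> \<in> pair_ann V (pair_part I) \<tau>"
    using cl triple_zero2[of _ "- \<tau>"] by (auto simp: pair_ann_def)
  ultimately show ?thesis by blast
qed

abbreviation "W \<equiv> Qm_pair R V"
abbreviation "\<iota> \<equiv> Qm_pair_emb R V"

lemma W_AP: "W = K.Q.AP"
  by (simp add: Qm_pair_def)

lemma W_jordan: "jordan_pair R W"
  unfolding W_AP by (rule K.Q.AP_jordan)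

lemma W_parts: "pcarrier W \<sigma> = K.Qg (deg \<sigma>)" "pzero W \<sigma> = \<zero>\<^bsub>K.Q\<^esub>"
  "x \<oplus>\<^bsub>part W \<sigma>\<^esub> y = x \<oplus>\<^bsub>K.Q\<^esub> y" "a \<odot>\<^bsub>part W \<sigma>\<^esub> x = a \<odot>\<^bsub>K.Q\<^esub> x"
  by (simp_all add: W_AP K.Q.part_AP)

lemma emb_in: "\<iota> \<sigma> x = K.emb (TKK_in R V \<sigma> x)"
  by (simp add: Qm_pair_emb_def)

lemma emb_mem: "x \<in> pcarrier V \<sigma> \<Longrightarrow> \<iota> \<sigma> x \<in> K.Qg (deg \<sigma>)"
  unfolding emb_in by (rule K.emb_grade[OF TKK_in_mem])

lemma W_triple: "\<lbrakk>x \<in> K.Qg (deg \<sigma>); y \<in> K.Qg (- deg \<sigma>); z \<in> K.Qg (deg \<sigma>)\<rbrakk> \<Longrightarrow>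
    triple W \<sigma> x y z = K.Q.br (K.Q.br x y) z"
  unfolding W_AP by (rule K.Q.triple_AP)

lemma W_quad: "quad W \<sigma> x y = half R \<odot>\<^bsub>K.Q\<^esub> K.Q.br (K.Q.br x y) x"
  unfolding W_AP by (rule K.Q.quad_AP)

lemma emb_mono: "pair_mono R V W \<iota>"
  unfolding pair_mono_def pair_hom_def
proof (intro conjI allI ballI)
  fix \<sigma>
  have l: "linear_map R (part V \<sigma>) K.Q (\<iota> \<sigma>)"
    unfolding emb_in[abs_def] by (rule linear_map_compose[OF TKK_in_linear K.emb_linear])
  show "linear_map R (part V \<sigma>) (part W \<sigma>) (\<iota> \<sigma>)"
    by (rule linear_mapI) (simp_all add: W_parts emb_mem linear_map_add[OF l] linear_map_smult[OF l])
  show "inj_on (\<iota> \<sigma>) (pcarrier V \<sigma>)"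
    by (rule inj_onI) (metis K.emb_inj TKK_in_closed TKK_in_inject emb_in inj_onD)
  fix x y assume xy: "x \<in> pcarrier V \<sigma>" "y \<in> pcarrier V (- \<sigma>)"
  have "\<iota> \<sigma> (quad V \<sigma> x y) = half R \<odot>\<^bsub>K.Q\<^esub> \<iota> \<sigma> (triple V \<sigma> x y x)"
    unfolding quad_half[OF xy] using xy by (intro linear_map_smult[OF l] six_module.half_closed[OF part_six]) simp_all
  also have "\<iota> \<sigma> (triple V \<sigma> x y x) = K.Q.br (K.Q.br (\<iota> \<sigma> x) (\<iota> (- \<sigma>) y)) (\<iota> \<sigma> x)"
    using xy TKK_triple[OF xy xy(1)] by (simp add: emb_in K.emb_bracket[symmetric])
  finally show "\<iota> \<sigma> (quad V \<sigma> x y) = quad W \<sigma> (\<iota> \<sigma> x) (\<iota> (- \<sigma>) y)" by (simp add: W_quad)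
qed

lemma emb_grade_image: "t \<in> TKK_grade R V (deg \<sigma>) \<Longrightarrow> K.emb t \<in> \<iota> \<sigma> ` pcarrier V \<sigma>"
  unfolding TKK_grade_deg by (auto simp: emb_in)

text \<open>The ideal of denominators of q is the part of degrees 1 and -1 of the domain of a
  homogeneous representative \<delta>; each product with q is a bracket with a value of
  \<delta>.\<close>

lemma W_M_quotients: "M_quotients R V W \<iota>"
  unfolding M_quotients_def
proof (intro conjI jordan_pair_axioms semiprime W_jordan emb_mono allI ballI)
  fix \<sigma> q assume q: "q \<in> pcarrier W \<sigma> - {pzero W \<sigma>}"
  then have qg: "q \<in> K.Qg (deg \<sigma>)" and qnz: "q \<noteq> \<zero>\<^bsub>K.Q\<^esub>" by (simp_all add: W_parts)
  obtain I \<delta> where I: "q = K.cl I \<delta>" "K.pder I \<delta>" "graded_ideal R T (TKK_grade R V) I" "K.homogeneous I \<delta> (deg \<sigma>)"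
    using K.QgE[OF qg] .
  note i = K.pder_ideal[OF I(2)] note ess = K.pder_ess[OF I(2)]
  note qc [simp] = K.Q.G_closed[OF qg]
  let ?I = "pair_part I"
  have act: "K.Q.br q (K.emb t) = K.emb (\<delta> t)" if "t \<in> I" for t
    unfolding I(1) by (rule K.emb_act[OF I(2) that])
  have dG: "\<delta> t \<in> TKK_grade R V k" if "t \<in> I" "t \<in> TKK_grade R V j" "j + deg \<sigma> = k" for t j k
    by (rule K.homogeneousD[OF I(4) that])
  have inI: "x \<in> pcarrier V \<tau>" "TKK_in R V \<tau> x \<in> I" if "x \<in> ?I \<tau>" for x \<tau> using that by (simp_all add: pair_part_def)
  have c1: "triple W \<sigma> q (\<iota> (- \<sigma>) y) (\<iota> \<sigma> x) = K.emb (T.br (\<delta> (TKK_in R V (- \<sigma>) y)) (TKK_in R V \<sigma> x))"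
    "\<delta> (TKK_in R V (- \<sigma>) y) \<in> TKK_grade R V 0"
    if y: "y \<in> ?I (- \<sigma>)" and x: "x \<in> pcarrier V \<sigma>" for x y
  proof -
    show d: "\<delta> (TKK_in R V (- \<sigma>) y) \<in> TKK_grade R V 0"
      using dG[OF inI(2)[OF y] TKK_in_mem[OF inI(1)[OF y]]] by simp
    show "triple W \<sigma> q (\<iota> (- \<sigma>) y) (\<iota> \<sigma> x) = K.emb (T.br (\<delta> (TKK_in R V (- \<sigma>) y)) (TKK_in R V \<sigma> x))"
      using W_triple[OF qg, of "\<iota> (- \<sigma>) y" "\<iota> \<sigma> x"] emb_mem[OF inI(1)[OF y]] emb_mem[OF x] act[OF inI(2)[OF y]]
        K.G_closed[OF d] TKK_in_closed[OF x] by (simp add: emb_in K.emb_bracket)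
  qed
  \<comment> \<open>Here q stands in the middle; moving it to the front of the inner bracket costs
    the sign.\<close>
  have c3: "triple W (- \<sigma>) (\<iota> (- \<sigma>) y) q (\<iota> (- \<sigma>) x) = K.emb (\<ominus>\<^bsub>T\<^esub> T.br (\<delta> (TKK_in R V (- \<sigma>) y)) (TKK_in R V (- \<sigma>) x))"
    if y: "y \<in> ?I (- \<sigma>)" and x: "x \<in> pcarrier V (- \<sigma>)" for x y
  proof -
    have d: "\<delta> (TKK_in R V (- \<sigma>) y) \<in> TKK_grade R V 0"
      using dG[OF inI(2)[OF y] TKK_in_mem[OF inI(1)[OF y]]] by simp
    note [simp] = K.G_closed[OF d] TKK_in_closed[OF x] TKK_in_closed[OF inI(1)[OF y]]
    have e: "K.Q.br (K.emb (TKK_in R V (- \<sigma>) y)) q = \<ominus>\<^bsub>K.Q\<^esub> K.emb (\<delta> (TKK_in R V (- \<sigma>) y))"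
      unfolding act[OF inI(2)[OF y], symmetric] by (rule K.Q.br_anti) (simp_all add: K.emb_closed)
    show ?thesis
      using W_triple[of "\<iota> (- \<sigma>) y" "- \<sigma>" q "\<iota> (- \<sigma>) x"] emb_mem[OF inI(1)[OF y]] emb_mem[OF x] qg
      by (simp add: emb_in e K.Q.br_neg_l K.emb_closed K.emb_bracket[symmetric]
          linear_map_neg[OF K.emb_linear T_module K.Q_module])
  qed
  \<comment> \<open>Now only x comes from the ideal, so [q,y] need not lie in T. Since [q,x] = 0 by
    degree, [[q,y],x] equals [q,[y,x]], the value of \<delta> at an element of its domain.\<close>
  have c2: "triple W \<sigma> q (\<iota> (- \<sigma>) y) (\<iota> \<sigma> x) \<in> \<iota> \<sigma> ` pcarrier V \<sigma>"
    if y: "y \<in> pcarrier V (- \<sigma>)" and x: "x \<in> ?I \<sigma>" for x y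
  proof -
    let ?X = "TKK_in R V \<sigma> x" and ?Y = "TKK_in R V (- \<sigma>) y"
    note [simp] = TKK_in_closed[OF y] TKK_in_closed[OF inI(1)[OF x]]
    have "\<delta> ?X = \<zero>\<^bsub>T\<^esub>"
      using dG[OF inI(2)[OF x] TKK_in_mem[OF inI(1)[OF x]] refl] K.grade_trivial[of "deg \<sigma> + deg \<sigma>"] by (cases \<sigma>) auto
    then have z: "K.Q.br q (K.emb ?X) = \<zero>\<^bsub>K.Q\<^esub>"
      using act[OF inI(2)[OF x]] linear_map_zero[OF K.emb_linear T_module K.Q_module] by simp
    have YX: "T.br ?Y ?X \<in> I" "T.br ?Y ?X \<in> TKK_grade R V 0"
      using T.ideal_right[OF i inI(2)[OF x]] K.brG[OF TKK_in_mem[OF y] TKK_in_mem[OF inI(1)[OF x]]] by simp_all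
    have "triple W \<sigma> q (\<iota> (- \<sigma>) y) (\<iota> \<sigma> x) = K.Q.br (K.Q.br q (K.emb ?Y)) (K.emb ?X)"
      using W_triple[OF qg, of "\<iota> (- \<sigma>) y" "\<iota> \<sigma> x"] emb_mem[OF y] emb_mem[OF inI(1)[OF x]] by (simp add: emb_in)
    also have "\<dots> = K.emb (\<delta> (T.br ?Y ?X))"
      using K.Q.jacobi_left[of q "K.emb ?Y" "K.emb ?X"] z act[OF YX(1)] K.emb_closed[of "\<delta> (T.br ?Y ?X)"]
        T.Der_closed[OF K.pder_der[OF I(2)] i YX(1)]
      by (simp add: K.emb_closed K.emb_bracket[symmetric])
    finally show ?thesis using emb_grade_image[of "\<delta> (T.br ?Y ?X)" \<sigma>] dG[OF YX refl] by simp
  qed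
  show "\<exists>I. pair_ideal R V I \<and> (\<forall>\<tau>. pair_ann V I \<tau> = {pzero V \<tau>}) \<and>
        (\<forall>y\<in>I (- \<sigma>). \<forall>x\<in>pcarrier V \<sigma>. triple W \<sigma> q (\<iota> (- \<sigma>) y) (\<iota> \<sigma> x) \<in> \<iota> \<sigma> ` pcarrier V \<sigma>) \<and>
        (\<forall>y\<in>pcarrier V (- \<sigma>). \<forall>x\<in>I \<sigma>. triple W \<sigma> q (\<iota> (- \<sigma>) y) (\<iota> \<sigma> x) \<in> \<iota> \<sigma> ` pcarrier V \<sigma>) \<and>
        (\<forall>y\<in>I (- \<sigma>). \<forall>x\<in>pcarrier V (- \<sigma>).
           triple W (- \<sigma>) (\<iota> (- \<sigma>) y) q (\<iota> (- \<sigma>) x) \<in> \<iota> (- \<sigma>) ` pcarrier V (- \<sigma>)) \<and>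
        ((\<exists>y\<in>I (- \<sigma>). \<exists>x\<in>pcarrier V \<sigma>. triple W \<sigma> q (\<iota> (- \<sigma>) y) (\<iota> \<sigma> x) \<noteq> pzero W \<sigma>) \<or>
         (\<exists>y\<in>pcarrier V (- \<sigma>). \<exists>x\<in>I \<sigma>. triple W \<sigma> q (\<iota> (- \<sigma>) y) (\<iota> \<sigma> x) \<noteq> pzero W \<sigma>) \<or>
         (\<exists>y\<in>I (- \<sigma>). \<exists>x\<in>pcarrier V (- \<sigma>).
            triple W (- \<sigma>) (\<iota> (- \<sigma>) y) q (\<iota> (- \<sigma>) x) \<noteq> pzero W (- \<sigma>)))"
  proof (intro exI[of _ ?I] conjI allI ballI)
    show "pair_ideal R V ?I" by (rule pair_part_ideal[OF i])
    show "pair_ann V ?I \<tau> = {pzero V \<tau>}" for \<tau> by (rule pair_part_ann[OF ess I(3)])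
    fix x y
    show "triple W \<sigma> q (\<iota> (- \<sigma>) y) (\<iota> \<sigma> x) \<in> \<iota> \<sigma> ` pcarrier V \<sigma>" if "y \<in> ?I (- \<sigma>)" "x \<in> pcarrier V \<sigma>"
      unfolding c1(1)[OF that] by (rule emb_grade_image[OF K.brG[OF c1(2)[OF that] TKK_in_mem[OF that(2)]]]) simp
    show "triple W (- \<sigma>) (\<iota> (- \<sigma>) y) q (\<iota> (- \<sigma>) x) \<in> \<iota> (- \<sigma>) ` pcarrier V (- \<sigma>)"
      if "y \<in> ?I (- \<sigma>)" "x \<in> pcarrier V (- \<sigma>)"
    proof -
      have d: "\<delta> (TKK_in R V (- \<sigma>) y) \<in> TKK_grade R V 0"
        using dG[OF inI(2)[OF that(1)] TKK_in_mem[OF inI(1)[OF that(1)]]] by simp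
      show ?thesis unfolding c3[OF that]
        by (rule emb_grade_image[OF K.G_neg[OF K.brG[OF d TKK_in_mem[OF that(2)]]]]) simp
    qed
    show "triple W \<sigma> q (\<iota> (- \<sigma>) y) (\<iota> \<sigma> x) \<in> \<iota> \<sigma> ` pcarrier V \<sigma>" if "y \<in> pcarrier V (- \<sigma>)" "x \<in> ?I \<sigma>"
      by (rule c2[OF that])
  next
    show "(\<exists>y\<in>?I (- \<sigma>). \<exists>x\<in>pcarrier V \<sigma>. triple W \<sigma> q (\<iota> (- \<sigma>) y) (\<iota> \<sigma> x) \<noteq> pzero W \<sigma>) \<or>
         (\<exists>y\<in>pcarrier V (- \<sigma>). \<exists>x\<in>?I \<sigma>. triple W \<sigma> q (\<iota> (- \<sigma>) y) (\<iota> \<sigma> x) \<noteq> pzero W \<sigma>) \<or>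
         (\<exists>y\<in>?I (- \<sigma>). \<exists>x\<in>pcarrier V (- \<sigma>).
            triple W (- \<sigma>) (\<iota> (- \<sigma>) y) q (\<iota> (- \<sigma>) x) \<noteq> pzero W (- \<sigma>))"
    \<comment> \<open>If all products vanish, then [[q,y],v] = 0 for y in the domain of degree
      opposite to q and v of degree 1 or -1, so \<open>Q_vanish2\<close> gives q = 0. The sign of v
      decides which of the first and third kinds of products is used.\<close>
    proof (rule ccontr)
      assume contra: "\<not> ?thesis"
      have "q = \<zero>\<^bsub>K.Q\<^esub>"
      proof (rule K.Q_vanish2[OF qg deg_cases ess I(3)])
        fix Y t X assume Y: "Y \<in> I" "Y \<in> TKK_grade R V (- deg \<sigma>)" and t: "t = (1::int) \<or> t = -1"
          and X: "X \<in> TKK_grade R V t"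
        obtain y where y: "y \<in> pcarrier V (- \<sigma>)" "Y = TKK_in R V (- \<sigma>) y"
          using Y(2) TKK_grade_deg[of "- \<sigma>"] by auto
        have yI: "y \<in> ?I (- \<sigma>)" using y Y(1) by (simp add: pair_part_def)
        obtain \<tau> where \<tau>: "t = deg \<tau>" using sign_deg_cases[OF t] .
        then obtain x where x: "x \<in> pcarrier V \<tau>" "X = TKK_in R V \<tau> x" using X TKK_grade_deg by auto
        have d: "\<delta> Y \<in> TKK_grade R V 0" using dG[OF Y] by simp
        note [simp] = K.G_closed[OF d] K.G_closed[OF X]
        have e: "K.Q.br (K.Q.br q (K.emb Y)) (K.emb X) = K.emb (T.br (\<delta> Y) X)"
          by (simp add: act[OF Y(1)] K.emb_bracket)
        show "K.Q.br (K.Q.br q (K.emb Y)) (K.emb X) = \<zero>\<^bsub>K.Q\<^esub>"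
        proof (cases "\<tau> = \<sigma>")
          case True
          then show ?thesis using c1(1)[OF yI] x contra yI unfolding e by (simp add: y(2)[symmetric] W_parts)
        next
          case False
          then have \<tau>': "\<tau> = - \<sigma>" by (cases \<sigma>; cases \<tau>) auto
          then have "K.emb (\<ominus>\<^bsub>T\<^esub> T.br (\<delta> Y) X) = \<zero>\<^bsub>K.Q\<^esub>"
            using c3[OF yI] x contra yI by (simp add: y(2)[symmetric] W_parts)
          then have "\<ominus>\<^bsub>T\<^esub> T.br (\<delta> Y) X = \<zero>\<^bsub>T\<^esub>" by (intro K.emb_eq_zero) simp_all
          then have "\<ominus>\<^bsub>T\<^esub> (\<ominus>\<^bsub>T\<^esub> T.br (\<delta> Y) X) = \<zero>\<^bsub>T\<^esub>" by simp
          then have "T.br (\<delta> Y) X = \<zero>\<^bsub>T\<^esub>" by simp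
          then show ?thesis unfolding e using linear_map_zero[OF K.emb_linear T_module K.Q_module] by simp
        qed
      qed
      then show False using qnz by simp
    qed
  qed
qed

end

section \<open>The universal property\<close>

text \<open>Closure under degrees 1 and -1 suffices: by Jacobi a bracket with [u,v] is a difference
  of two successive brackets with u and v.\<close>

lemma (in three_graded) ideal_from_generators:
  assumes gen: "lie_prod R L (G 1) (G (-1)) = G 0" and H: "submodule H R L"
    and h: "\<And>x s l. \<lbrakk>x \<in> H; s = 1 \<or> s = -1; l \<in> G s\<rbrakk> \<Longrightarrow> x \<bullet> l \<in> H"
  shows "lie_ideal R L H"
proof -
  have Hc: "x \<in> carrier L" if "x \<in> H" for x using submoduleE(1)[OF H] that by blast
  have Gc: "x \<in> carrier L" if "x \<in> G k" for x k using submoduleE(1)[OF grade_submodule] that by blast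
  let ?B = "{u \<bullet> v |u v. u \<in> G 1 \<and> v \<in> G (-1)}"
  have B: "?B \<subseteq> carrier L" using Gc by auto
  have h0: "x \<bullet> l \<in> H" if x: "x \<in> H" and l: "l \<in> G 0" for x l
  proof -
    have "l \<in> module_span R L ?B" using l gen by (simp add: lie_prod_def)
    then show ?thesis using B
    proof (induction rule: module_span_induct)
      case (base l)
      then obtain u v where l: "l = u \<bullet> v" and uv: "u \<in> G 1" "v \<in> G (-1)" by blast
      note [simp] = Gc[OF uv(1)] Gc[OF uv(2)] Hc[OF x]
      have "x \<bullet> u \<bullet> v = (x \<bullet> u) \<bullet> v \<boxplus> \<boxminus> ((x \<bullet> v) \<bullet> u)"
        using jacobi_der[of x u v] br_anti[of "x \<bullet> v" u] by simp
      moreover have "(x \<bullet> u) \<bullet> v \<in> H" "(x \<bullet> v) \<bullet> u \<in> H"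
        using h[OF h[OF x _ uv(1)] _ uv(2)] h[OF h[OF x _ uv(2)] _ uv(1)] by simp_all
      ultimately show ?case unfolding l using submoduleE(3,5)[OF H] by simp
    next
      case zero then show ?case using Hc[OF x] submodule_zero[OF H] by simp
    next
      case (add u v) then show ?case using Hc[OF x] submoduleE(5)[OF H] by (simp add: br_add_r)
    next
      case (smult a u) then show ?case using Hc[OF x] submoduleE(4)[OF H] by (simp add: br_smult_r)
    qed
  qed
  show ?thesis unfolding lie_ideal_def
  proof (intro conjI H ballI)
    fix x y assume x: "x \<in> H" and y: "y \<in> carrier L"
    obtain a b c where 1: "a \<in> G (-1)" "b \<in> G 0" "c \<in> G 1" "y = a \<boxplus> b \<boxplus> c" using decompose[OF y] .
    then show "x \<bullet> y \<in> H"
      using h[OF x _ 1(1)] h0[OF x 1(2)] h[OF x _ 1(3)] Hc[OF x] Gc submoduleE(5)[OF H] by (simp add: br_add_r)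
  qed
qed

lemma (in three_graded) subgraded: "add_pow R (6::nat) \<one> \<in> Units R \<Longrightarrow> subgraded_lie R L G"
  unfolding subgraded_lie_def subgraded_lie_axioms_def
  using lie_algebra_axioms grade_submodule grade_trivial grade_bracket by simp

context jordan_pair
begin

lemma pair_idealD:
  assumes I: "pair_ideal R V I"
  shows pair_ideal_sub: "submodule (I \<sigma>) R (part V \<sigma>)"
    and pair_ideal_closed: "x \<in> I \<sigma> \<Longrightarrow> x \<in> pcarrier V \<sigma>"
    and pair_ideal_3: "\<lbrakk>x \<in> pcarrier V \<sigma>; y \<in> pcarrier V (- \<sigma>); z \<in> I \<sigma>\<rbrakk> \<Longrightarrow> triple V \<sigma> x y z \<in> I \<sigma>"
    and pair_ideal_1: "\<lbrakk>x \<in> I \<sigma>; y \<in> pcarrier V (- \<sigma>); z \<in> pcarrier V \<sigma>\<rbrakk> \<Longrightarrow> triple V \<sigma> x y z \<in> I \<sigma>"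
    and pair_ideal_2: "\<lbrakk>x \<in> pcarrier V \<sigma>; y \<in> I (- \<sigma>); z \<in> pcarrier V \<sigma>\<rbrakk> \<Longrightarrow> triple V \<sigma> x y z \<in> I \<sigma>"
proof -
  have s: "submodule (I \<sigma>) R (part V \<sigma>)" for \<sigma> using I by (simp add: pair_ideal_def)
  then show "submodule (I \<sigma>) R (part V \<sigma>)" .
  have c: "x \<in> I \<sigma> \<Longrightarrow> x \<in> pcarrier V \<sigma>" for x \<sigma> using P.submoduleE(1)[OF s] by blast
  then show "x \<in> I \<sigma> \<Longrightarrow> x \<in> pcarrier V \<sigma>" .
  have t: "\<lbrakk>x \<in> pcarrier V \<sigma>; y \<in> pcarrier V (- \<sigma>); z \<in> I \<sigma>\<rbrakk> \<Longrightarrow> triple V \<sigma> x y z \<in> I \<sigma>" for x y z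
    using I by (simp add: pair_ideal_def)
  then show "\<lbrakk>x \<in> pcarrier V \<sigma>; y \<in> pcarrier V (- \<sigma>); z \<in> I \<sigma>\<rbrakk> \<Longrightarrow> triple V \<sigma> x y z \<in> I \<sigma>" .
  show "\<lbrakk>x \<in> I \<sigma>; y \<in> pcarrier V (- \<sigma>); z \<in> pcarrier V \<sigma>\<rbrakk> \<Longrightarrow> triple V \<sigma> x y z \<in> I \<sigma>"
    using t[of z y x] c[of x \<sigma>] by (simp add: triple_commute)
  show "triple V \<sigma> x y z \<in> I \<sigma>" if "x \<in> pcarrier V \<sigma>" "y \<in> I (- \<sigma>)" "z \<in> pcarrier V \<sigma>"
  proof -
    have q: "quad V \<sigma> u y \<in> I \<sigma>" if "u \<in> pcarrier V \<sigma>" for u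
      using I that \<open>y \<in> I (- \<sigma>)\<close> by (simp add: pair_ideal_def)
    have "quad V \<sigma> (x \<oplus>\<^bsub>part V \<sigma>\<^esub> z) y \<ominus>\<^bsub>part V \<sigma>\<^esub> quad V \<sigma> x y \<ominus>\<^bsub>part V \<sigma>\<^esub> quad V \<sigma> z y \<in> I \<sigma>"
      using that by (intro P.submodule_minus[OF s] q) simp_all
    then show ?thesis using that c[OF that(2)] by (simp add: triple_eq_quad)
  qed
qed

end

text \<open>Only a homomorphism is assumed. The locale is instantiated both with the inclusion of V
  in S and with the identity of V, so that one set of generators serves for brackets in TKK(S) and
  for the ideal of T generated by I.\<close>

locale pair_map = jordan_pair R V + S: jordan_pair R S
  for R :: "('a, 'r) ring_scheme" (structure) and V :: "('a, 'v) jordan_pair" and S :: "('a, 's) jordan_pair" +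
  fixes \<kappa> :: "sign \<Rightarrow> 'v \<Rightarrow> 's"
  assumes six: "add_pow R (6::nat) \<one> \<in> Units R" and kappa_hom: "pair_hom R V S \<kappa>"
begin

lemma N_subgraded: "subgraded_lie R S.T (TKK_grade R S)"
  by (rule S.T.subgraded[OF six])

sublocale N: subgraded_lie R "TKK R S" "TKK_grade R S" by (rule N_subgraded)

lemma kappa_linear: "linear_map R (part V \<sigma>) (part S \<sigma>) (\<kappa> \<sigma>)"
  using kappa_hom by (simp add: pair_hom_def)

lemma kappa_closed [simp, intro]: "x \<in> pcarrier V \<sigma> \<Longrightarrow> \<kappa> \<sigma> x \<in> pcarrier S \<sigma>"
  by (rule linear_map_closed[OF kappa_linear])

lemma kappa_triple:
  "\<lbrakk>x \<in> pcarrier V \<sigma>; y \<in> pcarrier V (- \<sigma>); z \<in> pcarrier V \<sigma>\<rbrakk> \<Longrightarrow>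
    \<kappa> \<sigma> (triple V \<sigma> x y z) = triple S \<sigma> (\<kappa> \<sigma> x) (\<kappa> (- \<sigma>) y) (\<kappa> \<sigma> z)"
  by (rule pair_hom_triple[OF quadratic_pair_axioms S.quadratic_pair_axioms kappa_hom])

definition k :: "sign \<Rightarrow> 'v \<Rightarrow> 's \<times> (sign \<Rightarrow> 's \<Rightarrow> 's) \<times> 's" where
  "k \<sigma> x = TKK_in R S \<sigma> (\<kappa> \<sigma> x)"

lemma k_grade: "x \<in> pcarrier V \<sigma> \<Longrightarrow> k \<sigma> x \<in> TKK_grade R S (deg \<sigma>)"
  unfolding k_def by (rule S.TKK_in_mem) simp

lemma k_closed [simp, intro]: "x \<in> pcarrier V \<sigma> \<Longrightarrow> k \<sigma> x \<in> carrier S.T"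
  unfolding k_def by (rule S.TKK_in_closed) simp

lemma k_triple:
  "\<lbrakk>x \<in> pcarrier V \<sigma>; y \<in> pcarrier V (- \<sigma>); z \<in> pcarrier V \<sigma>\<rbrakk> \<Longrightarrow>
    S.T.br (S.T.br (k \<sigma> x) (k (- \<sigma>) y)) (k \<sigma> z) = k \<sigma> (triple V \<sigma> x y z)"
  by (simp add: k_def S.TKK_triple kappa_triple)

lemma k_same: "\<lbrakk>x \<in> pcarrier V \<sigma>; y \<in> pcarrier V \<sigma>\<rbrakk> \<Longrightarrow> S.T.br (k \<sigma> x) (k \<sigma> y) = \<zero>\<^bsub>S.T\<^esub>"
  by (rule N.br0[OF k_grade k_grade]) (cases \<sigma>; simp)+

text \<open>The elements of I and their brackets with the opposite part of V. In T their span is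
  already the ideal generated by I, because these elements are stable up to sign under brackets with
  V.\<close>

definition ideal_gens :: "(sign \<Rightarrow> 'v set) \<Rightarrow> ('s \<times> (sign \<Rightarrow> 's \<Rightarrow> 's) \<times> 's) set" where
  "ideal_gens I = {k \<tau> i |\<tau> i. i \<in> I \<tau>} \<union> {S.T.br (k \<tau> i) (k (- \<tau>) v) |\<tau> i v. i \<in> I \<tau> \<and> v \<in> pcarrier V (- \<tau>)}"

lemma ideal_gens_in: "i \<in> I \<tau> \<Longrightarrow> k \<tau> i \<in> ideal_gens I"
  unfolding ideal_gens_def by blast

lemma ideal_gens_br: "\<lbrakk>i \<in> I \<tau>; v \<in> pcarrier V (- \<tau>)\<rbrakk> \<Longrightarrow> S.T.br (k \<tau> i) (k (- \<tau>) v) \<in> ideal_gens I"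
  unfolding ideal_gens_def by blast

lemma ideal_gens_closed: "\<lbrakk>pair_ideal R V I; n \<in> ideal_gens I\<rbrakk> \<Longrightarrow> n \<in> carrier S.T"
  by (auto simp: ideal_gens_def dest: pair_ideal_closed)

text \<open>The sign is unavoidable: for i in I and u, v of the opposite sign, [[i,u],v] = -{u,i,v}.
  Brackets of equal sign are zero by degree, which explains the first alternative.\<close>

lemma ideal_gens_bracket:
  assumes I: "pair_ideal R V I" and n: "n \<in> ideal_gens I" and v: "v \<in> pcarrier V \<sigma>"
  shows "S.T.br n (k \<sigma> v) = \<zero>\<^bsub>S.T\<^esub> \<or> S.T.br n (k \<sigma> v) \<in> ideal_gens I \<or> \<ominus>\<^bsub>S.T\<^esub> S.T.br n (k \<sigma> v) \<in> ideal_gens I"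
proof -
  consider \<tau> i where "n = k \<tau> i" "i \<in> I \<tau>"
    | \<tau> i u where "n = S.T.br (k \<tau> i) (k (- \<tau>) u)" "i \<in> I \<tau>" "u \<in> pcarrier V (- \<tau>)"
    using n unfolding ideal_gens_def by blast
  then show ?thesis
  proof cases
    case 1
    note ic = pair_ideal_closed[OF I 1(2)]
    show ?thesis
    proof (cases "\<sigma> = \<tau>")
      case True then show ?thesis using k_same[OF ic] v 1(1) by simp
    next
      case False
      then have s: "\<sigma> = - \<tau>" by (cases \<sigma>; cases \<tau>) auto
      then show ?thesis using 1 v unfolding ideal_gens_def by blast
    qed
  next
    case 2
    note ic = pair_ideal_closed[OF I 2(2)]
    show ?thesis
    proof (cases "\<sigma> = \<tau>")
      case True
      then show ?thesis using k_triple[OF ic 2(3)] v 2 ideal_gens_in[where I = I, OF pair_ideal_1[OF I 2(2,3)]] by simp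
    next
      case False
      then have s: "\<sigma> = - \<tau>" by (cases \<sigma>; cases \<tau>) auto
      note [simp] = k_closed[OF ic] k_closed[OF 2(3)]
      have v': "v \<in> pcarrier V (- \<tau>)" using v s by simp
      note [simp] = k_closed[OF v']
      have "\<ominus>\<^bsub>S.T\<^esub> S.T.br n (k \<sigma> v) = S.T.br (S.T.br (k (- \<tau>) u) (k \<tau> i)) (k (- \<tau>) v)"
        using S.T.br_anti[of "k \<tau> i" "k (- \<tau>) u"] by (simp add: 2(1) s S.T.br_neg_l)
      also have "\<dots> = k (- \<tau>) (triple V (- \<tau>) u i v)"
        using k_triple[of u "- \<tau>" i v] 2(3) ic v' by simp
      finally show ?thesis using ideal_gens_in[where I = I, OF pair_ideal_2[OF I, of u "- \<tau>" i v]] 2 v' by simp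
    qed
  qed
qed

end

section \<open>Pairs of \<MM>-quotients: vanishing against dense ideals\<close>

locale quotient_pair = nondeg_pair R V + pair_map R V S \<kappa>
  for R :: "('a, 'r) ring_scheme" (structure) and V :: "('a, 'v) jordan_pair" and S :: "('a, 's) jordan_pair"
    and \<kappa> :: "sign \<Rightarrow> 'v \<Rightarrow> 's" +
  assumes mq: "M_quotients R V S \<kappa>"
begin

lemma kappa_inj: "\<lbrakk>\<kappa> \<sigma> x = \<kappa> \<sigma> y; x \<in> pcarrier V \<sigma>; y \<in> pcarrier V \<sigma>\<rbrakk> \<Longrightarrow> x = y"
  using mq by (auto simp: M_quotients_def pair_mono_def dest: inj_onD)

lemma kappa_zero: "\<kappa> \<sigma> (pzero V \<sigma>) = pzero S \<sigma>"
  by (rule linear_map_zero[OF kappa_linear is_module S.is_module])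

text \<open>The inclusions from the definition of \<MM>-quotients, separated from the nonvanishing
  condition, because the proof uses such an ideal and the nonzero product for different
  purposes.\<close>

definition denominators :: "sign \<Rightarrow> 's \<Rightarrow> (sign \<Rightarrow> 'v set) \<Rightarrow> bool" where
  "denominators \<sigma> q I \<longleftrightarrow> pair_ideal R V I \<and> (\<forall>\<tau>. pair_ann V I \<tau> = {pzero V \<tau>}) \<and>
        (\<forall>y\<in>I (- \<sigma>). \<forall>x\<in>pcarrier V \<sigma>. triple S \<sigma> q (\<kappa> (- \<sigma>) y) (\<kappa> \<sigma> x) \<in> \<kappa> \<sigma> ` pcarrier V \<sigma>) \<and>
        (\<forall>y\<in>pcarrier V (- \<sigma>). \<forall>x\<in>I \<sigma>. triple S \<sigma> q (\<kappa> (- \<sigma>) y) (\<kappa> \<sigma> x) \<in> \<kappa> \<sigma> ` pcarrier V \<sigma>) \<and>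
        (\<forall>y\<in>I (- \<sigma>). \<forall>x\<in>pcarrier V (- \<sigma>).
           triple S (- \<sigma>) (\<kappa> (- \<sigma>) y) q (\<kappa> (- \<sigma>) x) \<in> \<kappa> (- \<sigma>) ` pcarrier V (- \<sigma>))"

text \<open>The three kinds of nonzero products in the definition of \<open>\<MM>\<close>-quotients are, up to sign, of the form \<open>[[q, u], v]\<close>.\<close>

lemma denominators_ex:
  assumes q: "q \<in> pcarrier S \<sigma>" "q \<noteq> pzero S \<sigma>"
  shows "\<exists>I \<tau> u v p. denominators \<sigma> q I \<and> u \<in> pcarrier V (- \<sigma>) \<and> v \<in> pcarrier V \<tau> \<and> p \<in> pcarrier V \<tau> \<and>
    p \<noteq> pzero V \<tau> \<and> (k \<tau> p = S.T.br (S.T.br (TKK_in R S \<sigma> q) (k (- \<sigma>) u)) (k \<tau> v) \<or>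
      k \<tau> p = \<ominus>\<^bsub>S.T\<^esub> S.T.br (S.T.br (TKK_in R S \<sigma> q) (k (- \<sigma>) u)) (k \<tau> v))"
proof -
  obtain I where I: "denominators \<sigma> q I" and nz:
    "((\<exists>y\<in>I (- \<sigma>). \<exists>x\<in>pcarrier V \<sigma>. triple S \<sigma> q (\<kappa> (- \<sigma>) y) (\<kappa> \<sigma> x) \<noteq> pzero S \<sigma>) \<or>
         (\<exists>y\<in>pcarrier V (- \<sigma>). \<exists>x\<in>I \<sigma>. triple S \<sigma> q (\<kappa> (- \<sigma>) y) (\<kappa> \<sigma> x) \<noteq> pzero S \<sigma>) \<or>
         (\<exists>y\<in>I (- \<sigma>). \<exists>x\<in>pcarrier V (- \<sigma>).
            triple S (- \<sigma>) (\<kappa> (- \<sigma>) y) q (\<kappa> (- \<sigma>) x) \<noteq> pzero S (- \<sigma>)))"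
    using mq q unfolding M_quotients_def denominators_def by blast
  have id: "pair_ideal R V I" using I by (simp add: denominators_def)
  note ic = pair_ideal_closed[OF id]
  have plus: ?thesis if h: "y \<in> pcarrier V (- \<sigma>)" "x \<in> pcarrier V \<sigma>"
    "triple S \<sigma> q (\<kappa> (- \<sigma>) y) (\<kappa> \<sigma> x) \<noteq> pzero S \<sigma>"
    "triple S \<sigma> q (\<kappa> (- \<sigma>) y) (\<kappa> \<sigma> x) \<in> \<kappa> \<sigma> ` pcarrier V \<sigma>" for x y
  proof -
    obtain p where p: "p \<in> pcarrier V \<sigma>" "\<kappa> \<sigma> p = triple S \<sigma> q (\<kappa> (- \<sigma>) y) (\<kappa> \<sigma> x)" using h(4) by auto
    have "p \<noteq> pzero V \<sigma>" using p h(3) kappa_zero by metis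
    moreover have "k \<sigma> p = S.T.br (S.T.br (TKK_in R S \<sigma> q) (k (- \<sigma>) y)) (k \<sigma> x)"
      using q(1) h(1,2) by (simp add: k_def S.TKK_triple p(2))
    ultimately show ?thesis using I h(1,2) p(1) by blast
  qed
  have minus: ?thesis if h: "y \<in> pcarrier V (- \<sigma>)" "x \<in> pcarrier V (- \<sigma>)"
    "triple S (- \<sigma>) (\<kappa> (- \<sigma>) y) q (\<kappa> (- \<sigma>) x) \<noteq> pzero S (- \<sigma>)"
    "triple S (- \<sigma>) (\<kappa> (- \<sigma>) y) q (\<kappa> (- \<sigma>) x) \<in> \<kappa> (- \<sigma>) ` pcarrier V (- \<sigma>)" for x y
  proof -
    obtain p where p: "p \<in> pcarrier V (- \<sigma>)" "\<kappa> (- \<sigma>) p = triple S (- \<sigma>) (\<kappa> (- \<sigma>) y) q (\<kappa> (- \<sigma>) x)" using h(4) by auto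
    have "p \<noteq> pzero V (- \<sigma>)" using p h(3) kappa_zero by metis
    moreover have "k (- \<sigma>) p = S.T.br (S.T.br (k (- \<sigma>) y) (TKK_in R S \<sigma> q)) (k (- \<sigma>) x)"
      using q(1) h(1,2) S.TKK_triple[of "\<kappa> (- \<sigma>) y" "- \<sigma>" q "\<kappa> (- \<sigma>) x"] by (simp add: k_def p(2))
    then have "k (- \<sigma>) p = \<ominus>\<^bsub>S.T\<^esub> S.T.br (S.T.br (TKK_in R S \<sigma> q) (k (- \<sigma>) y)) (k (- \<sigma>) x)"
      using S.T.br_anti[of "TKK_in R S \<sigma> q" "k (- \<sigma>) y"] q(1) h(1,2) by (simp add: S.T.br_neg_l)
    ultimately show ?thesis using I h(1,2) p(1) by blast
  qed
  from nz show ?thesis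
  proof (elim disjE bexE)
    fix y x assume "y \<in> I (- \<sigma>)" "x \<in> pcarrier V \<sigma>" "triple S \<sigma> q (\<kappa> (- \<sigma>) y) (\<kappa> \<sigma> x) \<noteq> pzero S \<sigma>"
    then show ?thesis using plus[of y x] ic I by (simp add: denominators_def)
  next
    fix y x assume "y \<in> pcarrier V (- \<sigma>)" "x \<in> I \<sigma>" "triple S \<sigma> q (\<kappa> (- \<sigma>) y) (\<kappa> \<sigma> x) \<noteq> pzero S \<sigma>"
    then show ?thesis using plus[of y x] ic I by (simp add: denominators_def)
  next
    fix y x assume "y \<in> I (- \<sigma>)" "x \<in> pcarrier V (- \<sigma>)"
      "triple S (- \<sigma>) (\<kappa> (- \<sigma>) y) q (\<kappa> (- \<sigma>) x) \<noteq> pzero S (- \<sigma>)"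
    then show ?thesis using minus[of y x] ic I by (simp add: denominators_def)
  qed
qed

lemma k_eq_zero: "\<lbrakk>k \<tau> x = \<zero>\<^bsub>S.T\<^esub>; x \<in> pcarrier V \<tau>\<rbrakk> \<Longrightarrow> x = pzero V \<tau>"
  using S.TKK_in_inject[of \<tau> "\<kappa> \<tau> x" "pzero S \<tau>"] kappa_inj[of \<tau> x "pzero V \<tau>"] kappa_zero
  by (simp add: k_def)

text \<open>An element \<open>z\<close> is annihilated if \<open>[[z, N], L] = 0\<close>, where \<open>N\<close> and \<open>L\<close> are generated by \<open>I\<close> and \<open>V\<close>.\<close>

definition annihilated :: "(sign \<Rightarrow> 'v set) \<Rightarrow> 's \<times> (sign \<Rightarrow> 's \<Rightarrow> 's) \<times> 's \<Rightarrow> bool" where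
  "annihilated I z \<longleftrightarrow> z \<in> carrier S.T \<and>
    (\<forall>n\<in>ideal_gens I. \<forall>\<tau>. \<forall>l\<in>pcarrier V \<tau>. S.T.br (S.T.br z n) (k \<tau> l) = \<zero>\<^bsub>S.T\<^esub>)"

text \<open>In [[z,v],n] = [z,[v,n]] - [v,[z,n]] the last term is zero by hypothesis, and [v,n] is
  zero or again a generator up to sign.\<close>

lemma annihilated_bracket:
  assumes I: "pair_ideal R V I" and z: "annihilated I z" and v: "v \<in> pcarrier V \<sigma>"
  shows "annihilated I (S.T.br z (k \<sigma> v))"
proof -
  have [simp]: "z \<in> carrier S.T" using z by (simp add: annihilated_def)
  have "S.T.br (S.T.br (S.T.br z (k \<sigma> v)) n) (k \<tau> l) = \<zero>\<^bsub>S.T\<^esub>" if n: "n \<in> ideal_gens I" and l: "l \<in> pcarrier V \<tau>" for n \<tau> l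
  proof -
    note [simp] = ideal_gens_closed[OF I n] k_closed[OF v] k_closed[OF l]
    define m where "m = S.T.br n (k \<sigma> v)"
    have [simp]: "m \<in> carrier S.T" by (simp add: m_def)
    have zn: "S.T.br (S.T.br z n) (k \<sigma> v) = \<zero>\<^bsub>S.T\<^esub>" using z n v by (simp add: annihilated_def)
    have "S.T.br (k \<sigma> v) (S.T.br z n) = \<zero>\<^bsub>S.T\<^esub>"
      using S.T.br_anti[of "S.T.br z n" "k \<sigma> v"] zn by simp
    moreover have "S.T.br (k \<sigma> v) n = \<ominus>\<^bsub>S.T\<^esub> m" unfolding m_def by (rule S.T.br_anti) simp_all
    ultimately have e: "S.T.br (S.T.br z (k \<sigma> v)) n = \<ominus>\<^bsub>S.T\<^esub> S.T.br z m"
      using S.T.jacobi_left[of z "k \<sigma> v" n] by (simp add: S.T.br_neg_r)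
    have "S.T.br (S.T.br z m) (k \<tau> l) = \<zero>\<^bsub>S.T\<^esub>"
    proof -
      consider "m = \<zero>\<^bsub>S.T\<^esub>" | "m \<in> ideal_gens I" | "\<ominus>\<^bsub>S.T\<^esub> m \<in> ideal_gens I"
        using ideal_gens_bracket[OF I n v] by (auto simp: m_def)
      then show ?thesis
      proof cases
        case 1 then show ?thesis by simp
      next
        case 2 then show ?thesis using z l by (simp add: annihilated_def)
      next
        case 3
        then have "S.T.br (S.T.br z (\<ominus>\<^bsub>S.T\<^esub> m)) (k \<tau> l) = \<zero>\<^bsub>S.T\<^esub>" using z l unfolding annihilated_def by blast
        then have "\<ominus>\<^bsub>S.T\<^esub> (\<ominus>\<^bsub>S.T\<^esub> S.T.br (S.T.br z m) (k \<tau> l)) = \<zero>\<^bsub>S.T\<^esub>"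
          by (simp add: S.T.br_neg_r S.T.br_neg_l)
        then show ?thesis by simp
      qed
    qed
    then show ?thesis by (simp add: e S.T.br_neg_l)
  qed
  then show ?thesis using k_closed[OF v] by (simp add: annihilated_def)
qed

text \<open>Such an element p of V satisfies the three conditions for membership in the annihilator
  of I. Two are read off directly from the generators in I; the third needs nondegeneracy of
  V.\<close>

lemma annihilated_k:
  assumes I: "pair_ideal R V I" "\<And>\<tau>. pair_ann V I \<tau> = {pzero V \<tau>}"
    and p: "p \<in> pcarrier V \<tau>" and a: "annihilated I (k \<tau> p) \<or> annihilated I (\<ominus>\<^bsub>S.T\<^esub> k \<tau> p)"
  shows "p = pzero V \<tau>"
proof -
  note ic = pair_ideal_closed[OF I(1)]
  note [simp] = k_closed[OF p]
  have a': "S.T.br (S.T.br (k \<tau> p) n) (k \<sigma> l) = \<zero>\<^bsub>S.T\<^esub>" if n: "n \<in> ideal_gens I" and l: "l \<in> pcarrier V \<sigma>" for n \<sigma> l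
    using a
  proof
    assume "annihilated I (\<ominus>\<^bsub>S.T\<^esub> k \<tau> p)"
    then have "S.T.br (S.T.br (\<ominus>\<^bsub>S.T\<^esub> k \<tau> p) n) (k \<sigma> l) = \<zero>\<^bsub>S.T\<^esub>" using n l unfolding annihilated_def by blast
    then have "\<ominus>\<^bsub>S.T\<^esub> (\<ominus>\<^bsub>S.T\<^esub> S.T.br (S.T.br (k \<tau> p) n) (k \<sigma> l)) = \<zero>\<^bsub>S.T\<^esub>"
      using ideal_gens_closed[OF I(1) n] l by (simp add: S.T.br_neg_l)
    then show ?thesis using ideal_gens_closed[OF I(1) n] l by simp
  qed (use n l in \<open>simp add: annihilated_def\<close>)
  have 1: "triple V \<tau> p i v = pzero V \<tau>" if i: "i \<in> I (- \<tau>)" and v: "v \<in> pcarrier V \<tau>" for i v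
  proof (rule k_eq_zero)
    show "k \<tau> (triple V \<tau> p i v) = \<zero>\<^bsub>S.T\<^esub>"
      using a'[OF ideal_gens_in[where I = I, OF i] v] k_triple[OF p ic[OF i] v] by simp
  qed (use p ic[OF i] v in simp)
  have 2: "triple V (- \<tau>) v p i = pzero V (- \<tau>)" if i: "i \<in> I (- \<tau>)" and v: "v \<in> pcarrier V (- \<tau>)" for i v
  proof -
    have "triple V (- \<tau>) i p v = pzero V (- \<tau>)"
    proof (rule k_eq_zero)
      note [simp] = k_closed[OF ic[OF i]] k_closed[OF v]
      have "k (- \<tau>) (triple V (- \<tau>) i p v) = S.T.br (S.T.br (k (- \<tau>) i) (k \<tau> p)) (k (- \<tau>) v)"
        using k_triple[of i "- \<tau>" p v] ic[OF i] p v by simp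
      also have "\<dots> = \<ominus>\<^bsub>S.T\<^esub> S.T.br (S.T.br (k \<tau> p) (k (- \<tau>) i)) (k (- \<tau>) v)"
        using S.T.br_anti[of "k \<tau> p" "k (- \<tau>) i"] by (simp add: S.T.br_neg_l)
      also have "\<dots> = \<zero>\<^bsub>S.T\<^esub>" using a'[OF ideal_gens_in[where I = I, OF i] v] by simp
      finally show "k (- \<tau>) (triple V (- \<tau>) i p v) = \<zero>\<^bsub>S.T\<^esub>" .
    qed (use p ic[OF i] v in simp)
    then show ?thesis using triple_commute[of v "- \<tau>" i p] ic[OF i] p v by simp
  qed
  \<comment> \<open>The generator [i,v] gives only [e,w] = 0 for e = {p,v,i} and every w of opposite
    sign. Hence {e,w,e} = 0, so Q_e = 0 and e = 0.\<close>
  have 3: "triple V \<tau> p v i = pzero V \<tau>" if i: "i \<in> I \<tau>" and v: "v \<in> pcarrier V (- \<tau>)" for i v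
  proof -
    note [simp] = k_closed[OF ic[OF i]] k_closed[OF v]
    let ?e = "triple V \<tau> p v i"
    have ec: "?e \<in> pcarrier V \<tau>" using p ic[OF i] v by simp
    let ?n = "S.T.br (k \<tau> i) (k (- \<tau>) v)"
    have pi: "S.T.br (k \<tau> p) (k \<tau> i) = \<zero>\<^bsub>S.T\<^esub>" by (rule k_same[OF p ic[OF i]])
    have "S.T.br (k \<tau> p) ?n = S.T.br (k \<tau> i) (S.T.br (k \<tau> p) (k (- \<tau>) v))"
      by (rule S.T.br_commute_op) (simp_all add: pi)
    also have "\<dots> = \<ominus>\<^bsub>S.T\<^esub> S.T.br (S.T.br (k \<tau> p) (k (- \<tau>) v)) (k \<tau> i)" by (rule S.T.br_anti) simp_all
    also have "\<dots> = \<ominus>\<^bsub>S.T\<^esub> k \<tau> ?e" by (simp add: k_triple[OF p v ic[OF i]])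
    finally have pn: "S.T.br (k \<tau> p) ?n = \<ominus>\<^bsub>S.T\<^esub> k \<tau> ?e" .
    show ?thesis
    proof (rule quad_eq_zero[OF ec])
      fix w assume w: "w \<in> pcarrier V (- \<tau>)"
      note [simp] = k_closed[OF w] k_closed[OF ec]
      have "S.T.br (S.T.br (k \<tau> p) ?n) (k (- \<tau>) w) = \<zero>\<^bsub>S.T\<^esub>"
        by (rule a'[OF ideal_gens_br[where I = I, OF i v] w])
      then have "\<ominus>\<^bsub>S.T\<^esub> (\<ominus>\<^bsub>S.T\<^esub> S.T.br (k \<tau> ?e) (k (- \<tau>) w)) = \<zero>\<^bsub>S.T\<^esub>" by (simp add: pn S.T.br_neg_l)
      then have "S.T.br (k \<tau> ?e) (k (- \<tau>) w) = \<zero>\<^bsub>S.T\<^esub>" by simp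
      then have "k \<tau> (triple V \<tau> ?e w ?e) = \<zero>\<^bsub>S.T\<^esub>" using k_triple[OF ec w ec] by simp
      then have "triple V \<tau> ?e w ?e = pzero V \<tau>" using ec w by (intro k_eq_zero) simp_all
      then show "quad V \<tau> ?e w = pzero V \<tau>"
        using quad_half[OF ec w] six_module.half_closed[OF part_six] by simp
    qed
  qed
  have "p \<in> pair_ann V I \<tau>" unfolding pair_ann_def using p 1 2 3 by simp
  then show ?thesis using I(2) by simp
qed

text \<open>The ideal that comes with q in the definition of \<MM>-quotients may differ from I. It
  yields a nonzero element p of V equal to [[q,u],v] up to sign with u, v in V. The hypotheses say
  that I annihilates q; by \<open>annihilated_bracket\<close> it then annihilates p, so p = 0 by
  \<open>annihilated_k\<close>, a contradiction.\<close>

lemma annihilated_zero: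
  assumes I: "pair_ideal R V I" "\<And>\<tau>. pair_ann V I \<tau> = {pzero V \<tau>}" and q: "q \<in> pcarrier S \<sigma>"
    and 1: "\<And>y x. \<lbrakk>y \<in> I (- \<sigma>); x \<in> pcarrier V \<sigma>\<rbrakk> \<Longrightarrow> triple S \<sigma> q (\<kappa> (- \<sigma>) y) (\<kappa> \<sigma> x) = pzero S \<sigma>"
    and 2: "\<And>y x. \<lbrakk>y \<in> pcarrier V (- \<sigma>); x \<in> I \<sigma>\<rbrakk> \<Longrightarrow> triple S \<sigma> q (\<kappa> (- \<sigma>) y) (\<kappa> \<sigma> x) = pzero S \<sigma>"
    and 3: "\<And>y x. \<lbrakk>y \<in> I (- \<sigma>); x \<in> pcarrier V (- \<sigma>)\<rbrakk> \<Longrightarrow>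
      triple S (- \<sigma>) (\<kappa> (- \<sigma>) y) q (\<kappa> (- \<sigma>) x) = pzero S (- \<sigma>)"
  shows "q = pzero S \<sigma>"
proof (rule ccontr)
  assume nz: "q \<noteq> pzero S \<sigma>"
  note ic = pair_ideal_closed[OF I(1)]
  let ?q = "TKK_in R S \<sigma> q"
  note [simp] = S.TKK_in_closed[OF q]
  have same: "S.T.br ?q (k \<sigma> v) = \<zero>\<^bsub>S.T\<^esub>" if "v \<in> pcarrier V \<sigma>" for v
    by (rule N.br0[OF S.TKK_in_mem[OF q] k_grade[OF that]]) (cases \<sigma>; simp)
  have qi: "S.T.br (S.T.br ?q (k (- \<sigma>) i)) (k \<tau> l) = \<zero>\<^bsub>S.T\<^esub>" if i: "i \<in> I (- \<sigma>)" and l: "l \<in> pcarrier V \<tau>" for i \<tau> l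
  proof (cases "\<tau> = \<sigma>")
    case True
    then show ?thesis using 1[OF i] l ic[OF i] q S.TKK_triple[of q \<sigma> "\<kappa> (- \<sigma>) i" "\<kappa> \<sigma> l"] by (simp add: k_def)
  next
    case False
    then have t: "\<tau> = - \<sigma>" by (cases \<sigma>; cases \<tau>) auto
    note [simp] = k_closed[OF ic[OF i]] k_closed[OF l]
    have "S.T.br (S.T.br (k (- \<sigma>) i) ?q) (k \<tau> l) = \<zero>\<^bsub>S.T\<^esub>"
      using 3[OF i] l ic[OF i] q t S.TKK_triple[of "\<kappa> (- \<sigma>) i" "- \<sigma>" q "\<kappa> \<tau> l"] by (simp add: k_def)
    then show ?thesis using S.T.br_anti[of "k (- \<sigma>) i" ?q] by (simp add: S.T.br_neg_l)
  qed
  have ann: "annihilated I ?q"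
    unfolding annihilated_def
  proof (intro conjI ballI allI)
    fix n \<tau> l assume n: "n \<in> ideal_gens I" and l: "l \<in> pcarrier V \<tau>"
    note [simp] = k_closed[OF l]
    consider \<rho> i where "n = k \<rho> i" "i \<in> I \<rho>"
      | \<rho> i u where "n = S.T.br (k \<rho> i) (k (- \<rho>) u)" "i \<in> I \<rho>" "u \<in> pcarrier V (- \<rho>)"
      using n unfolding ideal_gens_def by blast
    then show "S.T.br (S.T.br ?q n) (k \<tau> l) = \<zero>\<^bsub>S.T\<^esub>"
    proof cases
      case 1
      show ?thesis
      proof (cases "\<rho> = \<sigma>")
        case True then show ?thesis using same ic 1 by simp
      next
        case False
        then have "\<rho> = - \<sigma>" by (cases \<sigma>; cases \<rho>) auto
        then show ?thesis using qi[OF _ l] 1 by simp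
      qed
    next
      case 2
      note iu [simp] = k_closed[OF ic[OF 2(2)]] k_closed[OF 2(3)]
      have "S.T.br ?q n = \<zero>\<^bsub>S.T\<^esub>"
      proof (cases "\<rho> = \<sigma>")
        case True
        have z: "S.T.br (S.T.br ?q (k (- \<sigma>) u)) (k \<sigma> i) = \<zero>\<^bsub>S.T\<^esub>"
          using \<open>\<And>y x. \<lbrakk>y \<in> pcarrier V (- \<sigma>); x \<in> I \<sigma>\<rbrakk> \<Longrightarrow> _\<close>[of u i] True 2 ic[OF 2(2)] q
            S.TKK_triple[of q \<sigma> "\<kappa> (- \<sigma>) u" "\<kappa> \<sigma> i"] by (simp add: k_def)
        have "S.T.br ?q n = S.T.br (k \<sigma> i) (S.T.br ?q (k (- \<sigma>) u))"
          using S.T.br_commute_op[of ?q "k \<sigma> i" "k (- \<sigma>) u"] same[of i] ic[OF 2(2)] iu True by (simp add: 2(1))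
        also have "\<dots> = \<zero>\<^bsub>S.T\<^esub>"
          using S.T.br_anti[of "S.T.br ?q (k (- \<sigma>) u)" "k \<sigma> i"] z iu True by simp
        finally show ?thesis .
      next
        case False
        then have r: "\<rho> = - \<sigma>" by (cases \<sigma>; cases \<rho>) auto
        then have u: "u \<in> pcarrier V \<sigma>" using 2(3) by simp
        show ?thesis
          \<comment> \<open>For i and u of the signs opposite and equal to q, the term with [q,u]
            vanishes by degree, so [q,[i,u]] is [[q,i],u].\<close>
          using S.T.jacobi_der[of ?q "k (- \<sigma>) i" "k \<sigma> u"] qi[of i u \<sigma>] 2(2) same[OF u] u iu r by (simp add: 2(1))
      qed
      then show ?thesis by simp
    qed
  qed simp
  have br: "annihilated I (S.T.br (S.T.br ?q (k (- \<sigma>) u)) (k \<tau> v))" if "u \<in> pcarrier V (- \<sigma>)" "v \<in> pcarrier V \<tau>" for u v \<tau>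
    by (rule annihilated_bracket[OF I(1) annihilated_bracket[OF I(1) ann that(1)] that(2)])
  obtain \<tau> u v p where "u \<in> pcarrier V (- \<sigma>)" "v \<in> pcarrier V \<tau>" "p \<in> pcarrier V \<tau>" "p \<noteq> pzero V \<tau>"
    and kp: "k \<tau> p = S.T.br (S.T.br ?q (k (- \<sigma>) u)) (k \<tau> v) \<or> k \<tau> p = \<ominus>\<^bsub>S.T\<^esub> S.T.br (S.T.br ?q (k (- \<sigma>) u)) (k \<tau> v)"
    using denominators_ex[OF q nz] by blast
  then have "annihilated I (k \<tau> p) \<or> annihilated I (\<ominus>\<^bsub>S.T\<^esub> k \<tau> p)"
    using br[of u v \<tau>] by auto
  then show False using annihilated_k[OF I \<open>p \<in> pcarrier V \<tau>\<close>] \<open>p \<noteq> pzero V \<tau>\<close> by blast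
qed

text \<open>Hence an inner derivation of \<open>S\<close> is determined by its restriction to \<open>V\<close>.\<close>

lemma inner_derivation_zero:
  assumes d: "d \<in> IDer R S" and h: "\<And>\<sigma> v. v \<in> pcarrier V \<sigma> \<Longrightarrow> d \<sigma> (\<kappa> \<sigma> v) = pzero S \<sigma>"
  shows "d = \<zero>\<^bsub>S.E\<^esub>"
proof (rule S.E_ext)
  fix \<sigma> q assume q: "q \<in> pcarrier S \<sigma>"
  show "d \<sigma> q = \<zero>\<^bsub>S.E\<^esub> \<sigma> q"
  proof (cases "q = pzero S \<sigma>")
    case True then show ?thesis using d by (simp add: S.E_app_zero S.E_apply)
  next
    case False
    then obtain I where I: "denominators \<sigma> q I" using denominators_ex[OF q] by blast
    then have I': "pair_ideal R V I" "\<And>\<tau>. pair_ann V I \<tau> = {pzero V \<tau>}" by (simp_all add: denominators_def)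
    note ic = pair_ideal_closed[OF I'(1)]
    have dq: "d \<sigma> q \<in> pcarrier S \<sigma>" using d q by simp
    have "d \<sigma> q = pzero S \<sigma>"
    proof (rule annihilated_zero[OF I' dq])
      \<comment> \<open>Denominators of q also serve for d(q). In the derivation rule for {q,y,x},
        both the product, which lies in V, and the arguments y, x from V are killed by d, leaving
        {d(q),y,x} = 0.\<close>
      have plus: "triple S \<sigma> (d \<sigma> q) (\<kappa> (- \<sigma>) y) (\<kappa> \<sigma> x) = pzero S \<sigma>"
        if "y \<in> pcarrier V (- \<sigma>)" "x \<in> pcarrier V \<sigma>" "triple S \<sigma> q (\<kappa> (- \<sigma>) y) (\<kappa> \<sigma> x) \<in> \<kappa> \<sigma> ` pcarrier V \<sigma>" for x y
        using S.derivation_triple[OF d q, of "\<kappa> (- \<sigma>) y" "\<kappa> \<sigma> x"] that h q dq by auto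
      show "triple S \<sigma> (d \<sigma> q) (\<kappa> (- \<sigma>) y) (\<kappa> \<sigma> x) = pzero S \<sigma>" if "y \<in> I (- \<sigma>)" "x \<in> pcarrier V \<sigma>" for x y
        using plus[of y x] that ic I by (simp add: denominators_def)
      show "triple S \<sigma> (d \<sigma> q) (\<kappa> (- \<sigma>) y) (\<kappa> \<sigma> x) = pzero S \<sigma>" if "y \<in> pcarrier V (- \<sigma>)" "x \<in> I \<sigma>" for x y
        using plus[of y x] that ic I by (simp add: denominators_def)
      show "triple S (- \<sigma>) (\<kappa> (- \<sigma>) y) (d \<sigma> q) (\<kappa> (- \<sigma>) x) = pzero S (- \<sigma>)"
        if yx: "y \<in> I (- \<sigma>)" "x \<in> pcarrier V (- \<sigma>)" for x y
      proof -
        have "triple S (- \<sigma>) (\<kappa> (- \<sigma>) y) q (\<kappa> (- \<sigma>) x) \<in> \<kappa> (- \<sigma>) ` pcarrier V (- \<sigma>)"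
          using yx I by (simp add: denominators_def)
        then show ?thesis
          using S.derivation_triple[OF d, of "\<kappa> (- \<sigma>) y" "- \<sigma>" q "\<kappa> (- \<sigma>) x"] yx ic[OF yx(1)] h q dq by auto
      qed
    qed
    then show ?thesis using q by (simp add: S.E_apply)
  qed
qed (use d in \<open>simp_all add: S.E_zero_closed\<close>)

end

sublocale nondeg_pair \<subseteq> Id: pair_map R V V "\<lambda>\<sigma> x. x"
proof (intro pair_map.intro pair_map_axioms.intro jordan_pair_axioms six_unit)
  have "linear_map R (part V \<sigma>) (part V \<sigma>) (\<lambda>x. x)" for \<sigma> by (rule linear_mapI) simp_all
  then show "pair_hom R V V (\<lambda>\<sigma> x. x)" by (simp add: pair_hom_def)
qed

section \<open>The ideal of the TKK-algebra generated by an ideal of the pair\<close>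

context nondeg_pair
begin

lemma Id_k: "Id.k = TKK_in R V"
  by (intro ext) (simp add: Id.k_def)

definition generated_ideal :: "(sign \<Rightarrow> 'v set) \<Rightarrow> ('v \<times> (sign \<Rightarrow> 'v \<Rightarrow> 'v) \<times> 'v) set" where
  "generated_ideal I = module_span R T (Id.ideal_gens I)"

context
  fixes I assumes I: "pair_ideal R V I"
begin

lemma gens_closed: "Id.ideal_gens I \<subseteq> carrier T"
  using Id.ideal_gens_closed[OF I] by blast

lemma generated_submodule: "submodule (generated_ideal I) R T"
  unfolding generated_ideal_def by (rule T.module_span_submodule[OF gens_closed])

lemma generated_base: "n \<in> Id.ideal_gens I \<Longrightarrow> n \<in> generated_ideal I"
  unfolding generated_ideal_def by (rule T.module_span_base)

lemma generated_in: "i \<in> I \<tau> \<Longrightarrow> TKK_in R V \<tau> i \<in> generated_ideal I"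
  using generated_base[OF Id.ideal_gens_in[where I = I]] by (simp add: Id_k)

text \<open>By \<open>ideal_from_generators\<close> only brackets with V matter, and those preserve
  the spanning set up to sign.\<close>

lemma generated_is_ideal: "lie_ideal R T (generated_ideal I)"
proof (rule T.ideal_from_generators[OF T_generated generated_submodule])
  fix x s l assume x: "x \<in> generated_ideal I" and s: "s = (1::int) \<or> s = -1" and l: "l \<in> TKK_grade R V s"
  obtain \<sigma> where "s = deg \<sigma>" using sign_deg_cases[OF s] .
  then obtain v where v: "v \<in> pcarrier V \<sigma>" "l = Id.k \<sigma> v" using l TKK_grade_deg by (auto simp: Id_k)
  note [simp] = Id.k_closed[OF v(1)]
  note sub = generated_submodule
  show "T.br x l \<in> generated_ideal I"
    using x[unfolded generated_ideal_def] gens_closed unfolding v(2)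
  proof (induction rule: T.module_span_induct)
    case (base n)
    have n: "T.br n (Id.k \<sigma> v) \<in> carrier T" using Id.ideal_gens_closed[OF I base] by simp
    from Id.ideal_gens_bracket[OF I base v(1)] show ?case
    proof (elim disjE)
      assume "\<ominus>\<^bsub>T\<^esub> T.br n (Id.k \<sigma> v) \<in> Id.ideal_gens I"
      from T.submoduleE(3)[OF sub generated_base[OF this]] show ?thesis using n by simp
    qed (use T.submodule_zero[OF sub] generated_base in auto)
  next
    case zero then show ?case using T.submodule_zero[OF sub] by simp
  next
    case (add x y) then show ?case using T.submoduleE(5)[OF sub] by (simp add: T.br_add_l)
  next
    case (smult a x) then show ?case using T.submoduleE(4)[OF sub] by (simp add: T.br_smult_l)
  qed
qed

lemma generated_graded: "graded_ideal R T (TKK_grade R V) (generated_ideal I)"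
proof -
  note g = K.gr_ideal[OF generated_is_ideal]
  have "Id.ideal_gens I \<subseteq> T.gr (generated_ideal I)"
  proof
    fix n assume n: "n \<in> Id.ideal_gens I"
    consider \<tau> i where "n = Id.k \<tau> i" "i \<in> I \<tau>"
      | \<tau> i u where "n = T.br (Id.k \<tau> i) (Id.k (- \<tau>) u)" "i \<in> I \<tau>" "u \<in> pcarrier V (- \<tau>)"
      using n unfolding Id.ideal_gens_def by blast
    then obtain k where "n \<in> TKK_grade R V k"
    proof cases
      case 1 then show thesis using that Id.k_grade[OF pair_ideal_closed[OF I 1(2)]] by blast
    next
      case 2 then show thesis
        using that K.brG[OF Id.k_grade[OF pair_ideal_closed[OF I 2(2)]] Id.k_grade[OF 2(3)] refl] by blast
    qed
    then show "n \<in> T.gr (generated_ideal I)" using g(3)[OF generated_base[OF n]] by blast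
  qed
  from T.module_span_least[OF T.ideal_submodule[OF g(1)] this]
  show ?thesis unfolding T.graded_ideal_gr using generated_is_ideal by (simp add: generated_ideal_def)
qed

text \<open>No new elements appear in degrees 1 and -1: the elements of T with outer components in I
  form a submodule containing all generators, those of the form [i,u] having zero outer
  components.\<close>

lemma generated_part:
  assumes "TKK_in R V \<sigma> x \<in> generated_ideal I" "x \<in> pcarrier V \<sigma>"
  shows "x \<in> I \<sigma>"
proof -
  note Isub = pair_ideal_sub[OF I]
  let ?H = "{(x, \<gamma>, y). (x, \<gamma>, y) \<in> carrier T \<and> x \<in> I Pos \<and> y \<in> I Neg}"
  have H: "submodule ?H R T"
  proof (rule T.submoduleI')
    show "\<zero>\<^bsub>T\<^esub> \<in> ?H" using P.submodule_zero[OF Isub] by (simp add: T_ops T_carrier)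
    show "X \<oplus>\<^bsub>T\<^esub> Y \<in> ?H" if "X \<in> ?H" "Y \<in> ?H" for X Y
      using that P.submoduleE(5)[OF Isub[of Pos]] P.submoduleE(5)[OF Isub[of Neg]] by (auto simp: T_ops T_carrier)
    show "a \<odot>\<^bsub>T\<^esub> X \<in> ?H" if "a \<in> carrier R" "X \<in> ?H" for a X
      using that P.submoduleE(4)[OF Isub[of Pos]] P.submoduleE(4)[OF Isub[of Neg]] by (auto simp: T_ops T_carrier)
  qed auto
  have "Id.ideal_gens I \<subseteq> ?H"
  proof
    fix n assume n: "n \<in> Id.ideal_gens I"
    note z = P.submodule_zero[OF Isub[of Pos]] P.submodule_zero[OF Isub[of Neg]]
    consider \<tau> i where "n = Id.k \<tau> i" "i \<in> I \<tau>"
      | \<tau> i u where "n = T.br (Id.k \<tau> i) (Id.k (- \<tau>) u)" "i \<in> I \<tau>" "u \<in> pcarrier V (- \<tau>)"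
      using n unfolding Id.ideal_gens_def by blast
    then show "n \<in> ?H"
    proof cases
      case 1
      then show ?thesis using z Id.ideal_gens_closed[OF I n] by (cases \<tau>) (auto simp: Id_k)
    next
      case 2
      have "n \<in> TKK_grade R V 0"
        using K.brG[OF Id.k_grade[OF pair_ideal_closed[OF I 2(2)]] Id.k_grade[OF 2(3)], of 0] 2(1) by simp
      then show ?thesis using z by (cases n) (auto simp: T_grade_iff)
    qed
  qed
  from T.module_span_least[OF H this] have "TKK_in R V \<sigma> x \<in> ?H" using assms by (auto simp: generated_ideal_def)
  then show ?thesis by (cases \<sigma>) auto
qed

text \<open>A nonzero ideal of T contains a nonzero z from V. As z is not in the annihilator of I,
  one of the three kinds of products of z with I and V is nonzero, and it lies in I and in the given
  ideal.\<close>

lemma generated_essential: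
  assumes ann: "\<And>\<tau>. pair_ann V I \<tau> = {pzero V \<tau>}"
  shows "essential_ideal R T (generated_ideal I)"
proof (rule K.essentialI[OF generated_is_ideal])
  fix J s Z assume J: "lie_ideal R T J" and s: "s = (1::int) \<or> s = -1" and Z: "Z \<in> J" "Z \<in> TKK_grade R V s" "Z \<noteq> \<zero>\<^bsub>T\<^esub>"
  obtain \<sigma> where "s = deg \<sigma>" using sign_deg_cases[OF s] .
  then obtain z where z: "z \<in> pcarrier V \<sigma>" "Z = TKK_in R V \<sigma> z" using Z(2) TKK_grade_deg by auto
  have nz: "z \<noteq> pzero V \<sigma>" using Z(3) z(2) by auto
  then have "z \<notin> pair_ann V I \<sigma>" using ann[of \<sigma>] by simp
  then consider
      y x where "y \<in> I (- \<sigma>)" "x \<in> pcarrier V \<sigma>" "triple V \<sigma> z y x \<noteq> pzero V \<sigma>"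
    | y x where "y \<in> pcarrier V (- \<sigma>)" "x \<in> I \<sigma>" "triple V \<sigma> z y x \<noteq> pzero V \<sigma>"
    | y x where "y \<in> pcarrier V (- \<sigma>)" "x \<in> I (- \<sigma>)" "triple V (- \<sigma>) y z x \<noteq> pzero V (- \<sigma>)"
    using z(1) unfolding pair_ann_def by blast
  then obtain \<tau> t where t: "t \<in> pcarrier V \<tau>" "t \<noteq> pzero V \<tau>" "t \<in> I \<tau>" "TKK_in R V \<tau> t \<in> J"
  proof cases
    case 1
    note yc = pair_ideal_closed[OF I 1(1)]
    have "T.br (T.br Z (TKK_in R V (- \<sigma>) y)) (TKK_in R V \<sigma> x) \<in> J"
      using Z(1) yc 1(2) by (intro T.ideal_left[OF J]) simp_all
    then show thesis using that[of "triple V \<sigma> z y x" \<sigma>] 1 z yc pair_ideal_2[OF I z(1) 1(1,2)] by (simp add: TKK_triple)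
  next
    case 2
    note xc = pair_ideal_closed[OF I 2(2)]
    have "T.br (T.br Z (TKK_in R V (- \<sigma>) y)) (TKK_in R V \<sigma> x) \<in> J"
      using Z(1) xc 2(1) by (intro T.ideal_left[OF J]) simp_all
    then show thesis using that[of "triple V \<sigma> z y x" \<sigma>] 2 z xc pair_ideal_3[OF I z(1) 2(1,2)] by (simp add: TKK_triple)
  next
    case 3
    note xc = pair_ideal_closed[OF I 3(2)]
    have "T.br (TKK_in R V (- \<sigma>) y) Z \<in> J" using Z(1) 3(1) by (intro T.ideal_right[OF J]) simp_all
    from T.ideal_left[OF J this, of "TKK_in R V (- \<sigma>) x"]
    have "T.br (T.br (TKK_in R V (- \<sigma>) y) Z) (TKK_in R V (- \<sigma>) x) \<in> J" using xc by simp
    then show thesis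
      using that[of "triple V (- \<sigma>) y z x" "- \<sigma>"] 3 z xc pair_ideal_3[OF I, of y "- \<sigma>" z x] TKK_triple[of y "- \<sigma>" z x] by simp
  qed
  have "TKK_in R V \<tau> t \<noteq> \<zero>\<^bsub>T\<^esub>" using TKK_in_inject[of \<tau> t "pzero V \<tau>"] t(2) by simp
  then show "\<exists>w\<in>generated_ideal I \<inter> J. w \<noteq> \<zero>\<^bsub>T\<^esub>" using t(4) generated_in[OF t(3)] by blast
qed

end

end

section \<open>The embedding of TKK(V) in TKK(S)\<close>

context quotient_pair
begin

definition extends :: "(sign \<Rightarrow> 'v \<Rightarrow> 'v) \<Rightarrow> (sign \<Rightarrow> 's \<Rightarrow> 's) \<Rightarrow> bool" where
  "extends \<gamma> g \<longleftrightarrow> g \<in> IDer R S \<and> (\<forall>\<sigma>. \<forall>v\<in>pcarrier V \<sigma>. g \<sigma> (\<kappa> \<sigma> v) = \<kappa> \<sigma> (\<gamma> \<sigma> v))"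

lemma extendsD: "extends \<gamma> g \<Longrightarrow> g \<in> IDer R S" "\<lbrakk>extends \<gamma> g; v \<in> pcarrier V \<sigma>\<rbrakk> \<Longrightarrow> g \<sigma> (\<kappa> \<sigma> v) = \<kappa> \<sigma> (\<gamma> \<sigma> v)"
  by (simp_all add: extends_def)

text \<open>The difference of two extensions vanishes on V, so \<open>inner_derivation_zero\<close>
  applies. Hence sending a combination of inner derivations of V to the same combination in S is
  well defined.\<close>

lemma extends_unique:
  assumes "extends \<gamma> g" "extends \<gamma> g'"
  shows "g = g'"
proof -
  note [simp] = extendsD(1)[OF assms(1)] extendsD(1)[OF assms(2)]
  have "g \<ominus>\<^bsub>S.E\<^esub> g' = \<zero>\<^bsub>S.E\<^esub>"
  proof (rule inner_derivation_zero)
    fix \<sigma> v assume v: "v \<in> pcarrier V \<sigma>"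
    have "g' \<sigma> (\<kappa> \<sigma> v) \<in> pcarrier S \<sigma>" using v by simp
    then show "(g \<ominus>\<^bsub>S.E\<^esub> g') \<sigma> (\<kappa> \<sigma> v) = pzero S \<sigma>"
      using v extendsD(2)[OF assms(1) v] extendsD(2)[OF assms(2) v]
      by (simp add: a_minus_def S.E_apply S.E_app_a_inv S.P.r_neg)
  qed simp
  from arg_cong[OF this, of "sec S.E"] show ?thesis
    by (intro S.E.secI) (simp_all add: S.E.sec_simps)
qed

lemma kappa_neg: "v \<in> pcarrier V \<sigma> \<Longrightarrow> \<kappa> \<sigma> (\<ominus>\<^bsub>part V \<sigma>\<^esub> v) = \<ominus>\<^bsub>part S \<sigma>\<^esub> \<kappa> \<sigma> v"
  by (rule linear_map_neg[OF kappa_linear is_module S.is_module])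

lemma kappa_add: "\<lbrakk>v \<in> pcarrier V \<sigma>; w \<in> pcarrier V \<sigma>\<rbrakk> \<Longrightarrow> \<kappa> \<sigma> (v \<oplus>\<^bsub>part V \<sigma>\<^esub> w) = \<kappa> \<sigma> v \<oplus>\<^bsub>part S \<sigma>\<^esub> \<kappa> \<sigma> w"
  by (rule linear_map_add[OF kappa_linear])

lemma kappa_minus: "\<lbrakk>v \<in> pcarrier V \<sigma>; w \<in> pcarrier V \<sigma>\<rbrakk> \<Longrightarrow> \<kappa> \<sigma> (v \<ominus>\<^bsub>part V \<sigma>\<^esub> w) = \<kappa> \<sigma> v \<ominus>\<^bsub>part S \<sigma>\<^esub> \<kappa> \<sigma> w"
  by (simp add: a_minus_def kappa_add kappa_neg)

lemma kappa_smult: "\<lbrakk>a \<in> carrier R; v \<in> pcarrier V \<sigma>\<rbrakk> \<Longrightarrow> \<kappa> \<sigma> (a \<odot>\<^bsub>part V \<sigma>\<^esub> v) = a \<odot>\<^bsub>part S \<sigma>\<^esub> \<kappa> \<sigma> v"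
  by (rule linear_map_smult[OF kappa_linear])

lemma kappa_closed_Neg [simp]: "x \<in> pcarrier V Neg \<Longrightarrow> \<kappa> Neg x \<in> pcarrier S Neg"
  by (rule kappa_closed)

lemma extends_inner:
  assumes [simp]: "x \<in> pcarrier V Pos" "y \<in> pcarrier V Neg"
  shows "extends (inner_der V x y) (inner_der S (\<kappa> Pos x) (\<kappa> Neg y))"
  unfolding extends_def
proof (intro conjI allI ballI)
  fix \<sigma> v assume v: "v \<in> pcarrier V \<sigma>"
  show "inner_der S (\<kappa> Pos x) (\<kappa> Neg y) \<sigma> (\<kappa> \<sigma> v) = \<kappa> \<sigma> (inner_der V x y \<sigma> v)"
  proof (cases \<sigma>)
    case Pos
    then show ?thesis using v kappa_triple[of x Pos y v] by (simp add: inner_der_apply S.inner_der_apply)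
  next
    case Neg
    then show ?thesis using v kappa_triple[of y Neg x v] by (simp add: inner_der_apply S.inner_der_apply kappa_neg)
  qed
qed simp

lemma extends_ops:
  assumes 1: "extends \<gamma> g" and 2: "extends \<mu> m" and [simp]: "\<gamma> \<in> IDer R V" "\<mu> \<in> IDer R V"
  shows "extends (\<gamma> \<oplus>\<^bsub>E\<^esub> \<mu>) (g \<oplus>\<^bsub>S.E\<^esub> m)" "a \<in> carrier R \<Longrightarrow> extends (a \<odot>\<^bsub>E\<^esub> \<gamma>) (a \<odot>\<^bsub>S.E\<^esub> g)"
    "extends (\<gamma> \<otimes>\<^bsub>E\<^esub> \<mu>) (g \<otimes>\<^bsub>S.E\<^esub> m)" "extends (\<gamma> \<ominus>\<^bsub>E\<^esub> \<mu>) (g \<ominus>\<^bsub>S.E\<^esub> m)" "extends \<zero>\<^bsub>E\<^esub> \<zero>\<^bsub>S.E\<^esub>"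
  unfolding extends_def using extendsD[OF 1] extendsD[OF 2]
  by (auto simp: E_apply S.E_apply kappa_add kappa_smult kappa_minus kappa_neg kappa_zero E_app_a_inv S.E_app_a_inv
      a_minus_def[of E] a_minus_def[of S.E] a_minus_def[of "part V _"] a_minus_def[of "part S _"] E_app_closed)

lemma extends_zero: "extends \<zero>\<^bsub>E\<^esub> \<zero>\<^bsub>S.E\<^esub>"
  by (auto simp: extends_def E_apply S.E_apply kappa_zero)

lemma extends_ex: assumes "\<gamma> \<in> IDer R V" shows "\<exists>g. extends \<gamma> g"
proof -
  let ?S = "{inner_der V x y |x y. x \<in> pcarrier V Pos \<and> y \<in> pcarrier V Neg}"
  have S: "?S \<subseteq> carrier E" by auto
  have "\<gamma> \<in> module_span R E ?S" using assms by (simp add: IDer_def)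
  then have "\<gamma> \<in> IDer R V \<and> (\<exists>g. extends \<gamma> g)" using S
  proof (induction rule: E.module_span_induct)
    case (base \<gamma>) then show ?case using extends_inner by auto
  next
    case zero then show ?case using extends_zero by auto
  next
    case (add \<gamma> \<mu>)
    then obtain g m where "extends \<gamma> g" "extends \<mu> m" by blast
    then show ?case using add extends_ops(1)[of \<gamma> g \<mu> m] by auto
  next
    case (smult a \<gamma>)
    then obtain g where "extends \<gamma> g" by blast
    then show ?case using smult extends_ops(2)[of \<gamma> g \<gamma> g a] by auto
  qed
  then show ?thesis by simp
qed

definition Psi :: "(sign \<Rightarrow> 'v \<Rightarrow> 'v) \<Rightarrow> sign \<Rightarrow> 's \<Rightarrow> 's" where
  "Psi \<gamma> = (THE g. extends \<gamma> g)"

lemma Psi_eq: "extends \<gamma> g \<Longrightarrow> Psi \<gamma> = g"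
  unfolding Psi_def by (rule the_equality) (auto intro: extends_unique)

lemma Psi_extends: "\<gamma> \<in> IDer R V \<Longrightarrow> extends \<gamma> (Psi \<gamma>)"
  using extends_ex Psi_eq by metis

definition psi :: "'v \<times> (sign \<Rightarrow> 'v \<Rightarrow> 'v) \<times> 'v \<Rightarrow> 's \<times> (sign \<Rightarrow> 's \<Rightarrow> 's) \<times> 's" where
  "psi = (\<lambda>(x, \<gamma>, y). (\<kappa> Pos x, Psi \<gamma>, \<kappa> Neg y))"

lemma psi_apply: "psi (x, \<gamma>, y) = (\<kappa> Pos x, Psi \<gamma>, \<kappa> Neg y)"
  by (simp add: psi_def)

lemma Psi_closed: "\<gamma> \<in> IDer R V \<Longrightarrow> Psi \<gamma> \<in> IDer R S"
  using Psi_extends by (simp add: extends_def)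

lemma Psi_inj: assumes "\<gamma> \<in> IDer R V" "\<mu> \<in> IDer R V" "Psi \<gamma> = Psi \<mu>" shows "\<gamma> = \<mu>"
proof (rule E_ext)
  fix \<sigma> z assume z: "z \<in> pcarrier V \<sigma>"
  have "\<kappa> \<sigma> (\<gamma> \<sigma> z) = \<kappa> \<sigma> (\<mu> \<sigma> z)"
    using extendsD(2)[OF Psi_extends[OF assms(1)] z] extendsD(2)[OF Psi_extends[OF assms(2)] z] assms(3) by simp
  then show "\<gamma> \<sigma> z = \<mu> \<sigma> z" by (rule kappa_inj) (use assms z in simp_all)
qed (use assms in simp_all)

text \<open>Each identity for the middle component is obtained by exhibiting an extension of the
  required derivation and appealing to uniqueness through \<open>Psi_eq\<close>.\<close>

lemma psi_extension: "lie_extension R T (TKK_grade R V) S.T psi"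
proof (intro lie_extension.intro lie_extension_axioms.intro T_nondeg S.T_lie)
  show "linear_map R T S.T psi"
  proof (rule linear_mapI)
    show "psi X \<in> carrier S.T" if "X \<in> carrier T" for X
      using that by (cases X) (simp add: psi_apply T_carrier S.T_carrier Psi_closed)
    show "psi (X \<oplus>\<^bsub>T\<^esub> Y) = psi X \<oplus>\<^bsub>S.T\<^esub> psi Y" if "X \<in> carrier T" "Y \<in> carrier T" for X Y
      using that Psi_eq[OF extends_ops(1)[OF Psi_extends Psi_extends]]
      by (cases X; cases Y) (simp add: psi_apply T_carrier T_ops S.T_ops kappa_add)
    show "psi (a \<odot>\<^bsub>T\<^esub> X) = a \<odot>\<^bsub>S.T\<^esub> psi X" if "a \<in> carrier R" "X \<in> carrier T" for a X
      using that Psi_eq[OF extends_ops(2)[OF Psi_extends Psi_extends, of \<gamma> \<gamma> a for \<gamma>]]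
      by (cases X) (simp add: psi_apply T_carrier T_ops S.T_ops kappa_smult)
  qed
  show "inj_on psi (carrier T)"
  proof (rule inj_onI)
    fix X Y assume "X \<in> carrier T" "Y \<in> carrier T" "psi X = psi Y"
    then show "X = Y" by (cases X; cases Y) (auto simp: psi_apply T_carrier dest: kappa_inj Psi_inj)
  qed
  fix X Y assume XY: "X \<in> carrier T" "Y \<in> carrier T"
  obtain x \<gamma> x' y \<mu> y' where e: "X = (x, \<gamma>, x')" "Y = (y, \<mu>, y')" by (cases X, cases Y)
  have [simp]: "x \<in> pcarrier V Pos" "\<gamma> \<in> IDer R V" "x' \<in> pcarrier V Neg"
    "y \<in> pcarrier V Pos" "\<mu> \<in> IDer R V" "y' \<in> pcarrier V Neg" using XY by (simp_all add: e T_carrier)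
  note p = Psi_extends[of \<gamma>, simplified] Psi_extends[of \<mu>, simplified]
  have "extends (\<gamma> \<otimes>\<^bsub>E\<^esub> \<mu> \<oplus>\<^bsub>E\<^esub> inner_der V x y' \<ominus>\<^bsub>E\<^esub> inner_der V y x')
    (Psi \<gamma> \<otimes>\<^bsub>S.E\<^esub> Psi \<mu> \<oplus>\<^bsub>S.E\<^esub> inner_der S (\<kappa> Pos x) (\<kappa> Neg y') \<ominus>\<^bsub>S.E\<^esub> inner_der S (\<kappa> Pos y) (\<kappa> Neg x'))"
    by (intro extends_ops(1,3,4) p extends_inner) simp_all
  from Psi_eq[OF this] show "psi (T.br X Y) = S.T.br (psi X) (psi Y)"
    using extendsD(2)[OF p(1), of y Pos] extendsD(2)[OF p(2), of x Pos] extendsD(2)[OF p(1), of y' Neg] extendsD(2)[OF p(2), of x' Neg]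
    by (simp add: e T_ops S.T_ops psi_apply kappa_minus)
qed

sublocale X: lie_extension R "TKK R V" "TKK_grade R V" "TKK R S" psi by (rule psi_extension)

lemma psi_in: "psi (TKK_in R V \<sigma> x) = k \<sigma> x"
  using Psi_eq[OF extends_zero] by (cases \<sigma>) (simp_all add: psi_apply k_def kappa_zero)

lemma psi_grade_iff:
  assumes "X \<in> carrier T"
  shows "psi X \<in> TKK_grade R S j \<longleftrightarrow> X \<in> TKK_grade R V j"
proof -
  obtain x \<gamma> y where e: "X = (x, \<gamma>, y)" by (cases X)
  have [simp]: "x \<in> pcarrier V Pos" "\<gamma> \<in> IDer R V" "y \<in> pcarrier V Neg" using assms by (simp_all add: e T_carrier)
  have "\<kappa> Pos x = pzero S Pos \<longleftrightarrow> x = pzero V Pos" "\<kappa> Neg y = pzero S Neg \<longleftrightarrow> y = pzero V Neg"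
    using kappa_inj[of Pos x "pzero V Pos"] kappa_inj[of Neg y "pzero V Neg"] kappa_zero by auto
  moreover have "Psi \<gamma> = \<zero>\<^bsub>S.E\<^esub> \<longleftrightarrow> \<gamma> = \<zero>\<^bsub>E\<^esub>"
    using Psi_inj[of \<gamma> "\<zero>\<^bsub>E\<^esub>"] Psi_eq[OF extends_zero] by auto
  ultimately show ?thesis by (simp add: e psi_apply T_grade_iff S.T_grade_iff T_carrier S.T_carrier Psi_closed)
qed

abbreviation PT where "PT \<equiv> psi ` carrier T"

lemma PT_ops:
  "\<zero>\<^bsub>S.T\<^esub> \<in> PT" "\<lbrakk>x \<in> PT; y \<in> PT\<rbrakk> \<Longrightarrow> x \<oplus>\<^bsub>S.T\<^esub> y \<in> PT" "x \<in> PT \<Longrightarrow> \<ominus>\<^bsub>S.T\<^esub> x \<in> PT"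
  "\<lbrakk>a \<in> carrier R; x \<in> PT\<rbrakk> \<Longrightarrow> a \<odot>\<^bsub>S.T\<^esub> x \<in> PT" "\<lbrakk>x \<in> PT; y \<in> PT\<rbrakk> \<Longrightarrow> S.T.br x y \<in> PT"
  "v \<in> pcarrier V \<tau> \<Longrightarrow> k \<tau> v \<in> PT"
proof -
  show "\<zero>\<^bsub>S.T\<^esub> \<in> PT" using X.psi_zero[symmetric] by (rule image_eqI) simp
  show "\<lbrakk>x \<in> PT; y \<in> PT\<rbrakk> \<Longrightarrow> x \<oplus>\<^bsub>S.T\<^esub> y \<in> PT" by (auto simp: X.psi_add[symmetric])
  show "x \<in> PT \<Longrightarrow> \<ominus>\<^bsub>S.T\<^esub> x \<in> PT" by (auto simp: X.psi_neg[symmetric])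
  show "\<lbrakk>a \<in> carrier R; x \<in> PT\<rbrakk> \<Longrightarrow> a \<odot>\<^bsub>S.T\<^esub> x \<in> PT" by (auto simp: X.psi_smult[symmetric])
  show "\<lbrakk>x \<in> PT; y \<in> PT\<rbrakk> \<Longrightarrow> S.T.br x y \<in> PT" by (auto simp: X.psi_bracket[symmetric])
  show "v \<in> pcarrier V \<tau> \<Longrightarrow> k \<tau> v \<in> PT" by (auto simp: psi_in[symmetric])
qed

text \<open>Since T is generated by V, bracketing with V controls bracketing with T; for degree 0,
  Jacobi rewrites [w,[x,y]] as [[w,x],y] - [[w,y],x].\<close>

lemma bracket_PT:
  assumes w: "w \<in> carrier S.T" and h: "\<And>\<tau> v. v \<in> pcarrier V \<tau> \<Longrightarrow> S.T.br w (k \<tau> v) \<in> PT" and l: "l \<in> carrier T"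
  shows "S.T.br w (psi l) \<in> PT"
proof -
  let ?H = "{l \<in> carrier T. S.T.br w (psi l) \<in> PT}"
  have H: "submodule ?H R T"
    by (rule T.submoduleI') (use w PT_ops in \<open>auto simp: X.psi_zero X.psi_add X.psi_smult S.T.br_lin\<close>)
  have 1: "x \<in> ?H" if "x \<in> TKK_grade R V (deg \<sigma>)" for x \<sigma>
    using that h psi_in K.G_closed[OF that] unfolding TKK_grade_deg by auto
  have 0: "TKK_grade R V 0 \<subseteq> ?H"
  proof -
    have "T.br x y \<in> ?H" if x: "x \<in> TKK_grade R V 1" and y: "y \<in> TKK_grade R V (-1)" for x y
    proof -
    note [simp] = K.G_closed[OF x] K.G_closed[OF y] w
    have hx: "S.T.br w (psi x) \<in> PT" "S.T.br w (psi y) \<in> PT" using 1[of x Pos] 1[of y Neg] x y by simp_all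
    have "S.T.br w (psi (T.br x y)) = S.T.br (S.T.br w (psi x)) (psi y) \<oplus>\<^bsub>S.T\<^esub> \<ominus>\<^bsub>S.T\<^esub> S.T.br (S.T.br w (psi y)) (psi x)"
      using S.T.jacobi_der[of w "psi x" "psi y"] S.T.br_anti[of "S.T.br w (psi y)" "psi x"] by (simp add: X.psi_bracket)
    also have "\<dots> \<in> PT" by (intro PT_ops hx) auto
    finally show ?thesis by simp
    qed
    then have "lie_prod R T (TKK_grade R V 1) (TKK_grade R V (-1)) \<subseteq> ?H"
      unfolding lie_prod_def by (intro T.module_span_least[OF H]) blast
    then show ?thesis by (simp only: T_generated)
  qed
  obtain a b c where abc: "a \<in> TKK_grade R V (-1)" "b \<in> TKK_grade R V 0" "c \<in> TKK_grade R V 1" "l = a \<oplus>\<^bsub>T\<^esub> b \<oplus>\<^bsub>T\<^esub> c"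
    using T.decompose[OF l] .
  have "a \<in> ?H" "b \<in> ?H" "c \<in> ?H" using 1[of a Neg] 0 1[of c Pos] abc by auto
  then have "l \<in> ?H" unfolding abc(4) by (intro T.submoduleE(5)[OF H])
  then show ?thesis by simp
qed

lemma absorbs_denominators:
  assumes q: "q \<in> pcarrier S \<sigma>" and D: "denominators \<sigma> q I"
  shows "X.absorbs (TKK_in R S \<sigma> q) (lie_prod R T (generated_ideal I) (generated_ideal I))"
proof -
  have I: "pair_ideal R V I" "\<And>\<tau>. pair_ann V I \<tau> = {pzero V \<tau>}" using D by (simp_all add: denominators_def)
  note ic = pair_ideal_closed[OF I(1)]
  note gi = generated_is_ideal[OF I(1)] note ge = generated_essential[OF I]
  let ?q = "TKK_in R S \<sigma> q"
  note [simp] = S.TKK_in_closed[OF q]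
  have tri: "S.T.br (S.T.br ?q (k (- \<sigma>) y)) (k \<sigma> x) \<in> PT"
    if "y \<in> pcarrier V (- \<sigma>)" "x \<in> pcarrier V \<sigma>" "y \<in> I (- \<sigma>) \<or> x \<in> I \<sigma>" for x y
  proof -
    have "triple S \<sigma> q (\<kappa> (- \<sigma>) y) (\<kappa> \<sigma> x) \<in> \<kappa> \<sigma> ` pcarrier V \<sigma>" using D that by (auto simp: denominators_def)
    then obtain p where "p \<in> pcarrier V \<sigma>" "triple S \<sigma> q (\<kappa> (- \<sigma>) y) (\<kappa> \<sigma> x) = \<kappa> \<sigma> p" by auto
    then have "S.T.br (S.T.br ?q (k (- \<sigma>) y)) (k \<sigma> x) = k \<sigma> p" "p \<in> pcarrier V \<sigma>"
      using q that by (simp_all add: k_def S.TKK_triple)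
    then show ?thesis using PT_ops(6) by simp
  qed
  have tri': "S.T.br (S.T.br ?q (k (- \<sigma>) y)) (k (- \<sigma>) x) \<in> PT" if y: "y \<in> I (- \<sigma>)" and x: "x \<in> pcarrier V (- \<sigma>)" for x y
  proof -
    have "triple S (- \<sigma>) (\<kappa> (- \<sigma>) y) q (\<kappa> (- \<sigma>) x) \<in> \<kappa> (- \<sigma>) ` pcarrier V (- \<sigma>)"
      using D x y by (auto simp: denominators_def)
    then obtain p where p: "p \<in> pcarrier V (- \<sigma>)" "triple S (- \<sigma>) (\<kappa> (- \<sigma>) y) q (\<kappa> (- \<sigma>) x) = \<kappa> (- \<sigma>) p" by auto
    have "S.T.br (S.T.br (k (- \<sigma>) y) ?q) (k (- \<sigma>) x) = k (- \<sigma>) p"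
      using q x ic[OF y] p S.TKK_triple[of "\<kappa> (- \<sigma>) y" "- \<sigma>" q "\<kappa> (- \<sigma>) x"] by (simp add: k_def)
    then have "S.T.br (S.T.br ?q (k (- \<sigma>) y)) (k (- \<sigma>) x) = \<ominus>\<^bsub>S.T\<^esub> k (- \<sigma>) p"
      using S.T.br_anti[of "k (- \<sigma>) y" ?q] k_closed[OF x] k_closed[OF ic[OF y]] by (simp add: S.T.br_neg_l)
    then show ?thesis using PT_ops(3)[OF PT_ops(6)[OF p(1)]] by simp
  qed
  have same: "S.T.br ?q (k \<sigma> v) = \<zero>\<^bsub>S.T\<^esub>" if "v \<in> pcarrier V \<sigma>" for v
    by (rule N.br0[OF S.TKK_in_mem[OF q] k_grade[OF that]]) (cases \<sigma>; simp)
  let ?H = "{n \<in> carrier T. \<forall>\<tau>. \<forall>v\<in>pcarrier V \<tau>. S.T.br (S.T.br ?q (psi n)) (k \<tau> v) \<in> PT}"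
  have H: "submodule ?H R T"
    by (rule T.submoduleI') (use PT_ops in \<open>auto simp: X.psi_zero X.psi_add X.psi_smult S.T.br_lin k_closed\<close>)
  have "Id.ideal_gens I \<subseteq> ?H"
  proof
    fix n assume n: "n \<in> Id.ideal_gens I"
    note nc = Id.ideal_gens_closed[OF I(1) n]
    consider \<tau> i where "n = TKK_in R V \<tau> i" "i \<in> I \<tau>"
      | \<tau> i u where "n = T.br (TKK_in R V \<tau> i) (TKK_in R V (- \<tau>) u)" "i \<in> I \<tau>" "u \<in> pcarrier V (- \<tau>)"
      using n unfolding Id.ideal_gens_def Id_k by blast
    then have "S.T.br (S.T.br ?q (psi n)) (k \<tau>' v) \<in> PT" if v: "v \<in> pcarrier V \<tau>'" for \<tau>' v
    proof cases
      case 1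
      have pn: "psi n = k \<tau> i" by (simp add: 1(1) psi_in)
      show ?thesis
      proof (cases "\<tau> = \<sigma>")
        case True then show ?thesis unfolding pn using same[of i] ic[OF 1(2)] k_closed[OF v] PT_ops(1) by simp
      next
        case False
        then have t: "\<tau> = - \<sigma>" by (cases \<sigma>; cases \<tau>) auto
        show ?thesis
        proof (cases "\<tau>' = \<sigma>")
          case True then show ?thesis unfolding pn using tri[of i v] ic[OF 1(2)] 1(2) t v by simp
        next
          case False
          then have "\<tau>' = - \<sigma>" by (cases \<sigma>; cases \<tau>') auto
          then show ?thesis unfolding pn using tri'[of i v] 1(2) t v by simp
        qed
      qed
    next
      case 2
      note [simp] = k_closed[OF ic[OF 2(2)]] k_closed[OF 2(3)]
      have pn: "psi n = S.T.br (k \<tau> i) (k (- \<tau>) u)" using ic[OF 2(2)] 2(3) by (simp add: 2(1) X.psi_bracket psi_in)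
      \<comment> \<open>For generators of the form [i,u] even [q,[i,u]] lies in the image of T: one
        of i, u has the sign of q and commutes with q, so this is a triple product {q,u,i} or
        {q,i,u} up to sign.\<close>
      have "S.T.br ?q (psi n) \<in> PT"
      proof (cases "\<tau> = \<sigma>")
        case True
        have "S.T.br ?q (psi n) = S.T.br (k \<tau> i) (S.T.br ?q (k (- \<tau>) u))"
          unfolding pn using k_closed[OF 2(3)] k_closed[OF ic[OF 2(2)]] same[of i] ic[OF 2(2)] True by (intro S.T.br_commute_op) simp_all
        also have "\<dots> = \<ominus>\<^bsub>S.T\<^esub> S.T.br (S.T.br ?q (k (- \<tau>) u)) (k \<tau> i)" using k_closed[OF 2(3)] k_closed[OF ic[OF 2(2)]] True by (intro S.T.br_anti) simp_all
        finally show ?thesis using PT_ops(3)[OF tri[of u i]] ic[OF 2(2)] 2 True by simp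
      next
        case False
        then have t: "\<tau> = - \<sigma>" by (cases \<sigma>; cases \<tau>) auto
        then have u: "u \<in> pcarrier V \<sigma>" using 2(3) by simp
        have "S.T.br ?q (psi n) = S.T.br (S.T.br ?q (k \<tau> i)) (k (- \<tau>) u) \<oplus>\<^bsub>S.T\<^esub> S.T.br (k \<tau> i) (S.T.br ?q (k (- \<tau>) u))"
          unfolding pn by (rule S.T.jacobi_der) simp_all
        also have "\<dots> = S.T.br (S.T.br ?q (k (- \<sigma>) i)) (k \<sigma> u)" using same[OF u] t k_closed[OF ic[OF 2(2)]] k_closed[OF u] by simp
        finally show ?thesis using tri[of i u] u ic[OF 2(2)] 2(2) t by simp
      qed
      then show ?thesis by (rule PT_ops(5)[OF _ PT_ops(6)[OF v]])
    qed
    then show "n \<in> ?H" using nc by simp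
  qed
  from T.module_span_least[OF H this] have sub: "generated_ideal I \<subseteq> ?H" by (simp add: generated_ideal_def)
  have step: "S.T.br (S.T.br ?q (psi n)) (psi l) \<in> PT" if "n \<in> generated_ideal I" "l \<in> carrier T" for n l
    by (rule bracket_PT[OF _ _ that(2)]) (use that sub in auto)
  show ?thesis
    unfolding X.absorbs_def
  proof (intro conjI ballI)
    show "?q \<in> carrier S.T" by simp
    show "essential_ideal R T (lie_prod R T (generated_ideal I) (generated_ideal I))" by (rule K.essential_lie_prod[OF ge])
    fix x assume "x \<in> lie_prod R T (generated_ideal I) (generated_ideal I)"
    with gi gi show "S.T.br ?q (psi x) \<in> PT"
    proof (induction rule: T.lie_prod_induct)
      case (base a b)
      note [simp] = T.ideal_closed[OF gi base(1)] T.ideal_closed[OF gi base(2)]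
      have "S.T.br ?q (psi (T.br a b)) = S.T.br (S.T.br ?q (psi a)) (psi b) \<oplus>\<^bsub>S.T\<^esub> \<ominus>\<^bsub>S.T\<^esub> S.T.br (S.T.br ?q (psi b)) (psi a)"
        using S.T.jacobi_der[of ?q "psi a" "psi b"] S.T.br_anti[of "S.T.br ?q (psi b)" "psi a"] by (simp add: X.psi_bracket)
      also have "\<dots> \<in> PT" by (intro PT_ops step base) simp_all
      finally show ?case .
    qed (simp_all add: X.psi_zero X.psi_add X.psi_smult S.T.br_lin PT_ops)
  qed
qed

text \<open>The zero element is treated apart, because the definition of \<MM>-quotients provides
  denominators for nonzero elements only.\<close>

lemma absorbs_ex:
  assumes q: "q \<in> pcarrier S \<sigma>"
  shows "\<exists>K. X.absorbs (TKK_in R S \<sigma> q) K \<and> graded_ideal R T (TKK_grade R V) K"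
proof (cases "q = pzero S \<sigma>")
  case True
  have "X.absorbs (TKK_in R S \<sigma> q) (carrier T)"
    unfolding X.absorbs_def using True K.essential_carrier PT_ops(1) by auto
  then show ?thesis using K.graded_carrier by blast
next
  case False
  then obtain I where "denominators \<sigma> q I" using denominators_ex[OF q] by blast
  then show ?thesis
    using absorbs_denominators[OF q] K.graded_lie_prod[OF generated_graded] by (auto simp: denominators_def)
qed

definition h :: "sign \<Rightarrow> 's \<Rightarrow> (('v \<times> (sign \<Rightarrow> 'v \<Rightarrow> 'v) \<times> 'v) set \<times>
    ('v \<times> (sign \<Rightarrow> 'v \<Rightarrow> 'v) \<times> 'v \<Rightarrow> 'v \<times> (sign \<Rightarrow> 'v \<Rightarrow> 'v) \<times> 'v)) set" where
  "h \<sigma> q = X.hm (TKK_in R S \<sigma> q)"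

lemma h_grade: assumes q: "q \<in> pcarrier S \<sigma>" shows "h \<sigma> q \<in> K.Qg (deg \<sigma>)"
proof -
  obtain K where K: "X.absorbs (TKK_in R S \<sigma> q) K" "graded_ideal R T (TKK_grade R V) K" using absorbs_ex[OF q] by blast
  show ?thesis unfolding h_def
  proof (rule X.hm_grade[OF K])
    fix j x assume x: "x \<in> K" "x \<in> TKK_grade R V j"
    have xc: "x \<in> carrier T" by (rule K.G_closed[OF x(2)])
    have "psi x \<in> TKK_grade R S j" using psi_grade_iff[OF xc] x(2) by simp
    then have "S.T.br (TKK_in R S \<sigma> q) (psi x) \<in> TKK_grade R S (j + deg \<sigma>)"
      using N.brG[OF S.TKK_in_mem[OF q]] by (simp add: add.commute)
    then show "\<exists>y\<in>TKK_grade R V (j + deg \<sigma>). S.T.br (TKK_in R S \<sigma> q) (psi x) = psi y"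
      using psi_grade_iff[OF X.act_closed[OF K(1) x(1)]] X.psi_act[OF K(1) x(1)] by metis
  qed
qed

lemma h_kappa: "x \<in> pcarrier V \<sigma> \<Longrightarrow> h \<sigma> (\<kappa> \<sigma> x) = \<iota> \<sigma> x"
  using X.absorbs_psi(2)[of "TKK_in R V \<sigma> x"] by (simp add: h_def k_def[symmetric] psi_in emb_in)

lemma h_ops:
  assumes q: "q \<in> pcarrier S \<sigma>" and p: "p \<in> pcarrier S \<sigma>"
  shows "h \<sigma> (q \<oplus>\<^bsub>part S \<sigma>\<^esub> p) = h \<sigma> q \<oplus>\<^bsub>K.Q\<^esub> h \<sigma> p"
    and "a \<in> carrier R \<Longrightarrow> h \<sigma> (a \<odot>\<^bsub>part S \<sigma>\<^esub> q) = a \<odot>\<^bsub>K.Q\<^esub> h \<sigma> q"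
proof -
  obtain K J where K: "X.absorbs (TKK_in R S \<sigma> q) K" and J: "X.absorbs (TKK_in R S \<sigma> p) J"
    using absorbs_ex[OF q] absorbs_ex[OF p] by blast
  show "h \<sigma> (q \<oplus>\<^bsub>part S \<sigma>\<^esub> p) = h \<sigma> q \<oplus>\<^bsub>K.Q\<^esub> h \<sigma> p"
    unfolding h_def linear_map_add[OF S.TKK_in_linear q p] by (rule X.absorbs_add(2)[OF K J])
  show "h \<sigma> (a \<odot>\<^bsub>part S \<sigma>\<^esub> q) = a \<odot>\<^bsub>K.Q\<^esub> h \<sigma> q" if a: "a \<in> carrier R"
    unfolding h_def linear_map_smult[OF S.TKK_in_linear a q] using K a by (intro X.absorbs_smult(2))
qed

text \<open>\<open>hm\<close> is multiplicative on TKK(S) wherever it is defined, so it kills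
  [[q,u],v] together with q. For suitable u, v this is a nonzero element of V up to sign, on which
  \<open>hm\<close> is the injective embedding of T.\<close>

lemma h_kernel:
  assumes q: "q \<in> pcarrier S \<sigma>" and z: "h \<sigma> q = \<zero>\<^bsub>K.Q\<^esub>"
  shows "q = pzero S \<sigma>"
proof (rule ccontr)
  assume "q \<noteq> pzero S \<sigma>"
  then obtain \<tau> u v p where uvp: "u \<in> pcarrier V (- \<sigma>)" "v \<in> pcarrier V \<tau>" "p \<in> pcarrier V \<tau>" "p \<noteq> pzero V \<tau>"
    and kp: "k \<tau> p = S.T.br (S.T.br (TKK_in R S \<sigma> q) (k (- \<sigma>) u)) (k \<tau> v) \<or>
      k \<tau> p = \<ominus>\<^bsub>S.T\<^esub> S.T.br (S.T.br (TKK_in R S \<sigma> q) (k (- \<sigma>) u)) (k \<tau> v)"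
    using denominators_ex[OF q] by blast
  define w where "w = S.T.br (S.T.br (TKK_in R S \<sigma> q) (k (- \<sigma>) u)) (k \<tau> v)"
  have wc: "w \<in> carrier S.T" unfolding w_def using q uvp by simp
  obtain K where K: "X.absorbs (TKK_in R S \<sigma> q) K" using absorbs_ex[OF q] by blast
  note u = X.absorbs_psi[OF TKK_in_closed[OF uvp(1)], unfolded psi_in]
  note v = X.absorbs_psi[OF TKK_in_closed[OF uvp(2)], unfolded psi_in]
  have "X.hm w = K.Q.br (K.Q.br (X.hm (TKK_in R S \<sigma> q)) (X.hm (k (- \<sigma>) u))) (X.hm (k \<tau> v))"
    unfolding w_def X.absorbs_bracket(2)[OF X.absorbs_bracket(1)[OF K u(1)] v(1)] X.absorbs_bracket(2)[OF K u(1)] ..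
  also have "\<dots> = \<zero>\<^bsub>K.Q\<^esub>"
    using z X.hm_closed[OF u(1)] X.hm_closed[OF v(1)] by (simp add: h_def)
  finally have hw: "X.hm w = \<zero>\<^bsub>K.Q\<^esub>" .
  let ?P = "TKK_in R V \<tau> p"
  have pc: "?P \<in> carrier T" using uvp by simp
  have "?P = \<zero>\<^bsub>T\<^esub>"
  proof (cases "k \<tau> p = w")
    case True
    then show ?thesis using X.absorbs_psi(2)[OF pc] hw K.emb_eq_zero[OF pc] by (simp add: psi_in)
  next
    case False
    then have "w = \<ominus>\<^bsub>S.T\<^esub> k \<tau> p" using kp wc by (simp add: w_def[symmetric])
    then have "w = psi (\<ominus>\<^bsub>T\<^esub> ?P)" using pc by (simp add: X.psi_neg psi_in)
    then have "\<ominus>\<^bsub>T\<^esub> ?P = \<zero>\<^bsub>T\<^esub>" using X.absorbs_psi(2)[of "\<ominus>\<^bsub>T\<^esub> ?P"] hw K.emb_eq_zero[of "\<ominus>\<^bsub>T\<^esub> ?P"] pc by simp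
    then have "\<ominus>\<^bsub>T\<^esub> (\<ominus>\<^bsub>T\<^esub> ?P) = \<zero>\<^bsub>T\<^esub>" by simp
    then show ?thesis using pc by simp
  qed
  then show False using TKK_in_inject[of \<tau> p "pzero V \<tau>"] uvp(4) by simp
qed

lemma h_mono: "pair_mono R S W h"
  unfolding pair_mono_def pair_hom_def
proof (intro conjI allI ballI)
  fix \<sigma>
  show "linear_map R (part S \<sigma>) (part W \<sigma>) (h \<sigma>)"
    by (rule linear_mapI) (simp_all add: W_parts h_grade h_ops)
  show "inj_on (h \<sigma>) (pcarrier S \<sigma>)"
  proof (rule inj_onI)
    fix q p assume qp: "q \<in> pcarrier S \<sigma>" "p \<in> pcarrier S \<sigma>" "h \<sigma> q = h \<sigma> p"
    have m: "\<ominus> \<one> \<in> carrier R" by simp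
    have hp: "h \<sigma> p \<in> carrier K.Q" by (rule K.Q.G_closed[OF h_grade[OF qp(2)]])
    have e: "(\<ominus> \<one>) \<odot>\<^bsub>part S \<sigma>\<^esub> p = \<ominus>\<^bsub>part S \<sigma>\<^esub> p" using qp(2) by (simp add: S.P.smult_l_minus)
    have "h \<sigma> (q \<oplus>\<^bsub>part S \<sigma>\<^esub> \<ominus>\<^bsub>part S \<sigma>\<^esub> p) = \<zero>\<^bsub>K.Q\<^esub>"
      using h_ops(1)[of q \<sigma> "\<ominus>\<^bsub>part S \<sigma>\<^esub> p"] h_ops(2)[OF qp(2,2) m] qp hp
      by (simp add: e K.Q.smult_l_minus K.Q.M.r_neg)
    then have "q \<oplus>\<^bsub>part S \<sigma>\<^esub> \<ominus>\<^bsub>part S \<sigma>\<^esub> p = pzero S \<sigma>" using qp by (intro h_kernel) simp_all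
    from arg_cong[OF this, of "sec (part S \<sigma>)"] show "q = p"
      using qp(1,2) by (intro S.P.secI[of \<sigma>]) (simp_all add: S.P.sec_simps)
  qed
  fix q y assume q: "q \<in> pcarrier S \<sigma>" and y: "y \<in> pcarrier S (- \<sigma>)"
  obtain K J where K: "X.absorbs (TKK_in R S \<sigma> q) K" and J: "X.absorbs (TKK_in R S (- \<sigma>) y) J"
    using absorbs_ex[OF q] absorbs_ex[OF y] by blast
  have s6: "six_module R (part S \<sigma>)" using six_unit S.P.module_axioms by (simp add: six_module_def six_module_axioms_def)
  note hc = six_module.half_closed[OF s6]
  have "quad S \<sigma> q y = half R \<odot>\<^bsub>part S \<sigma>\<^esub> triple S \<sigma> q y q"
    using q y by (simp add: S.triple_self six_module.half_double[OF s6])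
  then have "h \<sigma> (quad S \<sigma> q y) = half R \<odot>\<^bsub>K.Q\<^esub> h \<sigma> (triple S \<sigma> q y q)"
    using h_ops(2)[OF _ _ hc, of "triple S \<sigma> q y q" \<sigma> q] q y by simp
  also have "h \<sigma> (triple S \<sigma> q y q) = K.Q.br (K.Q.br (h \<sigma> q) (h (- \<sigma>) y)) (h \<sigma> q)"
    using X.absorbs_bracket(2)[OF X.absorbs_bracket(1)[OF K J] K] X.absorbs_bracket(2)[OF K J] S.TKK_triple[OF q y q]
    by (simp add: h_def)
  finally show "h \<sigma> (quad S \<sigma> q y) = quad W \<sigma> (h \<sigma> q) (h (- \<sigma>) y)" by (simp add: W_quad)
qed

text \<open>The products of f(q) with denominators y of q and arbitrary x in V are determined by V,
  since f sends {q,y,x} and {y,q,x} to the images of elements of V. So f(q) - g(q) satisfies the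
  hypothesis of \<open>Q_vanish2\<close> on the ideal generated by the denominators.\<close>

lemma mono_unique:
  assumes f: "pair_hom R S W f" "\<And>\<sigma> x. x \<in> pcarrier V \<sigma> \<Longrightarrow> f \<sigma> (\<kappa> \<sigma> x) = \<iota> \<sigma> x"
    and g: "pair_hom R S W g" "\<And>\<sigma> x. x \<in> pcarrier V \<sigma> \<Longrightarrow> g \<sigma> (\<kappa> \<sigma> x) = \<iota> \<sigma> x"
    and q: "q \<in> pcarrier S \<sigma>"
  shows "f \<sigma> q = g \<sigma> q"
proof -
  interpret W: jordan_pair R W by (rule W_jordan)
  have lf: "linear_map R (part S \<tau>) (part W \<tau>) (f \<tau>)" for \<tau> using f(1) by (simp add: pair_hom_def)
  have lg: "linear_map R (part S \<tau>) (part W \<tau>) (g \<tau>)" for \<tau> using g(1) by (simp add: pair_hom_def)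
  have fq: "f \<sigma> q \<in> K.Qg (deg \<sigma>)" "g \<sigma> q \<in> K.Qg (deg \<sigma>)"
    using linear_map_closed[OF lf q] linear_map_closed[OF lg q] by (simp_all add: W_parts)
  show ?thesis
  proof (cases "q = pzero S \<sigma>")
    case True
    then show ?thesis using linear_map_zero[OF lf S.is_module W.is_module] linear_map_zero[OF lg S.is_module W.is_module] by simp
  next
    case False
    then obtain I where D: "denominators \<sigma> q I" using denominators_ex[OF q] by blast
    then have I: "pair_ideal R V I" "\<And>\<tau>. pair_ann V I \<tau> = {pzero V \<tau>}" by (simp_all add: denominators_def)
    note ic = pair_ideal_closed[OF I(1)]
    let ?A = "f \<sigma> q \<oplus>\<^bsub>K.Q\<^esub> \<ominus>\<^bsub>K.Q\<^esub> g \<sigma> q"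
    note [simp] = K.Q.G_closed[OF fq(1)] K.Q.G_closed[OF fq(2)]
    have agree: "K.Q.br (K.Q.br (f \<sigma> q) (\<iota> (- \<sigma>) y)) (\<iota> \<tau> x) = K.Q.br (K.Q.br (g \<sigma> q) (\<iota> (- \<sigma>) y)) (\<iota> \<tau> x)"
      if y: "y \<in> I (- \<sigma>)" and x: "x \<in> pcarrier V \<tau>" for x y \<tau>
    proof (cases "\<tau> = \<sigma>")
      case True
      have "triple S \<sigma> q (\<kappa> (- \<sigma>) y) (\<kappa> \<sigma> x) \<in> \<kappa> \<sigma> ` pcarrier V \<sigma>" using D y x True by (auto simp: denominators_def)
      then obtain p where p: "p \<in> pcarrier V \<sigma>" "triple S \<sigma> q (\<kappa> (- \<sigma>) y) (\<kappa> \<sigma> x) = \<kappa> \<sigma> p" by auto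
      have *: "K.Q.br (K.Q.br (f \<sigma> q) (\<iota> (- \<sigma>) y)) (\<iota> \<sigma> x) = \<iota> \<sigma> p"
        if f: "pair_hom R S W f" "\<And>\<sigma> x. x \<in> pcarrier V \<sigma> \<Longrightarrow> f \<sigma> (\<kappa> \<sigma> x) = \<iota> \<sigma> x" "f \<sigma> q \<in> K.Qg (deg \<sigma>)" for f
        using pair_hom_triple[OF S.quadratic_pair_axioms W.quadratic_pair_axioms f(1) q kappa_closed[OF ic[OF y]], of "\<kappa> \<sigma> x"]
          f(2)[OF p(1)] f(2)[OF ic[OF y]] f(2)[of x \<sigma>] x True p(2) W_triple[OF f(3), of "\<iota> (- \<sigma>) y" "\<iota> \<sigma> x"]
          emb_mem[OF ic[OF y]] emb_mem[of x \<sigma>] by simp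
      show ?thesis using *[OF f fq(1)] *[OF g fq(2)] True by simp
    next
      case False
      then have t: "\<tau> = - \<sigma>" by (cases \<sigma>; cases \<tau>) auto
      have "triple S (- \<sigma>) (\<kappa> (- \<sigma>) y) q (\<kappa> (- \<sigma>) x) \<in> \<kappa> (- \<sigma>) ` pcarrier V (- \<sigma>)" using D y x t by (auto simp: denominators_def)
      then obtain p where p: "p \<in> pcarrier V (- \<sigma>)" "triple S (- \<sigma>) (\<kappa> (- \<sigma>) y) q (\<kappa> (- \<sigma>) x) = \<kappa> (- \<sigma>) p" by auto
      have *: "K.Q.br (K.Q.br (f \<sigma> q) (\<iota> (- \<sigma>) y)) (\<iota> (- \<sigma>) x) = \<ominus>\<^bsub>K.Q\<^esub> \<iota> (- \<sigma>) p"
        if f: "pair_hom R S W f" "\<And>\<sigma> x. x \<in> pcarrier V \<sigma> \<Longrightarrow> f \<sigma> (\<kappa> \<sigma> x) = \<iota> \<sigma> x" "f \<sigma> q \<in> K.Qg (deg \<sigma>)" for f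
      proof -
        note [simp] = K.Q.G_closed[OF emb_mem[OF ic[OF y]]] K.Q.G_closed[OF f(3)] K.Q.G_closed[OF emb_mem[OF x]]
        have "K.Q.br (K.Q.br (\<iota> (- \<sigma>) y) (f \<sigma> q)) (\<iota> (- \<sigma>) x) = \<iota> (- \<sigma>) p"
          using pair_hom_triple[OF S.quadratic_pair_axioms W.quadratic_pair_axioms f(1) kappa_closed[OF ic[OF y]], of q "\<kappa> (- \<sigma>) x"]
            f(2)[OF p(1)] f(2)[OF ic[OF y]] f(2)[of x "- \<sigma>"] x t p(2) q W_triple[of "\<iota> (- \<sigma>) y" "- \<sigma>" "f \<sigma> q" "\<iota> (- \<sigma>) x"] f(3)
            emb_mem[OF ic[OF y]] emb_mem[of x "- \<sigma>"] by simp
        then show ?thesis using K.Q.br_anti[of "\<iota> (- \<sigma>) y" "f \<sigma> q"] x t K.Q.G_closed[OF emb_mem[of x "- \<sigma>"]]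
          by (simp add: K.Q.br_neg_l)
      qed
      show ?thesis using *[OF f fq(1)] *[OF g fq(2)] t by simp
    qed
    have "?A = \<zero>\<^bsub>K.Q\<^esub>"
    proof (rule K.Q_vanish2[OF _ deg_cases generated_essential[OF I] generated_graded[OF I(1)]])
      show "?A \<in> K.Qg (deg \<sigma>)" by (intro K.Q.G_add K.Q.G_neg fq)
      fix Y t X assume Y: "Y \<in> generated_ideal I" "Y \<in> TKK_grade R V (- deg \<sigma>)" and t: "t = (1::int) \<or> t = -1"
        and X: "X \<in> TKK_grade R V t"
      obtain y where y: "y \<in> pcarrier V (- \<sigma>)" "Y = TKK_in R V (- \<sigma>) y" using Y(2) TKK_grade_deg[of "- \<sigma>"] by auto
      \<comment> \<open>\<open>generated_part\<close> returns from the ideal of T to I itself, where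
        the inclusions for denominators hold.\<close>
      have yI: "y \<in> I (- \<sigma>)" using generated_part[OF I(1)] y Y(1) by simp
      obtain \<tau> where "t = deg \<tau>" using sign_deg_cases[OF t] .
      then obtain x where x: "x \<in> pcarrier V \<tau>" "X = TKK_in R V \<tau> x" using X TKK_grade_deg by auto
      note [simp] = K.Q.G_closed[OF emb_mem[OF y(1)]] K.Q.G_closed[OF emb_mem[OF x(1)]]
      show "K.Q.br (K.Q.br ?A (K.emb Y)) (K.emb X) = \<zero>\<^bsub>K.Q\<^esub>"
        using agree[OF yI x(1)] by (simp add: x(2) y(2) emb_in[symmetric] K.Q.br_lin K.Q.M.r_neg)
    qed
    from arg_cong[OF this, of "sec K.Q"] show ?thesis by (intro K.Q.M.secI) (simp_all add: K.Q.M.sec_simps)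
  qed
qed

end

lemma maximal_pair:
  assumes V: "nondeg_pair R V"
  shows "maximal_M_quotients TYPE('s) R V (Qm_pair R V) (Qm_pair_emb R V)"
proof -
  interpret V: nondeg_pair R V by (rule V)
  show ?thesis
    unfolding maximal_M_quotients_def
  proof (intro conjI V.W_M_quotients allI impI)
    fix S :: "('a, 's) jordan_pair" and \<kappa> assume mq: "M_quotients R V S \<kappa>"
    have "quotient_pair R V S \<kappa>"
      using V mq V.six_unit V.jordan_pair_axioms
      unfolding quotient_pair_def quotient_pair_axioms_def pair_map_def pair_map_axioms_def
      by (auto simp: M_quotients_def pair_mono_def)
    then interpret X: quotient_pair R V S \<kappa> .
    show "\<exists>h. pair_mono R S (Qm_pair R V) h \<and> (\<forall>\<sigma>. \<forall>x\<in>pcarrier V \<sigma>. h \<sigma> (\<kappa> \<sigma> x) = Qm_pair_emb R V \<sigma> x) \<and>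
          (\<forall>h'. pair_mono R S (Qm_pair R V) h' \<and> (\<forall>\<sigma>. \<forall>x\<in>pcarrier V \<sigma>. h' \<sigma> (\<kappa> \<sigma> x) = Qm_pair_emb R V \<sigma> x) \<longrightarrow>
             (\<forall>\<sigma>. \<forall>s\<in>pcarrier S \<sigma>. h' \<sigma> s = h \<sigma> s))"
    proof (intro exI[of _ X.h] conjI allI ballI impI X.h_mono X.h_kappa, assumption)
      fix h' \<sigma> s assume h': "pair_mono R S (Qm_pair R V) h' \<and> (\<forall>\<sigma>. \<forall>x\<in>pcarrier V \<sigma>. h' \<sigma> (\<kappa> \<sigma> x) = Qm_pair_emb R V \<sigma> x)"
        and s: "s \<in> pcarrier S \<sigma>"
      show "h' \<sigma> s = X.h \<sigma> s"
        by (rule X.mono_unique[OF _ _ _ X.h_kappa s]) (use h' X.h_mono in \<open>auto simp: pair_mono_def\<close>)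
    qed
  qed
qed

section \<open>Isomorphisms of graded Lie algebras\<close>

locale lie_iso = lie_algebra R L + N: lie_algebra R N
  for R :: "('a, 'r) ring_scheme" (structure) and L :: "('a, 'l) module" (structure) and N :: "('a, 'n) module" +
  fixes \<phi> :: "'l \<Rightarrow> 'n"
  assumes phi_linear: "linear_map R L N \<phi>" and phi_bij: "bij_betw \<phi> (carrier L) (carrier N)"
    and phi_bracket: "\<lbrakk>x \<in> carrier L; y \<in> carrier L\<rbrakk> \<Longrightarrow> \<phi> (x \<otimes>\<^bsub>L\<^esub> y) = \<phi> x \<otimes>\<^bsub>N\<^esub> \<phi> y"
begin

lemma phi_closed [simp, intro]: "x \<in> carrier L \<Longrightarrow> \<phi> x \<in> carrier N"
  by (rule linear_map_closed[OF phi_linear])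

lemma phi_add: "\<lbrakk>x \<in> carrier L; y \<in> carrier L\<rbrakk> \<Longrightarrow> \<phi> (x \<boxplus> y) = \<phi> x \<oplus>\<^bsub>N\<^esub> \<phi> y"
  by (rule linear_map_add[OF phi_linear])

lemma phi_smult: "\<lbrakk>a \<in> carrier R; x \<in> carrier L\<rbrakk> \<Longrightarrow> \<phi> (a \<cdot> x) = a \<odot>\<^bsub>N\<^esub> \<phi> x"
  by (rule linear_map_smult[OF phi_linear])

lemma phi_zero [simp]: "\<phi> \<zero>\<^sub>L = \<zero>\<^bsub>N\<^esub>"
  by (rule linear_map_zero[OF phi_linear module_axioms N.module_axioms])

lemma phi_eq: "\<lbrakk>\<phi> x = \<phi> y; x \<in> carrier L; y \<in> carrier L\<rbrakk> \<Longrightarrow> x = y"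
  using bij_betw_imp_inj_on[OF phi_bij] by (auto dest: inj_onD)

lemma phi_surj: assumes "y \<in> carrier N" obtains x where "x \<in> carrier L" "y = \<phi> x"
  using bij_betw_imp_surj_on[OF phi_bij] assms by blast

text \<open>The inverse of \<open>\<phi>\<close>; \<open>lie_iso_inv\<close> lets statements about
  images be reused for preimages.\<close>

definition \<theta> :: "'n \<Rightarrow> 'l" where "\<theta> = the_inv_into (carrier L) \<phi>"

lemma theta_phi [simp]: "x \<in> carrier L \<Longrightarrow> \<theta> (\<phi> x) = x"
  unfolding \<theta>_def by (rule the_inv_into_f_f[OF bij_betw_imp_inj_on[OF phi_bij]])

lemma theta_closed [simp, intro]: "y \<in> carrier N \<Longrightarrow> \<theta> y \<in> carrier L"
  by (erule phi_surj) simp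

lemma phi_theta [simp]: "y \<in> carrier N \<Longrightarrow> \<phi> (\<theta> y) = y"
  by (erule phi_surj) simp

lemma lie_iso_inv: "lie_iso R N L \<theta>"
proof (intro lie_iso.intro lie_iso_axioms.intro lie_algebra_axioms N.lie_algebra_axioms)
  show "linear_map R N L \<theta>"
    by (rule linear_mapI) (auto intro!: phi_eq simp: phi_add phi_smult)
  show "bij_betw \<theta> (carrier N) (carrier L)"
    unfolding \<theta>_def by (rule bij_betw_the_inv_into[OF phi_bij])
qed (auto intro!: phi_eq simp: phi_bracket)

lemma image_submodule: assumes H: "submodule H R L" shows "submodule (\<phi> ` H) R N"
proof (rule N.submoduleI')
  have c: "x \<in> H \<Longrightarrow> x \<in> carrier L" for x using submoduleE(1)[OF H] by blast
  show "\<phi> ` H \<subseteq> carrier N" using c by auto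
  show "\<zero>\<^bsub>N\<^esub> \<in> \<phi> ` H" using submodule_zero[OF H] phi_zero by (metis image_eqI)
  fix x assume "x \<in> \<phi> ` H"
  then obtain x' where x: "x = \<phi> x'" "x' \<in> H" by blast
  { fix y assume "y \<in> \<phi> ` H"
    then obtain y' where y: "y = \<phi> y'" "y' \<in> H" by blast
    show "x \<oplus>\<^bsub>N\<^esub> y \<in> \<phi> ` H"
      using submoduleE(5)[OF H x(2) y(2)] by (rule image_eqI[rotated]) (simp add: x y c phi_add) }
  fix a assume a: "a \<in> carrier R"
  show "a \<odot>\<^bsub>N\<^esub> x \<in> \<phi> ` H"
    using submoduleE(4)[OF H a x(2)] by (rule image_eqI[rotated]) (simp add: x a c phi_smult)
qed

lemma preimage_submodule:
  assumes H: "submodule H R N" shows "submodule {x \<in> carrier L. \<phi> x \<in> H} R L"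
  by (rule submoduleI')
    (use N.submodule_zero[OF H] N.submoduleE(4,5)[OF H] in \<open>auto simp: phi_add phi_smult\<close>)

lemma image_ideal: assumes I: "lie_ideal R L I" shows "lie_ideal R N (\<phi> ` I)"
  unfolding lie_ideal_def
proof (intro conjI ballI image_submodule[OF ideal_submodule[OF I]])
  fix x y assume "x \<in> \<phi> ` I" and y: "y \<in> carrier N"
  then obtain x' where x: "x = \<phi> x'" "x' \<in> I" by blast
  show "x \<otimes>\<^bsub>N\<^esub> y \<in> \<phi> ` I"
    using ideal_left[OF I x(2) theta_closed[OF y]]
    by (rule image_eqI[rotated]) (simp add: x y phi_bracket ideal_closed[OF I])
qed

lemma preimage_ideal: "lie_ideal R N J \<Longrightarrow> lie_ideal R L {x \<in> carrier L. \<phi> x \<in> J}"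
  using preimage_submodule unfolding lie_ideal_def by (auto simp: phi_bracket)

lemma image_essential: assumes I: "essential_ideal R L I" shows "essential_ideal R N (\<phi> ` I)"
  unfolding essential_ideal_def
proof (intro conjI allI impI)
  have i: "lie_ideal R L I" using I by (simp add: essential_ideal_def)
  then show "lie_ideal R N (\<phi> ` I)" by (rule image_ideal)
  fix J assume "lie_ideal R N J \<and> J \<noteq> {\<zero>\<^bsub>N\<^esub>}"
  then have J: "lie_ideal R N J" "J \<noteq> {\<zero>\<^bsub>N\<^esub>}" by simp_all
  let ?J = "{x \<in> carrier L. \<phi> x \<in> J}"
  have z: "\<zero>\<^bsub>N\<^esub> \<in> J" using N.submodule_zero[OF N.ideal_submodule[OF J(1)]] .
  then obtain y where y: "y \<in> J" "y \<noteq> \<zero>\<^bsub>N\<^esub>" using J(2) by blast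
  then have yc: "y \<in> carrier N" using N.ideal_closed[OF J(1)] by blast
  then obtain x where x: "x \<in> carrier L" "y = \<phi> x" by (rule phi_surj)
  have "x \<in> ?J" "x \<noteq> \<zero>\<^sub>L" using x y by auto
  then have "?J \<noteq> {\<zero>\<^sub>L}" by blast
  then have ne: "I \<inter> ?J \<noteq> {\<zero>\<^sub>L}" using I preimage_ideal[OF J(1)] by (simp add: essential_ideal_def)
  have "\<zero>\<^sub>L \<in> I \<inter> ?J" using z submodule_zero[OF ideal_submodule[OF i]] by simp
  then obtain w where w: "w \<in> I \<inter> ?J" "w \<noteq> \<zero>\<^sub>L" using ne by blast
  then have "\<phi> w \<in> \<phi> ` I \<inter> J" "\<phi> w \<noteq> \<zero>\<^bsub>N\<^esub>" using phi_eq[of w "\<zero>\<^sub>L"] by auto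
  then show "\<phi> ` I \<inter> J \<noteq> {\<zero>\<^bsub>N\<^esub>}" by blast
qed

lemma image_lie_prod:
  assumes A: "A \<subseteq> carrier L" and B: "B \<subseteq> carrier L"
  shows "\<phi> ` lie_prod R L A B = lie_prod R N (\<phi> ` A) (\<phi> ` B)"
proof
  let ?g = "{x \<bullet> y |x y. x \<in> A \<and> y \<in> B}" and ?h = "{x \<otimes>\<^bsub>N\<^esub> y |x y. x \<in> \<phi> ` A \<and> y \<in> \<phi> ` B}"
  have g: "?g \<subseteq> carrier L" using A B by blast
  have h: "?h \<subseteq> carrier N" using A B by blast
  have gh: "\<phi> n \<in> ?h" if n: "n \<in> ?g" for n
  proof -
    obtain x y where "n = x \<bullet> y" "x \<in> A" "y \<in> B" using n by blast
    then show ?thesis using A B phi_bracket[of x y] by blast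
  qed
  have "lie_prod R L A B \<subseteq> {x \<in> carrier L. \<phi> x \<in> lie_prod R N (\<phi> ` A) (\<phi> ` B)}"
    unfolding lie_prod_def
    by (rule module_span_least[OF preimage_submodule[OF N.module_span_submodule[OF h]]])
      (use g gh N.module_span_base[of _ ?h] in blast)
  then show "\<phi> ` lie_prod R L A B \<subseteq> lie_prod R N (\<phi> ` A) (\<phi> ` B)" by blast
  show "lie_prod R N (\<phi> ` A) (\<phi> ` B) \<subseteq> \<phi> ` lie_prod R L A B"
    unfolding lie_prod_def
  proof (rule N.module_span_least[OF image_submodule[OF module_span_submodule[OF g]]], rule subsetI)
    fix n assume "n \<in> ?h"
    then obtain x y where xy: "n = \<phi> x \<otimes>\<^bsub>N\<^esub> \<phi> y" "x \<in> A" "y \<in> B" by blast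
    then have "x \<bullet> y \<in> module_span R L ?g" by (intro module_span_base) blast
    then show "n \<in> \<phi> ` module_span R L ?g"
      by (rule image_eqI[rotated]) (use xy A B phi_bracket[of x y] in \<open>auto simp: subset_iff\<close>)
  qed
qed

lemma image_three_graded:
  assumes G: "three_graded R L G" and H: "\<And>k. \<phi> ` G k = H k"
  shows "three_graded R N H"
proof -
  interpret G: three_graded R L G by (rule G)
  have c: "x \<in> G k \<Longrightarrow> x \<in> carrier L" for x k using submoduleE(1)[OF G.grade_submodule] by blast
  show ?thesis
  proof (intro three_graded.intro three_graded_axioms.intro N.lie_algebra_axioms)
    show "submodule (H k) R N" for k using image_submodule[OF G.grade_submodule[of k]] by (simp add: H)
    show "H k = {\<zero>\<^bsub>N\<^esub>}" if "\<bar>k\<bar> > 1" for k using G.grade_trivial[OF that] H[of k] by auto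
    show "x \<otimes>\<^bsub>N\<^esub> y \<in> H (i + j)" if h: "x \<in> H i" "y \<in> H j" for x y i j
    proof -
      obtain x' y' where xy: "x = \<phi> x'" "x' \<in> G i" "y = \<phi> y'" "y' \<in> G j" using h unfolding H[symmetric] by blast
      show ?thesis unfolding H[symmetric] using G.grade_bracket[OF xy(2,4)]
        by (rule image_eqI[rotated]) (simp add: xy phi_bracket[OF c[OF xy(2)] c[OF xy(4)]])
    qed
    fix y assume "y \<in> carrier N"
    then obtain x where x: "x \<in> carrier L" "y = \<phi> x" by (rule phi_surj)
    obtain a b d where abd: "a \<in> G (-1)" "b \<in> G 0" "d \<in> G 1" "x = a \<boxplus> b \<boxplus> d" using G.decompose[OF x(1)] .
    show "\<exists>!p\<in>H (-1) \<times> H 0 \<times> H 1. y = fst p \<oplus>\<^bsub>N\<^esub> fst (snd p) \<oplus>\<^bsub>N\<^esub> snd (snd p)"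
    proof (rule ex1I[of _ "(\<phi> a, \<phi> b, \<phi> d)"])
      have "(\<phi> a, \<phi> b, \<phi> d) \<in> H (-1) \<times> H 0 \<times> H 1" unfolding H[symmetric] using abd by blast
      then show "(\<phi> a, \<phi> b, \<phi> d) \<in> H (-1) \<times> H 0 \<times> H 1 \<and>
          y = fst (\<phi> a, \<phi> b, \<phi> d) \<oplus>\<^bsub>N\<^esub> fst (snd (\<phi> a, \<phi> b, \<phi> d)) \<oplus>\<^bsub>N\<^esub> snd (snd (\<phi> a, \<phi> b, \<phi> d))"
        using abd(1-3)[THEN c] by (simp add: x(2) abd(4) phi_add)
      fix p assume "p \<in> H (-1) \<times> H 0 \<times> H 1 \<and> y = fst p \<oplus>\<^bsub>N\<^esub> fst (snd p) \<oplus>\<^bsub>N\<^esub> snd (snd p)"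
      then have p: "p \<in> H (-1) \<times> H 0 \<times> H 1" and e: "y = fst p \<oplus>\<^bsub>N\<^esub> fst (snd p) \<oplus>\<^bsub>N\<^esub> snd (snd p)" by simp_all
      obtain a' b' d' where q: "a' \<in> G (-1)" "b' \<in> G 0" "d' \<in> G 1" "p = (\<phi> a', \<phi> b', \<phi> d')"
        using p unfolding H[symmetric] by (cases p) auto
      note [simp] = abd(1-3)[THEN c] q(1-3)[THEN c]
      have "\<phi> (a \<boxplus> b \<boxplus> d) = \<phi> (a' \<boxplus> b' \<boxplus> d')" using e x(2) by (simp add: q(4) abd(4) phi_add)
      then have "a \<boxplus> b \<boxplus> d = a' \<boxplus> b' \<boxplus> d'" by (rule phi_eq) simp_all
      from G.decompose_unique[OF abd(1-3) q(1-3) this] show "p = (\<phi> a, \<phi> b, \<phi> d)" by (simp add: q(4))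
    qed
  qed
qed

end

locale graded_iso = nondeg_graded R L G + N: nondeg_graded R N H + lie_iso R L N \<phi>
  for R :: "('a, 'r) ring_scheme" (structure) and L :: "('a, 'l) module" (structure) and G
    and N :: "('a, 'n) module" and H and \<phi> +
  assumes phi_grade: "x \<in> carrier L \<Longrightarrow> \<phi> x \<in> H k \<longleftrightarrow> x \<in> G k"
begin

lemma theta_grade: "y \<in> carrier N \<Longrightarrow> \<theta> y \<in> G k \<longleftrightarrow> y \<in> H k"
  using phi_grade[of "\<theta> y"] by simp

lemma graded_iso_inv: "graded_iso R N H L G \<theta>"
  by (intro graded_iso.intro graded_iso_axioms.intro lie_iso_inv nondeg_graded_axioms N.nondeg_graded_axioms theta_grade)

lemma image_graded: assumes I: "graded_ideal R L G I" shows "graded_ideal R N H (\<phi> ` I)"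
  unfolding graded_ideal_def
proof (intro conjI ballI)
  note i = graded_idealD[OF I]
  show "lie_ideal R N (\<phi> ` I)" by (rule image_ideal[OF i])
  fix y assume "y \<in> \<phi> ` I"
  then obtain x where x: "y = \<phi> x" "x \<in> I" by blast
  then obtain a b c where abc: "a \<in> I" "a \<in> G (-1)" "b \<in> I" "b \<in> G 0" "c \<in> I" "c \<in> G 1" "x = a \<boxplus> b \<boxplus> c"
    using I unfolding graded_ideal_def by blast
  note [simp] = ideal_closed[OF i abc(1)] ideal_closed[OF i abc(3)] ideal_closed[OF i abc(5)]
  show "\<exists>a\<in>\<phi> ` I \<inter> H (-1). \<exists>b\<in>\<phi> ` I \<inter> H 0. \<exists>c\<in>\<phi> ` I \<inter> H 1. y = a \<oplus>\<^bsub>N\<^esub> b \<oplus>\<^bsub>N\<^esub> c"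
    by (rule bexI[of _ "\<phi> a"], rule bexI[of _ "\<phi> b"], rule bexI[of _ "\<phi> c"])
      (use abc in \<open>simp_all add: x(1) phi_add phi_grade\<close>)
qed

text \<open>Through \<open>\<theta>\<close> the algebra N sits inside the quotient algebra of L.
  Every class of L absorbs an essential ideal of N, so the map \<open>hm\<close> of this extension
  compares the two quotient algebras and inherits linearity and multiplicativity from the general
  theory.\<close>

lemma quotient_extension: "lie_extension R N H Q (\<lambda>y. emb (\<theta> y))"
proof (intro lie_extension.intro lie_extension_axioms.intro N.nondeg_graded_axioms Q_lie)
  interpret I: lie_iso R N L \<theta> by (rule lie_iso_inv)
  show "linear_map R N Q (\<lambda>y. emb (\<theta> y))" by (rule linear_map_compose[OF I.phi_linear emb_linear])
  show "inj_on (\<lambda>y. emb (\<theta> y)) (carrier N)"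
    by (rule inj_onI) (auto dest!: inj_onD[OF emb_inj] intro: I.phi_eq)
  show "emb (\<theta> (x \<otimes>\<^bsub>N\<^esub> y)) = emb (\<theta> x) \<otimes>\<^bsub>Q\<^esub> emb (\<theta> y)" if "x \<in> carrier N" "y \<in> carrier N" for x y
    using that by (simp add: I.phi_bracket emb_bracket)
qed

sublocale X: lie_extension R N H "Qm R L" "\<lambda>y. emb (\<theta> y)"
  by (rule quotient_extension)

lemma absorbs_cl:
  assumes p: "pder I \<delta>"
  shows "X.absorbs (cl I \<delta>) (\<phi> ` I)"
    and "x \<in> I \<Longrightarrow> cl I \<delta> \<otimes>\<^bsub>Q\<^esub> emb (\<theta> (\<phi> x)) = emb (\<theta> (\<phi> (\<delta> x)))"
proof -
  note i = pder_ideal[OF p]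
  show *: "cl I \<delta> \<otimes>\<^bsub>Q\<^esub> emb (\<theta> (\<phi> x)) = emb (\<theta> (\<phi> (\<delta> x)))" if "x \<in> I" for x
    using emb_act[OF p that] ideal_closed[OF i that] Der_closed[OF pder_der[OF p] i that] by simp
  show "X.absorbs (cl I \<delta>) (\<phi> ` I)"
  proof (rule X.absorbsI[OF cl_closed[OF p] image_essential[OF pder_ess[OF p]]])
    fix y assume "y \<in> \<phi> ` I"
    then obtain x where x: "y = \<phi> x" "x \<in> I" by blast
    show "\<exists>z\<in>carrier N. cl I \<delta> \<otimes>\<^bsub>Q\<^esub> emb (\<theta> y) = emb (\<theta> z)"
      unfolding x(1) using *[OF x(2)] phi_closed[OF Der_closed[OF pder_der[OF p] i x(2)]] by blast
  qed
qed

lemma hm_grade_image: assumes "A \<in> Qg k" shows "X.hm A \<in> N.Qg k"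
proof -
  obtain I \<delta> where I: "A = cl I \<delta>" "pder I \<delta>" "graded_ideal R L G I" "homogeneous I \<delta> k" using QgE[OF assms] .
  note i = pder_ideal[OF I(2)]
  show ?thesis
    unfolding I(1)
  proof (rule X.hm_grade[OF absorbs_cl(1)[OF I(2)] image_graded[OF I(3)]])
    fix j y assume y: "y \<in> \<phi> ` I" "y \<in> H j"
    then obtain x where x: "y = \<phi> x" "x \<in> I" by blast
    have d: "\<delta> x \<in> G (j + k)"
      using homogeneousD[OF I(4) x(2) _ refl] y(2) phi_grade[OF ideal_closed[OF i x(2)]] by (simp add: x(1))
    then have "\<phi> (\<delta> x) \<in> H (j + k)" using phi_grade[OF G_closed[OF d]] by simp
    then show "\<exists>z\<in>H (j + k). cl I \<delta> \<otimes>\<^bsub>Q\<^esub> emb (\<theta> y) = emb (\<theta> z)"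
      unfolding x(1) using absorbs_cl(2)[OF I(2) x(2)] by blast
  qed
qed

text \<open>Surjectivity: a class of N comes from the conjugate of its representative by the
  isomorphism.\<close>

lemma hm_preimage:
  assumes p: "N.pder I \<mu>"
  defines "\<delta> \<equiv> (\<lambda>x\<in>\<theta> ` I. \<theta> (\<mu> (\<phi> x)))"
  shows "pder (\<theta> ` I) \<delta>" "X.hm (cl (\<theta> ` I) \<delta>) = N.cl I \<mu>"
proof -
  interpret J: graded_iso R N H L G \<theta> by (rule graded_iso_inv)
  note i = N.pder_ideal[OF p] and d = N.pder_der[OF p]
  note e = J.image_essential[OF N.pder_ess[OF p]]
  have c: "x \<in> carrier L" "\<phi> x \<in> I" if "x \<in> \<theta> ` I" for x
    using that N.ideal_closed[OF i] by auto
  have m: "\<mu> (\<phi> x) \<in> carrier N" if "x \<in> \<theta> ` I" for x using N.Der_closed[OF d i c(2)[OF that]] .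
  have "\<delta> \<in> Der R L (\<theta> ` I)"
    unfolding \<delta>_def
    by (rule DerI[OF _ _ _ _ J.image_ideal[OF i]])
      (simp_all add: c m phi_add phi_smult phi_bracket N.Der_add[OF d i] N.Der_smult[OF d i] N.Der_br[OF d i]
        J.phi_add J.phi_smult J.phi_bracket)
  then show q: "pder (\<theta> ` I) \<delta>" using e by (simp add: pder_def)
  have im: "\<phi> ` \<theta> ` I = I" using N.ideal_closed[OF i] by (force simp: image_image)
  show "X.hm (cl (\<theta> ` I) \<delta>) = N.cl I \<mu>"
  proof (rule X.hm_eqI[OF absorbs_cl(1)[OF q] p N.pder_ess[OF p]])
    fix y assume y: "y \<in> I"
    have "y \<in> carrier N" "\<mu> y \<in> carrier N" using N.ideal_closed[OF i y] N.Der_closed[OF d i y] .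
    then show "emb (\<theta> (\<mu> y)) = cl (\<theta> ` I) \<delta> \<otimes>\<^bsub>Q\<^esub> emb (\<theta> y)"
      using absorbs_cl(2)[OF q, of "\<theta> y"] y by (simp add: \<delta>_def)
  qed (simp add: im)
qed

lemma hm_grade_eq: "X.hm ` Qg k = N.Qg k"
proof (intro equalityI subsetI)
  fix B assume "B \<in> N.Qg k"
  then obtain I \<mu> where I: "B = N.cl I \<mu>" "N.pder I \<mu>" "graded_ideal R N H I" "N.homogeneous I \<mu> k" by (rule N.QgE)
  interpret J: graded_iso R N H L G \<theta> by (rule graded_iso_inv)
  have "homogeneous (\<theta> ` I) (\<lambda>x\<in>\<theta> ` I. \<theta> (\<mu> (\<phi> x))) k"
    unfolding homogeneous_def
  proof (intro allI ballI)
    fix j x assume "x \<in> \<theta> ` I \<inter> G j"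
    then obtain y where y: "x = \<theta> y" "y \<in> I" "\<theta> y \<in> G j" by blast
    have yc: "y \<in> carrier N" "\<mu> y \<in> carrier N"
      using N.ideal_closed[OF N.pder_ideal[OF I(2)] y(2)] N.Der_closed[OF N.pder_der[OF I(2)] N.pder_ideal[OF I(2)] y(2)] .
    then have "\<mu> y \<in> H (j + k)" using N.homogeneousD[OF I(4) y(2) _ refl] y(3) theta_grade by simp
    then show "(\<lambda>x\<in>\<theta> ` I. \<theta> (\<mu> (\<phi> x))) x \<in> G (j + k)" using y yc theta_grade by simp
  qed
  from QgI[OF hm_preimage(1)[OF I(2)] J.image_graded[OF I(3)] this] hm_preimage(2)[OF I(2)] I(1)
  show "B \<in> X.hm ` Qg k" by (metis image_eqI)
qed (use hm_grade_image in blast)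

lemma quotient_iso: "lie_iso R Q N.Q X.hm"
proof (intro lie_iso.intro lie_iso_axioms.intro Q_lie N.Q_lie)
  have ab: "\<exists>K. X.absorbs A K" if "A \<in> carrier Q" for A
    using that absorbs_cl(1) by (elim Q_carrierE) blast
  show add: "linear_map R Q N.Q X.hm"
  proof (rule linear_mapI)
    show "X.hm A \<in> carrier N.Q" if "A \<in> carrier Q" for A using ab[OF that] X.hm_closed by blast
    show "X.hm (A \<oplus>\<^bsub>Q\<^esub> B) = X.hm A \<oplus>\<^bsub>N.Q\<^esub> X.hm B" if "A \<in> carrier Q" "B \<in> carrier Q" for A B
      using ab[OF that(1)] ab[OF that(2)] X.absorbs_add(2) by blast
    show "X.hm (a \<odot>\<^bsub>Q\<^esub> A) = a \<odot>\<^bsub>N.Q\<^esub> X.hm A" if "a \<in> carrier R" "A \<in> carrier Q" for a A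
      using ab[OF that(2)] X.absorbs_smult(2) that(1) by blast
  qed
  show "X.hm (A \<otimes>\<^bsub>Q\<^esub> B) = X.hm A \<otimes>\<^bsub>N.Q\<^esub> X.hm B" if "A \<in> carrier Q" "B \<in> carrier Q" for A B
    using ab[OF that(1)] ab[OF that(2)] X.absorbs_bracket(2) by blast
  have ker: "A = \<zero>\<^bsub>Q\<^esub>" if A: "A \<in> carrier Q" "X.hm A = \<zero>\<^bsub>N.Q\<^esub>" for A
  proof -
    obtain I \<delta> where I: "pder I \<delta>" "A = cl I \<delta>" using Q_carrierE[OF A(1)] .
    have "\<delta> x = \<zero>\<^sub>L" if x: "x \<in> I" for x
    proof -
      have d: "\<delta> x \<in> carrier L" using Der_closed[OF pder_der[OF I(1)] pder_ideal[OF I(1)] x] .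
      have "cl I \<delta> \<otimes>\<^bsub>Q\<^esub> emb (\<theta> (\<phi> x)) = \<zero>\<^bsub>Q\<^esub>"
        using X.hm_zero_iff[OF absorbs_cl(1)[OF I(1)]] A(2) x by (simp add: I(2))
      then show ?thesis using absorbs_cl(2)[OF I(1) x] emb_eq_zero[OF d] d by simp
    qed
    then show ?thesis unfolding I(2) by (simp add: cl_eq_zero[OF I(1)])
  qed
  show "bij_betw X.hm (carrier Q) (carrier N.Q)"
    unfolding bij_betw_def
  proof (intro conjI equalityI subsetI)
    show "inj_on X.hm (carrier Q)"
    proof (rule inj_onI)
      fix A B assume AB: "A \<in> carrier Q" "B \<in> carrier Q" "X.hm A = X.hm B"
      have "X.hm (A \<oplus>\<^bsub>Q\<^esub> \<ominus>\<^bsub>Q\<^esub> B) = \<zero>\<^bsub>N.Q\<^esub>"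
        using AB linear_map_closed[OF add AB(2)]
        by (simp add: linear_map_add[OF add] linear_map_neg[OF add Q_module N.Q_module] N.Q.M.r_neg)
      then have "A \<oplus>\<^bsub>Q\<^esub> \<ominus>\<^bsub>Q\<^esub> B = \<zero>\<^bsub>Q\<^esub>" using AB by (intro ker) simp_all
      from arg_cong[OF this, of "sec Q"] show "A = B"
        using AB by (intro Q.M.secI) (simp_all add: Q.M.sec_simps)
    qed
    show "B \<in> carrier N.Q" if "B \<in> X.hm ` carrier Q" for B using that linear_map_closed[OF add] by blast
    show "B \<in> X.hm ` carrier Q" if "B \<in> carrier N.Q" for B
      using that hm_preimage cl_closed by (elim N.Q_carrierE) (metis image_eqI)
  qed
qed

end

lemma lie_isoD: "lie_iso R L N \<phi> \<Longrightarrow> lie_isomorphic R L N"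
  unfolding lie_isomorphic_def lie_iso_def lie_iso_axioms_def by blast

section \<open>Strongly nondegenerate Jordan 3-graded algebras\<close>

locale nondeg_jordan_graded = jordan_three_graded R L G
  for R :: "('a, 'r) ring_scheme" (structure) and L :: "('a, 'l) module" (structure) and G :: "int \<Rightarrow> 'l set" +
  assumes six_unit: "add_pow R (6::nat) \<one> \<in> Units R" and strongly_nondegenerate: "lie_strongly_nondegenerate L"

sublocale nondeg_jordan_graded \<subseteq> subgraded_lie R L G
  by (intro subgraded_lie.intro subgraded_lie_axioms.intro lie_algebra_axioms)
    (fact six_unit grade_submodule grade_trivial grade_bracket)+

context nondeg_jordan_graded
begin

lemma absolute_zero_divisor: "\<lbrakk>x \<in> carrier L; \<And>y. y \<in> carrier L \<Longrightarrow> x \<bullet> x \<bullet> y = \<zero>\<^sub>L\<rbrakk> \<Longrightarrow> x = \<zero>\<^sub>L"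
  using strongly_nondegenerate unfolding lie_strongly_nondegenerate_def by blast

text \<open>For z of degree s, (ad z)^2 kills degrees 0 and s automatically, so testing against
  degree -s already makes z an absolute zero divisor.\<close>

lemma homogeneous_nondeg:
  assumes s: "s = 1 \<or> s = -1" and z: "z \<in> G s" and h: "\<And>y. y \<in> G (- s) \<Longrightarrow> z \<bullet> z \<bullet> y = \<zero>\<^sub>L"
  shows "z = \<zero>\<^sub>L"
proof (rule absolute_zero_divisor)
  show zc: "z \<in> carrier L" by (rule G_closed[OF z])
  fix y assume "y \<in> carrier L"
  then obtain a b c where abc: "a \<in> G (-1)" "b \<in> G 0" "c \<in> G 1" "y = a \<boxplus> b \<boxplus> c" by (rule decompose)
  have *: "z \<bullet> z \<bullet> u = \<zero>\<^sub>L" if u: "u \<in> G k" and k: "k = -1 \<or> k = 0 \<or> k = 1" for u k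
  proof (cases "k = - s")
    case True then show ?thesis using h u by simp
  next
    case False
    then show ?thesis using br0[OF z brG[OF z u refl]] s k by auto
  qed
  show "z \<bullet> z \<bullet> y = \<zero>\<^sub>L"
    unfolding abc(4) using *[OF abc(1)] *[OF abc(2)] *[OF abc(3)] abc(1-3)[THEN G_closed] zc by (simp add: br_lin)
qed

text \<open>The centralizer of d contains degrees 1 and -1, hence by Jacobi their brackets, which
  span degree 0. So d is central and in particular an absolute zero divisor.\<close>

lemma degree_zero_faithful:
  assumes d: "d \<in> G 0" and h: "\<And>s x. \<lbrakk>s = 1 \<or> s = -1; x \<in> G s\<rbrakk> \<Longrightarrow> d \<bullet> x = \<zero>\<^sub>L"
  shows "d = \<zero>\<^sub>L"
proof (rule absolute_zero_divisor)
  show dc: "d \<in> carrier L" by (rule G_closed[OF d])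
  have sub: "submodule {x \<in> carrier L. d \<bullet> x = \<zero>\<^sub>L} R L"
    by (rule submoduleI') (use dc in \<open>auto simp: br_lin\<close>)
  have 0: "G 0 \<subseteq> {x \<in> carrier L. d \<bullet> x = \<zero>\<^sub>L}"
    unfolding generated[symmetric] lie_prod_def
  proof (rule module_span_least[OF sub], rule subsetI)
    fix n assume "n \<in> {x \<bullet> y |x y. x \<in> G 1 \<and> y \<in> G (- 1)}"
    then obtain x y where xy: "n = x \<bullet> y" "x \<in> G 1" "y \<in> G (-1)" by blast
    note [simp] = G_closed[OF xy(2)] G_closed[OF xy(3)]
    have "d \<bullet> n = \<zero>\<^sub>L" unfolding xy(1) using jacobi_der[OF dc, of x y] h[of 1 x] h[of "-1" y] xy by simp
    then show "n \<in> {x \<in> carrier L. d \<bullet> x = \<zero>\<^sub>L}" using xy by simp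
  qed
  fix y assume "y \<in> carrier L"
  then obtain a b c where abc: "a \<in> G (-1)" "b \<in> G 0" "c \<in> G 1" "y = a \<boxplus> b \<boxplus> c" by (rule decompose)
  have "d \<bullet> y = \<zero>\<^sub>L"
    unfolding abc(4) using h[of "-1" a] h[of 1 c] 0 abc(1-3) abc(1-3)[THEN G_closed] dc by (auto simp: br_lin)
  then show "d \<bullet> d \<bullet> y = \<zero>\<^sub>L" using dc by simp
qed

end

sublocale nondeg_jordan_graded \<subseteq> nondeg_graded R L G
  by (intro nondeg_graded.intro nondeg_graded_axioms.intro three_graded_axioms six_unit)
    (fact homogeneous_nondeg degree_zero_faithful)+

sublocale nondeg_jordan_graded \<subseteq> reduced_graded R L G
  by (intro reduced_graded.intro reduced_graded_axioms.intro three_graded_axioms six_unit generated)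
    (fact degree_zero_faithful)

context nondeg_jordan_graded
begin

lemma AP_nondeg: "nondeg_pair R AP"
proof (intro nondeg_pair.intro nondeg_pair_axioms.intro AP_jordan six_unit)
  show "pair_strongly_nondegenerate AP"
    unfolding pair_strongly_nondegenerate_def
  proof (intro allI ballI impI)
    fix \<sigma> x assume "x \<in> pcarrier AP \<sigma>" and h: "\<forall>y\<in>pcarrier AP (- \<sigma>). quad AP \<sigma> x y = pzero AP \<sigma>"
    then have x: "x \<in> G (deg \<sigma>)" by (simp add: AP_parts)
    have "x = \<zero>\<^sub>L"
    proof (rule homogeneous_nondeg[OF _ x])
      show "deg \<sigma> = 1 \<or> deg \<sigma> = -1" by (cases \<sigma>) simp_all
      fix y assume y: "y \<in> G (- deg \<sigma>)"
      note [simp] = G_closed[OF x] G_closed[OF y]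
      have "y \<in> pcarrier AP (- \<sigma>)" using y by (cases \<sigma>) (simp_all add: AP_parts)
      then have "half R \<cdot> ((x \<bullet> y) \<bullet> x) = \<zero>\<^sub>L" using h by (simp add: quad_AP AP_parts)
      then have "(x \<bullet> y) \<bullet> x = \<zero>\<^sub>L" by (rule S.half_eq_zero[rotated]) simp
      then have "\<boxminus> (x \<bullet> x \<bullet> y) = \<zero>\<^sub>L" by (simp add: br_xyx)
      then have "\<boxminus> (\<boxminus> (x \<bullet> x \<bullet> y)) = \<zero>\<^sub>L" by simp
      then show "x \<bullet> x \<bullet> y = \<zero>\<^sub>L" by simp
    qed
    then show "x = pzero AP \<sigma>" by (simp add: AP_parts)
  qed
qed

text \<open>The first isomorphism is induced on quotient algebras by the graded isomorphism
  \<open>toT\<close> from L to the TKK-algebra of its pair. The second is the same recognition of a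
  TKK-algebra, applied to the quotient algebra of that TKK-algebra.\<close>

lemma quotient_isomorphisms:
  assumes J: "jordan_three_graded R Q Qg"
  shows "lie_isomorphic R Q (Qm R TA)" "lie_isomorphic R (Qm R TA) (TKK R (Qm_pair R AP))"
proof -
  interpret A: nondeg_pair R AP by (rule AP_nondeg)
  interpret J: jordan_three_graded R Q Qg by (rule J)
  interpret T: graded_iso R L G TA "TKK_grade R AP" toT
    by (intro graded_iso.intro graded_iso_axioms.intro lie_iso.intro lie_iso_axioms.intro nondeg_graded_axioms
        A.K.nondeg_graded_axioms lie_algebra_axioms J.T_lie toT_linear toT_bij toT_bracket toT_grade_iff)
  interpret I: lie_iso R Q A.K.Q T.X.hm by (rule T.quotient_iso)
  show "lie_isomorphic R Q (Qm R TA)" by (rule lie_isoD[OF T.quotient_iso])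
  have c: "Qg k \<subseteq> carrier Q" for k using Q.G_closed by blast
  \<comment> \<open>The hypothesis gives the direct sum decomposition and generation of degree 0 for
    the quotient algebra of L; both are carried over along the first isomorphism, which matches the
    gradings. Faithfulness holds for the target by itself.\<close>
  have "reduced_graded R A.K.Q A.K.Qg"
  proof (intro reduced_graded.intro reduced_graded_axioms.intro six_unit)
    show "three_graded R A.K.Q A.K.Qg" by (rule I.image_three_graded[OF J.three_graded_axioms T.hm_grade_eq])
    show "lie_prod R A.K.Q (A.K.Qg 1) (A.K.Qg (-1)) = A.K.Qg 0"
      unfolding T.hm_grade_eq[symmetric] I.image_lie_prod[OF c c, symmetric] J.generated ..
  qed (rule A.K.Q_faithful)
  then interpret B: reduced_graded R A.K.Q A.K.Qg .
  show "lie_isomorphic R (Qm R TA) (TKK R (Qm_pair R AP))"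
    unfolding Qm_pair_def by (rule B.TKK_assoc_iso)
qed

end

theorem theorem4p7:
  fixes R :: "('a, 'r) ring_scheme"
  assumes "cring R" and "add_pow R (6::nat) \<one>\<^bsub>R\<^esub> \<in> Units R"
  shows "(\<forall>V :: ('a, 'v) jordan_pair.
            jordan_pair R V \<and> pair_strongly_nondegenerate V \<longrightarrow>
            maximal_M_quotients TYPE('s) R V (Qm_pair R V) (Qm_pair_emb R V))
       \<and> (\<forall>(L :: ('a, 'l) module) G.
            jordan_three_graded R L G \<and> lie_strongly_nondegenerate L \<and>
            jordan_three_graded R (Qm R L) (Qm_grade R L G) \<longrightarrow>
            (let V = assoc_pair R L G in
               lie_isomorphic R (Qm R L) (Qm R (TKK R V)) \<and>
               lie_isomorphic R (Qm R (TKK R V)) (TKK R (Qm_pair R V))))"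
proof (intro conjI allI impI)
  fix V :: "('a, 'v) jordan_pair" assume "jordan_pair R V \<and> pair_strongly_nondegenerate V"
  then show "maximal_M_quotients TYPE('s) R V (Qm_pair R V) (Qm_pair_emb R V)"
    using assms(2) by (intro maximal_pair nondeg_pair.intro nondeg_pair_axioms.intro) simp_all
next
  fix L :: "('a, 'l) module" and G
  assume L: "jordan_three_graded R L G \<and> lie_strongly_nondegenerate L \<and> jordan_three_graded R (Qm R L) (Qm_grade R L G)"
  then have "nondeg_jordan_graded R L G"
    using assms(2) by (intro nondeg_jordan_graded.intro nondeg_jordan_graded_axioms.intro) simp_all
  from nondeg_jordan_graded.quotient_isomorphisms[OF this] L
  show "let V = assoc_pair R L G in
      lie_isomorphic R (Qm R L) (Qm R (TKK R V)) \<and> lie_isomorphic R (Qm R (TKK R V)) (TKK R (Qm_pair R V))"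
    unfolding Let_def by blast
qed

end
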